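(* Let $A$ be a $\sigma$-finite von Neumann algebra, consider any $k_1,\dots,k_n\in A$, and let $W_2$ be the associated Wasserstein distance on the set $\mathfrak{F}(A)$ of faithful normal states on $A$. Then $$W_2(\mu,\nu)=W_2(\nu,\mu)$$ for all $\mu,\nu\in\mathfrak{F}(A)$.
   Context: Inner products are linear in the second variable. $\mathfrak{F}(A)$ denotes the set of faithful normal states on the von Neumann algebra $A$. Take $A$ in standard form on a Hilbert space $G$; each $\mu\in\mathfrak{F}(A)$ is represented by a cyclic and separating vector $\Lambda_\mu\in G$ for $A$, i.e. $\mu(a)=\langle\Lambda_\mu,a\Lambda_\mu\rangle$ for $a\in A$. On the commutant $A'$ one defines the state $\mu'(a')=\langle\Lambda_\mu,a'\Lambda_\mu\rangle$. Let $\sigma^\mu$ denote the modular group of $A$ associated with $\mu$. Transport plans: for $\mu,\nu\in\mathfrak{F}(A)$, a transport plan from $\mu$ to $\nu$ is a state $\omega$ on the algebraic tensor product $A\odot A'$ with $\omega(a\otimes 1)=\mu(a)$ and $\omega(1\otimes a')=\nu'(a')$ for all $a\in A$, $a'\in A'$; $T(\mu,\nu)$ is the set of these. For a unital completely positive map $\beta:A\to A$ with $\nu\circ\beta=\nu$, its dual $\beta':A'\to A'$ is defined by $\langle\Lambda_\nu,b\beta'(b')\Lambda_\nu\rangle=\langle\Lambda_\nu,\beta(b)b'\Lambda_\nu\rangle$ for all $b\in A$, $b'\in A'$. The set $T_\sigma(\mu,\nu)$ of modular transport plans consists of those $\omega\in T(\mu,\nu)$ with $\omega(\sigma_t^\mu(a)\otimes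 b')=\omega(a\otimes(\sigma_t^\nu)'(b'))$ for all $a\in A$, $b'\in A'$, $t\in\mathbb{R}$. Cost: for $\omega\in T(\mu,\nu)$ let $(H_\omega,\pi_\omega,\Omega)$ be a cyclic representation of $(A\odot A',\omega)$, i.e. $\Omega$ is cyclic and $\omega=\langle\Omega,\pi_\omega(\cdot)\Omega\rangle_\omega$; $\|\cdot\|_\omega$ is the norm of $H_\omega$. Put $\pi_\mu^\omega(a)=\pi_\omega(a\otimes1)|_{H_\mu^\omega}$ for $a\in A$, where $H_\mu^\omega=\overline{\pi_\omega(A\otimes1)\Omega}$. Let $H_\nu^\omega=\overline{\pi_\omega(1\otimes A')\Omega}$, let $u_\nu:G\to H_\nu^\omega$ be the unitary determined by $u_\nu a'\Lambda_\nu=\pi_\omega(1\otimes a')\Omega$ for $a'\in A'$, and put $\pi_\nu^\omega(b)=u_\nu bu_\nu^*$ for $b\in A$. Given $k_1,\dots,k_n\in A$, the cost of $\omega$ is $I(\omega)=\sum_{l=1}^n\|\pi_\mu^\omega(k_l)\Omega-\pi_\nu^\omega(k_l)\Omega\|_\omega^2$. The Wasserstein distance associated to $k_1,\dots,k_n$ is $W_2(\mu,\nu)=\inf_{\omega\in T_\sigma(\mu,\nu)}I(\omega)^{1/2}$ for $\mu,\nu\in\mathfrak{F}(A)$. *)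

theory Defs
  imports "HOL-Analysis.Analysis"
begin

section \<open>Complex Hilbert spaces\<close>

class scaleC =
  fixes scaleC :: "complex \<Rightarrow> 'a \<Rightarrow> 'a"  (infixr \<open>*\<^sub>C\<close> 75)

class complex_vector = ab_group_add + scaleC +
  assumes scaleC_add_right: "c *\<^sub>C (x + y) = c *\<^sub>C x + c *\<^sub>C y"
    and scaleC_add_left: "(c + d) *\<^sub>C x = c *\<^sub>C x + d *\<^sub>C x"
    and scaleC_scaleC: "c *\<^sub>C d *\<^sub>C x = (c * d) *\<^sub>C x"
    and scaleC_one: "1 *\<^sub>C x = x"

lemma scaleC_zero_right: "c *\<^sub>C (0::'a::complex_vector) = 0"
  using scaleC_add_right[of c "0::'a" 0] by simp

lemma scaleC_minus_right: "c *\<^sub>C (- x) = - (c *\<^sub>C x)" for x :: "'a::complex_vector"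
proof -
  have "c *\<^sub>C (- x) + c *\<^sub>C x = 0"
    using scaleC_add_right[of c "- x" x] by (simp add: scaleC_zero_right)
  then show ?thesis by (simp add: eq_neg_iff_add_eq_0)
qed

lemma scaleC_diff_right: "c *\<^sub>C (x - y) = c *\<^sub>C x - c *\<^sub>C y"
  for x y :: "'a::complex_vector"
  using scaleC_add_right[of c x "- y"] by (simp add: scaleC_minus_right)

text \<open>The norm and the topology are those of the underlying real inner product space.
  The complex inner product is linear in the second variable.\<close>

class complex_inner = real_inner + complex_vector +
  fixes cinner :: "'a \<Rightarrow> 'a \<Rightarrow> complex"
  assumes scaleR_scaleC: "scaleR r x = complex_of_real r *\<^sub>C x"
    and cinner_commute: "cinner x y = cnj (cinner y x)"
    and cinner_add_right: "cinner x (y + z) = cinner x y + cinner x z"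
    and cinner_scaleC_right: "cinner x (c *\<^sub>C y) = c * cinner x y"
    and inner_eq_Re_cinner: "inner x y = Re (cinner x y)"

class chilbert_space = complex_inner + complete_space

instantiation complex :: chilbert_space
begin
definition scaleC_complex :: "complex \<Rightarrow> complex \<Rightarrow> complex" where
  "scaleC_complex c x = c * x"
definition cinner_complex :: "complex \<Rightarrow> complex \<Rightarrow> complex" where
  "cinner_complex x y = cnj x * y"
instance
  by standard
    (simp_all add: scaleC_complex_def cinner_complex_def algebra_simps scaleR_conv_of_real
      inner_complex_def)
end

lemma cinner_add_left: "cinner (x + y) z = cinner x z + cinner y z"
  by (metis cinner_add_right cinner_commute complex_cnj_add)

lemma cinner_scaleC_left: "cinner (c *\<^sub>C x) y = cnj c * cinner x y"
  by (metis cinner_commute cinner_scaleC_right complex_cnj_mult)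

lemma Im_cinner: "Im (cinner x y) = - inner x (\<i> *\<^sub>C y)"
  by (simp add: inner_eq_Re_cinner cinner_scaleC_right)

lemma cinner_eqI: "(\<And>y. inner x y = inner x' y) \<Longrightarrow> cinner x y = cinner x' y"
  by (simp add: complex_eq_iff Im_cinner) (simp add: inner_eq_Re_cinner)

lemma cinner_ext: "(\<And>y. cinner x y = cinner x' y) \<Longrightarrow> x = x'"
  by (metis inner_eq_Re_cinner inner_commute vector_eq_ldot)

lemma riesz_representation:
  fixes \<phi> :: "'a::{real_inner, complete_space} \<Rightarrow> real"
  assumes "bounded_linear \<phi>"
  shows "\<exists>v. \<forall>x. \<phi> x = inner v x"
proof -
  interpret bounded_linear \<phi> by fact
  obtain K where K: "\<And>x. \<bar>\<phi> x\<bar> \<le> norm x * K"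
    using bounded by auto
  define Q where "Q x = (norm x)\<^sup>2 - 2 * \<phi> x" for x
  have lower: "- (K\<^sup>2) \<le> Q x" for x
  proof -
    have "0 \<le> (norm x - K)\<^sup>2" by simp
    then have "2 * (norm x * K) \<le> (norm x)\<^sup>2 + K\<^sup>2" by (simp add: power2_diff)
    with K[of x] show ?thesis unfolding Q_def by linarith
  qed
  define m where "m = Inf (range Q)"
  have bdd: "bdd_below (range Q)" using lower by (meson bdd_belowI2)
  have mQ: "m \<le> Q x" for x unfolding m_def by (rule cINF_lower[OF bdd]) simp
  have "\<exists>x. Q x < m + inverse (real (Suc n))" for n
  proof -
    have "Inf (range Q) < m + inverse (real (Suc n))" by (simp add: m_def)
    then obtain y where "y \<in> range Q" "y < m + inverse (real (Suc n))"
      using cInf_lessD[of "range Q"] by blast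
    then show ?thesis by blast
  qed
  then obtain X where X: "\<And>n. Q (X n) < m + inverse (real (Suc n))" by metis
  have par: "(norm (x - y))\<^sup>2 = 2 * Q x + 2 * Q y - 4 * Q ((1/2) *\<^sub>R (x + y))" for x y
    by (simp add: Q_def scaleR add power2_norm_eq_inner inner_simps inner_commute field_simps)
  have dist: "(norm (X i - X j))\<^sup>2 \<le> 4 * inverse (real (Suc N))" if "N \<le> i" "N \<le> j" for N i j
  proof -
    have "inverse (real (Suc i)) \<le> inverse (real (Suc N))"
      and "inverse (real (Suc j)) \<le> inverse (real (Suc N))"
      using that by simp_all
    with par[of "X i" "X j"] mQ[of "(1/2) *\<^sub>R (X i + X j)"] X[of i] X[of j]
    show ?thesis by linarith
  qed
  have "Cauchy X"
  proof (rule CauchyI)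
    fix e :: real assume "e > 0"
    then obtain N where N: "inverse (real (Suc N)) < e\<^sup>2 / 4"
      using reals_Archimedean[of "e\<^sup>2 / 4"] by auto
    have "norm (X i - X j) < e" if "N \<le> i" "N \<le> j" for i j
    proof -
      have "(norm (X i - X j))\<^sup>2 < e\<^sup>2" using dist[OF that] N by linarith
      then show ?thesis by (rule power2_less_imp_less) (use \<open>e > 0\<close> in simp)
    qed
    then show "\<exists>M. \<forall>m\<ge>M. \<forall>n\<ge>M. norm (X m - X n) < e" by blast
  qed
  then obtain v where v: "X \<longlonglongrightarrow> v"
    using Cauchy_convergent convergent_def by blast
  have "(\<lambda>n. Q (X n)) \<longlonglongrightarrow> Q v"
    unfolding Q_def by (intro tendsto_intros v tendsto)
  moreover have "(\<lambda>n. m + inverse (real (Suc n))) \<longlonglongrightarrow> m + 0"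
    by (intro tendsto_intros LIMSEQ_inverse_real_of_nat)
  ultimately have "Q v \<le> m + 0"
    by (rule LIMSEQ_le) (use X less_imp_le in blast)
  then have "Q v \<le> m" by simp
  have "\<phi> x = inner v x" for x
  proof (rule ccontr)
    assume ne: "\<phi> x \<noteq> inner v x"
    define d where "d = inner v x - \<phi> x"
    have "d \<noteq> 0" using ne by (simp add: d_def)
    then have x0: "x \<noteq> 0" by (auto simp: d_def zero)
    have "Q (v + t *\<^sub>R x) = Q v + 2 * t * d + t\<^sup>2 * (norm x)\<^sup>2" for t
      unfolding Q_def d_def power2_norm_eq_inner
      by (simp add: add scaleR inner_simps inner_commute algebra_simps power2_eq_square)
    from this[of "- d / (norm x)\<^sup>2"]
    have "Q (v + (- d / (norm x)\<^sup>2) *\<^sub>R x) = Q v - d\<^sup>2 / (norm x)\<^sup>2"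
      using x0 by (simp add: power2_eq_square)
    moreover have "d\<^sup>2 / (norm x)\<^sup>2 > 0" using \<open>d \<noteq> 0\<close> x0 by simp
    ultimately show False
      using mQ[of "v + (- d / (norm x)\<^sup>2) *\<^sub>R x"] \<open>Q v \<le> m\<close> by linarith
  qed
  then show ?thesis by blast
qed


section \<open>Complex star algebras and bounded operators\<close>

text \<open>Unital complex algebras with involution; \<open>1 \<noteq> 0\<close> is not required, so that the operators
  on the zero Hilbert space are included.\<close>

class star_algebra = ring + monoid_mult + complex_vector +
  fixes star :: "'a \<Rightarrow> 'a"
  assumes scaleC_mult_left: "(c *\<^sub>C x) * y = c *\<^sub>C (x * y)"
    and scaleC_mult_right: "x * (c *\<^sub>C y) = c *\<^sub>C (x * y)"
    and star_add: "star (x + y) = star x + star y"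
    and star_scaleC: "star (c *\<^sub>C x) = cnj c *\<^sub>C star x"
    and star_mult: "star (x * y) = star y * star x"
    and star_star: "star (star x) = x"

typedef (overloaded) 'g bop =
  "{f :: 'g::complex_inner \<Rightarrow> 'g. bounded_linear f \<and> (\<forall>c x. f (c *\<^sub>C x) = c *\<^sub>C f x)}"
  morphisms bop_apply Bop
  by (rule exI[of _ "\<lambda>x. x"]) (simp add: bounded_linear_ident)

notation bop_apply (infixr \<open>\<cdot>\<close> 75)

setup_lifting type_definition_bop

lemma bop_eqI: "(\<And>x. a \<cdot> x = b \<cdot> x) \<Longrightarrow> a = b"
  by transfer (rule ext)

lemma bop_bounded_linear: "bounded_linear (bop_apply a)"
  by transfer simp

lemma bop_scaleC: "a \<cdot> c *\<^sub>C x = c *\<^sub>C (a \<cdot> x)"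
  by transfer simp

lemma bounded_linear_scaleC: "bounded_linear (\<lambda>x::'a::complex_inner. c *\<^sub>C x)"
proof (rule bounded_linear_intro[where K = "norm c"])
  show "c *\<^sub>C (x + y) = c *\<^sub>C x + c *\<^sub>C y" for x y :: 'a by (rule scaleC_add_right)
  show "c *\<^sub>C (r *\<^sub>R x) = r *\<^sub>R (c *\<^sub>C x)" for r and x :: 'a
    by (simp add: scaleR_scaleC scaleC_scaleC mult.commute)
  show "norm (c *\<^sub>C x) \<le> norm x * norm c" for x :: 'a
  proof -
    have "(norm (c *\<^sub>C x))\<^sup>2 = Re ((cnj c * c) * cinner x x)"
      by (simp only: power2_norm_eq_inner inner_eq_Re_cinner cinner_scaleC_left
          cinner_scaleC_right mult.assoc mult.left_commute)
    also have "cnj c * c = of_real ((norm c)\<^sup>2)"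
      by (simp add: mult.commute flip: complex_norm_square)
    also have "Re (of_real ((norm c)\<^sup>2) * cinner x x) = (norm x * norm c)\<^sup>2"
      by (simp add: power2_norm_eq_inner inner_eq_Re_cinner power_mult_distrib)
    finally show ?thesis
      by (simp add: power2_eq_iff_nonneg)
  qed
qed

instantiation bop :: (complex_inner) "{ring, monoid_mult, complex_vector}"
begin
lift_definition zero_bop :: "'a bop" is "\<lambda>x. 0"
  by (simp add: scaleC_zero_right)
lift_definition one_bop :: "'a bop" is "\<lambda>x. x"
  by (simp add: bounded_linear_ident)
lift_definition plus_bop :: "'a bop \<Rightarrow> 'a bop \<Rightarrow> 'a bop" is "\<lambda>f g x. f x + g x"
  by (simp add: bounded_linear_add scaleC_add_right)
lift_definition uminus_bop :: "'a bop \<Rightarrow> 'a bop" is "\<lambda>f x. - f x"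
  by (simp add: bounded_linear_minus scaleC_minus_right)
lift_definition minus_bop :: "'a bop \<Rightarrow> 'a bop \<Rightarrow> 'a bop" is "\<lambda>f g x. f x - g x"
  by (simp add: bounded_linear_sub scaleC_diff_right)
lift_definition times_bop :: "'a bop \<Rightarrow> 'a bop \<Rightarrow> 'a bop" is "\<lambda>f g x. f (g x)"
  by (simp add: bounded_linear_compose)
lift_definition scaleC_bop :: "complex \<Rightarrow> 'a bop \<Rightarrow> 'a bop" is "\<lambda>c f x. c *\<^sub>C f x"
  by (simp add: bounded_linear_compose[OF bounded_linear_scaleC] scaleC_scaleC mult.commute)
instance
proof
  fix a b c :: "'a bop" and s t :: complex
  show "a + b + c = a + (b + c)" by transfer (simp add: add.assoc)
  show "a + b = b + a" by transfer (simp add: add.commute)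
  show "0 + a = a" by transfer simp
  show "- a + a = 0" by transfer simp
  show "a - b = a + - b" by transfer simp
  show "a * b * c = a * (b * c)" by transfer simp
  show "(a + b) * c = a * c + b * c" by transfer simp
  show "a * (b + c) = a * b + a * c"
    by transfer (auto simp: linear_simps)
  show "1 * a = a" "a * 1 = a" by (transfer, simp)+
  show "s *\<^sub>C (a + b) = s *\<^sub>C a + s *\<^sub>C b" by transfer (simp add: scaleC_add_right)
  show "(s + t) *\<^sub>C a = s *\<^sub>C a + t *\<^sub>C a" by transfer (simp add: scaleC_add_left)
  show "s *\<^sub>C t *\<^sub>C a = (s * t) *\<^sub>C a" by transfer (simp add: scaleC_scaleC)
  show "1 *\<^sub>C a = a" by transfer (simp add: scaleC_one)
qed
end

lemma bop_adjoint_ex: "\<exists>b. \<forall>x y. cinner (b \<cdot> x) y = cinner x (a \<cdot> y)"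
  for a :: "'g::chilbert_space bop"
proof -
  interpret a: bounded_linear "bop_apply a" by (rule bop_bounded_linear)
  have "\<exists>v. \<forall>y. inner x (a \<cdot> y) = inner v y" for x
    by (rule riesz_representation)
      (rule bounded_linear_compose[OF bounded_linear_inner_right bop_bounded_linear])
  then obtain f where f: "\<And>x y. inner x (a \<cdot> y) = inner (f x) y" by metis
  have cf: "cinner (f x) y = cinner x (a \<cdot> y)" for x y
    using f[of x y] f[of x "\<i> *\<^sub>C y"] by (simp add: complex_eq_iff Im_cinner bop_scaleC)
      (simp add: inner_eq_Re_cinner)
  obtain K where K: "\<And>y. norm (a \<cdot> y) \<le> norm y * K" using a.bounded by auto
  have "bounded_linear f"
  proof (rule bounded_linear_intro[where K = K])
    show "f (x + y) = f x + f y" for x y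
      by (rule cinner_ext) (simp add: cf cinner_add_left)
    show "f (r *\<^sub>R x) = r *\<^sub>R f x" for r x
      by (rule cinner_ext) (simp add: cf scaleR_scaleC cinner_scaleC_left)
    show "norm (f x) \<le> norm x * K" for x
    proof (cases "f x = 0")
      case True
      have "0 \<le> norm x * K" using K[of x] norm_ge_zero order_trans by blast
      then show ?thesis using True by simp
    next
      case False
      have "norm (f x) * norm (f x) = inner x (a \<cdot> f x)"
        by (simp add: f power2_norm_eq_inner flip: power2_eq_square)
      also have "\<dots> \<le> norm x * norm (a \<cdot> f x)" by (rule norm_cauchy_schwarz)
      also have "\<dots> \<le> norm x * (norm (f x) * K)" by (simp add: K mult_left_mono)
      finally show ?thesis using False by (simp add: mult.assoc mult.left_commute)
    qed
  qed
  moreover have "f (c *\<^sub>C x) = c *\<^sub>C f x" for c x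
    by (rule cinner_ext) (simp add: cf cinner_scaleC_left)
  ultimately have "bop_apply (Bop f) = f" by (simp add: Bop_inverse)
  with cf show ?thesis by (intro exI[of _ "Bop f"]) simp
qed

instantiation bop :: (chilbert_space) star_algebra
begin

definition star_bop :: "'a bop \<Rightarrow> 'a bop" where
  "star_bop a = (THE b. \<forall>x y. cinner (b \<cdot> x) y = cinner x (a \<cdot> y))"

lemma cinner_star_left: "cinner (star a \<cdot> x) y = cinner x (a \<cdot> y)" for a :: "'a bop"
proof -
  have "\<exists>!b. \<forall>x y. cinner (b \<cdot> x) y = cinner x (a \<cdot> y)"
  proof (rule ex_ex1I[OF bop_adjoint_ex])
    fix b b' :: "'a bop"
    assume "\<forall>x y. cinner (b \<cdot> x) y = cinner x (a \<cdot> y)"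
      and "\<forall>x y. cinner (b' \<cdot> x) y = cinner x (a \<cdot> y)"
    then have "cinner (b \<cdot> x) y = cinner (b' \<cdot> x) y" for x y by simp
    then show "b = b'" by (metis bop_eqI cinner_ext)
  qed
  from theI'[OF this] show ?thesis unfolding star_bop_def by blast
qed

lemma star_bop_eqI: "(\<And>x y. cinner (b \<cdot> x) y = cinner x (a \<cdot> y)) \<Longrightarrow> star a = b" for a b :: "'a bop"
  by (rule bop_eqI, rule cinner_ext) (simp add: cinner_star_left)

lemma cinner_star_right: "cinner x (star a \<cdot> y) = cinner (a \<cdot> x) y" for a :: "'a bop"
  using cinner_star_left[of a y x] cinner_commute[of x "star a \<cdot> y"]
    cinner_commute[of "a \<cdot> x" y] by simp

instance
proof
  fix a b :: "'a bop" and c :: complex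
  show "(c *\<^sub>C a) * b = c *\<^sub>C (a * b)" by transfer simp
  show "a * (c *\<^sub>C b) = c *\<^sub>C (a * b)" by transfer simp
  show "star (a + b) = star a + star b"
    by (rule star_bop_eqI)
      (simp add: plus_bop.rep_eq cinner_add_left cinner_add_right cinner_star_left)
  show "star (c *\<^sub>C a) = cnj c *\<^sub>C star a"
    by (rule star_bop_eqI)
      (simp add: scaleC_bop.rep_eq cinner_scaleC_left cinner_scaleC_right cinner_star_left)
  show "star (a * b) = star b * star a"
    by (rule star_bop_eqI) (simp add: times_bop.rep_eq cinner_star_left)
  show "star (star a) = a"
    by (rule star_bop_eqI) (simp add: cinner_star_right)
qed

end


section \<open>Algebraic tensor products\<close>

text \<open>Elements of the algebraic tensor product are formal finite sums of elementary tensors,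
  represented by lists of pairs. Over a field, two formal sums define the same tensor iff all
  bilinear forms take the same value on them.\<close>

definition cbilinear :: "('a::complex_vector \<Rightarrow> 'b::complex_vector \<Rightarrow> complex) \<Rightarrow> bool" where
  "cbilinear B \<longleftrightarrow>
    (\<forall>x x' y. B (x + x') y = B x y + B x' y) \<and> (\<forall>c x y. B (c *\<^sub>C x) y = c * B x y) \<and>
    (\<forall>x y y'. B x (y + y') = B x y + B x y') \<and> (\<forall>c x y. B x (c *\<^sub>C y) = c * B x y)"

lemma cbilinear_simps:
  assumes "cbilinear B"
  shows "B (x + x') y = B x y + B x' y" "B (c *\<^sub>C x) y = c * B x y"
    "B x (y + y') = B x y + B x y'" "B x (c *\<^sub>C y) = c * B x y"
  using assms unfolding cbilinear_def by blast+

definition formal_value :: "('a \<Rightarrow> 'b \<Rightarrow> complex) \<Rightarrow> ('a \<times> 'b) list \<Rightarrow> complex" where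
  "formal_value B xs = (\<Sum>(a, b)\<leftarrow>xs. B a b)"

definition tensor_eq ::
    "('a::complex_vector \<times> 'b::complex_vector) list \<Rightarrow> ('a \<times> 'b) list \<Rightarrow> bool" where
  "tensor_eq xs ys \<longleftrightarrow> (\<forall>B. cbilinear B \<longrightarrow> formal_value B xs = formal_value B ys)"

lemma formal_value_Nil [simp]: "formal_value B [] = 0"
  and formal_value_Cons [simp]: "formal_value B (p # xs) = B (fst p) (snd p) + formal_value B xs"
  and formal_value_append [simp]:
    "formal_value B (xs @ ys) = formal_value B xs + formal_value B ys"
  by (simp_all add: formal_value_def case_prod_beta)

lemma formal_value_map:
  "formal_value B (map (map_prod f g) xs) = formal_value (\<lambda>a b. B (f a) (g b)) xs"
  by (induction xs) auto

lemma formal_value_add: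
  "formal_value (\<lambda>a b. B a b + C a b) xs = formal_value B xs + formal_value C xs"
  by (induction xs) auto

lemma formal_value_mult: "formal_value (\<lambda>a b. c * B a b) xs = c * formal_value B xs"
  by (induction xs) (auto simp: algebra_simps)

lemma formal_value_cnj: "formal_value (\<lambda>a b. cnj (B a b)) xs = cnj (formal_value B xs)"
  by (induction xs) auto

lemma tensor_eqI: "(\<And>B. cbilinear B \<Longrightarrow> formal_value B xs = formal_value B ys) \<Longrightarrow> tensor_eq xs ys"
  by (simp add: tensor_eq_def)

lemma tensor_eqD: "tensor_eq xs ys \<Longrightarrow> cbilinear B \<Longrightarrow> formal_value B xs = formal_value B ys"
  by (simp add: tensor_eq_def)

quotient_type (overloaded) ('a, 'b) tensor =
  "('a::star_algebra \<times> 'b::star_algebra) list" / tensor_eq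
  by (rule equivpI) (auto simp: reflp_def symp_def transp_def tensor_eq_def)

definition formal_mult ::
    "('a::times \<times> 'b::times) list \<Rightarrow> ('a \<times> 'b) list \<Rightarrow> ('a \<times> 'b) list" where
  "formal_mult xs ys = concat (map (\<lambda>(a, b). map (\<lambda>(c, d). (a * c, b * d)) ys) xs)"

lemma formal_mult_Nil [simp]: "formal_mult [] ys = []"
  and formal_mult_Cons: "formal_mult (p # xs) ys =
    map (map_prod ((*) (fst p)) ((*) (snd p))) ys @ formal_mult xs ys"
  by (simp_all add: formal_mult_def case_prod_beta map_prod_def)

lemma formal_value_formal_mult:
  "formal_value B (formal_mult xs ys) =
    formal_value (\<lambda>a b. formal_value (\<lambda>c d. B (a * c) (b * d)) ys) xs"
  by (induction xs) (auto simp: formal_mult_Cons formal_value_map)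

lemma formal_value_swap:
  "formal_value (\<lambda>a b. formal_value (\<lambda>c d. F a b c d) ys) xs =
    formal_value (\<lambda>c d. formal_value (\<lambda>a b. F a b c d) xs) ys"
  by (induction xs) (simp_all add: formal_value_add formal_value_mult[of 0, simplified])

lemma cbilinear_mult_right:
  "cbilinear B \<Longrightarrow> cbilinear (\<lambda>a b. formal_value (\<lambda>c d. B (a * c) (b * d)) ys)"
  for B :: "'a::star_algebra \<Rightarrow> 'b::star_algebra \<Rightarrow> complex"
  unfolding cbilinear_def
  by (simp add: distrib_right scaleC_mult_left formal_value_add formal_value_mult)

lemma cbilinear_mult_left:
  "cbilinear B \<Longrightarrow> cbilinear (\<lambda>c d. formal_value (\<lambda>a b. B (a * c) (b * d)) xs)"
  for B :: "'a::star_algebra \<Rightarrow> 'b::star_algebra \<Rightarrow> complex"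
  unfolding cbilinear_def
  by (simp add: distrib_left scaleC_mult_right formal_value_add formal_value_mult)

lemma cbilinear_scale: "cbilinear B \<Longrightarrow> cbilinear (\<lambda>a b. B (c *\<^sub>C a) b)"
  unfolding cbilinear_def by (simp add: scaleC_add_right scaleC_scaleC algebra_simps)

lemma cbilinear_star: "cbilinear B \<Longrightarrow> cbilinear (\<lambda>a b. cnj (B (star a) (star b)))"
  unfolding cbilinear_def by (simp add: star_add star_scaleC)

instantiation tensor :: (star_algebra, star_algebra) star_algebra
begin

lift_definition zero_tensor :: "('a, 'b) tensor" is "[]" .

lift_definition one_tensor :: "('a, 'b) tensor" is "[(1, 1)]" .

lift_definition plus_tensor :: "('a, 'b) tensor \<Rightarrow> ('a, 'b) tensor \<Rightarrow> ('a, 'b) tensor" is "(@)"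
  by (simp add: tensor_eq_def)

lift_definition scaleC_tensor :: "complex \<Rightarrow> ('a, 'b) tensor \<Rightarrow> ('a, 'b) tensor"
  is "\<lambda>c. map (map_prod (scaleC c) id)"
  by (rule tensor_eqI) (simp add: formal_value_map tensor_eqD[OF _ cbilinear_scale])

lift_definition uminus_tensor :: "('a, 'b) tensor \<Rightarrow> ('a, 'b) tensor"
  is "map (map_prod (scaleC (- 1)) id)"
  by (rule tensor_eqI) (simp add: formal_value_map tensor_eqD[OF _ cbilinear_scale])

definition minus_tensor :: "('a, 'b) tensor \<Rightarrow> ('a, 'b) tensor \<Rightarrow> ('a, 'b) tensor" where
  "minus_tensor x y = x + - y"

lift_definition times_tensor :: "('a, 'b) tensor \<Rightarrow> ('a, 'b) tensor \<Rightarrow> ('a, 'b) tensor"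
  is formal_mult
proof (rule tensor_eqI)
  fix xs xs' ys ys' :: "('a \<times> 'b) list" and B :: "'a \<Rightarrow> 'b \<Rightarrow> complex"
  assume xs: "tensor_eq xs xs'" and ys: "tensor_eq ys ys'" and B: "cbilinear B"
  have "formal_value B (formal_mult xs ys) = formal_value B (formal_mult xs' ys)"
    unfolding formal_value_formal_mult by (rule tensor_eqD[OF xs cbilinear_mult_right[OF B]])
  also have "\<dots> = formal_value B (formal_mult xs' ys')"
    unfolding formal_value_formal_mult formal_value_swap[where xs = xs']
    by (rule tensor_eqD[OF ys cbilinear_mult_left[OF B]])
  finally show "formal_value B (formal_mult xs ys) = formal_value B (formal_mult xs' ys')" .
qed

lift_definition star_tensor :: "('a, 'b) tensor \<Rightarrow> ('a, 'b) tensor"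
  is "map (map_prod star star)"
proof (rule tensor_eqI)
  fix xs ys :: "('a \<times> 'b) list" and B :: "'a \<Rightarrow> 'b \<Rightarrow> complex"
  assume eq: "tensor_eq xs ys" and B: "cbilinear B"
  have "cnj (formal_value B (map (map_prod star star) xs)) =
      cnj (formal_value B (map (map_prod star star) ys))"
    unfolding formal_value_map formal_value_cnj[symmetric]
    by (rule tensor_eqD[OF eq cbilinear_star[OF B]])
  then show "formal_value B (map (map_prod star star) xs) =
      formal_value B (map (map_prod star star) ys)" by simp
qed

instance
proof
  fix x y z :: "('a, 'b) tensor" and c d :: complex
  show "x + y + z = x + (y + z)" by transfer (simp add: tensor_eq_def)
  show "x + y = y + x" by transfer (simp add: tensor_eq_def)
  show "0 + x = x" by transfer (simp add: tensor_eq_def)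
  show "- x + x = 0"
    by transfer (auto simp: tensor_eq_def formal_value_map cbilinear_simps
        formal_value_mult[of "- 1", simplified])
  show "x - y = x + - y" by (rule minus_tensor_def)
  show "x * y * z = x * (y * z)"
    by transfer (simp add: tensor_eq_def formal_value_formal_mult mult.assoc)
  show "(x + y) * z = x * z + y * z"
    by transfer (simp add: tensor_eq_def formal_value_formal_mult)
  show "x * (y + z) = x * y + x * z"
    by transfer (simp add: tensor_eq_def formal_value_formal_mult formal_value_add)
  show "1 * x = x"
    by transfer (simp add: tensor_eq_def formal_value_formal_mult)
  show "x * 1 = x"
    by transfer (simp add: tensor_eq_def formal_value_formal_mult)
  show "c *\<^sub>C (x + y) = c *\<^sub>C x + c *\<^sub>C y"
    by transfer (simp add: tensor_eq_def)
  show "(c + d) *\<^sub>C x = c *\<^sub>C x + d *\<^sub>C x"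
    by transfer (simp add: tensor_eq_def formal_value_map cbilinear_simps formal_value_add formal_value_mult
        algebra_simps)
  show "c *\<^sub>C d *\<^sub>C x = (c * d) *\<^sub>C x"
    by transfer (simp add: tensor_eq_def formal_value_map cbilinear_simps formal_value_add formal_value_mult
        algebra_simps del: map_map)
  show "1 *\<^sub>C x = x"
    by transfer (simp add: tensor_eq_def formal_value_map scaleC_one del: map_map)
  show "(c *\<^sub>C x) * y = c *\<^sub>C (x * y)"
    by transfer (simp del: map_map add: tensor_eq_def formal_value_formal_mult formal_value_map
        scaleC_mult_left cbilinear_simps formal_value_add formal_value_mult)
  show "x * (c *\<^sub>C y) = c *\<^sub>C (x * y)"
    by transfer (simp del: map_map add: tensor_eq_def formal_value_formal_mult formal_value_map
        scaleC_mult_right cbilinear_simps formal_value_add formal_value_mult)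
  show "star (x + y) = star x + star y"
    by transfer (simp add: tensor_eq_def)
  show "star (c *\<^sub>C x) = cnj c *\<^sub>C star x"
    by transfer (simp add: tensor_eq_def formal_value_map star_scaleC del: map_map)
  show "star (x * y) = star y * star x"
  proof (transfer, rule tensor_eqI)
    fix xs ys :: "('a \<times> 'b) list" and B :: "'a \<Rightarrow> 'b \<Rightarrow> complex"
    show "formal_value B (map (map_prod star star) (formal_mult xs ys)) =
        formal_value B (formal_mult (map (map_prod star star) ys) (map (map_prod star star) xs))"
      by (simp add: formal_value_map formal_value_formal_mult star_mult)
        (rule formal_value_swap)
  qed
  show "star (star x) = x"
    by transfer (simp add: tensor_eq_def formal_value_map star_star del: map_map)
qed

end

lift_definition elem_tensor :: "'a::star_algebra \<Rightarrow> 'b::star_algebra \<Rightarrow> ('a, 'b) tensor"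
    (infixr \<open>\<otimes>\<close> 70)
  is "\<lambda>a b. [(a, b)]" .

text \<open>For linear subspaces \<open>A\<close> and \<open>B\<close>, the tensor product \<open>A \<odot> B\<close> is identified with its
  (injective) image in the tensor product of the ambient algebras, the span of the elementary
  tensors; scalars are absorbed in the first factor.\<close>

definition tensor_product ::
    "'a::star_algebra set \<Rightarrow> 'b::star_algebra set \<Rightarrow> ('a, 'b) tensor set"  (infixr \<open>\<odot>\<close> 70) where
  "A \<odot> B = {\<Sum>(a, b)\<leftarrow>xs. a \<otimes> b |xs. set xs \<subseteq> A \<times> B}"


section \<open>Von Neumann algebras, states, standard form\<close>

definition commutant :: "'g::chilbert_space bop set \<Rightarrow> 'g bop set" where
  "commutant A = {b. \<forall>a\<in>A. a * b = b * a}"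

definition von_neumann_algebra :: "'g::chilbert_space bop set \<Rightarrow> bool" where
  "von_neumann_algebra A \<longleftrightarrow> (\<forall>a\<in>A. star a \<in> A) \<and> commutant (commutant A) = A"

definition projection :: "'g::chilbert_space bop \<Rightarrow> bool" where
  "projection p \<longleftrightarrow> star p = p \<and> p * p = p"

definition sigma_finite :: "'g::chilbert_space bop set \<Rightarrow> bool" where
  "sigma_finite A \<longleftrightarrow>
    (\<forall>Q \<subseteq> A. (\<forall>p\<in>Q. projection p \<and> p \<noteq> 0) \<and> (\<forall>p\<in>Q. \<forall>q\<in>Q. p \<noteq> q \<longrightarrow> p * q = 0)
      \<longrightarrow> countable Q)"

text \<open>A state on a unital star subalgebra \<open>B\<close> is a function on the ambient algebra of which only
  the values on \<open>B\<close> matter.\<close>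

definition state :: "'a::star_algebra set \<Rightarrow> ('a \<Rightarrow> complex) \<Rightarrow> bool" where
  "state B \<omega> \<longleftrightarrow>
    (\<forall>x\<in>B. \<forall>y\<in>B. \<omega> (x + y) = \<omega> x + \<omega> y) \<and> (\<forall>c. \<forall>x\<in>B. \<omega> (c *\<^sub>C x) = c * \<omega> x) \<and>
    (\<forall>x\<in>B. \<omega> (star x * x) \<in> \<real>\<^sub>\<ge>\<^sub>0) \<and> \<omega> 1 = 1"

definition bop_le :: "'g::chilbert_space bop \<Rightarrow> 'g bop \<Rightarrow> bool" where
  "bop_le a b \<longleftrightarrow> (\<forall>x. cinner x ((b - a) \<cdot> x) \<in> \<real>\<^sub>\<ge>\<^sub>0)"

text \<open>Normality: \<open>\<mu> (sup D) = sup \<mu> D\<close> for every upward directed set \<open>D\<close> of positive elements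
  that has a supremum in the self-adjoint part of \<open>A\<close>.\<close>

definition normal_functional :: "'g::chilbert_space bop set \<Rightarrow> ('g bop \<Rightarrow> complex) \<Rightarrow> bool" where
  "normal_functional A \<mu> \<longleftrightarrow>
    (\<forall>D s. D \<subseteq> A \<and> D \<noteq> {} \<and> (\<forall>d\<in>D. bop_le 0 d)
        \<and> (\<forall>d\<in>D. \<forall>d'\<in>D. \<exists>e\<in>D. bop_le d e \<and> bop_le d' e)
        \<and> s \<in> A \<and> star s = s \<and> (\<forall>d\<in>D. bop_le d s)
        \<and> (\<forall>b\<in>A. star b = b \<and> (\<forall>d\<in>D. bop_le d b) \<longrightarrow> bop_le s b)
      \<longrightarrow> \<mu> s = complex_of_real (SUP d\<in>D. Re (\<mu> d)))"

definition faithful_normal_states :: "'g::chilbert_space bop set \<Rightarrow> ('g bop \<Rightarrow> complex) set"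
    (\<open>\<FF>\<close>) where
  "\<FF> A = {\<mu>. state A \<mu> \<and> normal_functional A \<mu> \<and> (\<forall>a\<in>A. \<mu> (star a * a) = 0 \<longrightarrow> a = 0)}"

definition vector_state :: "'g::chilbert_space \<Rightarrow> 'g bop \<Rightarrow> complex" where
  "vector_state \<Lambda> a = cinner \<Lambda> (a \<cdot> \<Lambda>)"

definition cyclic_vector :: "'g::chilbert_space bop set \<Rightarrow> 'g \<Rightarrow> bool" where
  "cyclic_vector A \<Lambda> \<longleftrightarrow> closure {a \<cdot> \<Lambda> |a. a \<in> A} = UNIV"

definition separating_vector :: "'g::chilbert_space bop set \<Rightarrow> 'g \<Rightarrow> bool" where
  "separating_vector A \<Lambda> \<longleftrightarrow> (\<forall>a\<in>A. a \<cdot> \<Lambda> = 0 \<longrightarrow> a = 0)"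

text \<open>Standard form in the sense of Haagerup: a conjugation \<open>J\<close> and a self-dual cone \<open>P\<close> with
  \<open>J A J = A'\<close>, \<open>J c J = c\<^sup>*\<close> for central \<open>c\<close>, \<open>J \<xi> = \<xi>\<close> for \<open>\<xi> \<in> P\<close> and
  \<open>a J a J P \<subseteq> P\<close> for \<open>a \<in> A\<close>.\<close>

definition standard_form :: "'g::chilbert_space bop set \<Rightarrow> bool" where
  "standard_form A \<longleftrightarrow>
    (\<exists>J P.
      (\<forall>x y. J (x + y) = J x + J y) \<and> (\<forall>c x. J (c *\<^sub>C x) = cnj c *\<^sub>C J x) \<and>
      (\<forall>x. norm (J x) = norm x) \<and> (\<forall>x. J (J x) = x) \<and>
      P = {\<xi>. \<forall>\<eta>\<in>P. cinner \<xi> \<eta> \<in> \<real>\<^sub>\<ge>\<^sub>0} \<and>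
      commutant A = {b. \<exists>a\<in>A. \<forall>x. b \<cdot> x = J (a \<cdot> J x)} \<and>
      (\<forall>c \<in> A \<inter> commutant A. \<forall>x. J (c \<cdot> J x) = star c \<cdot> x) \<and>
      (\<forall>\<xi>\<in>P. J \<xi> = \<xi>) \<and>
      (\<forall>a\<in>A. \<forall>\<xi>\<in>P. a \<cdot> J (a \<cdot> J \<xi>) \<in> P))"


section \<open>The modular group\<close>

text \<open>Unbounded operators are represented by their graphs. \<open>tomita_operator A \<Lambda>\<close> is the closure of
  \<open>a \<Lambda> \<mapsto> a\<^sup>* \<Lambda>\<close> on \<open>A \<Lambda>\<close>, and the adjoint of a conjugate-linear operator \<open>S\<close> is determined by
  \<open>\<langle>S x, y\<rangle> = \<langle>S\<^sup>* y, x\<rangle>\<close>.\<close>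

definition tomita_operator :: "'g::chilbert_space bop set \<Rightarrow> 'g \<Rightarrow> ('g \<times> 'g) set" where
  "tomita_operator A \<Lambda> = closure {(a \<cdot> \<Lambda>, star a \<cdot> \<Lambda>) |a. a \<in> A}"

definition conjugate_linear_adjoint :: "('g::chilbert_space \<times> 'g) set \<Rightarrow> ('g \<times> 'g) set" where
  "conjugate_linear_adjoint S = {(y, z). \<forall>(x, w)\<in>S. cinner w y = cinner z x}"

definition modular_operator :: "'g::chilbert_space bop set \<Rightarrow> 'g \<Rightarrow> ('g \<times> 'g) set" where
  "modular_operator A \<Lambda> = tomita_operator A \<Lambda> O conjugate_linear_adjoint (tomita_operator A \<Lambda>)"

definition projection_valued_measure :: "(real set \<Rightarrow> 'g::chilbert_space bop) \<Rightarrow> bool" where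
  "projection_valued_measure E \<longleftrightarrow>
    (\<forall>X\<in>sets borel. projection (E X)) \<and> E UNIV = 1 \<and>
    (\<forall>X :: nat \<Rightarrow> real set. range X \<subseteq> sets borel \<and> disjoint_family X
      \<longrightarrow> (\<forall>x. (\<lambda>n. E (X n) \<cdot> x) sums (E (\<Union>n. X n) \<cdot> x)))"

definition diagonal_measure ::
    "(real set \<Rightarrow> 'g::chilbert_space bop) \<Rightarrow> 'g \<Rightarrow> real measure" where
  "diagonal_measure E x = measure_of UNIV (sets borel) (\<lambda>X. ennreal (Re (cinner x (E X \<cdot> x))))"

text \<open>\<open>T = \<integral> s dE(s)\<close>. The two operators have the same domain and, on it, the same quadratic form
  \<open>\<langle>x, T x\<rangle>\<close>; by polarization this means that they coincide.\<close>

definition spectral_measure_of ::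
    "(real set \<Rightarrow> 'g::chilbert_space bop) \<Rightarrow> ('g \<times> 'g) set \<Rightarrow> bool" where
  "spectral_measure_of E T \<longleftrightarrow> projection_valued_measure E \<and>
    Domain T = {x. integrable (diagonal_measure E x) (\<lambda>s. s\<^sup>2)} \<and>
    (\<forall>(x, y)\<in>T. cinner x y = complex_of_real (\<integral>s. s \<partial>diagonal_measure E x))"

text \<open>\<open>U t = T\<^sup>i\<^sup>t = \<integral> s\<^sup>i\<^sup>t dE(s)\<close> for a positive injective operator \<open>T\<close>, whose spectral
  measure \<open>E\<close> is concentrated on \<open>{0<..}\<close>, where \<open>s\<^sup>i\<^sup>t = cis (t * ln s)\<close>.\<close>

definition imaginary_powers ::
    "('g::chilbert_space \<times> 'g) set \<Rightarrow> (real \<Rightarrow> 'g bop) \<Rightarrow> bool" where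
  "imaginary_powers T U \<longleftrightarrow>
    (\<exists>E. spectral_measure_of E T \<and>
      (\<forall>t x. cinner x (U t \<cdot> x) = (\<integral>s. cis (t * ln s) \<partial>diagonal_measure E x)))"

text \<open>\<open>\<sigma>\<close> is the modular group of \<open>A\<close> for the state given by \<open>\<Lambda>\<close>: the maps
  \<open>\<sigma>\<^sub>t : A \<rightarrow> A\<close>, \<open>\<sigma>\<^sub>t(a) = \<Delta>\<^sup>i\<^sup>t a \<Delta>\<^sup>-\<^sup>i\<^sup>t\<close>. As functions on all operators, they are determined
  on \<open>A\<close> only.\<close>

definition modular_group ::
    "'g::chilbert_space bop set \<Rightarrow> 'g \<Rightarrow> (real \<Rightarrow> 'g bop \<Rightarrow> 'g bop) \<Rightarrow> bool" where
  "modular_group A \<Lambda> \<sigma> \<longleftrightarrow>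
    (\<forall>t. \<sigma> t \<in> A \<rightarrow> A) \<and>
    (\<exists>U. imaginary_powers (modular_operator A \<Lambda>) U \<and>
      (\<forall>t. \<forall>a\<in>A. \<sigma> t a = U t * a * U (- t)))"


section \<open>Transport plans\<close>

text \<open>In the following, \<open>\<Lambda>\<close> assigns to every state its representing vector, and \<open>\<sigma>\<close> its modular
  group.\<close>

definition transport_plans ::
    "'g::chilbert_space bop set \<Rightarrow> (('g bop \<Rightarrow> complex) \<Rightarrow> 'g) \<Rightarrow>
      ('g bop \<Rightarrow> complex) \<Rightarrow> ('g bop \<Rightarrow> complex) \<Rightarrow> (('g bop, 'g bop) tensor \<Rightarrow> complex) set" where
  "transport_plans A \<Lambda> \<mu> \<nu> =
    {\<omega>. state (A \<odot> commutant A) \<omega> \<and>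
      (\<forall>a\<in>A. \<omega> (a \<otimes> 1) = \<mu> a) \<and>
      (\<forall>a'\<in>commutant A. \<omega> (1 \<otimes> a') = vector_state (\<Lambda> \<nu>) a')}"

definition dual_map ::
    "'g::chilbert_space bop set \<Rightarrow> 'g \<Rightarrow> ('g bop \<Rightarrow> 'g bop) \<Rightarrow> 'g bop \<Rightarrow> 'g bop" where
  "dual_map A \<Lambda> \<beta> b' =
    (THE c'. c' \<in> commutant A \<and>
      (\<forall>b\<in>A. cinner \<Lambda> (b \<cdot> c' \<cdot> \<Lambda>) = cinner \<Lambda> (\<beta> b \<cdot> b' \<cdot> \<Lambda>)))"

definition modular_transport_plans ::
    "'g::chilbert_space bop set \<Rightarrow> (('g bop \<Rightarrow> complex) \<Rightarrow> 'g) \<Rightarrow>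
      (('g bop \<Rightarrow> complex) \<Rightarrow> real \<Rightarrow> 'g bop \<Rightarrow> 'g bop) \<Rightarrow>
      ('g bop \<Rightarrow> complex) \<Rightarrow> ('g bop \<Rightarrow> complex) \<Rightarrow> (('g bop, 'g bop) tensor \<Rightarrow> complex) set" where
  "modular_transport_plans A \<Lambda> \<sigma> \<mu> \<nu> =
    {\<omega> \<in> transport_plans A \<Lambda> \<mu> \<nu>.
      \<forall>a\<in>A. \<forall>b'\<in>commutant A. \<forall>t.
        \<omega> (\<sigma> \<mu> t a \<otimes> b') = \<omega> (a \<otimes> dual_map A (\<Lambda> \<nu>) (\<sigma> \<nu> t) b')}"


section \<open>Cyclic representations and the cost\<close>

text \<open>The Hilbert space of a cyclic representation depends on the state, so it is given by an
  explicit carrier set with its own operations.\<close>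

record 'h hspace =
  hcarrier :: "'h set"
  hzero :: 'h
  hadd :: "'h \<Rightarrow> 'h \<Rightarrow> 'h"
  hscale :: "complex \<Rightarrow> 'h \<Rightarrow> 'h"
  hinner :: "'h \<Rightarrow> 'h \<Rightarrow> complex"

definition hdiff :: "'h hspace \<Rightarrow> 'h \<Rightarrow> 'h \<Rightarrow> 'h" where
  "hdiff H x y = hadd H x (hscale H (- 1) y)"

definition hnorm :: "'h hspace \<Rightarrow> 'h \<Rightarrow> real" where
  "hnorm H x = sqrt (Re (hinner H x x))"

definition hclosure :: "'h hspace \<Rightarrow> 'h set \<Rightarrow> 'h set" where
  "hclosure H M = {x \<in> hcarrier H. \<forall>e>0. \<exists>y\<in>M. hnorm H (hdiff H x y) < e}"

definition hilbert_space :: "'h hspace \<Rightarrow> bool" where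
  "hilbert_space H \<longleftrightarrow>
    hzero H \<in> hcarrier H \<and>
    (\<forall>x\<in>hcarrier H. \<forall>y\<in>hcarrier H. hadd H x y \<in> hcarrier H) \<and>
    (\<forall>c. \<forall>x\<in>hcarrier H. hscale H c x \<in> hcarrier H) \<and>
    (\<forall>x\<in>hcarrier H. \<forall>y\<in>hcarrier H. \<forall>z\<in>hcarrier H.
      hadd H (hadd H x y) z = hadd H x (hadd H y z)) \<and>
    (\<forall>x\<in>hcarrier H. \<forall>y\<in>hcarrier H. hadd H x y = hadd H y x) \<and>
    (\<forall>x\<in>hcarrier H. hadd H (hzero H) x = x) \<and>
    (\<forall>x\<in>hcarrier H. hdiff H x x = hzero H) \<and>
    (\<forall>c. \<forall>x\<in>hcarrier H. \<forall>y\<in>hcarrier H.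
      hscale H c (hadd H x y) = hadd H (hscale H c x) (hscale H c y)) \<and>
    (\<forall>c d. \<forall>x\<in>hcarrier H. hscale H (c + d) x = hadd H (hscale H c x) (hscale H d x)) \<and>
    (\<forall>c d. \<forall>x\<in>hcarrier H. hscale H c (hscale H d x) = hscale H (c * d) x) \<and>
    (\<forall>x\<in>hcarrier H. hscale H 1 x = x) \<and>
    (\<forall>x\<in>hcarrier H. \<forall>y\<in>hcarrier H. \<forall>z\<in>hcarrier H.
      hinner H x (hadd H y z) = hinner H x y + hinner H x z) \<and>
    (\<forall>c. \<forall>x\<in>hcarrier H. \<forall>y\<in>hcarrier H. hinner H x (hscale H c y) = c * hinner H x y) \<and>
    (\<forall>x\<in>hcarrier H. \<forall>y\<in>hcarrier H. hinner H x y = cnj (hinner H y x)) \<and>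
    (\<forall>x\<in>hcarrier H. hinner H x x \<in> \<real>\<^sub>\<ge>\<^sub>0) \<and>
    (\<forall>x\<in>hcarrier H. hinner H x x = 0 \<longrightarrow> x = hzero H) \<and>
    (\<forall>X :: nat \<Rightarrow> 'h. range X \<subseteq> hcarrier H \<and>
      (\<forall>e>0. \<exists>N. \<forall>m\<ge>N. \<forall>n\<ge>N. hnorm H (hdiff H (X m) (X n)) < e)
      \<longrightarrow> (\<exists>x\<in>hcarrier H. (\<lambda>n. hnorm H (hdiff H (X n) x)) \<longlonglongrightarrow> 0))"

definition bounded_hop :: "'h hspace \<Rightarrow> ('h \<Rightarrow> 'h) \<Rightarrow> bool" where
  "bounded_hop H f \<longleftrightarrow>
    f \<in> hcarrier H \<rightarrow> hcarrier H \<and>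
    (\<forall>x\<in>hcarrier H. \<forall>y\<in>hcarrier H. f (hadd H x y) = hadd H (f x) (f y)) \<and>
    (\<forall>c. \<forall>x\<in>hcarrier H. f (hscale H c x) = hscale H c (f x)) \<and>
    (\<exists>K. \<forall>x\<in>hcarrier H. hnorm H (f x) \<le> K * hnorm H x)"

definition representation ::
    "'a::star_algebra set \<Rightarrow> 'h hspace \<Rightarrow> ('a \<Rightarrow> 'h \<Rightarrow> 'h) \<Rightarrow> bool" where
  "representation B H \<pi> \<longleftrightarrow>
    (\<forall>x\<in>B. bounded_hop H (\<pi> x)) \<and>
    (\<forall>x\<in>B. \<forall>y\<in>B. \<forall>h\<in>hcarrier H. \<pi> (x + y) h = hadd H (\<pi> x h) (\<pi> y h)) \<and>
    (\<forall>c. \<forall>x\<in>B. \<forall>h\<in>hcarrier H. \<pi> (c *\<^sub>C x) h = hscale H c (\<pi> x h)) \<and>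
    (\<forall>x\<in>B. \<forall>y\<in>B. \<forall>h\<in>hcarrier H. \<pi> (x * y) h = \<pi> x (\<pi> y h)) \<and>
    (\<forall>h\<in>hcarrier H. \<pi> 1 h = h) \<and>
    (\<forall>x\<in>B. \<forall>g\<in>hcarrier H. \<forall>h\<in>hcarrier H. hinner H (\<pi> (star x) g) h = hinner H g (\<pi> x h))"

definition cyclic_representation ::
    "'a::star_algebra set \<Rightarrow> ('a \<Rightarrow> complex) \<Rightarrow> 'h hspace \<times> ('a \<Rightarrow> 'h \<Rightarrow> 'h) \<times> 'h \<Rightarrow> bool" where
  "cyclic_representation B \<omega> = (\<lambda>(H, \<pi>, \<Omega>).
    hilbert_space H \<and> representation B H \<pi> \<and> \<Omega> \<in> hcarrier H \<and>
    hclosure H {\<pi> x \<Omega> |x. x \<in> B} = hcarrier H \<and>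
    (\<forall>x\<in>B. \<omega> x = hinner H \<Omega> (\<pi> x \<Omega>)))"

definition left_subspace ::
    "'g::chilbert_space bop set \<Rightarrow>
      'h hspace \<times> (('g bop, 'g bop) tensor \<Rightarrow> 'h \<Rightarrow> 'h) \<times> 'h \<Rightarrow> 'h set" where
  "left_subspace A = (\<lambda>(H, \<pi>, \<Omega>). hclosure H {\<pi> (a \<otimes> 1) \<Omega> |a. a \<in> A})"

definition left_rep ::
    "'g::chilbert_space bop set \<Rightarrow>
      'h hspace \<times> (('g bop, 'g bop) tensor \<Rightarrow> 'h \<Rightarrow> 'h) \<times> 'h \<Rightarrow> 'g bop \<Rightarrow> 'h \<Rightarrow> 'h" where
  "left_rep A = (\<lambda>(H, \<pi>, \<Omega>) a. restrict (\<pi> (a \<otimes> 1)) (left_subspace A (H, \<pi>, \<Omega>)))"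

definition right_subspace ::
    "'g::chilbert_space bop set \<Rightarrow>
      'h hspace \<times> (('g bop, 'g bop) tensor \<Rightarrow> 'h \<Rightarrow> 'h) \<times> 'h \<Rightarrow> 'h set" where
  "right_subspace A = (\<lambda>(H, \<pi>, \<Omega>). hclosure H {\<pi> (1 \<otimes> a') \<Omega> |a'. a' \<in> commutant A})"

definition right_unitary ::
    "'g::chilbert_space bop set \<Rightarrow> 'g \<Rightarrow>
      'h hspace \<times> (('g bop, 'g bop) tensor \<Rightarrow> 'h \<Rightarrow> 'h) \<times> 'h \<Rightarrow> 'g \<Rightarrow> 'h" where
  "right_unitary A \<Lambda> = (\<lambda>(H, \<pi>, \<Omega>). THE u.
    bij_betw u UNIV (right_subspace A (H, \<pi>, \<Omega>)) \<and>
    (\<forall>x y. u (x + y) = hadd H (u x) (u y)) \<and> (\<forall>c x. u (c *\<^sub>C x) = hscale H c (u x)) \<and>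
    (\<forall>x y. hinner H (u x) (u y) = cinner x y) \<and>
    (\<forall>a'\<in>commutant A. u (a' \<cdot> \<Lambda>) = \<pi> (1 \<otimes> a') \<Omega>))"

definition right_rep ::
    "'g::chilbert_space bop set \<Rightarrow> 'g \<Rightarrow>
      'h hspace \<times> (('g bop, 'g bop) tensor \<Rightarrow> 'h \<Rightarrow> 'h) \<times> 'h \<Rightarrow> 'g bop \<Rightarrow> 'h \<Rightarrow> 'h" where
  "right_rep A \<Lambda> R b = restrict
    (\<lambda>h. right_unitary A \<Lambda> R (b \<cdot> inv (right_unitary A \<Lambda> R) h)) (right_subspace A R)"

text \<open>The cost computed in a given cyclic representation of \<open>\<omega>\<close>; \<open>\<Lambda>\<close> represents the target
  state.\<close>

definition cost_in ::
    "'g::chilbert_space bop set \<Rightarrow> 'g \<Rightarrow> nat \<Rightarrow> (nat \<Rightarrow> 'g bop) \<Rightarrow>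
      'h hspace \<times> (('g bop, 'g bop) tensor \<Rightarrow> 'h \<Rightarrow> 'h) \<times> 'h \<Rightarrow> real" where
  "cost_in A \<Lambda> n k = (\<lambda>(H, \<pi>, \<Omega>).
    \<Sum>l = 1..n. (hnorm H (hdiff H (left_rep A (H, \<pi>, \<Omega>) (k l) \<Omega>)
                                (right_rep A \<Lambda> (H, \<pi>, \<Omega>) (k l) \<Omega>)))\<^sup>2)"

text \<open>A cyclic representation of a state is unique up to unitary equivalence, and the cost is
  invariant under it, so any one may be chosen. One exists on a space of complex functions on the
  algebra: a vector \<open>h\<close> of an arbitrary cyclic representation can be identified with the function
  \<open>x \<mapsto> \<langle>\<pi> x \<Omega>, h\<rangle>\<close>.\<close>

definition transport_cost ::
    "'g::chilbert_space bop set \<Rightarrow> 'g \<Rightarrow> nat \<Rightarrow> (nat \<Rightarrow> 'g bop) \<Rightarrow>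
      (('g bop, 'g bop) tensor \<Rightarrow> complex) \<Rightarrow> real" where
  "transport_cost A \<Lambda> n k \<omega> = cost_in A \<Lambda> n k
    (SOME R :: (('g bop, 'g bop) tensor \<Rightarrow> complex) hspace \<times> _ \<times> _.
      cyclic_representation (A \<odot> commutant A) \<omega> R)"

definition wasserstein_distance ::
    "'g::chilbert_space bop set \<Rightarrow> (('g bop \<Rightarrow> complex) \<Rightarrow> 'g) \<Rightarrow>
      (('g bop \<Rightarrow> complex) \<Rightarrow> real \<Rightarrow> 'g bop \<Rightarrow> 'g bop) \<Rightarrow> nat \<Rightarrow> (nat \<Rightarrow> 'g bop) \<Rightarrow>
      ('g bop \<Rightarrow> complex) \<Rightarrow> ('g bop \<Rightarrow> complex) \<Rightarrow> real" where
  "wasserstein_distance A \<Lambda> \<sigma> n k \<mu> \<nu> =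
    (INF \<omega> \<in> modular_transport_plans A \<Lambda> \<sigma> \<mu> \<nu>. sqrt (transport_cost A (\<Lambda> \<nu>) n k \<omega>))"

end

theory Submission
  imports Defs "HOL-Probability.Characteristic_Functions"
begin

text \<open>A plan \<open>\<omega>\<close> from \<open>\<mu>\<close> to \<open>\<nu>\<close> is encoded by the bounded operator \<open>V\<close> with
  \<open>\<langle>a' \<Lambda>\<^sub>\<nu>, V a \<Lambda>\<^sub>\<mu>\<rangle> = \<omega>(a \<otimes> a'\<^sup>*)\<close>, and expanding the squares in any cyclic representation gives
  \<open>I(\<omega>) = \<Sum>\<^sub>l \<parallel>k\<^sub>l \<Lambda>\<^sub>\<mu>\<parallel>\<^sup>2 + \<parallel>k\<^sub>l \<Lambda>\<^sub>\<nu>\<parallel>\<^sup>2 - 2 Re \<langle>V k\<^sub>l \<Lambda>\<^sub>\<mu>, k\<^sub>l \<Lambda>\<^sub>\<nu>\<rangle>\<close>. This is symmetric under exchanging \<open>\<mu>\<close> and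
  \<open>\<nu>\<close> and replacing \<open>V\<close> by \<open>V\<^sup>*\<close>, so it suffices that \<open>V\<^sup>*\<close> comes from a modular plan \<open>\<theta>\<close> from \<open>\<nu>\<close> to \<open>\<mu>\<close>;
  the issue is the positivity of \<open>\<theta>\<close>.

  Modularity of \<open>\<omega>\<close> means that \<open>V\<close> intertwines the unitaries \<open>\<Delta>\<^sub>\<mu>\<^sup>i\<^sup>t\<close> and \<open>\<Delta>\<^sub>\<nu>\<^sup>i\<^sup>t\<close>. It also intertwines the
  closed involutions \<open>S = J \<Delta>\<^sup>1\<^sup>/\<^sup>2\<close>, hence the modular conjugations: \<open>V J\<^sub>\<mu> = J\<^sub>\<nu> V\<close>. Therefore
  \<open>\<theta>(b \<otimes> a') = \<omega>((J\<^sub>\<mu> a' J\<^sub>\<mu>)\<^sup>* \<otimes> (J\<^sub>\<nu> b J\<^sub>\<nu>)\<^sup>*)\<close>, and as \<open>J A J = A'\<close> by Tomita's theorem, \<open>\<theta>\<close> inherits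
  positivity from \<open>\<omega>\<close>.

  Since the modular group is known to preserve \<open>A\<close>, Tomita's theorem follows from a comparison of
  \<open>\<Delta>\<^sup>1\<^sup>/\<^sup>2 a \<Delta>\<^sup>-\<^sup>1\<^sup>/\<^sup>2\<close> with \<open>\<Delta>\<^sup>i\<^sup>t a \<Delta>\<^sup>-\<^sup>i\<^sup>t\<close>, in which the analytic continuation to \<open>t = -\<i>/2\<close> is replaced by
  averaging over \<open>t\<close> with modulated Gaussian weights.\<close>

section \<open>Complex inner products and bounded operators\<close>

lemma scaleC_zero_left [simp]: "0 *\<^sub>C (x::'a::complex_vector) = 0"
  using scaleC_add_left[of 0 0 x] by simp

lemma scaleC_minus_left: "(- c) *\<^sub>C (x::'a::complex_vector) = - (c *\<^sub>C x)"
proof -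
  have "(- c) *\<^sub>C x + c *\<^sub>C x = 0" by (simp flip: scaleC_add_left)
  then show ?thesis by (simp add: eq_neg_iff_add_eq_0)
qed

lemma cnj_cinner: "cnj (cinner x y) = cinner y x"
  using cinner_commute[of y x] by simp

lemma cinner_zero_right [simp]: "cinner x 0 = 0"
  using cinner_scaleC_right[of x 0 0] by simp

lemma cinner_zero_left [simp]: "cinner 0 x = 0"
  using cinner_scaleC_left[of 0 0 x] by simp

lemma cinner_minus_right: "cinner x (- y) = - cinner x y"
  using cinner_scaleC_right[of x "- 1" y] by (simp add: scaleC_minus_left scaleC_one)

lemma cinner_minus_left: "cinner (- x) y = - cinner x y"
  using cinner_scaleC_left[of "- 1" x y] by (simp add: scaleC_minus_left scaleC_one)

lemma cinner_diff_right: "cinner x (y - z) = cinner x y - cinner x z"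
  using cinner_add_right[of x y "- z"] by (simp add: cinner_minus_right)

lemma cinner_diff_left: "cinner (x - y) z = cinner x z - cinner y z"
  using cinner_add_left[of x "- y" z] by (simp add: cinner_minus_left)

lemma cinner_sum_right: "cinner x (\<Sum>i\<in>I. f i) = (\<Sum>i\<in>I. cinner x (f i))"
  by (induction I rule: infinite_finite_induct) (auto simp: cinner_add_right)

lemma cinner_sum_left: "cinner (\<Sum>i\<in>I. f i) x = (\<Sum>i\<in>I. cinner (f i) x)"
  by (induction I rule: infinite_finite_induct) (auto simp: cinner_add_left)

lemmas cinner_simps = cinner_add_left cinner_add_right cinner_diff_left cinner_diff_right
  cinner_scaleC_left cinner_scaleC_right cinner_minus_left cinner_minus_right

lemma cinner_self: "cinner x x = of_real ((norm x)\<^sup>2)"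
proof -
  have "Im (cinner x x) = 0" using cinner_commute[of x x] by (simp add: complex_eq_iff)
  then show ?thesis
    by (simp add: complex_eq_iff power2_norm_eq_inner inner_eq_Re_cinner)
qed

lemma norm_scaleC: "norm (c *\<^sub>C x) = cmod c * norm (x::'a::complex_inner)"
proof -
  have "complex_of_real ((norm (c *\<^sub>C x))\<^sup>2) = (c * cnj c) * cinner x x"
    by (simp only: cinner_self[symmetric] cinner_scaleC_left cinner_scaleC_right) simp
  also have "\<dots> = of_real ((cmod c * norm x)\<^sup>2)"
    by (simp add: complex_norm_square[symmetric] cinner_self power_mult_distrib)
  finally show ?thesis by (simp del: of_real_power add: power2_eq_iff_nonneg)
qed

lemma cinner_cauchy_schwarz: "cmod (cinner x y) \<le> norm x * norm y"
proof (cases "cinner x y = 0")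
  case False
  define c where "c = cnj (sgn (cinner x y))"
  have c: "cmod c = 1" using False by (simp add: c_def norm_sgn)
  have "cinner x (c *\<^sub>C y) = of_real (cmod (cinner x y))"
    using False by (simp add: c_def cinner_scaleC_right sgn_div_norm scaleR_conv_of_real
        complex_norm_square[symmetric] power2_eq_square field_simps)
  then have "cmod (cinner x y) = inner x (c *\<^sub>C y)" by (simp add: inner_eq_Re_cinner)
  also have "\<dots> \<le> norm x * norm (c *\<^sub>C y)" by (rule norm_cauchy_schwarz)
  finally show ?thesis using c by (simp add: norm_scaleC)
qed simp

lemma bounded_bilinear_cinner: "bounded_bilinear cinner"
proof
  show "cinner (r *\<^sub>R a) b = r *\<^sub>R cinner a b" "cinner a (r *\<^sub>R b) = r *\<^sub>R cinner a b" for r a b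
    by (simp_all add: scaleR_scaleC cinner_simps scaleC_complex_def)
  show "\<exists>K. \<forall>a b. norm (cinner a b) \<le> norm a * norm b * K"
    by (rule exI[of _ 1]) (simp add: cinner_cauchy_schwarz)
qed (simp_all add: cinner_simps)

lemmas tendsto_cinner = bounded_bilinear.tendsto[OF bounded_bilinear_cinner]
lemmas continuous_on_cinner = bounded_bilinear.continuous_on[OF bounded_bilinear_cinner]
lemmas tendsto_scaleC = bounded_linear.tendsto[OF bounded_linear_scaleC]
lemmas tendsto_bop = bounded_linear.tendsto[OF bop_bounded_linear]

lemma bop_add: "a \<cdot> (x + y) = a \<cdot> x + a \<cdot> y"
  and bop_diff: "a \<cdot> (x - y) = a \<cdot> x - a \<cdot> y"
  and bop_zero [simp]: "a \<cdot> 0 = 0"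
  using bop_bounded_linear[of a] by (simp_all add: linear_simps bounded_linear.linear linear_0)

lemma bop_sum: "a \<cdot> (\<Sum>i\<in>I. f i) = (\<Sum>i\<in>I. a \<cdot> f i)"
  by (induction I rule: infinite_finite_induct) (auto simp: bop_add)

lemmas bop_simps = plus_bop.rep_eq minus_bop.rep_eq uminus_bop.rep_eq times_bop.rep_eq
  scaleC_bop.rep_eq one_bop.rep_eq zero_bop.rep_eq

lemma bop_mult_apply: "(a * b) \<cdot> x = a \<cdot> b \<cdot> x"
  by (simp add: times_bop.rep_eq)

lemma sum_bop_apply: "(\<Sum>i\<in>I. f i) \<cdot> x = (\<Sum>i\<in>I. f i \<cdot> x)"
  by (induction I rule: infinite_finite_induct) (auto simp: bop_simps)

lemma bop_bound: "\<exists>K>0. \<forall>x. norm (a \<cdot> x) \<le> K * norm x"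
  using bounded_linear.pos_bounded[OF bop_bounded_linear[of a]] by (metis mult.commute)

lemma cinner_bop_left: "cinner (a \<cdot> x) y = cinner x (star a \<cdot> y)" for a :: "'g::chilbert_space bop"
  by (simp add: cinner_star_right)

lemma Bop_apply:
  assumes "\<And>x y. f (x + y) = f x + f y" "\<And>c x. f (c *\<^sub>C x) = c *\<^sub>C f x"
    "\<And>x. norm (f x) \<le> norm x * K"
  shows "Bop f \<cdot> x = f x"
proof -
  have "bounded_linear f"
    by (rule bounded_linear_intro[where K = K]) (use assms in \<open>auto simp: scaleR_scaleC\<close>)
  then show ?thesis using assms(2) by (simp add: Bop_inverse)
qed

lemma quadratic_form_eq_0:
  assumes "\<And>x. cinner x (a \<cdot> x) = 0"
  shows "a = 0"
proof -
  have "cinner x (a \<cdot> y) = 0" for x y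
  proof -
    have 1: "cinner x (a \<cdot> y) + cinner y (a \<cdot> x) = 0"
      using assms[of "x + y"] assms[of x] assms[of y]
      by (simp add: bop_add cinner_simps add.commute)
    have "\<i> * cinner x (a \<cdot> y) - \<i> * cinner y (a \<cdot> x) = 0"
      using assms[of "x + \<i> *\<^sub>C y"] assms[of x] assms[of y]
      by (simp add: bop_add bop_scaleC cinner_simps)
    then have "cinner x (a \<cdot> y) = cinner y (a \<cdot> x)" by (simp flip: right_diff_distrib)
    with 1 show ?thesis by simp
  qed
  then show ?thesis
    by (intro bop_eqI) (metis cinner_commute cinner_ext cinner_zero_left complex_cnj_zero zero_bop.rep_eq)
qed

lemma quadratic_form_ext:
  assumes "\<And>x. cinner x (a \<cdot> x) = cinner x (b \<cdot> x)"
  shows "a = b"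
  using quadratic_form_eq_0[of "a - b"] assms by (simp add: bop_simps cinner_simps)

lemma cinner_ext_right: "(\<And>y. cinner y x = cinner y x') \<Longrightarrow> x = x'"
  by (metis cinner_commute cinner_ext)

lemma dense_sequence:
  fixes x :: "'a::first_countable_topology"
  assumes "closure K = UNIV"
  obtains X where "\<And>n::nat. X n \<in> K" "X \<longlonglongrightarrow> x"
  using assms closure_sequential[of x K] by auto

lemma dense_cinner_ext:
  fixes x x' :: "'a::complex_inner"
  assumes "closure K = UNIV" "\<And>y. y \<in> K \<Longrightarrow> cinner y x = cinner y x'"
  shows "x = x'"
proof (rule cinner_ext_right)
  fix y
  obtain Y where Y: "\<And>n::nat. Y n \<in> K" "Y \<longlonglongrightarrow> y"
    using dense_sequence[OF assms(1)] by blast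
  have "(\<lambda>n. cinner (Y n) x) \<longlonglongrightarrow> cinner y x" "(\<lambda>n. cinner (Y n) x') \<longlonglongrightarrow> cinner y x'"
    by (intro tendsto_cinner Y tendsto_const)+
  then show "cinner y x = cinner y x'" using assms(2) Y(1) LIMSEQ_unique by auto
qed

lemma dense_bop_eqI:
  fixes a b :: "'a::complex_inner bop"
  assumes "closure K = UNIV" "\<And>y. y \<in> K \<Longrightarrow> a \<cdot> y = b \<cdot> y"
  shows "a = b"
proof (rule bop_eqI)
  fix x
  obtain Y where Y: "\<And>n::nat. Y n \<in> K" "Y \<longlonglongrightarrow> x"
    using dense_sequence[OF assms(1)] by blast
  have "(\<lambda>n. a \<cdot> Y n) \<longlonglongrightarrow> a \<cdot> x" "(\<lambda>n. b \<cdot> Y n) \<longlonglongrightarrow> b \<cdot> x"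
    by (intro tendsto_bop Y)+
  then show "a \<cdot> x = b \<cdot> x" using assms(2) Y(1) LIMSEQ_unique by auto
qed

lemma dense_extension:
  fixes T :: "'a::complex_inner \<Rightarrow> 'b::chilbert_space"
  assumes dense: "closure K = UNIV"
    and K: "\<And>x y. x \<in> K \<Longrightarrow> y \<in> K \<Longrightarrow> x + y \<in> K" "\<And>c x. x \<in> K \<Longrightarrow> c *\<^sub>C x \<in> K"
    and add: "\<And>x y. x \<in> K \<Longrightarrow> y \<in> K \<Longrightarrow> T (x + y) = T x + T y"
    and scale: "\<And>c x. x \<in> K \<Longrightarrow> T (c *\<^sub>C x) = c *\<^sub>C T x"
    and bound: "\<And>x. x \<in> K \<Longrightarrow> norm (T x) \<le> C * norm x"
  shows "\<exists>F. bounded_linear F \<and> (\<forall>c x. F (c *\<^sub>C x) = c *\<^sub>C F x) \<and> (\<forall>x\<in>K. F x = T x)"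
proof -
  have diff: "T (x - y) = T x - T y" "x - y \<in> K" if "x \<in> K" "y \<in> K" for x y
    using add[of x "- y"] scale[of y "-1"] K(1)[of x "- y"] K(2)[of y "-1"] that
    by (simp_all add: scaleC_minus_left scaleC_one)
  define D where "D = \<bar>C\<bar> + 1"
  have D: "D > 0" "\<And>x. x \<in> K \<Longrightarrow> norm (T x) \<le> D * norm x"
    using bound unfolding D_def
    by (auto intro!: order_trans[OF bound] mult_right_mono)
  have "uniformly_continuous_on K T"
    unfolding uniformly_continuous_on_def
  proof (intro allI impI)
    fix e :: real assume "e > 0"
    have "dist (T x') (T x) < e" if "x \<in> K" "x' \<in> K" "dist x' x < e / D" for x x'
    proof -
      have "dist (T x') (T x) \<le> D * dist x' x"
        using D(2)[of "x' - x"] diff that by (simp add: dist_norm)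
      also have "\<dots> < e" using that(3) D(1) by (simp add: field_simps)
      finally show ?thesis .
    qed
    then show "\<exists>d>0. \<forall>x\<in>K. \<forall>x'\<in>K. dist x' x < d \<longrightarrow> dist (T x') (T x) < e"
      using \<open>e > 0\<close> D(1) by (intro exI[of _ "e / D"]) auto
  qed
  then obtain F where F: "uniformly_continuous_on (closure K) F" "\<And>x. x \<in> K \<Longrightarrow> T x = F x"
    using uniformly_continuous_on_extension_on_closure[of K T] by metis
  have lim: "(\<lambda>n. F (X n)) \<longlonglongrightarrow> F x" if "X \<longlonglongrightarrow> x" for X and x
  proof -
    have "continuous_on UNIV F" using F(1) dense uniformly_continuous_imp_continuous by metis
    then show ?thesis using that continuous_on_tendsto_compose[of UNIV F X x] by auto
  qed
  have Fadd: "F (x + y) = F x + F y" for x y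
  proof -
    obtain X where X: "\<And>n::nat. X n \<in> K" "X \<longlonglongrightarrow> x" using dense_sequence[OF dense] by blast
    obtain Y where Y: "\<And>n::nat. Y n \<in> K" "Y \<longlonglongrightarrow> y" using dense_sequence[OF dense] by blast
    have "(\<lambda>n. F (X n + Y n)) \<longlonglongrightarrow> F (x + y)" by (rule lim[OF tendsto_add[OF X(2) Y(2)]])
    moreover have "(\<lambda>n. F (X n) + F (Y n)) \<longlonglongrightarrow> F x + F y" by (rule tendsto_add[OF lim[OF X(2)] lim[OF Y(2)]])
    moreover have "F (X n + Y n) = F (X n) + F (Y n)" for n
      using F(2) add X(1) Y(1) K by metis
    ultimately show ?thesis using LIMSEQ_unique by auto
  qed
  have Fscale: "F (c *\<^sub>C x) = c *\<^sub>C F x" for c x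
  proof -
    obtain X where X: "\<And>n::nat. X n \<in> K" "X \<longlonglongrightarrow> x" using dense_sequence[OF dense] by blast
    have "(\<lambda>n. F (c *\<^sub>C X n)) \<longlonglongrightarrow> F (c *\<^sub>C x)" by (rule lim[OF tendsto_scaleC[OF X(2)]])
    moreover have "(\<lambda>n. c *\<^sub>C F (X n)) \<longlonglongrightarrow> c *\<^sub>C F x" by (rule tendsto_scaleC[OF lim[OF X(2)]])
    moreover have "F (c *\<^sub>C X n) = c *\<^sub>C F (X n)" for n using F(2) scale X(1) K by metis
    ultimately show ?thesis using LIMSEQ_unique by auto
  qed
  have Fb: "norm (F x) \<le> norm x * D" for x
  proof -
    obtain X where X: "\<And>n::nat. X n \<in> K" "X \<longlonglongrightarrow> x" using dense_sequence[OF dense] by blast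
    have "(\<lambda>n. norm (F (X n))) \<longlonglongrightarrow> norm (F x)" "(\<lambda>n. norm (X n) * D) \<longlonglongrightarrow> norm x * D"
      by (rule tendsto_norm[OF lim[OF X(2)]] tendsto_mult_right[OF tendsto_norm[OF X(2)]])+
    then show ?thesis
      by (rule LIMSEQ_le) (metis D(2) F(2) X(1) mult.commute)
  qed
  have "bounded_linear F"
    by (rule bounded_linear_intro[where K = D]) (auto simp: Fadd Fscale Fb scaleR_scaleC)
  with Fscale F(2) show ?thesis by metis
qed

lemma sesquilinear_extension:
  fixes f :: "'a::complex_inner \<Rightarrow> 'b::chilbert_space \<Rightarrow> complex"
  assumes dense: "closure K = UNIV" "closure L = UNIV"
    and K: "\<And>x y. x \<in> K \<Longrightarrow> y \<in> K \<Longrightarrow> x + y \<in> K" "\<And>c x. x \<in> K \<Longrightarrow> c *\<^sub>C x \<in> K"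
    and L: "\<And>x y. x \<in> L \<Longrightarrow> y \<in> L \<Longrightarrow> x + y \<in> L" "\<And>c x. x \<in> L \<Longrightarrow> c *\<^sub>C x \<in> L"
    and right: "\<And>x y y'. x \<in> K \<Longrightarrow> y \<in> L \<Longrightarrow> y' \<in> L \<Longrightarrow> f x (y + y') = f x y + f x y'"
      "\<And>c x y. x \<in> K \<Longrightarrow> y \<in> L \<Longrightarrow> f x (c *\<^sub>C y) = c * f x y"
    and left: "\<And>x x' y. x \<in> K \<Longrightarrow> x' \<in> K \<Longrightarrow> y \<in> L \<Longrightarrow> f (x + x') y = f x y + f x' y"
      "\<And>c x y. x \<in> K \<Longrightarrow> y \<in> L \<Longrightarrow> f (c *\<^sub>C x) y = cnj c * f x y"
    and bound: "\<And>x y. x \<in> K \<Longrightarrow> y \<in> L \<Longrightarrow> cmod (f x y) \<le> norm x * norm y"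
  shows "\<exists>F. bounded_linear F \<and> (\<forall>c x. F (c *\<^sub>C x) = c *\<^sub>C F x) \<and>
    (\<forall>x\<in>K. \<forall>y\<in>L. cinner (F x) y = f x y)"
proof -
  have "\<exists>v. \<forall>y\<in>L. cinner v y = f x y" if x: "x \<in> K" for x
  proof -
    obtain F where F: "bounded_linear F" "\<And>c y. F (c *\<^sub>C y) = c * F y" "\<And>y. y \<in> L \<Longrightarrow> F y = f x y"
      using dense_extension[OF dense(2) L, of "f x" "norm x"] right bound x
      by (auto simp: scaleC_complex_def)
    have "bounded_linear (\<lambda>y. Re (F y))"
      by (rule bounded_linear_compose[OF bounded_linear_Re F(1)])
    then obtain v where v: "\<And>y. Re (F y) = inner v y" using riesz_representation by blast
    have "cinner v y = F y" for y
      using v[of y] v[of "\<i> *\<^sub>C y"] by (simp add: complex_eq_iff Im_cinner F(2)) (simp add: inner_eq_Re_cinner)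
    then show ?thesis using F(3) by metis
  qed
  then obtain T where T: "\<And>x y. x \<in> K \<Longrightarrow> y \<in> L \<Longrightarrow> cinner (T x) y = f x y" by metis
  have ext: "v = v'" if "\<And>y. y \<in> L \<Longrightarrow> cinner v y = cinner v' y" for v v'
    using dense_cinner_ext[OF dense(2), of v v'] that by (metis cinner_commute)
  have "\<exists>F. bounded_linear F \<and> (\<forall>c x. F (c *\<^sub>C x) = c *\<^sub>C F x) \<and> (\<forall>x\<in>K. F x = T x)"
  proof (rule dense_extension[OF dense(1) K, where C = 1])
    show "T (x + y) = T x + T y" if "x \<in> K" "y \<in> K" for x y
      using that by (intro ext) (simp add: T K left cinner_simps)
    show "T (c *\<^sub>C x) = c *\<^sub>C T x" if "x \<in> K" for c x
      using that by (intro ext) (simp add: T K left cinner_simps)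
    show "norm (T x) \<le> 1 * norm x" if x: "x \<in> K" for x
    proof -
      obtain Y where Y: "\<And>n::nat. Y n \<in> L" "Y \<longlonglongrightarrow> T x" using dense_sequence[OF dense(2)] by blast
      have "(\<lambda>n. cmod (cinner (T x) (Y n))) \<longlonglongrightarrow> cmod (cinner (T x) (T x))"
        "(\<lambda>n. norm x * norm (Y n)) \<longlonglongrightarrow> norm x * norm (T x)"
        by (intro tendsto_intros tendsto_cinner Y)+
      then have "cmod (cinner (T x) (T x)) \<le> norm x * norm (T x)"
        by (rule LIMSEQ_le) (use T x Y bound in auto)
      then have "norm (T x) * norm (T x) \<le> norm x * norm (T x)"
        by (simp add: cinner_self norm_mult power2_eq_square)
      then show ?thesis by (cases "T x = 0") auto
    qed
  qed
  then show ?thesis using T by metis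
qed

lemma star_one [simp]: "star (1 :: 'a::star_algebra) = 1"
  by (metis mult_1 mult_1_right star_mult star_star)

lemma star_zero [simp]: "star (0 :: 'a::star_algebra) = 0"
  using star_scaleC[of 0 "0::'a"] by simp

section \<open>Bounded Borel functional calculus of a projection-valued measure\<close>

definition bounded_borel :: "(real \<Rightarrow> complex) \<Rightarrow> bool" where
  "bounded_borel f \<longleftrightarrow> f \<in> borel_measurable borel \<and> (\<exists>K. \<forall>s. cmod (f s) \<le> K)"

lemma bounded_borelI: "f \<in> borel_measurable borel \<Longrightarrow> (\<And>s. cmod (f s) \<le> K) \<Longrightarrow> bounded_borel f"
  unfolding bounded_borel_def by blast

lemma bounded_borel_measurable: "bounded_borel f \<Longrightarrow> f \<in> borel_measurable borel"
  unfolding bounded_borel_def by blast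

lemma bounded_borel_const [simp]: "bounded_borel (\<lambda>s. c)"
  by (rule bounded_borelI[where K = "cmod c"]) auto

lemma bounded_borel_cnj: "bounded_borel f \<Longrightarrow> bounded_borel (\<lambda>s. cnj (f s))"
proof -
  have "cnj \<in> borel_measurable borel"
    by (intro borel_measurable_continuous_onI continuous_on_cnj continuous_on_id)
  then show "bounded_borel f \<Longrightarrow> bounded_borel (\<lambda>s. cnj (f s))"
    unfolding bounded_borel_def using measurable_compose[of f borel borel cnj borel] by auto
qed

lemma bounded_borel_mult: "bounded_borel f \<Longrightarrow> bounded_borel g \<Longrightarrow> bounded_borel (\<lambda>s. f s * g s)"
  unfolding bounded_borel_def norm_mult by (auto intro: mult_mono' norm_ge_zero)

lemma bounded_borel_add: "bounded_borel f \<Longrightarrow> bounded_borel g \<Longrightarrow> bounded_borel (\<lambda>s. f s + g s)"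
  unfolding bounded_borel_def by auto (meson add_mono norm_triangle_le)

lemma bounded_borel_scale: "bounded_borel f \<Longrightarrow> bounded_borel (\<lambda>s. c * f s)"
  by (intro bounded_borel_mult bounded_borel_const)

lemma bounded_borel_diff: "bounded_borel f \<Longrightarrow> bounded_borel g \<Longrightarrow> bounded_borel (\<lambda>s. f s - g s)"
  using bounded_borel_add[of f "\<lambda>s. -1 * g s"] bounded_borel_scale[of g "-1"] by simp

lemma bounded_borel_indicator: "X \<in> sets borel \<Longrightarrow> bounded_borel (indicator X)"
  by (rule bounded_borelI[where K = 1]) (auto simp: indicator_def)

locale pvm =
  fixes E :: "real set \<Rightarrow> 'g::chilbert_space bop"
  assumes pvm: "projection_valued_measure E"
begin

lemma projection: "X \<in> sets borel \<Longrightarrow> star (E X) = E X \<and> E X * E X = E X"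
  using pvm unfolding projection_valued_measure_def projection_def by blast

lemma E_UNIV: "E UNIV = 1"
  using pvm unfolding projection_valued_measure_def by blast

lemma E_sums: "range X \<subseteq> sets borel \<Longrightarrow> disjoint_family X \<Longrightarrow> (\<lambda>n. E (X n) \<cdot> x) sums (E (\<Union>n. X n) \<cdot> x)"
  for X :: "nat \<Rightarrow> real set"
  using pvm unfolding projection_valued_measure_def by blast

lemma E_empty: "E {} = 0"
proof (rule bop_eqI)
  fix x
  have "(\<lambda>n::nat. E {} \<cdot> x) sums (E (\<Union>n::nat. {}) \<cdot> x)"
    by (rule E_sums[of "\<lambda>n. {}"]) (auto simp: disjoint_family_on_def)
  then have "(\<lambda>n::nat. E {} \<cdot> x) \<longlonglongrightarrow> 0" by (intro summable_LIMSEQ_zero) (rule sums_summable)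
  then show "E {} \<cdot> x = 0 \<cdot> x" by (simp add: bop_simps LIMSEQ_const_iff)
qed

lemma E_Un:
  assumes "X \<in> sets borel" "Y \<in> sets borel" "X \<inter> Y = {}"
  shows "E (X \<union> Y) = E X + E Y"
proof (rule bop_eqI)
  fix x
  have "(\<lambda>n. E (binaryset X Y n) \<cdot> x) sums (E (\<Union>n. binaryset X Y n) \<cdot> x)"
    by (rule E_sums) (use assms in \<open>auto simp: binaryset_def disjoint_family_on_def\<close>)
  moreover have "(\<lambda>n. E (binaryset X Y n) \<cdot> x) sums (E X \<cdot> x + E Y \<cdot> x)"
    by (rule binaryset_sums) (simp add: E_empty bop_simps)
  ultimately show "E (X \<union> Y) \<cdot> x = (E X + E Y) \<cdot> x"
    using sums_unique2 by (auto simp: UN_binaryset_eq bop_simps)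
qed

lemma E_mult_disjoint:
  assumes "X \<in> sets borel" "Y \<in> sets borel" "X \<inter> Y = {}"
  shows "E X * E Y = 0"
proof -
  define p where "p = E X"
  define q where "q = E Y"
  have pp: "p * p = p" and qq: "q * q = q" using projection assms by (auto simp: p_def q_def)
  have "(p + q) * (p + q) = p + q"
    using projection[of "X \<union> Y"] E_Un[OF assms] assms by (simp add: p_def q_def)
  then have 1: "p * q + q * p = 0" by (simp add: algebra_simps pp qq)
  have "p * (p * q + q * p) = p * q + p * q * p" "(p * q + q * p) * p = p * q * p + q * p"
    using pp by (simp_all add: distrib_left distrib_right mult.assoc flip: mult.assoc[of p p])
  then have "p * q + p * q * p = 0" "p * q * p + q * p = 0" using 1 by simp_all
  then have "p * q = q * p" by (metis add.commute add_left_cancel)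
  with 1 have "(p * q) + (p * q) = 0" by simp
  then have "2 *\<^sub>C (p * q) = 0" by (metis one_add_one scaleC_add_left scaleC_one)
  then have "(1/2) *\<^sub>C 2 *\<^sub>C (p * q) = 0" by (simp add: scaleC_zero_right)
  then show ?thesis by (simp add: scaleC_scaleC scaleC_one p_def q_def)
qed

lemma E_Int:
  assumes "X \<in> sets borel" "Y \<in> sets borel"
  shows "E X * E Y = E (X \<inter> Y)"
proof -
  have X: "E X = E (X \<inter> Y) + E (X - Y)"
    using E_Un[of "X \<inter> Y" "X - Y"] assms by (simp add: Int_Diff_Un Int_Diff Diff_Int_distrib)
  have Y: "E Y = E (X \<inter> Y) + E (Y - X)"
    using E_Un[of "Y \<inter> X" "Y - X"] assms
    by (simp add: Int_Diff_Un Int_Diff Diff_Int_distrib) (simp add: Int_commute)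
  have "E X * E Y = E (X \<inter> Y) * E (X \<inter> Y) + E (X \<inter> Y) * E (Y - X)
      + (E (X - Y) * E (X \<inter> Y) + E (X - Y) * E (Y - X))"
    unfolding X Y by (simp add: algebra_simps)
  also have "\<dots> = E (X \<inter> Y)"
    using projection[of "X \<inter> Y"] assms by (subst (1 2 3) E_mult_disjoint) auto
  finally show ?thesis .
qed

lemma cinner_E: "X \<in> sets borel \<Longrightarrow> cinner x (E X \<cdot> x) = of_real ((norm (E X \<cdot> x))\<^sup>2)"
  by (metis cinner_self cinner_star_right projection times_bop.rep_eq)

abbreviation dm :: "'g \<Rightarrow> real measure" where "dm \<equiv> diagonal_measure E"

lemma space_dm [simp]: "space (dm x) = UNIV" and sets_dm [simp, measurable_cong]: "sets (dm x) = sets borel"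
  unfolding diagonal_measure_def by (simp_all add: space_measure_of_conv sets_measure_of_conv
      sets.sigma_sets_eq[of borel, simplified])

lemma emeasure_dm:
  assumes "X \<in> sets borel"
  shows "emeasure (dm x) X = ennreal ((norm (E X \<cdot> x))\<^sup>2)"
proof -
  let ?\<mu> = "\<lambda>X. ennreal (Re (cinner x (E X \<cdot> x)))"
  have "countably_additive (sets borel) ?\<mu>"
  proof (rule countably_additiveI)
    fix X :: "nat \<Rightarrow> real set"
    assume X: "range X \<subseteq> sets borel" "disjoint_family X"
    have "(\<lambda>n. Re (cinner x (E (X n) \<cdot> x))) sums Re (cinner x (E (\<Union>n. X n) \<cdot> x))"
      by (intro bounded_linear.sums[OF bounded_linear_Re]
          bounded_linear.sums[OF bounded_bilinear.bounded_linear_right[OF bounded_bilinear_cinner]]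
          E_sums X)
    then have "(\<lambda>n. ?\<mu> (X n)) sums ?\<mu> (\<Union>n. X n)"
      using X(1) by (intro sums_ennreal[THEN iffD2]) (auto simp: cinner_E)
    then show "(\<Sum>n. ?\<mu> (X n)) = ?\<mu> (\<Union>n. X n)" by (rule sums_unique[symmetric])
  qed
  moreover have "positive (sets borel) ?\<mu>" by (simp add: positive_def E_empty bop_simps)
  moreover have "sigma_algebra UNIV (sets (borel :: real measure))"
    using sets.sigma_algebra_axioms[of "borel :: real measure"] by simp
  ultimately have "emeasure (dm x) X = ?\<mu> X"
    unfolding diagonal_measure_def using assms by (intro emeasure_measure_of_sigma) auto
  then show ?thesis using assms by (simp add: cinner_E)
qed

lemma measure_dm: "X \<in> sets borel \<Longrightarrow> measure (dm x) X = (norm (E X \<cdot> x))\<^sup>2"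
  by (simp add: measure_def emeasure_dm)

lemma measure_dm_UNIV: "measure (dm x) UNIV = (norm x)\<^sup>2"
  by (simp add: measure_dm E_UNIV bop_simps)

lemma finite_measure_dm: "finite_measure (dm x)"
  by (rule finite_measureI) (simp add: emeasure_dm)

lemma integrable_dm: "bounded_borel f \<Longrightarrow> integrable (dm x) f"
  using finite_measure.integrable_const_bound[OF finite_measure_dm, of f] unfolding bounded_borel_def
  by (auto intro!: finite_measure.integrable_const_bound[OF finite_measure_dm])

lemma integral_indicator_dm:
  assumes "X \<in> sets borel"
  shows "(\<integral>s. indicator X s \<partial>dm x) = complex_of_real (measure (dm x) X)"
proof -
  have "(\<lambda>s. complex_of_real (indicator X s)) = indicator X" by (auto simp: indicator_def)
  then show ?thesis
    using integral_complex_of_real[of "dm x" "indicator X"] assms by simp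
qed

definition simple_fun :: "(real \<Rightarrow> complex) \<Rightarrow> bool" where
  "simple_fun f \<longleftrightarrow> finite (range f) \<and> (\<forall>c. f -` {c} \<in> sets borel)"

definition simple_op :: "(real \<Rightarrow> complex) \<Rightarrow> 'g bop" where
  "simple_op f = (\<Sum>c\<in>range f. c *\<^sub>C E (f -` {c}))"

lemma simple_fun_measurable:
  assumes "simple_fun f" shows "f \<in> borel_measurable borel"
proof -
  have "simple_function borel f"
    unfolding simple_function_def using assms by (auto simp: simple_fun_def)
  then show ?thesis by (rule borel_measurable_simple_function)
qed

lemma simple_fun_bounded_borel:
  assumes "simple_fun f" shows "bounded_borel f"
proof (rule bounded_borelI[where K = "Max (cmod ` range f)"])
  show "f \<in> borel_measurable borel" using assms by (rule simple_fun_measurable)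
  show "cmod (f s) \<le> Max (cmod ` range f)" for s
    using assms by (intro Max_ge) (auto simp: simple_fun_def)
qed

lemma simple_op_cinner:
  assumes f: "simple_fun f" and g: "simple_fun g"
  shows "cinner (simple_op f \<cdot> x) (simple_op g \<cdot> x) = (\<integral>s. cnj (f s) * g s \<partial>dm x)"
proof -
  have fin: "finite (range f)" "finite (range g)"
    and meas: "\<And>c. f -` {c} \<in> sets borel" "\<And>c. g -` {c} \<in> sets borel"
    using f g by (auto simp: simple_fun_def)
  have ind: "(\<Sum>c\<in>range h. c * indicator (h -` {c}) s) = h s" if "finite (range h)" for h :: "real \<Rightarrow> complex" and s
  proof -
    have "(\<Sum>c\<in>range h. c * indicator (h -` {c}) s) = (\<Sum>c\<in>range h. if c = h s then h s else 0)"
      by (intro sum.cong) (auto simp: indicator_def)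
    then show ?thesis using that by simp
  qed
  have EE: "cinner (E X \<cdot> x) (E Y \<cdot> x) = of_real (measure (dm x) (X \<inter> Y))"
    if "X \<in> sets borel" "Y \<in> sets borel" for X Y
  proof -
    have "cinner (E X \<cdot> x) (E Y \<cdot> x) = cinner x ((E X * E Y) \<cdot> x)"
      using that by (simp add: cinner_bop_left projection times_bop.rep_eq)
    then show ?thesis using that by (simp add: E_Int measure_dm cinner_E)
  qed
  have "cinner (simple_op f \<cdot> x) (simple_op g \<cdot> x) =
      (\<Sum>c\<in>range f. \<Sum>d\<in>range g. cnj c * d * of_real (measure (dm x) (f -` {c} \<inter> g -` {d})))"
    by (simp add: simple_op_def sum_bop_apply bop_simps cinner_sum_left cinner_sum_right cinner_simps
        EE meas sum_distrib_left mult.assoc) (subst sum.swap, simp add: mult.left_commute)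
  also have "\<dots> = (\<Sum>c\<in>range f. \<Sum>d\<in>range g. \<integral>s. cnj c * d * indicator (f -` {c} \<inter> g -` {d}) s \<partial>dm x)"
    using meas by (simp add: integral_indicator_dm sets.Int)
  also have "\<dots> = (\<integral>s. (\<Sum>c\<in>range f. \<Sum>d\<in>range g. cnj c * d * indicator (f -` {c} \<inter> g -` {d}) s) \<partial>dm x)"
    by (subst Bochner_Integration.integral_sum, intro Bochner_Integration.integrable_sum integrable_dm
        bounded_borel_scale bounded_borel_indicator sets.Int meas)
      (intro sum.cong refl Bochner_Integration.integral_sum[symmetric] integrable_dm
        bounded_borel_scale bounded_borel_indicator sets.Int meas)
  also have "(\<lambda>s. \<Sum>c\<in>range f. \<Sum>d\<in>range g. cnj c * d * indicator (f -` {c} \<inter> g -` {d}) s)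
      = (\<lambda>s. cnj (\<Sum>c\<in>range f. c * indicator (f -` {c}) s) * (\<Sum>d\<in>range g. d * indicator (g -` {d}) s))"
    by (rule ext, simp add: sum_product) (intro sum.cong refl, auto simp: indicator_def)
  finally show ?thesis unfolding ind[OF fin(1)] ind[OF fin(2)] .
qed

lemma simple_fun_const [simp]: "simple_fun (\<lambda>s. c)"
  by (auto simp: simple_fun_def vimage_def)

lemma simple_op_one: "simple_op (\<lambda>s. 1) = 1"
  by (simp add: simple_op_def E_UNIV scaleC_one)

text \<open>The operators of simple functions converge strongly, since
  \<open>f \<mapsto> f(E) x\<close> is isometric on \<open>L\<^sup>2\<close> of the diagonal measure of \<open>x\<close>.\<close>

lemma simple_approximation:
  assumes f: "bounded_borel f"
  obtains F W where "\<And>n::nat. simple_fun (F n)" "\<And>s. (\<lambda>n. F n s) \<longlonglongrightarrow> f s"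
    "\<And>n s. cmod (F n s) \<le> 2 * cmod (f s)" "\<And>x. (\<lambda>n. simple_op (F n) \<cdot> x) \<longlonglongrightarrow> W \<cdot> x"
proof -
  obtain F where F: "\<And>n. simple_function borel (F n)" "\<And>s. (\<lambda>n. F n s) \<longlonglongrightarrow> f s"
      "\<And>n s. cmod (F n s) \<le> 2 * cmod (f s)"
    using borel_measurable_implies_sequence_metric[OF bounded_borel_measurable[OF f], of 0]
    by (auto simp: dist_norm)
  have sF: "simple_fun (F n)" for n
    using F(1)[of n] unfolding simple_fun_def simple_function_def
    by simp (metis sets.empty_sets vimage_singleton_eq equals0I rangeI)
  obtain K where K: "\<And>s. cmod (f s) \<le> K" using f by (auto simp: bounded_borel_def)
  have K0: "K \<ge> 0" using K[of 0] norm_ge_zero order_trans by blast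
  have FK: "cmod (F n s) \<le> 2 * K" for n s using F(3)[of n s] K[of s] by linarith
  note [measurable] = simple_fun_measurable[OF sF] bounded_borel_measurable[OF f]
  have nsq: "(norm (simple_op (F n) \<cdot> x - simple_op (F m) \<cdot> x))\<^sup>2 = (\<integral>s. (cmod (F n s - F m s))\<^sup>2 \<partial>dm x)" for n m x
  proof -
    note int = integrable_dm[OF bounded_borel_mult[OF bounded_borel_cnj[OF simple_fun_bounded_borel] simple_fun_bounded_borel]]
    let ?a = "simple_op (F n) \<cdot> x" and ?b = "simple_op (F m) \<cdot> x"
    have "complex_of_real ((norm (?a - ?b))\<^sup>2) = cinner ?a ?a - cinner ?a ?b - (cinner ?b ?a - cinner ?b ?b)"
      unfolding cinner_self[symmetric] by (simp add: cinner_simps)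
    also have "\<dots> = (\<integral>s. cnj (F n s) * F n s - cnj (F n s) * F m s - (cnj (F m s) * F n s - cnj (F m s) * F m s) \<partial>dm x)"
      using int sF by (simp add: simple_op_cinner)
    also have "\<dots> = (\<integral>s. of_real ((cmod (F n s - F m s))\<^sup>2) \<partial>dm x)"
      by (intro Bochner_Integration.integral_cong refl)
        (simp add: complex_norm_square algebra_simps del: of_real_power)
    finally show ?thesis unfolding integral_complex_of_real of_real_eq_iff .
  qed
  have e0: "(\<lambda>n. \<integral>s. (cmod (F n s - f s))\<^sup>2 \<partial>dm x) \<longlonglongrightarrow> 0" for x
  proof -
    have "(\<lambda>n. \<integral>s. (cmod (F n s - f s))\<^sup>2 \<partial>dm x) \<longlonglongrightarrow> (\<integral>s. 0 \<partial>dm x)"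
    proof (rule integral_dominated_convergence[where w = "\<lambda>s. (3 * K)\<^sup>2"])
      show "AE s in dm x. (\<lambda>n. (cmod (F n s - f s))\<^sup>2) \<longlonglongrightarrow> 0"
      proof (rule AE_I2)
        fix s
        have "(\<lambda>n. (cmod (F n s - f s))\<^sup>2) \<longlonglongrightarrow> (cmod (f s - f s))\<^sup>2" by (intro tendsto_intros F(2))
        then show "(\<lambda>n. (cmod (F n s - f s))\<^sup>2) \<longlonglongrightarrow> 0" by simp
      qed
      show "AE s in dm x. norm ((cmod (F n s - f s))\<^sup>2) \<le> (3 * K)\<^sup>2" for n
      proof (rule AE_I2)
        fix s
        have "cmod (F n s - f s) \<le> 3 * K" using norm_triangle_ineq4[of "F n s" "f s"] FK[of n s] K[of s] by linarith
        then show "norm ((cmod (F n s - f s))\<^sup>2) \<le> (3 * K)\<^sup>2" using power_mono[OF _ norm_ge_zero, of _ _ 2] by fastforce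
      qed
      show "integrable (dm x) (\<lambda>s. (3 * K)\<^sup>2)" using finite_measure.integrable_const[OF finite_measure_dm] .
    qed auto
    then show ?thesis by simp
  qed
  have "Cauchy (\<lambda>n. simple_op (F n) \<cdot> x)" for x
  proof (rule CauchyI)
    fix e :: real assume "e > 0"
    define d where "d n = (\<integral>s. (cmod (F n s - f s))\<^sup>2 \<partial>dm x)" for n
    have iK: "integrable (dm x) (\<lambda>s. (cmod (F n s - f s))\<^sup>2)" for n
    proof (rule finite_measure.integrable_const_bound[OF finite_measure_dm, where B = "(3*K)\<^sup>2"])
      show "AE s in dm x. norm ((cmod (F n s - f s))\<^sup>2) \<le> (3 * K)\<^sup>2"
      proof (rule AE_I2)
        fix s
        have "cmod (F n s - f s) \<le> 3 * K" using norm_triangle_ineq4[of "F n s" "f s"] FK[of n s] K[of s] by linarith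
        then show "norm ((cmod (F n s - f s))\<^sup>2) \<le> (3 * K)\<^sup>2" using power_mono[OF _ norm_ge_zero, of _ _ 2] by fastforce
      qed
    qed auto
    have le: "(norm (simple_op (F n) \<cdot> x - simple_op (F m) \<cdot> x))\<^sup>2 \<le> 2 * d n + 2 * d m" for n m
    proof -
      have "(\<integral>s. (cmod (F n s - F m s))\<^sup>2 \<partial>dm x) \<le> (\<integral>s. 2 * (cmod (F n s - f s))\<^sup>2 + 2 * (cmod (F m s - f s))\<^sup>2 \<partial>dm x)"
      proof (rule integral_mono)
        show "integrable (dm x) (\<lambda>s. (cmod (F n s - F m s))\<^sup>2)"
          by (rule finite_measure.integrable_const_bound[OF finite_measure_dm, where B = "(4*K)\<^sup>2"])
            (use power_mono[OF order_trans[OF norm_triangle_ineq4 add_mono[OF FK FK]] norm_ge_zero, of _ _ _ _ 2]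
              in \<open>auto intro!: AE_I2\<close>)
        fix s
        have "(cmod (F n s - F m s))\<^sup>2 \<le> (cmod (F n s - f s) + cmod (F m s - f s))\<^sup>2"
          using norm_triangle_ineq4[of "F n s - f s" "F m s - f s"] by (simp add: power_mono)
        also have "\<dots> \<le> 2 * (cmod (F n s - f s))\<^sup>2 + 2 * (cmod (F m s - f s))\<^sup>2"
          using sum_squares_bound[of "cmod (F n s - f s)" "cmod (F m s - f s)"] by (simp add: power2_sum)
        finally show "(cmod (F n s - F m s))\<^sup>2 \<le> 2 * (cmod (F n s - f s))\<^sup>2 + 2 * (cmod (F m s - f s))\<^sup>2" .
      qed (use iK in simp)
      then show ?thesis using iK by (simp add: nsq d_def)
    qed
    have "e\<^sup>2 / 4 > 0" using \<open>e > 0\<close> by simp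
    then obtain N where N: "\<And>n. n \<ge> N \<Longrightarrow> norm (d n) < e\<^sup>2 / 4"
      using LIMSEQ_D[OF e0[of x], of "e\<^sup>2 / 4"] unfolding d_def by auto
    have "norm (simple_op (F n) \<cdot> x - simple_op (F m) \<cdot> x) < e" if "n \<ge> N" "m \<ge> N" for n m
    proof -
      have "(norm (simple_op (F n) \<cdot> x - simple_op (F m) \<cdot> x))\<^sup>2 < e\<^sup>2"
        using le[of n m] N[OF that(1)] N[OF that(2)] by simp
      then show ?thesis by (rule power2_less_imp_less) (use \<open>e > 0\<close> in simp)
    qed
    then show "\<exists>M. \<forall>m\<ge>M. \<forall>n\<ge>M. norm (simple_op (F m) \<cdot> x - simple_op (F n) \<cdot> x) < e" by blast
  qed
  then have "\<exists>y. (\<lambda>n. simple_op (F n) \<cdot> x) \<longlonglongrightarrow> y" for x using Cauchy_convergent convergent_def by blast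
  then obtain w where w: "\<And>x. (\<lambda>n. simple_op (F n) \<cdot> x) \<longlonglongrightarrow> w x" by metis
  have "Bop w \<cdot> x = w x" for x
  proof (rule Bop_apply[where K = "2 * K"])
    show "w (x + y) = w x + w y" for x y
      using tendsto_add[OF w[of x] w[of y]] w[of "x + y"] LIMSEQ_unique by (auto simp: bop_add)
    show "w (c *\<^sub>C x) = c *\<^sub>C w x" for c x
      using tendsto_scaleC[OF w[of x], of c] w[of "c *\<^sub>C x"] LIMSEQ_unique by (auto simp: bop_scaleC)
    show "norm (w x) \<le> norm x * (2 * K)" for x
    proof (rule LIMSEQ_le_const2[OF tendsto_norm[OF w]], intro exI allI impI)
      fix n
      have "complex_of_real ((norm (simple_op (F n) \<cdot> x))\<^sup>2) = (\<integral>s. cnj (F n s) * F n s \<partial>dm x)"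
        unfolding cinner_self[symmetric] by (rule simple_op_cinner[OF sF sF])
      also have "\<dots> = (\<integral>s. of_real ((cmod (F n s))\<^sup>2) \<partial>dm x)"
        by (intro Bochner_Integration.integral_cong refl)
          (simp add: complex_norm_square mult.commute del: of_real_power)
      finally have "(norm (simple_op (F n) \<cdot> x))\<^sup>2 = (\<integral>s. (cmod (F n s))\<^sup>2 \<partial>dm x)"
        unfolding integral_complex_of_real of_real_eq_iff .
      also have "\<dots> \<le> (\<integral>s. (2 * K)\<^sup>2 \<partial>dm x)"
      proof (rule integral_mono)
        show "integrable (dm x) (\<lambda>s. (cmod (F n s))\<^sup>2)"
          by (rule finite_measure.integrable_const_bound[OF finite_measure_dm, where B = "(2*K)\<^sup>2"])
            (use power_mono[OF FK norm_ge_zero, of _ _ 2] in \<open>auto intro!: AE_I2\<close>)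
        show "(cmod (F n s))\<^sup>2 \<le> (2 * K)\<^sup>2" for s
          using FK by (rule power_mono) simp
      qed (rule finite_measure.integrable_const[OF finite_measure_dm])
      also have "\<dots> = (norm x * (2 * K))\<^sup>2" by (simp add: measure_dm_UNIV power_mult_distrib)
      finally show "norm (simple_op (F n) \<cdot> x) \<le> norm x * (2 * K)"
        by (rule power2_le_imp_le) (simp add: K0)
    qed
  qed
  with w have "\<And>x. (\<lambda>n. simple_op (F n) \<cdot> x) \<longlonglongrightarrow> Bop w \<cdot> x" by simp
  with sF F that show ?thesis by blast
qed

definition calc :: "(real \<Rightarrow> complex) \<Rightarrow> 'g bop" where
  "calc f = (THE W. \<forall>x. cinner x (W \<cdot> x) = (\<integral>s. f s \<partial>dm x))"

lemma calc_eqI: "(\<And>x. cinner x (W \<cdot> x) = (\<integral>s. f s \<partial>dm x)) \<Longrightarrow> calc f = W"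
  unfolding calc_def by (rule the_equality) (auto intro: quadratic_form_ext)

lemma calc_limit:
  assumes f: "bounded_borel f" "\<And>n. simple_fun (F n)" "\<And>s. (\<lambda>n. F n s) \<longlonglongrightarrow> f s"
    "\<And>n s. cmod (F n s) \<le> 2 * cmod (f s)" "\<And>x. (\<lambda>n. simple_op (F n) \<cdot> x) \<longlonglongrightarrow> W \<cdot> x"
  and g: "bounded_borel g" "\<And>n. simple_fun (G n)" "\<And>s. (\<lambda>n. G n s) \<longlonglongrightarrow> g s"
    "\<And>n s. cmod (G n s) \<le> 2 * cmod (g s)" "\<And>x. (\<lambda>n. simple_op (G n) \<cdot> x) \<longlonglongrightarrow> V \<cdot> x"
  shows "cinner (W \<cdot> x) (V \<cdot> x) = (\<integral>s. cnj (f s) * g s \<partial>dm x)"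
proof (rule LIMSEQ_unique)
  show "(\<lambda>n. cinner (simple_op (F n) \<cdot> x) (simple_op (G n) \<cdot> x)) \<longlonglongrightarrow> cinner (W \<cdot> x) (V \<cdot> x)"
    by (intro tendsto_cinner f g)
  note [measurable] = simple_fun_measurable[OF f(2)] bounded_borel_measurable[OF f(1)]
    simple_fun_measurable[OF g(2)] bounded_borel_measurable[OF g(1)]
  obtain K L where K: "\<And>s. cmod (f s) \<le> K" and L: "\<And>s. cmod (g s) \<le> L"
    using f(1) g(1) by (auto simp: bounded_borel_def)
  have "(\<lambda>n. \<integral>s. cnj (F n s) * G n s \<partial>dm x) \<longlonglongrightarrow> (\<integral>s. cnj (f s) * g s \<partial>dm x)"
  proof (rule integral_dominated_convergence[where w = "\<lambda>s. (2 * K) * (2 * L)"])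
    show "AE s in dm x. (\<lambda>n. cnj (F n s) * G n s) \<longlonglongrightarrow> cnj (f s) * g s"
      by (intro AE_I2 tendsto_intros f g)
    show "AE s in dm x. norm (cnj (F n s) * G n s) \<le> 2 * K * (2 * L)" for n
    proof (rule AE_I2)
      fix s
      have "cmod (F n s) \<le> 2 * K" "cmod (G n s) \<le> 2 * L"
        using f(4)[of n s] g(4)[of n s] K[of s] L[of s] by linarith+
      then show "norm (cnj (F n s) * G n s) \<le> 2 * K * (2 * L)"
        unfolding norm_mult complex_mod_cnj by (intro mult_mono') auto
    qed
    show "integrable (dm x) (\<lambda>s. 2 * K * (2 * L))" by (rule finite_measure.integrable_const[OF finite_measure_dm])
    show "(\<lambda>s. cnj (f s) * g s) \<in> borel_measurable (dm x)"
      using bounded_borel_measurable[OF bounded_borel_mult[OF bounded_borel_cnj[OF f(1)] g(1)]] by simp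
    show "(\<lambda>s. cnj (F n s) * G n s) \<in> borel_measurable (dm x)" for n
      using bounded_borel_measurable[OF bounded_borel_mult[OF bounded_borel_cnj simple_fun_bounded_borel[OF g(2)]]]
        simple_fun_bounded_borel[OF f(2)] by simp
  qed
  then show "(\<lambda>n. cinner (simple_op (F n) \<cdot> x) (simple_op (G n) \<cdot> x)) \<longlonglongrightarrow> (\<integral>s. cnj (f s) * g s \<partial>dm x)"
    by (simp add: simple_op_cinner f g)
qed

lemma calc_exists:
  assumes f: "bounded_borel f"
  obtains F where "\<And>n::nat. simple_fun (F n)" "\<And>s. (\<lambda>n. F n s) \<longlonglongrightarrow> f s"
    "\<And>n s. cmod (F n s) \<le> 2 * cmod (f s)" "\<And>x. (\<lambda>n. simple_op (F n) \<cdot> x) \<longlonglongrightarrow> calc f \<cdot> x"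
proof -
  obtain F W where F: "\<And>n::nat. simple_fun (F n)" "\<And>s. (\<lambda>n. F n s) \<longlonglongrightarrow> f s"
    "\<And>n s. cmod (F n s) \<le> 2 * cmod (f s)" "\<And>x. (\<lambda>n. simple_op (F n) \<cdot> x) \<longlonglongrightarrow> W \<cdot> x"
    using simple_approximation[OF f] by blast
  have "cinner (1 \<cdot> x) (W \<cdot> x) = (\<integral>s. cnj 1 * f s \<partial>dm x)" for x
    by (rule calc_limit[where F = "\<lambda>n s. 1" and G = F]) (use f F in \<open>auto simp: simple_op_one\<close>)
  then have "calc f = W" by (intro calc_eqI) (simp add: bop_simps)
  with F that show ?thesis by blast
qed

lemma cinner_calc_calc:
  assumes f: "bounded_borel f" and g: "bounded_borel g"
  shows "cinner (calc f \<cdot> x) (calc g \<cdot> x) = (\<integral>s. cnj (f s) * g s \<partial>dm x)"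
proof -
  obtain F where F: "\<And>n::nat. simple_fun (F n)" "\<And>s. (\<lambda>n. F n s) \<longlonglongrightarrow> f s"
    "\<And>n s. cmod (F n s) \<le> 2 * cmod (f s)" "\<And>x. (\<lambda>n. simple_op (F n) \<cdot> x) \<longlonglongrightarrow> calc f \<cdot> x"
    using calc_exists[OF f] by blast
  obtain G where G: "\<And>n::nat. simple_fun (G n)" "\<And>s. (\<lambda>n. G n s) \<longlonglongrightarrow> g s"
    "\<And>n s. cmod (G n s) \<le> 2 * cmod (g s)" "\<And>x. (\<lambda>n. simple_op (G n) \<cdot> x) \<longlonglongrightarrow> calc g \<cdot> x"
    using calc_exists[OF g] by blast
  show ?thesis by (rule calc_limit[OF f F g G])
qed

lemma calc_one: "calc (\<lambda>s. 1) = 1"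
  by (rule calc_eqI) (simp add: cinner_self measure_dm_UNIV bop_simps scaleR_conv_of_real)

lemma cinner_calc: "bounded_borel f \<Longrightarrow> cinner x (calc f \<cdot> x) = (\<integral>s. f s \<partial>dm x)"
  using cinner_calc_calc[of "\<lambda>s. 1" f x] by (simp add: calc_one bop_simps)

lemma star_calc_mult: "bounded_borel f \<Longrightarrow> bounded_borel g \<Longrightarrow> star (calc f) * calc g = calc (\<lambda>s. cnj (f s) * g s)"
  by (rule calc_eqI[symmetric]) (simp add: cinner_calc_calc bop_simps cinner_star_right)

lemma star_calc: "bounded_borel f \<Longrightarrow> star (calc f) = calc (\<lambda>s. cnj (f s))"
  using star_calc_mult[of f "\<lambda>s. 1"] by (simp add: calc_one)

lemma calc_mult: "bounded_borel f \<Longrightarrow> bounded_borel g \<Longrightarrow> calc f * calc g = calc (\<lambda>s. f s * g s)"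
  using star_calc_mult[of "\<lambda>s. cnj (f s)" g] star_calc[of "\<lambda>s. cnj (f s)"] bounded_borel_cnj[of f] by simp

lemma calc_diff: "bounded_borel f \<Longrightarrow> bounded_borel g \<Longrightarrow> calc (\<lambda>s. f s - g s) = calc f - calc g"
  by (rule calc_eqI) (simp add: bop_simps cinner_simps cinner_calc integrable_dm)

lemma calc_scale: "bounded_borel f \<Longrightarrow> calc (\<lambda>s. c * f s) = c *\<^sub>C calc f"
  by (rule calc_eqI) (simp add: bop_simps cinner_simps cinner_calc integrable_dm)

lemma calc_sum: "(\<And>i. i \<in> I \<Longrightarrow> bounded_borel (f i)) \<Longrightarrow> finite I \<Longrightarrow>
    calc (\<lambda>s. \<Sum>i\<in>I. f i s) = (\<Sum>i\<in>I. calc (f i))"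
  by (rule calc_eqI) (simp add: sum_bop_apply cinner_sum_right cinner_calc integrable_dm)

lemma calc_indicator:
  assumes "X \<in> sets borel"
  shows "calc (indicator X) = E X"
proof (rule calc_eqI)
  fix x
  show "cinner x (E X \<cdot> x) = (\<integral>s. indicator X s \<partial>dm x)"
    using assms by (simp add: cinner_E measure_dm integral_indicator_dm)
qed

lemma norm_calc: "bounded_borel f \<Longrightarrow> (norm (calc f \<cdot> x))\<^sup>2 = (\<integral>s. (cmod (f s))\<^sup>2 \<partial>dm x)"
proof -
  assume f: "bounded_borel f"
  have "complex_of_real ((norm (calc f \<cdot> x))\<^sup>2) = (\<integral>s. of_real ((cmod (f s))\<^sup>2) \<partial>dm x)"
    unfolding cinner_self[symmetric, of "calc f \<cdot> x"] cinner_calc_calc[OF f f]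
    by (intro Bochner_Integration.integral_cong refl) (simp add: complex_norm_square mult.commute del: of_real_power)
  then show ?thesis unfolding integral_complex_of_real of_real_eq_iff .
qed

lemma calc_strong_convergence:
  assumes F: "\<And>n. F n \<in> borel_measurable borel" "\<And>n s. cmod (F n s) \<le> K" "\<And>s. (\<lambda>n::nat. F n s) \<longlonglongrightarrow> f s"
  shows "(\<lambda>n. calc (F n) \<cdot> x) \<longlonglongrightarrow> calc f \<cdot> x"
proof -
  have fm: "f \<in> borel_measurable borel" by (rule borel_measurable_LIMSEQ_metric[OF F(1)]) (use F(3) in auto)
  have fK: "cmod (f s) \<le> K" for s
    by (rule LIMSEQ_le_const2[OF tendsto_norm[OF F(3)]]) (use F(2) in auto)
  have bF: "bounded_borel (F n)" and bf: "bounded_borel f" for n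
    by (rule bounded_borelI[where K = K], fact+)+
  note [measurable] = fm F(1)
  have "(\<lambda>n. \<integral>s. (cmod (F n s - f s))\<^sup>2 \<partial>dm x) \<longlonglongrightarrow> (\<integral>s. 0 \<partial>dm x)"
  proof (rule integral_dominated_convergence[where w = "\<lambda>s. (2 * K)\<^sup>2"])
    show "AE s in dm x. (\<lambda>n. (cmod (F n s - f s))\<^sup>2) \<longlonglongrightarrow> 0"
    proof (rule AE_I2)
      fix s
      have "(\<lambda>n. (cmod (F n s - f s))\<^sup>2) \<longlonglongrightarrow> (cmod (f s - f s))\<^sup>2" by (intro tendsto_intros F(3))
      then show "(\<lambda>n. (cmod (F n s - f s))\<^sup>2) \<longlonglongrightarrow> 0" by simp
    qed
    show "AE s in dm x. norm ((cmod (F n s - f s))\<^sup>2) \<le> (2 * K)\<^sup>2" for n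
    proof (rule AE_I2)
      fix s
      have "cmod (F n s - f s) \<le> 2 * K" using norm_triangle_ineq4[of "F n s" "f s"] F(2)[of n s] fK[of s] by linarith
      then show "norm ((cmod (F n s - f s))\<^sup>2) \<le> (2 * K)\<^sup>2" using power_mono[OF _ norm_ge_zero, of _ _ 2] by fastforce
    qed
    show "integrable (dm x) (\<lambda>s. (2 * K)\<^sup>2)" using finite_measure.integrable_const[OF finite_measure_dm] .
  qed auto
  then have "(\<lambda>n. (norm (calc (F n) \<cdot> x - calc f \<cdot> x))\<^sup>2) \<longlonglongrightarrow> 0"
    using norm_calc[where x = x, OF bounded_borel_diff[OF bF bf]] by (simp add: calc_diff[OF bF bf] bop_simps)
  then have "(\<lambda>n. sqrt ((norm (calc (F n) \<cdot> x - calc f \<cdot> x))\<^sup>2)) \<longlonglongrightarrow> sqrt 0" by (rule tendsto_real_sqrt)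
  then show ?thesis by (simp add: LIM_zero_iff tendsto_norm_zero_iff)
qed

lemma calc_null:
  assumes f: "bounded_borel f" and g: "bounded_borel g" "calc g \<cdot> x = 0"
    and null: "\<And>r. g r = 0 \<Longrightarrow> f r = 0"
  shows "calc f \<cdot> x = 0"
proof -
  have i: "integrable (dm x) (\<lambda>s. (cmod (g s))\<^sup>2)"
  proof -
    have "integrable (dm x) (\<lambda>s. g s * cnj (g s))"
      by (intro integrable_dm bounded_borel_mult bounded_borel_cnj g)
    then show ?thesis
      unfolding complex_norm_square[symmetric] by (simp add: complex_of_real_integrable_eq del: of_real_power)
  qed
  have "(\<integral>s. (cmod (g s))\<^sup>2 \<partial>dm x) = 0" using norm_calc[OF g(1), of x] g(2) by simp
  then have "AE s in dm x. g s = 0" using integral_nonneg_eq_0_iff_AE[OF i] by simp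
  then have "AE s in dm x. (cmod (f s))\<^sup>2 = 0" using null by auto
  then have "(\<integral>s. (cmod (f s))\<^sup>2 \<partial>dm x) = 0" by (rule integral_eq_zero_AE)
  then show ?thesis using norm_calc[OF f, of x] by simp
qed

lemma calc_injective:
  assumes "bounded_borel f" "\<And>s. f s \<noteq> 0" "calc f \<cdot> x = 0"
  shows "x = 0"
  using calc_null[of "\<lambda>s. 1" f x] assms by (simp add: calc_one bop_simps)

end

section \<open>Gaussian smoothing of the imaginary powers\<close>

abbreviation gauss :: "real measure" where "gauss \<equiv> std_normal_distribution"

lemma prob_space_gauss: "prob_space gauss"
  using real_dist_normal_dist real_distribution.axioms(1) by blast

lemma finite_measure_gauss: "finite_measure gauss"
  using prob_space_gauss prob_space.finite_measure by blast

lemma gauss_cis: "(\<integral>t. cis (s * t * l) \<partial>gauss) = of_real (exp (- (s * l)\<^sup>2 / 2))"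
  using fun_cong[OF char_std_normal_distribution, of "s * l"]
  by (simp add: char_def cis_conv_exp mult.commute mult.left_commute mult.assoc)

text \<open>Completing the square, the modulated Gaussian with weight \<open>gauss_weight s\<close> has the Fourier
  transform of the Gaussian shifted by \<open>\<i>/2\<close>; this replaces a shift of contour.\<close>

definition gauss_weight :: "real \<Rightarrow> real \<Rightarrow> complex" where
  "gauss_weight s t = of_real (exp (1 / (8 * s\<^sup>2))) * cis (- t / (2 * s))"

lemma gauss_weight_cis:
  assumes "s \<noteq> 0"
  shows "(\<integral>t. gauss_weight s t * cis (s * t * l) \<partial>gauss) = of_real (exp (l / 2 - (s * l)\<^sup>2 / 2))"
proof -
  have "(\<integral>t. gauss_weight s t * cis (s * t * l) \<partial>gauss)
      = (\<integral>t. of_real (exp (1 / (8 * s\<^sup>2))) * cis (1 * t * (s * l - 1 / (2 * s))) \<partial>gauss)"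
    by (intro Bochner_Integration.integral_cong refl)
      (simp add: gauss_weight_def mult.assoc cis_mult algebra_simps)
  also have "\<dots> = of_real (exp (1 / (8 * s\<^sup>2)) * exp (- (s * l - 1 / (2 * s))\<^sup>2 / 2))"
    using gauss_cis[of 1 "s * l - 1 / (2 * s)"] by simp
  also have "exp (1 / (8 * s\<^sup>2)) * exp (- (s * l - 1 / (2 * s))\<^sup>2 / 2) = exp (l / 2 - (s * l)\<^sup>2 / 2)"
    unfolding exp_add[symmetric] using assms
    by (intro arg_cong[of _ _ exp]) (simp add: power2_eq_square field_simps)
  finally show ?thesis .
qed

lemma gauss_weight_bounded: "cmod (gauss_weight s t) \<le> exp (1 / (8 * s\<^sup>2))"
  by (simp add: gauss_weight_def norm_mult)

lemma continuous_gauss_weight: "s \<noteq> 0 \<Longrightarrow> continuous_on UNIV (gauss_weight s)"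
  unfolding gauss_weight_def by (intro continuous_intros) auto

lemma gauss_weight_measurable [measurable]: "gauss_weight s \<in> borel_measurable borel"
proof (cases "s = 0")
  case False
  then show ?thesis by (intro borel_measurable_continuous_onI continuous_gauss_weight)
next
  case True
  then have "gauss_weight s = (\<lambda>t. 1)" by (simp add: gauss_weight_def fun_eq_iff)
  then show ?thesis by simp
qed

lemma gauss_weight_cnj_cis:
  assumes "s \<noteq> 0"
  shows "(\<integral>t. cnj (gauss_weight s t) * cis (s * t * l) \<partial>gauss) = of_real (exp (- (l / 2) - (s * l)\<^sup>2 / 2))"
proof -
  have "(\<integral>t. cnj (gauss_weight s t) * cis (s * t * l) \<partial>gauss) = (\<integral>t. cnj (gauss_weight s t * cis (s * t * (- l))) \<partial>gauss)"
    by (intro Bochner_Integration.integral_cong refl) (simp add: cis_cnj)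
  also have "\<dots> = cnj (\<integral>t. gauss_weight s t * cis (s * t * (- l)) \<partial>gauss)"
    by (rule Bochner_Integration.integral_cnj)
  also have "\<dots> = of_real (exp (- (l / 2) - (s * l)\<^sup>2 / 2))"
    unfolding gauss_weight_cis[OF assms] by simp
  finally show ?thesis .
qed

lemma measurable_cnj_gauss_weight [measurable]: "(\<lambda>t. cnj (gauss_weight s t)) \<in> borel_measurable borel"
  by (rule measurable_compose[OF gauss_weight_measurable])
    (intro borel_measurable_continuous_onI continuous_on_cnj continuous_on_id)

lemma gauss_approximate_identity:
  fixes f :: "real \<Rightarrow> complex"
  assumes f: "continuous_on UNIV f" "\<And>t. cmod (f t) \<le> K"
  shows "(\<lambda>n. \<integral>t. f (inverse (real (Suc n)) * t) \<partial>gauss) \<longlonglongrightarrow> f 0"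
proof -
  have [measurable]: "f \<in> borel_measurable borel" using f(1) by (rule borel_measurable_continuous_onI)
  have "(\<lambda>n. \<integral>t. f (inverse (real (Suc n)) * t) \<partial>gauss) \<longlonglongrightarrow> (\<integral>t. f 0 \<partial>gauss)"
  proof (rule integral_dominated_convergence[where w = "\<lambda>t. K"])
    have "(\<lambda>n. f (inverse (real (Suc n)) * t)) \<longlonglongrightarrow> f (0 * t)" for t
      using f(1) by (intro continuous_on_tendsto_compose[OF f(1)] tendsto_mult LIMSEQ_inverse_real_of_nat) auto
    then show "AE t in gauss. (\<lambda>n. f (inverse (real (Suc n)) * t)) \<longlonglongrightarrow> f 0" by simp
    show "integrable gauss (\<lambda>t. K)" using finite_measure.integrable_const[OF finite_measure_gauss] .
  qed (use f(2) in auto)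
  then show ?thesis using prob_space.prob_space[OF prob_space_gauss] by simp
qed

lemma polarization:
  "4 * cinner y (a \<cdot> x) = cinner (x + y) (a \<cdot> (x + y)) - cinner (x - y) (a \<cdot> (x - y))
    + \<i> * (cinner (x + \<i> *\<^sub>C y) (a \<cdot> (x + \<i> *\<^sub>C y)) - cinner (x - \<i> *\<^sub>C y) (a \<cdot> (x - \<i> *\<^sub>C y)))"
  by (simp add: bop_add bop_diff bop_scaleC cinner_simps algebra_simps)

context pvm
begin

definition U :: "real \<Rightarrow> 'g bop" where "U t = calc (\<lambda>r. cis (t * ln r))"

lemma bounded_borel_cis: "l \<in> borel_measurable borel \<Longrightarrow> bounded_borel (\<lambda>r. cis (t * l r))"
proof (rule bounded_borelI[where K = 1])
  assume [measurable]: "l \<in> borel_measurable borel"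
  have [measurable]: "cis \<in> borel_measurable borel"
    by (intro borel_measurable_continuous_onI continuous_intros)
  show "(\<lambda>r. cis (t * l r)) \<in> borel_measurable borel" by measurable
qed simp

lemma bounded_borel_cis_ln: "bounded_borel (\<lambda>r. cis (t * ln r))"
  by (rule bounded_borel_cis) simp

lemma calc_prod:
  "bounded_borel f \<Longrightarrow> bounded_borel g \<Longrightarrow> (\<And>r. f r * g r = h r) \<Longrightarrow> calc f \<cdot> calc g \<cdot> x = calc h \<cdot> x"
  using calc_mult[of f g] by (simp flip: bop_mult_apply)

lemma U_mult: "U s * U t = U (s + t)"
  unfolding U_def by (simp add: calc_mult bounded_borel_cis_ln cis_mult distrib_right)

lemma U_0: "U 0 = 1"
  unfolding U_def by (simp add: calc_one)

lemma star_U: "star (U t) = U (- t)"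
  unfolding U_def by (simp add: star_calc bounded_borel_cis_ln cis_cnj)

lemma U_U_minus [simp]: "U t \<cdot> U (- t) \<cdot> x = x" "U (- t) \<cdot> U t \<cdot> x = x"
  using U_mult[of t "- t"] U_mult[of "- t" t] by (simp_all add: U_0 bop_simps flip: bop_mult_apply)

lemma cinner_U_left: "cinner (U t \<cdot> x) y = cinner x (U (- t) \<cdot> y)"
  by (simp add: cinner_bop_left star_U)

lemma norm_U [simp]: "norm (U t \<cdot> x) = norm x"
proof -
  have "complex_of_real ((norm (U t \<cdot> x))\<^sup>2) = of_real ((norm x)\<^sup>2)"
    unfolding cinner_self[symmetric] by (simp add: cinner_U_left)
  then show ?thesis by (simp del: of_real_power)
qed

lemma U_continuous: "continuous_on UNIV (\<lambda>t. U t \<cdot> x)"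
proof -
  have "(\<lambda>n. U (T n) \<cdot> x) \<longlonglongrightarrow> U t \<cdot> x" if "T \<longlonglongrightarrow> t" for T :: "nat \<Rightarrow> real" and t
    unfolding U_def
  proof (rule calc_strong_convergence[where K = 1])
    show "(\<lambda>r. cis (T n * ln r)) \<in> borel_measurable borel" for n
      using bounded_borel_measurable[OF bounded_borel_cis_ln] .
    show "(\<lambda>n. cis (T n * ln s)) \<longlonglongrightarrow> cis (t * ln s)" for s
      by (intro tendsto_intros that)
  qed simp
  then show ?thesis unfolding continuous_on_sequentially by (auto simp: comp_def)
qed

lemma smoothing:
  assumes w: "w \<in> borel_measurable borel" "\<And>t. cmod (w t) \<le> K"
    and f: "\<And>r. f r = (\<integral>t. w t * cis (s * t * ln r) \<partial>gauss)" "bounded_borel f"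
  shows "(\<integral>t. w t * cinner y (U (s * t) \<cdot> x) \<partial>gauss) = cinner y (calc f \<cdot> x)"
proof -
  note [measurable] = w(1)
  have cis_m [measurable]: "cis \<in> borel_measurable borel"
    by (intro borel_measurable_continuous_onI continuous_intros)
  have quad: "(\<integral>t. w t * cinner x (U (s * t) \<cdot> x) \<partial>gauss) = cinner x (calc f \<cdot> x)" for x
  proof -
    interpret D: finite_measure "dm x" by (rule finite_measure_dm)
    interpret G: prob_space gauss by (rule prob_space_gauss)
    interpret P: pair_sigma_finite gauss "dm x" ..
    have int: "integrable (gauss \<Otimes>\<^sub>M dm x) (\<lambda>(t, r). w t * cis (s * t * ln r))"
    proof (rule finite_measure.integrable_const_bound[where B = K])
      show "finite_measure (gauss \<Otimes>\<^sub>M dm x)" by (rule finite_measure_pair_measure; unfold_locales)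
      show "AE p in gauss \<Otimes>\<^sub>M dm x. norm (case p of (t, r) \<Rightarrow> w t * cis (s * t * ln r)) \<le> K"
        by (intro AE_I2) (auto simp: norm_mult w(2))
      show "(\<lambda>(t, r). w t * cis (s * t * ln r)) \<in> borel_measurable (gauss \<Otimes>\<^sub>M dm x)" by measurable
    qed
    have "(\<integral>t. w t * cinner x (U (s * t) \<cdot> x) \<partial>gauss) = (\<integral>t. (\<integral>r. w t * cis (s * t * ln r) \<partial>dm x) \<partial>gauss)"
      by (intro Bochner_Integration.integral_cong refl)
        (simp add: U_def cinner_calc bounded_borel_cis_ln)
    also have "\<dots> = (\<integral>r. (\<integral>t. w t * cis (s * t * ln r) \<partial>gauss) \<partial>dm x)"
      using P.Fubini_integral[OF int] by simp
    also have "\<dots> = cinner x (calc f \<cdot> x)" by (simp add: cinner_calc f flip: f(1))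
    finally show ?thesis .
  qed
  have int: "integrable gauss (\<lambda>t. w t * cinner y (U (s * t) \<cdot> x))" for x y
  proof (rule finite_measure.integrable_const_bound[OF finite_measure_gauss, where B = "K * (norm y * norm x)"])
    have "cmod (cinner y (U (s * t) \<cdot> x)) \<le> norm y * norm x" for t
      using cinner_cauchy_schwarz[of y "U (s * t) \<cdot> x"] by simp
    then have "cmod (w t * cinner y (U (s * t) \<cdot> x)) \<le> K * (norm y * norm x)" for t
      unfolding norm_mult by (intro mult_mono' w) auto
    then show "AE t in gauss. cmod (w t * cinner y (U (s * t) \<cdot> x)) \<le> K * (norm y * norm x)" by simp
    have "continuous_on UNIV (\<lambda>t. cinner y (U (s * t) \<cdot> x))"
      by (intro continuous_on_cinner continuous_intros continuous_on_compose2[OF U_continuous]) auto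
    note [measurable] = borel_measurable_continuous_onI[OF this]
    show "(\<lambda>t. w t * cinner y (U (s * t) \<cdot> x)) \<in> borel_measurable gauss"
      by measurable
  qed
  have "4 * (\<integral>t. w t * cinner y (U (s * t) \<cdot> x) \<partial>gauss) = (\<integral>t. w t * (4 * cinner y (U (s * t) \<cdot> x)) \<partial>gauss)"
    unfolding Bochner_Integration.integral_mult_right_zero[symmetric]
    by (intro Bochner_Integration.integral_cong refl) simp
  also have "\<dots> = (\<integral>t. (w t * cinner (x + y) (U (s * t) \<cdot> (x + y)) - w t * cinner (x - y) (U (s * t) \<cdot> (x - y)))
    + \<i> * (w t * cinner (x + \<i> *\<^sub>C y) (U (s * t) \<cdot> (x + \<i> *\<^sub>C y))
      - w t * cinner (x - \<i> *\<^sub>C y) (U (s * t) \<cdot> (x - \<i> *\<^sub>C y))) \<partial>gauss)"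
    unfolding polarization by (intro Bochner_Integration.integral_cong refl) (simp add: algebra_simps)
  also have "\<dots> = 4 * cinner y (calc f \<cdot> x)"
    unfolding polarization by (simp add: int quad)
  finally show ?thesis by simp
qed

definition G :: "real \<Rightarrow> 'g bop" where "G s = calc (\<lambda>r. of_real (exp (- (s * ln r)\<^sup>2 / 2)))"
definition G_half :: "real \<Rightarrow> 'g bop" where "G_half s = calc (\<lambda>r. of_real (exp (ln r / 2 - (s * ln r)\<^sup>2 / 2)))"

definition G_neg :: "real \<Rightarrow> 'g bop" where
  "G_neg s = calc (\<lambda>r. of_real (exp (- (ln r / 2) - (s * ln r)\<^sup>2 / 2)))"

lemma bounded_borel_G: "bounded_borel (\<lambda>r. of_real (exp (- (s * ln r)\<^sup>2 / 2)))"
  by (rule bounded_borelI[where K = 1]) auto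

lemma bounded_borel_G_half:
  assumes "s \<noteq> 0"
  shows "bounded_borel (\<lambda>r. of_real (exp (ln r / 2 - (s * ln r)\<^sup>2 / 2)))"
proof (rule bounded_borelI[where K = "exp (1 / (8 * s\<^sup>2))"])
  fix r :: real
  have "1 / (8 * s\<^sup>2) - (ln r / 2 - (s * ln r)\<^sup>2 / 2) = (s * ln r - 1 / (2 * s))\<^sup>2 / 2"
    using assms by (simp add: power2_eq_square field_simps)
  moreover have "(s * ln r - 1 / (2 * s))\<^sup>2 / 2 \<ge> 0" by simp
  ultimately have "ln r / 2 - (s * ln r)\<^sup>2 / 2 \<le> 1 / (8 * s\<^sup>2)" by linarith
  then show "cmod (of_real (exp (ln r / 2 - (s * ln r)\<^sup>2 / 2))) \<le> exp (1 / (8 * s\<^sup>2))" by simp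
qed simp

lemma bounded_borel_G_neg:
  assumes "s \<noteq> 0"
  shows "bounded_borel (\<lambda>r. of_real (exp (- (ln r / 2) - (s * ln r)\<^sup>2 / 2)))"
proof (rule bounded_borelI[where K = "exp (1 / (8 * s\<^sup>2))"])
  fix r :: real
  have "1 / (8 * s\<^sup>2) - (- (ln r / 2) - (s * ln r)\<^sup>2 / 2) = (s * ln r + 1 / (2 * s))\<^sup>2 / 2"
    using assms by (simp add: power2_eq_square field_simps)
  moreover have "(s * ln r + 1 / (2 * s))\<^sup>2 / 2 \<ge> 0" by simp
  ultimately have "- (ln r / 2) - (s * ln r)\<^sup>2 / 2 \<le> 1 / (8 * s\<^sup>2)" by linarith
  then show "cmod (of_real (exp (- (ln r / 2) - (s * ln r)\<^sup>2 / 2))) \<le> exp (1 / (8 * s\<^sup>2))" by simp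
qed simp

lemma cinner_G: "cinner y (G s \<cdot> x) = (\<integral>t. cinner y (U (s * t) \<cdot> x) \<partial>gauss)"
  using smoothing[of "\<lambda>t. 1" 1 "\<lambda>r. of_real (exp (- (s * ln r)\<^sup>2 / 2))" s y x] bounded_borel_G[of s]
  by (simp add: gauss_cis[of s] G_def)

lemma cinner_G_half:
  "s \<noteq> 0 \<Longrightarrow> cinner y (G_half s \<cdot> x) = (\<integral>t. gauss_weight s t * cinner y (U (s * t) \<cdot> x) \<partial>gauss)"
  unfolding G_half_def
  by (rule smoothing[symmetric, where K = "exp (1 / (8 * s\<^sup>2))"])
    (auto simp: gauss_weight_bounded gauss_weight_cis bounded_borel_G_half simp del: of_real_exp)

lemma cinner_G_neg:
  "s \<noteq> 0 \<Longrightarrow> cinner y (G_neg s \<cdot> x) = (\<integral>t. cnj (gauss_weight s t) * cinner y (U (s * t) \<cdot> x) \<partial>gauss)"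
  unfolding G_neg_def
  by (rule smoothing[symmetric, where K = "exp (1 / (8 * s\<^sup>2))"])
    (auto simp: gauss_weight_bounded gauss_weight_cnj_cis bounded_borel_G_neg simp del: of_real_exp)

lemma G_injective: "G s \<cdot> x = 0 \<Longrightarrow> x = 0"
  unfolding G_def by (rule calc_injective[OF bounded_borel_G]) auto

lemma G_inj: "G s \<cdot> x = G s \<cdot> y \<Longrightarrow> x = y"
  using G_injective[of s "x - y"] by (simp add: bop_diff)

lemma G_tendsto: "(\<lambda>n. G (inverse (real (Suc n))) \<cdot> x) \<longlonglongrightarrow> x"
proof -
  have "(\<lambda>n. G (inverse (real (Suc n))) \<cdot> x) \<longlonglongrightarrow> calc (\<lambda>r. 1) \<cdot> x"
    unfolding G_def
  proof (rule calc_strong_convergence[where K = 1])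
    show "(\<lambda>r. complex_of_real (exp (- (inverse (real (Suc n)) * ln r)\<^sup>2 / 2))) \<in> borel_measurable borel" for n
      using bounded_borel_measurable[OF bounded_borel_G] .
    have "(\<lambda>n. complex_of_real (exp (- (inverse (real (Suc n)) * ln r)\<^sup>2 / 2))) \<longlonglongrightarrow>
        of_real (exp (- (0 * ln r)\<^sup>2 / 2))" for r
      by (intro tendsto_of_real tendsto_exp tendsto_divide tendsto_minus tendsto_power tendsto_mult
          LIMSEQ_inverse_real_of_nat tendsto_const) auto
    then show "(\<lambda>n. complex_of_real (exp (- (inverse (real (Suc n)) * ln r)\<^sup>2 / 2))) \<longlonglongrightarrow> 1" for r by simp
  qed auto
  then show ?thesis by (simp add: calc_one bop_simps)
qed

subsection \<open>Truncated square roots\<close>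

definition trunc :: "nat \<Rightarrow> (real \<Rightarrow> complex) \<Rightarrow> real \<Rightarrow> complex" where
  "trunc L f r = (if r \<in> {exp (- real L)..exp (real L)} then f r else 0)"

lemma bounded_borel_trunc:
  assumes "f \<in> borel_measurable borel" "\<And>r. exp (- real L) \<le> r \<Longrightarrow> r \<le> exp (real L) \<Longrightarrow> cmod (f r) \<le> K"
  shows "bounded_borel (trunc L f)"
proof (rule bounded_borelI[where K = "max K 0"])
  show "trunc L f \<in> borel_measurable borel" unfolding trunc_def[abs_def] using assms(1) by measurable
  show "cmod (trunc L f s) \<le> max K 0" for s using assms(2)[of s] by (auto simp: trunc_def)
qed

lemma abs_ln_le: "exp (- real L) \<le> r \<Longrightarrow> r \<le> exp (real L) \<Longrightarrow> \<bar>ln r\<bar> \<le> real L"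
proof -
  assume *: "exp (- real L) \<le> r" "r \<le> exp (real L)"
  have r: "r > 0" using *(1) exp_gt_zero less_le_trans by blast
  have "ln r \<le> real L" using *(2) r by (metis ln_exp ln_le_cancel_iff exp_gt_zero)
  moreover have "- real L \<le> ln r" using *(1) r by (metis ln_exp ln_le_cancel_iff exp_gt_zero)
  ultimately show ?thesis by linarith
qed

definition EL :: "nat \<Rightarrow> 'g bop" where "EL L = calc (trunc L (\<lambda>r. 1))"
definition HL :: "nat \<Rightarrow> 'g bop" where "HL L = calc (trunc L (\<lambda>r. of_real (exp (ln r / 2))))"
definition KL :: "nat \<Rightarrow> 'g bop" where "KL L = calc (trunc L (\<lambda>r. of_real (exp (- (ln r / 2)))))"

lemma bounded_borel_EL: "bounded_borel (trunc L (\<lambda>r. 1))"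
  by (rule bounded_borel_trunc[where K = 1]) auto
lemma bounded_borel_HL: "bounded_borel (trunc L (\<lambda>r. of_real (exp (ln r / 2))))"
  by (rule bounded_borel_trunc[where K = "exp (real L / 2)"]) (use abs_ln_le in force)+
lemma bounded_borel_KL: "bounded_borel (trunc L (\<lambda>r. of_real (exp (- (ln r / 2)))))"
  by (rule bounded_borel_trunc[where K = "exp (real L / 2)"]) (use abs_ln_le in force)+

lemma star_EL: "star (EL L) = EL L" and star_HL: "star (HL L) = HL L"
proof -
  have "(\<lambda>r. cnj (trunc L (\<lambda>r. complex_of_real (f r)) r)) = trunc L (\<lambda>r. of_real (f r))" for f
    by (auto simp: trunc_def)
  from this[of "\<lambda>r. 1"] this[of "\<lambda>r. exp (ln r / 2)"]
  show "star (EL L) = EL L" "star (HL L) = HL L"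
    unfolding EL_def HL_def by (simp_all add: star_calc bounded_borel_EL bounded_borel_HL)
qed

lemma cinner_EL: "cinner (EL L \<cdot> x) y = cinner x (EL L \<cdot> y)"
  and cinner_HL: "cinner (HL L \<cdot> x) y = cinner x (HL L \<cdot> y)"
  by (simp_all add: cinner_bop_left star_EL star_HL)

lemma trunc_exp_mono:
  assumes "L \<le> L'" "r \<in> {exp (- real L)..exp (real L)}"
  shows "r \<in> {exp (- real L')..exp (real L')}"
proof -
  have "exp (- real L') \<le> exp (- real L)" "exp (real L) \<le> exp (real L')" using assms(1) by auto
  then show ?thesis using assms(2) by (meson atLeastAtMost_iff order_trans)
qed

lemmas bounded_borel_truncs = bounded_borel_EL bounded_borel_HL bounded_borel_KL

lemma EL_EL: "L \<le> L' \<Longrightarrow> EL L \<cdot> EL L' \<cdot> x = EL L \<cdot> x"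
    "L \<le> L' \<Longrightarrow> EL L' \<cdot> EL L \<cdot> x = EL L \<cdot> x"
  and EL_HL: "L \<le> L' \<Longrightarrow> EL L \<cdot> HL L' \<cdot> x = HL L \<cdot> x" "L \<le> L' \<Longrightarrow> EL L' \<cdot> HL L \<cdot> x = HL L \<cdot> x"
  and HL_EL: "L \<le> L' \<Longrightarrow> HL L \<cdot> EL L' \<cdot> x = HL L \<cdot> x" "L \<le> L' \<Longrightarrow> HL L' \<cdot> EL L \<cdot> x = HL L \<cdot> x"
  and EL_KL: "L \<le> L' \<Longrightarrow> EL L' \<cdot> KL L \<cdot> x = KL L \<cdot> x"
  and KL_EL: "L \<le> L' \<Longrightarrow> KL L' \<cdot> EL L \<cdot> x = KL L \<cdot> x"
  unfolding EL_def HL_def KL_def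
  by (rule calc_prod; (rule bounded_borel_truncs)?; auto simp: trunc_def dest: trunc_exp_mono)+

lemma HL_KL: "L \<le> L' \<Longrightarrow> HL L' \<cdot> KL L \<cdot> x = EL L \<cdot> x"
  and KL_HL: "L \<le> L' \<Longrightarrow> KL L' \<cdot> HL L \<cdot> x = EL L \<cdot> x"
proof -
  have 1: "complex_of_real (exp a) * of_real (exp (- a)) = 1" "complex_of_real (exp (- a)) * of_real (exp a) = 1" for a
    unfolding of_real_mult[symmetric] exp_add[symmetric] by simp_all
  show "L \<le> L' \<Longrightarrow> HL L' \<cdot> KL L \<cdot> x = EL L \<cdot> x" "L \<le> L' \<Longrightarrow> KL L' \<cdot> HL L \<cdot> x = EL L \<cdot> x"
    unfolding EL_def HL_def KL_def
    by (rule calc_prod; (rule bounded_borel_truncs)?; use 1 in \<open>auto simp: trunc_def dest: trunc_exp_mono\<close>)+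
qed

lemma U_EL: "U t \<cdot> EL L \<cdot> x = EL L \<cdot> U t \<cdot> x"
  using calc_mult[OF bounded_borel_cis_ln bounded_borel_EL, of t L]
    calc_mult[OF bounded_borel_EL bounded_borel_cis_ln, of L t]
  by (simp add: EL_def U_def mult.commute flip: bop_mult_apply)

lemma U_HL: "U t \<cdot> HL L \<cdot> x = HL L \<cdot> U t \<cdot> x"
  using calc_mult[OF bounded_borel_cis_ln bounded_borel_HL, of t L]
    calc_mult[OF bounded_borel_HL bounded_borel_cis_ln, of L t]
  by (simp add: HL_def U_def mult.commute flip: bop_mult_apply)

lemma G_HL:
  assumes "s \<noteq> 0"
  shows "G s \<cdot> HL L \<cdot> x = G_half s \<cdot> EL L \<cdot> x"
proof -
  define h where "h = trunc L (\<lambda>r. complex_of_real (exp (ln r / 2 - (s * ln r)\<^sup>2 / 2)))"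
  have "complex_of_real (exp (- (s * l)\<^sup>2 / 2)) * of_real (exp (l / 2)) = of_real (exp (l / 2 - (s * l)\<^sup>2 / 2))" for l
    unfolding of_real_mult[symmetric] exp_add[symmetric] by simp
  then have "G s \<cdot> HL L \<cdot> x = calc h \<cdot> x"
    unfolding G_def HL_def
    by (intro calc_prod bounded_borel_HL bounded_borel_G) (auto simp: trunc_def h_def)
  moreover have "G_half s \<cdot> EL L \<cdot> x = calc h \<cdot> x"
    unfolding G_half_def EL_def
    by (intro calc_prod bounded_borel_EL bounded_borel_G_half assms) (auto simp: trunc_def h_def)
  ultimately show ?thesis by simp
qed

lemma G_neg_HL:
  assumes "s \<noteq> 0"
  shows "G_neg s \<cdot> HL L \<cdot> x = G s \<cdot> EL L \<cdot> x"
proof -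
  define h where "h = trunc L (\<lambda>r. complex_of_real (exp (- (s * ln r)\<^sup>2 / 2)))"
  have "complex_of_real (exp (- (l / 2) - (s * l)\<^sup>2 / 2)) * of_real (exp (l / 2)) = of_real (exp (- (s * l)\<^sup>2 / 2))" for l
    unfolding of_real_mult[symmetric] exp_add[symmetric] by simp
  then have "G_neg s \<cdot> HL L \<cdot> x = calc h \<cdot> x"
    unfolding G_neg_def HL_def
    by (intro calc_prod bounded_borel_HL bounded_borel_G_neg assms) (auto simp: trunc_def h_def)
  moreover have "G s \<cdot> EL L \<cdot> x = calc h \<cdot> x"
    unfolding G_def EL_def
    by (intro calc_prod bounded_borel_EL bounded_borel_G) (auto simp: trunc_def h_def)
  ultimately show ?thesis by simp
qed

lemma EL_tendsto_pos: "(\<lambda>L. EL L \<cdot> x) \<longlonglongrightarrow> E {0<..} \<cdot> x"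
proof -
  have "(\<lambda>L. EL L \<cdot> x) \<longlonglongrightarrow> calc (indicator {0<..}) \<cdot> x"
    unfolding EL_def
  proof (rule calc_strong_convergence[where K = 1])
    show "(\<lambda>L. trunc L (\<lambda>r. 1) r) \<longlonglongrightarrow> indicator {0<..} r" for r
    proof (cases "r > 0")
      case True
      obtain N where N: "real N \<ge> \<bar>ln r\<bar>" using real_arch_simple by blast
      have "trunc L (\<lambda>r. 1) r = 1" if "L \<ge> N" for L
      proof -
        have "- real L \<le> ln r" "ln r \<le> real L" using N that by auto
        then have "exp (- real L) \<le> r" "r \<le> exp (real L)"
          using True by (metis exp_le_cancel_iff exp_ln)+
        then show ?thesis by (simp add: trunc_def)
      qed
      then have "\<forall>\<^sub>F L in sequentially. trunc L (\<lambda>r. 1) r = 1" unfolding eventually_sequentially by blast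
      then show ?thesis using True by (simp add: tendsto_eventually)
    next
      case False
      then have "\<not> exp (- real L) \<le> r" for L using exp_gt_zero less_le_trans by (metis not_le)
      then show ?thesis using False by (simp add: trunc_def)
    qed
    show "trunc L (\<lambda>r. 1) \<in> borel_measurable borel" for L
      using bounded_borel_measurable[OF bounded_borel_EL] .
  qed (auto simp: trunc_def)
  then show ?thesis by (simp add: calc_indicator)
qed

text \<open>If the logarithm is replaced by a function with finitely many values, then both sides of the
  following identity are finite double sums, whose terms agree by the Fourier transforms above.\<close>

lemma smoothed_commutation:
  assumes s: "s \<noteq> 0"
  shows "(\<integral>t. cinner (EL L \<cdot> y) (U (s * t) \<cdot> a \<cdot> U (- (s * t)) \<cdot> HL L \<cdot> x) \<partial>gauss)
    = (\<integral>t. cnj (gauss_weight s t) * cinner (HL L \<cdot> y) (U (s * t) \<cdot> a \<cdot> U (- (s * t)) \<cdot> EL L \<cdot> x) \<partial>gauss)"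
proof -
  define l where "l r = (if r \<in> {exp (- real L)..exp (real L)} then ln r else 0)" for r
  have lm [measurable]: "l \<in> borel_measurable borel" unfolding l_def[abs_def] by measurable
  have lL: "\<bar>l r\<bar> \<le> real L" for r using abs_ln_le[of L r] by (auto simp: l_def)
  obtain F where F: "\<And>n. simple_function borel (F n)" "\<And>r. (\<lambda>n. F n r) \<longlonglongrightarrow> l r"
      "\<And>n r. \<bar>F n r\<bar> \<le> 2 * \<bar>l r\<bar>"
    using borel_measurable_implies_sequence_metric[OF lm, of 0] by (auto simp: dist_norm)
  have Fm [measurable]: "F n \<in> borel_measurable borel" for n using F(1) by (rule borel_measurable_simple_function)
  have FL: "\<bar>F n r\<bar> \<le> 2 * real L" for n r using F(3)[of n r] lL[of r] by linarith
  have Ff: "finite (range (F n))" for n using F(1)[of n] by (simp add: simple_function_def)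
  have Fv: "F n -` {c} \<in> sets borel" for n c
    using measurable_sets[OF Fm, of "{c}" n] by simp
  define h0 where "h0 t c = cis (t * c)" for t c
  define h1 where "h1 t c = cis (t * c) * complex_of_real (exp (c / 2))" for t c
  have h0: "continuous_on UNIV (h0 t)" "\<bar>c\<bar> \<le> 2 * real L \<Longrightarrow> cmod (h0 t c) \<le> exp (real L)"
   and h1: "continuous_on UNIV (h1 t)" "\<bar>c\<bar> \<le> 2 * real L \<Longrightarrow> cmod (h1 t c) \<le> exp (real L)" for t c
    unfolding h0_def h1_def by (auto intro!: continuous_intros simp: norm_mult)
  define cut where "cut n h = calc (trunc L (\<lambda>r. h (F n r)))" for n h
  define comp where "comp n c = E (F n -` {c} \<inter> {exp (- real L)..exp (real L)})" for n c
  have cut_sum: "cut n h \<cdot> z = (\<Sum>c\<in>range (F n). h c *\<^sub>C (comp n c \<cdot> z))" for n h z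
  proof -
    let ?X = "\<lambda>c. F n -` {c} \<inter> {exp (- real L)..exp (real L)}"
    have X: "?X c \<in> sets borel" for c using Fv by auto
    have "trunc L (\<lambda>r. h (F n r)) r = (\<Sum>c\<in>range (F n). h c * indicator (?X c) r)" for r
    proof -
      have "(\<Sum>c\<in>range (F n). h c * indicator (?X c) r) = (\<Sum>c\<in>range (F n). if c = F n r then trunc L (\<lambda>r. h (F n r)) r else 0)"
        by (intro sum.cong) (auto simp: indicator_def trunc_def)
      then show ?thesis using Ff by simp
    qed
    then have "cut n h = calc (\<lambda>r. \<Sum>c\<in>range (F n). h c * indicator (?X c) r)"
      unfolding cut_def by (intro arg_cong[of _ _ calc]) auto
    also have "\<dots> = (\<Sum>c\<in>range (F n). h c *\<^sub>C E (?X c))"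
      using X Ff by (subst calc_sum) (auto simp: calc_scale bounded_borel_scale bounded_borel_indicator calc_indicator)
    finally show ?thesis by (simp add: sum_bop_apply bop_simps comp_def)
  qed
  have cut_lim: "(\<lambda>n. cut n h \<cdot> z) \<longlonglongrightarrow> calc (trunc L (\<lambda>r. h (ln r))) \<cdot> z"
    and cut_bound: "norm (cut n h \<cdot> z) \<le> exp (real L) * norm z"
    if h: "continuous_on UNIV h" "\<And>c. \<bar>c\<bar> \<le> 2 * real L \<Longrightarrow> cmod (h c) \<le> exp (real L)" for h z n
  proof -
    have [measurable]: "h \<in> borel_measurable borel" using h(1) by (rule borel_measurable_continuous_onI)
    have bb: "trunc L (\<lambda>r. h (F n r)) \<in> borel_measurable borel" for n
      unfolding trunc_def[abs_def] by measurable
    have bd: "cmod (trunc L (\<lambda>r. h (F n r)) r) \<le> exp (real L)" for n r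
      using h(2)[OF FL] by (auto simp: trunc_def)
    show "(\<lambda>n. cut n h \<cdot> z) \<longlonglongrightarrow> calc (trunc L (\<lambda>r. h (ln r))) \<cdot> z"
      unfolding cut_def
    proof (rule calc_strong_convergence[where K = "exp (real L)"])
      have hl: "(\<lambda>n. h (F n r)) \<longlonglongrightarrow> h (l r)" for r
        using F(2) by (intro continuous_on_tendsto_compose[OF h(1)]) auto
      show "(\<lambda>n. trunc L (\<lambda>r. h (F n r)) r) \<longlonglongrightarrow> trunc L (\<lambda>r. h (ln r)) r" for r
        using hl[of r] by (cases "r \<in> {exp (- real L)..exp (real L)}")
          (simp_all add: trunc_def l_def del: atLeastAtMost_iff)
    qed (use bb bd in auto)
    have "(norm (cut n h \<cdot> z))\<^sup>2 = (\<integral>r. (cmod (trunc L (\<lambda>r. h (F n r)) r))\<^sup>2 \<partial>dm z)"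
      unfolding cut_def by (intro norm_calc bounded_borelI[OF bb bd])
    also have "\<dots> \<le> (\<integral>r. (exp (real L))\<^sup>2 \<partial>dm z)"
    proof (rule integral_mono)
      note [measurable] = bb
      show "integrable (dm z) (\<lambda>r. (cmod (trunc L (\<lambda>r. h (F n r)) r))\<^sup>2)"
        by (rule finite_measure.integrable_const_bound[OF finite_measure_dm, where B = "(exp (real L))\<^sup>2"])
          (use power_mono[OF bd norm_ge_zero, of _ _ 2] in auto)
    qed (use power_mono[OF bd norm_ge_zero, of _ _ 2] finite_measure.integrable_const[OF finite_measure_dm] in auto)
    also have "\<dots> = (exp (real L) * norm z)\<^sup>2" by (simp add: measure_dm_UNIV power_mult_distrib)
    finally show "norm (cut n h \<cdot> z) \<le> exp (real L) * norm z" by (rule power2_le_imp_le) simp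
  qed
  have limits: "U t \<cdot> EL L \<cdot> z = calc (trunc L (\<lambda>r. h0 t (ln r))) \<cdot> z"
    "U t \<cdot> HL L \<cdot> z = calc (trunc L (\<lambda>r. h1 t (ln r))) \<cdot> z" for t z
    unfolding EL_def HL_def U_def h0_def h1_def bop_mult_apply[symmetric]
    by (auto simp: calc_mult bounded_borel_EL bounded_borel_HL bounded_borel_cis_ln trunc_def fun_eq_iff
        intro!: arg_cong[of _ _ "\<lambda>W. W \<cdot> z"] arg_cong[of _ _ calc])
  define p where "p n t = cinner (cut n (h0 (- (s * t))) \<cdot> y) (a \<cdot> cut n (h1 (- (s * t))) \<cdot> x)" for n t
  define q where "q n t = cnj (gauss_weight s t) * cinner (cut n (h1 (- (s * t))) \<cdot> y) (a \<cdot> cut n (h0 (- (s * t))) \<cdot> x)" for n t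
  obtain B where B: "B > 0" "\<And>z. norm (a \<cdot> z) \<le> B * norm z" using bop_bound by blast
  have bound: "cmod (cinner (cut n h \<cdot> y) (a \<cdot> cut n h' \<cdot> x)) \<le> exp (real L) * norm y * (B * (exp (real L) * norm x))"
    if "h = h0 u \<or> h = h1 u" "h' = h0 u \<or> h' = h1 u" for n h h' u
  proof -
    have "norm (cut n h \<cdot> y) \<le> exp (real L) * norm y" "norm (cut n h' \<cdot> x) \<le> exp (real L) * norm x"
      using that h0 h1 by (auto intro!: cut_bound)
    moreover from this(2) have "norm (a \<cdot> cut n h' \<cdot> x) \<le> B * (exp (real L) * norm x)"
      using B(2)[of "cut n h' \<cdot> x"] B(1) by (meson mult_left_mono less_imp_le order_trans)
    ultimately show ?thesis
      by (intro order_trans[OF cinner_cauchy_schwarz] mult_mono') auto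
  qed
  have cis_m [measurable]: "cis \<in> borel_measurable borel"
    by (intro borel_measurable_continuous_onI continuous_intros)
  have p_sum: "p n t = (\<Sum>c\<in>range (F n). \<Sum>d\<in>range (F n).
      cinner (comp n c \<cdot> y) (a \<cdot> comp n d \<cdot> x) * of_real (exp (d / 2)) * cis (s * t * (c - d)))"
   and q_sum: "q n t = (\<Sum>c\<in>range (F n). \<Sum>d\<in>range (F n).
      cinner (comp n c \<cdot> y) (a \<cdot> comp n d \<cdot> x) * of_real (exp (c / 2)) * (cnj (gauss_weight s t) * cis (s * t * (c - d))))" for n t
  proof -
    have ss: "cinner (\<Sum>c\<in>I. f c) (\<Sum>d\<in>J. g d) = (\<Sum>c\<in>I. \<Sum>d\<in>J. cinner (f c) (g d))"
      for I J :: "real set" and f g :: "real \<Rightarrow> 'g"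
      by (subst cinner_sum_left) (simp add: cinner_sum_right)
    have cc: "cnj (cis (- (s * t) * c)) * cis (- (s * t) * d) = cis (s * t * (c - d))" for c d
      by (simp add: cis_cnj cis_mult algebra_simps)
    have pt: "cinner (h0 (- (s * t)) c *\<^sub>C u) (a \<cdot> h1 (- (s * t)) d *\<^sub>C v)
        = cinner u (a \<cdot> v) * of_real (exp (d / 2)) * cis (s * t * (c - d))" for c d u v
      unfolding cc[symmetric] by (simp add: h0_def h1_def bop_scaleC cinner_simps)
    have qt: "cinner (h1 (- (s * t)) c *\<^sub>C u) (a \<cdot> h0 (- (s * t)) d *\<^sub>C v)
        = cinner u (a \<cdot> v) * of_real (exp (c / 2)) * cis (s * t * (c - d))" for c d u v
      unfolding cc[symmetric] by (simp add: h0_def h1_def bop_scaleC cinner_simps)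
    show "p n t = (\<Sum>c\<in>range (F n). \<Sum>d\<in>range (F n).
      cinner (comp n c \<cdot> y) (a \<cdot> comp n d \<cdot> x) * of_real (exp (d / 2)) * cis (s * t * (c - d)))"
      unfolding p_def cut_sum bop_sum ss pt ..
    show "q n t = (\<Sum>c\<in>range (F n). \<Sum>d\<in>range (F n).
      cinner (comp n c \<cdot> y) (a \<cdot> comp n d \<cdot> x) * of_real (exp (c / 2)) * (cnj (gauss_weight s t) * cis (s * t * (c - d))))"
      unfolding q_def cut_sum bop_sum ss qt by (simp add: sum_distrib_left mult.left_commute mult.assoc)
  qed
  have p_lim: "(\<lambda>n. \<integral>t. p n t \<partial>gauss) \<longlonglongrightarrow>
      (\<integral>t. cinner (EL L \<cdot> y) (U (s * t) \<cdot> a \<cdot> U (- (s * t)) \<cdot> HL L \<cdot> x) \<partial>gauss)"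
  proof (rule integral_dominated_convergence[where w = "\<lambda>t. exp (real L) * norm y * (B * (exp (real L) * norm x))"])
    have "(\<lambda>n. p n t) \<longlonglongrightarrow> cinner (U (- (s * t)) \<cdot> EL L \<cdot> y) (a \<cdot> U (- (s * t)) \<cdot> HL L \<cdot> x)" for t
      unfolding p_def limits by (intro tendsto_cinner tendsto_bop cut_lim h0 h1)
    then show "AE t in gauss. (\<lambda>n. p n t) \<longlonglongrightarrow> cinner (EL L \<cdot> y) (U (s * t) \<cdot> a \<cdot> U (- (s * t)) \<cdot> HL L \<cdot> x)"
      by (simp add: cinner_U_left)
    show "integrable gauss (\<lambda>t. exp (real L) * norm y * (B * (exp (real L) * norm x)))"
      by (rule finite_measure.integrable_const[OF finite_measure_gauss])
    show "AE t in gauss. norm (p n t) \<le> exp (real L) * norm y * (B * (exp (real L) * norm x))" for n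
      unfolding p_def by (intro AE_I2 bound) auto
    show "p n \<in> borel_measurable gauss" for n
      unfolding p_sum[abs_def] by measurable
    have "continuous_on UNIV (\<lambda>t. cinner (U (- (s * t)) \<cdot> EL L \<cdot> y) (a \<cdot> U (- (s * t)) \<cdot> HL L \<cdot> x))"
      by (intro continuous_on_cinner continuous_intros continuous_on_compose2[OF U_continuous]
         bounded_linear.continuous_on[OF bop_bounded_linear]) auto
    then show "(\<lambda>t. cinner (EL L \<cdot> y) (U (s * t) \<cdot> a \<cdot> U (- (s * t)) \<cdot> HL L \<cdot> x)) \<in> borel_measurable gauss"
      using borel_measurable_continuous_onI by (simp add: cinner_U_left)
  qed
  have q_lim: "(\<lambda>n. \<integral>t. q n t \<partial>gauss) \<longlonglongrightarrow>
      (\<integral>t. cnj (gauss_weight s t) * cinner (HL L \<cdot> y) (U (s * t) \<cdot> a \<cdot> U (- (s * t)) \<cdot> EL L \<cdot> x) \<partial>gauss)"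
  proof (rule integral_dominated_convergence[where
        w = "\<lambda>t. exp (1 / (8 * s\<^sup>2)) * (exp (real L) * norm y * (B * (exp (real L) * norm x)))"])
    have "(\<lambda>n. q n t) \<longlonglongrightarrow> cnj (gauss_weight s t) * cinner (U (- (s * t)) \<cdot> HL L \<cdot> y) (a \<cdot> U (- (s * t)) \<cdot> EL L \<cdot> x)" for t
      unfolding q_def limits by (intro tendsto_mult tendsto_const tendsto_cinner tendsto_bop cut_lim h0 h1)
    then show "AE t in gauss. (\<lambda>n. q n t) \<longlonglongrightarrow> cnj (gauss_weight s t) * cinner (HL L \<cdot> y) (U (s * t) \<cdot> a \<cdot> U (- (s * t)) \<cdot> EL L \<cdot> x)"
      by (simp add: cinner_U_left)
    show "integrable gauss (\<lambda>t. exp (1 / (8 * s\<^sup>2)) * (exp (real L) * norm y * (B * (exp (real L) * norm x))))"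
      by (rule finite_measure.integrable_const[OF finite_measure_gauss])
    show "AE t in gauss. norm (q n t) \<le> exp (1 / (8 * s\<^sup>2)) * (exp (real L) * norm y * (B * (exp (real L) * norm x)))" for n
      unfolding q_def norm_mult complex_mod_cnj by (intro AE_I2 mult_mono' bound gauss_weight_bounded) auto
    show "q n \<in> borel_measurable gauss" for n
      unfolding q_sum[abs_def] by measurable
    have "continuous_on UNIV (\<lambda>t. cinner (U (- (s * t)) \<cdot> HL L \<cdot> y) (a \<cdot> U (- (s * t)) \<cdot> EL L \<cdot> x))"
      by (intro continuous_on_cinner continuous_intros continuous_on_compose2[OF U_continuous]
         bounded_linear.continuous_on[OF bop_bounded_linear]) auto
    then have "(\<lambda>t. cinner (HL L \<cdot> y) (U (s * t) \<cdot> a \<cdot> U (- (s * t)) \<cdot> EL L \<cdot> x)) \<in> borel_measurable borel"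
      using borel_measurable_continuous_onI by (simp add: cinner_U_left)
    then show "(\<lambda>t. cnj (gauss_weight s t) * cinner (HL L \<cdot> y) (U (s * t) \<cdot> a \<cdot> U (- (s * t)) \<cdot> EL L \<cdot> x)) \<in> borel_measurable gauss"
      by measurable
  qed
  have int1: "integrable gauss (\<lambda>t. cis (s * t * c))" for c
    by (rule finite_measure.integrable_const_bound[OF finite_measure_gauss, where B = 1]) auto
  have int2: "integrable gauss (\<lambda>t. cnj (gauss_weight s t) * cis (s * t * c))" for c
  proof (rule finite_measure.integrable_const_bound[OF finite_measure_gauss, where B = "exp (1 / (8 * s\<^sup>2))"])
    show "(\<lambda>t. cnj (gauss_weight s t) * cis (s * t * c)) \<in> borel_measurable gauss" by measurable
  qed (auto simp: norm_mult gauss_weight_bounded)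
  have "(\<integral>t. p n t \<partial>gauss) = (\<integral>t. q n t \<partial>gauss)" for n
  proof -
    have "(\<integral>t. p n t \<partial>gauss) = (\<Sum>c\<in>range (F n). \<Sum>d\<in>range (F n).
      cinner (comp n c \<cdot> y) (a \<cdot> comp n d \<cdot> x) * of_real (exp (d / 2)) * of_real (exp (- (s * (c - d))\<^sup>2 / 2)))"
      unfolding p_sum by (simp add: int1 gauss_cis del: of_real_exp)
    also have "\<dots> = (\<Sum>c\<in>range (F n). \<Sum>d\<in>range (F n).
      cinner (comp n c \<cdot> y) (a \<cdot> comp n d \<cdot> x) * of_real (exp (c / 2)) * of_real (exp (- ((c - d) / 2) - (s * (c - d))\<^sup>2 / 2)))"
    proof (intro sum.cong refl)
      fix c d :: real
      have "exp (d / 2) * exp (- (s * (c - d))\<^sup>2 / 2) = exp (c / 2) * exp (- ((c - d) / 2) - (s * (c - d))\<^sup>2 / 2)"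
        unfolding exp_add[symmetric] by (simp add: field_simps)
      then show "cinner (comp n c \<cdot> y) (a \<cdot> comp n d \<cdot> x) * of_real (exp (d / 2)) * of_real (exp (- (s * (c - d))\<^sup>2 / 2))
        = cinner (comp n c \<cdot> y) (a \<cdot> comp n d \<cdot> x) * of_real (exp (c / 2)) * of_real (exp (- ((c - d) / 2) - (s * (c - d))\<^sup>2 / 2))"
        unfolding mult.assoc of_real_mult[symmetric] by simp
    qed
    also have "\<dots> = (\<integral>t. q n t \<partial>gauss)"
      unfolding q_sum by (simp add: int2 gauss_weight_cnj_cis[OF s] del: of_real_exp)
    finally show ?thesis .
  qed
  then show ?thesis using p_lim q_lim LIMSEQ_unique by simp
qed

end

section \<open>Von Neumann algebras\<close>

lemma commutant_closed:
  "1 \<in> commutant A" "0 \<in> commutant A"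
  "a \<in> commutant A \<Longrightarrow> b \<in> commutant A \<Longrightarrow> a + b \<in> commutant A"
  "a \<in> commutant A \<Longrightarrow> b \<in> commutant A \<Longrightarrow> a - b \<in> commutant A"
  "a \<in> commutant A \<Longrightarrow> b \<in> commutant A \<Longrightarrow> a * b \<in> commutant A"
  "a \<in> commutant A \<Longrightarrow> c *\<^sub>C a \<in> commutant A"
  by (auto simp: commutant_def algebra_simps scaleC_mult_left scaleC_mult_right)
    (metis mult.assoc)

lemma commutant_commute: "a \<in> A \<Longrightarrow> b \<in> commutant A \<Longrightarrow> a * b = b * a"
  by (auto simp: commutant_def)

lemma commutant_commute_apply: "a \<in> A \<Longrightarrow> b \<in> commutant A \<Longrightarrow> a \<cdot> b \<cdot> x = b \<cdot> a \<cdot> x"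
  using commutant_commute[of a A b] by (simp flip: bop_mult_apply)

lemma von_neumann_algebra_commutant:
  assumes "von_neumann_algebra A"
  shows "von_neumann_algebra (commutant A)"
  unfolding von_neumann_algebra_def
proof
  show "\<forall>b\<in>commutant A. star b \<in> commutant A"
  proof
    fix b assume b: "b \<in> commutant A"
    have "a * star b = star b * a" if "a \<in> A" for a
    proof -
      have "star a * b = b * star a"
        using assms that b by (intro commutant_commute) (auto simp: von_neumann_algebra_def)
      then have "star (star a * b) = star (b * star a)" by simp
      then show ?thesis by (simp add: star_mult star_star)
    qed
    then show "star b \<in> commutant A" by (simp add: commutant_def)
  qed
  show "commutant (commutant (commutant A)) = commutant A"
    using assms by (simp add: von_neumann_algebra_def)
qed

lemma von_neumann_algebra_closed:
  assumes "von_neumann_algebra A"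
  shows "1 \<in> A" "0 \<in> A" "a \<in> A \<Longrightarrow> b \<in> A \<Longrightarrow> a + b \<in> A" "a \<in> A \<Longrightarrow> b \<in> A \<Longrightarrow> a - b \<in> A"
    "a \<in> A \<Longrightarrow> b \<in> A \<Longrightarrow> a * b \<in> A" "a \<in> A \<Longrightarrow> c *\<^sub>C a \<in> A" "a \<in> A \<Longrightarrow> star a \<in> A"
proof -
  have A: "commutant (commutant A) = A" using assms by (simp add: von_neumann_algebra_def)
  note closed = commutant_closed[where A = "commutant A", unfolded A]
  show "1 \<in> A" "0 \<in> A" by (rule closed)+
  show "a \<in> A \<Longrightarrow> b \<in> A \<Longrightarrow> a + b \<in> A" by (rule closed)
  show "a \<in> A \<Longrightarrow> b \<in> A \<Longrightarrow> a - b \<in> A" by (rule closed)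
  show "a \<in> A \<Longrightarrow> b \<in> A \<Longrightarrow> a * b \<in> A" by (rule closed)
  show "a \<in> A \<Longrightarrow> c *\<^sub>C a \<in> A" by (rule closed)
  show "a \<in> A \<Longrightarrow> star a \<in> A" using assms by (simp add: von_neumann_algebra_def)
qed

lemma projection_onto_closure:
  fixes K :: "'g::chilbert_space set"
  assumes ne: "K \<noteq> {}" and K: "\<And>x y. x \<in> K \<Longrightarrow> y \<in> K \<Longrightarrow> x + y \<in> K" "\<And>c x. x \<in> K \<Longrightarrow> c *\<^sub>C x \<in> K"
  shows "\<exists>p. star p = p \<and> (\<forall>x. p \<cdot> x \<in> closure K) \<and> (\<forall>x\<in>closure K. p \<cdot> x = x)"
proof -
  define N where "N = closure K"
  have N: "x + y \<in> N" "c *\<^sub>C x \<in> N" if xy: "x \<in> N" "y \<in> N" for x y c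
  proof -
    obtain X Y where X: "\<And>n::nat. X n \<in> K" "X \<longlonglongrightarrow> x" and Y: "\<And>n::nat. Y n \<in> K" "Y \<longlonglongrightarrow> y"
      using xy unfolding N_def closure_sequential by blast
    have "(\<lambda>n. X n + Y n) \<longlonglongrightarrow> x + y" "(\<lambda>n. c *\<^sub>C X n) \<longlonglongrightarrow> c *\<^sub>C x"
      using tendsto_add[OF X(2) Y(2)] tendsto_scaleC[OF X(2)] by auto
    then show "x + y \<in> N" "c *\<^sub>C x \<in> N"
      unfolding N_def closure_sequential using K X(1) Y(1) by (metis (no_types, lifting))+
  qed
  have N_diff: "x - y \<in> N" if "x \<in> N" "y \<in> N" for x y
    using N(1)[OF that(1) N(2)[OF that(2,2), of "-1"]] by (simp add: scaleC_minus_left scaleC_one)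
  have N_ne: "N \<noteq> {}" using ne by (simp add: N_def)
  have "\<exists>y\<in>N. \<forall>z\<in>N. cinner z (x - y) = 0" for x
  proof -
    define Q where "Q y = (norm (x - y))\<^sup>2" for y
    define m where "m = Inf (Q ` N)"
    have bdd: "bdd_below (Q ` N)" by (rule bdd_belowI2[where m = 0]) (simp add: Q_def)
    have mQ: "m \<le> Q y" if "y \<in> N" for y unfolding m_def by (rule cINF_lower[OF bdd that])
    have "\<exists>y\<in>N. Q y < m + inverse (real (Suc n))" for n
    proof -
      have "Inf (Q ` N) < m + inverse (real (Suc n))" by (simp add: m_def)
      then show ?thesis using cInf_lessD[of "Q ` N"] N_ne by blast
    qed
    then obtain X where X: "\<And>n. X n \<in> N" "\<And>n. Q (X n) < m + inverse (real (Suc n))" by metis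
    have par: "(norm (y - z))\<^sup>2 = 2 * Q y + 2 * Q z - 4 * Q ((1/2) *\<^sub>R (y + z))" for y z
      by (simp add: Q_def power2_norm_eq_inner inner_simps inner_commute field_simps)
    have half: "(1/2) *\<^sub>R (y + z) \<in> N" if "y \<in> N" "z \<in> N" for y z
      using N that by (simp add: scaleR_scaleC)
    have dist: "(norm (X i - X j))\<^sup>2 \<le> 4 * inverse (real (Suc M))" if "M \<le> i" "M \<le> j" for M i j
    proof -
      have "inverse (real (Suc i)) \<le> inverse (real (Suc M))" "inverse (real (Suc j)) \<le> inverse (real (Suc M))"
        using that by simp_all
      with par[of "X i" "X j"] mQ[OF half[OF X(1) X(1)], of i j] X(2)[of i] X(2)[of j]
      show ?thesis by linarith
    qed
    have "Cauchy X"
    proof (rule CauchyI)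
      fix e :: real assume "e > 0"
      then obtain M where M: "inverse (real (Suc M)) < e\<^sup>2 / 4"
        using reals_Archimedean[of "e\<^sup>2 / 4"] by auto
      have "norm (X i - X j) < e" if "M \<le> i" "M \<le> j" for i j
      proof -
        have "(norm (X i - X j))\<^sup>2 < e\<^sup>2" using dist[OF that] M by linarith
        then show ?thesis by (rule power2_less_imp_less) (use \<open>e > 0\<close> in simp)
      qed
      then show "\<exists>M. \<forall>m\<ge>M. \<forall>n\<ge>M. norm (X m - X n) < e" by blast
    qed
    then obtain y where y: "X \<longlonglongrightarrow> y" using Cauchy_convergent convergent_def by blast
    have yN: "y \<in> N" using closed_sequentially[of N X y] X(1) y by (simp add: N_def)
    have "(\<lambda>n. Q (X n)) \<longlonglongrightarrow> Q y" unfolding Q_def by (intro tendsto_intros y)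
    moreover have "(\<lambda>n. m + inverse (real (Suc n))) \<longlonglongrightarrow> m + 0"
      by (intro tendsto_intros LIMSEQ_inverse_real_of_nat)
    ultimately have "Q y \<le> m + 0" by (rule LIMSEQ_le) (use X(2) less_imp_le in blast)
    then have Qy: "Q y \<le> m" by simp
    have "cinner z (x - y) = 0" if z: "z \<in> N" for z
    proof (cases "z = 0")
      case False
      define c where "c = cinner z (x - y) / of_real ((norm z)\<^sup>2)"
      have "complex_of_real (Q (y + c *\<^sub>C z)) = of_real (Q y) - c * cinner (x - y) z - cnj c * (cinner z (x - y) - c * cinner z z)"
        unfolding Q_def cinner_self[symmetric] by (simp add: cinner_simps algebra_simps)
      also have "cinner z (x - y) - c * cinner z z = 0"
        using False by (simp add: c_def cinner_self)
      also have "c * cinner (x - y) z = of_real ((cmod (cinner z (x - y)))\<^sup>2 / (norm z)\<^sup>2)"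
        unfolding c_def cinner_commute[of "x - y" z] of_real_divide complex_norm_square by simp
      finally have "complex_of_real (Q (y + c *\<^sub>C z)) = of_real (Q y - (cmod (cinner z (x - y)))\<^sup>2 / (norm z)\<^sup>2)"
        by simp
      then have "Q (y + c *\<^sub>C z) = Q y - (cmod (cinner z (x - y)))\<^sup>2 / (norm z)\<^sup>2"
        unfolding of_real_eq_iff .
      moreover have "m \<le> Q (y + c *\<^sub>C z)" by (intro mQ N(1)[OF yN N(2)[OF z z]])
      ultimately have "(cmod (cinner z (x - y)))\<^sup>2 / (norm z)\<^sup>2 \<le> 0" using Qy by linarith
      then show ?thesis using False by (simp add: divide_le_0_iff)
    qed simp
    then show ?thesis using yN by blast
  qed
  then obtain f where f: "\<And>x. f x \<in> N" "\<And>x z. z \<in> N \<Longrightarrow> cinner z (x - f x) = 0" by metis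
  have uniq: "f x = y" if "y \<in> N" "\<And>z. z \<in> N \<Longrightarrow> cinner z (x - y) = 0" for x y
  proof -
    have "cinner (f x - y) ((x - y) - (x - f x)) = 0"
      using that f N_diff by (subst cinner_diff_right) simp
    then show ?thesis by (simp add: cinner_self)
  qed
  have app: "Bop f \<cdot> x = f x" for x
  proof (rule Bop_apply[where K = 1])
    show "f (x + y) = f x + f y" for x y
    proof (rule uniq)
      fix z assume z: "z \<in> N"
      have "x + y - (f x + f y) = (x - f x) + (y - f y)" by simp
      then show "cinner z (x + y - (f x + f y)) = 0" using f(2)[OF z] by (simp only: cinner_add_right add_0)
    qed (intro N f)
    show "f (c *\<^sub>C x) = c *\<^sub>C f x" for c x
    proof (rule uniq)
      fix z assume z: "z \<in> N"
      have "c *\<^sub>C x - c *\<^sub>C f x = c *\<^sub>C (x - f x)" by (simp add: scaleC_diff_right)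
      then show "cinner z (c *\<^sub>C x - c *\<^sub>C f x) = 0" using f(2)[OF z] by (simp only: cinner_scaleC_right mult_zero_right)
    qed (rule N(2)[OF f(1) f(1)])
    show "norm (f x) \<le> norm x * 1" for x
    proof -
      have "cinner (f x) (f x) = cinner (f x) x" using f(2)[OF f(1), of x x] by (simp add: cinner_simps)
      then have "cmod (cinner (f x) x) = (norm (f x))\<^sup>2" by (metis cinner_self norm_of_real abs_of_nonneg zero_le_power2)
      then have "(norm (f x))\<^sup>2 \<le> norm (f x) * norm x"
        using cinner_cauchy_schwarz[of "f x" x] by simp
      then show ?thesis by (cases "f x = 0") (auto simp: power2_eq_square)
    qed
  qed
  have "star (Bop f) = Bop f"
  proof (rule star_bop_eqI)
    fix x y
    have "cinner (f x) y = cinner (f x) (f y)" using f(2)[OF f(1), of x y] by (simp add: cinner_simps)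
    moreover have "cinner (f y) x = cinner (f y) (f x)" using f(2)[OF f(1), of y x] by (simp add: cinner_simps)
    ultimately have "cinner (f x) y = cinner x (f y)" by (metis cinner_commute)
    then show "cinner (Bop f \<cdot> x) y = cinner x (Bop f \<cdot> y)" by (simp add: app)
  qed
  moreover have "f x = x" if "x \<in> N" for x using that by (intro uniq) auto
  ultimately show ?thesis using f(1) app unfolding N_def by (intro exI[of _ "Bop f"]) auto
qed

lemma cyclic_for_commutant:
  assumes A: "von_neumann_algebra A" and sep: "separating_vector A \<Lambda>"
  shows "closure {a' \<cdot> \<Lambda> |a'. a' \<in> commutant A} = UNIV"
proof -
  let ?K = "{a' \<cdot> \<Lambda> |a'. a' \<in> commutant A}"
  note A' = von_neumann_algebra_closed[OF von_neumann_algebra_commutant[OF A]]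
  have "\<exists>p. star p = p \<and> (\<forall>x. p \<cdot> x \<in> closure ?K) \<and> (\<forall>x\<in>closure ?K. p \<cdot> x = x)"
  proof (rule projection_onto_closure)
    show "?K \<noteq> {}" using A'(1) by blast
    show "x + y \<in> ?K" if xy: "x \<in> ?K" "y \<in> ?K" for x y
    proof -
      obtain a b where "a \<in> commutant A" "x = a \<cdot> \<Lambda>" "b \<in> commutant A" "y = b \<cdot> \<Lambda>" using xy by blast
      then show ?thesis using A'(3)[of a b] by (auto simp: plus_bop.rep_eq intro!: exI[of _ "a + b"])
    qed
    show "c *\<^sub>C x \<in> ?K" if x: "x \<in> ?K" for c x
    proof -
      obtain a where "a \<in> commutant A" "x = a \<cdot> \<Lambda>" using x by blast
      then show ?thesis using A'(6)[of a c] by (auto simp: scaleC_bop.rep_eq intro!: exI[of _ "c *\<^sub>C a"])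
    qed
  qed
  then obtain p where p: "star p = p" "\<And>x. p \<cdot> x \<in> closure ?K" "\<And>x. x \<in> closure ?K \<Longrightarrow> p \<cdot> x = x" by blast
  have inv: "b \<cdot> x \<in> closure ?K" if b: "b \<in> commutant A" and x: "x \<in> closure ?K" for b x
  proof -
    obtain X where X: "\<And>n::nat. X n \<in> ?K" "X \<longlonglongrightarrow> x" using x unfolding closure_sequential by blast
    have "b \<cdot> X n \<in> ?K" for n
    proof -
      obtain a where "a \<in> commutant A" "X n = a \<cdot> \<Lambda>" using X(1)[of n] by blast
      then show ?thesis using A'(5)[OF b, of a] by (auto simp: bop_mult_apply intro!: exI[of _ "b * a"])
    qed
    then show ?thesis unfolding closure_sequential using tendsto_bop[OF X(2)] by (intro exI[of _ "\<lambda>n. b \<cdot> X n"]) auto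
  qed
  have pbp: "p * b * p = b * p" if "b \<in> commutant A" for b
    by (rule bop_eqI) (simp add: bop_mult_apply p inv that)
  have "b * p = p * b" if b: "b \<in> commutant A" for b
  proof -
    have "star (p * star b * p) = star (star b * p)" using pbp[OF A'(7)[OF b]] by simp
    then have "p * b * p = p * b" by (simp add: star_mult star_star p(1) mult.assoc)
    then show ?thesis using pbp[OF b] by simp
  qed
  then have "p \<in> commutant (commutant A)" by (auto simp: commutant_def)
  then have "p \<in> A" using A by (simp add: von_neumann_algebra_def)
  then have "1 - p \<in> A" by (rule von_neumann_algebra_closed(4)[OF A von_neumann_algebra_closed(1)[OF A]])
  moreover have "\<Lambda> \<in> ?K" using A'(1) by (auto simp: one_bop.rep_eq intro!: exI[of _ 1])
  then have "p \<cdot> \<Lambda> = \<Lambda>" using p(3)[OF subsetD[OF closure_subset]] by simp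
  then have "(1 - p) \<cdot> \<Lambda> = 0" by (simp add: bop_simps)
  ultimately have "1 - p = 0" using sep unfolding separating_vector_def by blast
  then have "p = 1" by simp
  then show ?thesis using p(2) by (auto simp: bop_simps)
qed

section \<open>The modular operator and the modular conjugation\<close>

locale modular_data = pvm E for E :: "real set \<Rightarrow> 'g::chilbert_space bop" +
  fixes A :: "'g bop set" and \<Lambda> :: 'g
  assumes vn: "von_neumann_algebra A"
    and cyclic: "cyclic_vector A \<Lambda>"
    and separating: "separating_vector A \<Lambda>"
    and spectral: "spectral_measure_of E (modular_operator A \<Lambda>)"
    and invariant: "a \<in> A \<Longrightarrow> U t * a * U (- t) \<in> A"
begin

lemmas A_closed = von_neumann_algebra_closed[OF vn]
lemmas A'_closed = von_neumann_algebra_closed[OF von_neumann_algebra_commutant[OF vn]]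

lemma dense_A: "closure {a \<cdot> \<Lambda> |a. a \<in> A} = UNIV"
  using cyclic by (simp add: cyclic_vector_def)

lemma dense_A': "closure {a' \<cdot> \<Lambda> |a'. a' \<in> commutant A} = UNIV"
  by (rule cyclic_for_commutant[OF vn separating])

definition S :: "('g \<times> 'g) set" where "S = tomita_operator A \<Lambda>"

lemma S_A: "a \<in> A \<Longrightarrow> (a \<cdot> \<Lambda>, star a \<cdot> \<Lambda>) \<in> S"
  unfolding S_def tomita_operator_def using closure_subset by fast

lemma S_approx:
  assumes "(x, w) \<in> S"
  obtains a where "\<And>n::nat. a n \<in> A" "(\<lambda>n. a n \<cdot> \<Lambda>) \<longlonglongrightarrow> x" "(\<lambda>n. star (a n) \<cdot> \<Lambda>) \<longlonglongrightarrow> w"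
proof -
  obtain Z where Z: "\<And>n::nat. Z n \<in> {(a \<cdot> \<Lambda>, star a \<cdot> \<Lambda>) |a. a \<in> A}" "Z \<longlonglongrightarrow> (x, w)"
    using assms unfolding S_def tomita_operator_def closure_sequential by blast
  have "\<exists>a. a \<in> A \<and> Z n = (a \<cdot> \<Lambda>, star a \<cdot> \<Lambda>)" for n using Z(1)[of n] by blast
  then obtain a where a: "\<And>n. a n \<in> A" "\<And>n. Z n = (a n \<cdot> \<Lambda>, star (a n) \<cdot> \<Lambda>)" by metis
  have "(\<lambda>n. a n \<cdot> \<Lambda>) \<longlonglongrightarrow> x" "(\<lambda>n. star (a n) \<cdot> \<Lambda>) \<longlonglongrightarrow> w"
    using tendsto_fst[OF Z(2)] tendsto_snd[OF Z(2)] a(2) by simp_all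
  with a(1) that show ?thesis by blast
qed

lemma S_limit:
  assumes "\<And>n::nat. (X n, W n) \<in> S" "X \<longlonglongrightarrow> x" "W \<longlonglongrightarrow> w"
  shows "(x, w) \<in> S"
proof -
  have "closed S" by (simp add: S_def tomita_operator_def)
  then show ?thesis using closed_sequentially[of S "\<lambda>n. (X n, W n)"] tendsto_Pair[OF assms(2,3)] assms(1) by blast
qed

lemma S_add: assumes "(x, w) \<in> S" "(y, v) \<in> S" shows "(x + y, w + v) \<in> S"
proof -
  obtain a where a: "\<And>n::nat. a n \<in> A" "(\<lambda>n. a n \<cdot> \<Lambda>) \<longlonglongrightarrow> x" "(\<lambda>n. star (a n) \<cdot> \<Lambda>) \<longlonglongrightarrow> w"
    using S_approx[OF assms(1)] by blast
  obtain b where b: "\<And>n::nat. b n \<in> A" "(\<lambda>n. b n \<cdot> \<Lambda>) \<longlonglongrightarrow> y" "(\<lambda>n. star (b n) \<cdot> \<Lambda>) \<longlonglongrightarrow> v"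
    using S_approx[OF assms(2)] by blast
  show ?thesis
  proof (rule S_limit)
    show "((a n + b n) \<cdot> \<Lambda>, star (a n + b n) \<cdot> \<Lambda>) \<in> S" for n by (intro S_A A_closed a b)
  qed (auto simp: star_add bop_simps intro!: tendsto_add a b)
qed

lemma S_scale: assumes "(x, w) \<in> S" shows "(c *\<^sub>C x, cnj c *\<^sub>C w) \<in> S"
proof -
  obtain a where a: "\<And>n::nat. a n \<in> A" "(\<lambda>n. a n \<cdot> \<Lambda>) \<longlonglongrightarrow> x" "(\<lambda>n. star (a n) \<cdot> \<Lambda>) \<longlonglongrightarrow> w"
    using S_approx[OF assms(1)] by blast
  show ?thesis
  proof (rule S_limit)
    show "((c *\<^sub>C a n) \<cdot> \<Lambda>, star (c *\<^sub>C a n) \<cdot> \<Lambda>) \<in> S" for n by (intro S_A A_closed a)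
  qed (auto simp: star_scaleC bop_simps intro!: tendsto_scaleC a)
qed

lemma S_diff: assumes "(x, w) \<in> S" "(y, v) \<in> S" shows "(x - y, w - v) \<in> S"
  using S_add[OF assms(1) S_scale[OF assms(2), of "-1"]] by (simp add: scaleC_minus_left scaleC_one)

lemma S_sym: assumes "(x, w) \<in> S" shows "(w, x) \<in> S"
proof -
  obtain a where a: "\<And>n::nat. a n \<in> A" "(\<lambda>n. a n \<cdot> \<Lambda>) \<longlonglongrightarrow> x" "(\<lambda>n. star (a n) \<cdot> \<Lambda>) \<longlonglongrightarrow> w"
    using S_approx[OF assms(1)] by blast
  show ?thesis
  proof (rule S_limit[of "\<lambda>n. star (a n) \<cdot> \<Lambda>" "\<lambda>n. a n \<cdot> \<Lambda>"])
    show "(star (a n) \<cdot> \<Lambda>, a n \<cdot> \<Lambda>) \<in> S" for n using S_A[OF A_closed(7)[OF a(1)]] by (simp add: star_star)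
  qed (intro a)+
qed

lemma S_adjoint: assumes "a' \<in> commutant A" "(x, w) \<in> S" shows "cinner w (a' \<cdot> \<Lambda>) = cinner (star a' \<cdot> \<Lambda>) x"
proof -
  obtain a where a: "\<And>n::nat. a n \<in> A" "(\<lambda>n. a n \<cdot> \<Lambda>) \<longlonglongrightarrow> x" "(\<lambda>n. star (a n) \<cdot> \<Lambda>) \<longlonglongrightarrow> w"
    using S_approx[OF assms(2)] by blast
  have "cinner (star (a n) \<cdot> \<Lambda>) (a' \<cdot> \<Lambda>) = cinner (star a' \<cdot> \<Lambda>) (a n \<cdot> \<Lambda>)" for n
    by (simp add: cinner_star_left commutant_commute_apply[OF a(1) assms(1)])
  moreover have "(\<lambda>n. cinner (star (a n) \<cdot> \<Lambda>) (a' \<cdot> \<Lambda>)) \<longlonglongrightarrow> cinner w (a' \<cdot> \<Lambda>)"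
    "(\<lambda>n. cinner (star a' \<cdot> \<Lambda>) (a n \<cdot> \<Lambda>)) \<longlonglongrightarrow> cinner (star a' \<cdot> \<Lambda>) x"
    by (intro tendsto_cinner tendsto_const a)+
  ultimately show ?thesis using LIMSEQ_unique by simp
qed

lemma S_zero: assumes "(0, w) \<in> S" shows "w = 0"
proof -
  have "cinner y w = cinner y 0" if "y \<in> {a' \<cdot> \<Lambda> |a'. a' \<in> commutant A}" for y
    using that S_adjoint[OF _ assms] by (auto simp: cinner_commute[of _ w])
  then show ?thesis using dense_cinner_ext[OF dense_A'] by blast
qed

lemma S_unique: "(x, w) \<in> S \<Longrightarrow> (x, w') \<in> S \<Longrightarrow> w = w'"
  using S_diff[of x w x w'] S_zero[of "w - w'"] by simp

lemma S_injective: "(x, 0) \<in> S \<Longrightarrow> x = 0"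
  using S_zero S_sym by blast

abbreviation \<Delta> :: "('g \<times> 'g) set" where "\<Delta> \<equiv> modular_operator A \<Lambda>"

lemma \<Delta>_iff: "(x, z) \<in> \<Delta> \<longleftrightarrow> (\<exists>w. (x, w) \<in> S \<and> (\<forall>y v. (y, v) \<in> S \<longrightarrow> cinner v w = cinner z y))"
  by (auto simp: modular_operator_def conjugate_linear_adjoint_def S_def)

lemma \<Delta>_add_scale:
  assumes "(x, z) \<in> \<Delta>" "(x', z') \<in> \<Delta>"
  shows "(x + c *\<^sub>C x', z + c *\<^sub>C z') \<in> \<Delta>"
proof -
  obtain w w' where w: "(x, w) \<in> S" "\<And>y v. (y, v) \<in> S \<Longrightarrow> cinner v w = cinner z y"
    and w': "(x', w') \<in> S" "\<And>y v. (y, v) \<in> S \<Longrightarrow> cinner v w' = cinner z' y"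
    using assms unfolding \<Delta>_iff by blast
  show ?thesis unfolding \<Delta>_iff
    by (rule exI[of _ "w + cnj c *\<^sub>C w'"])
      (auto simp: w w' cinner_simps intro: S_add[OF w(1) S_scale[OF w'(1)]])
qed

lemma \<Delta>_domain: "(\<exists>z. (x, z) \<in> \<Delta>) \<longleftrightarrow> integrable (dm x) (\<lambda>s. s\<^sup>2)"
  using spectral unfolding spectral_measure_of_def by (auto simp: Domain_unfold)

lemma \<Delta>_form: "(x, z) \<in> \<Delta> \<Longrightarrow> cinner x z = of_real (\<integral>s. s \<partial>dm x)"
  using spectral unfolding spectral_measure_of_def by blast

lemma AE_dm:
  assumes "X \<in> sets borel" "E X \<cdot> x = x"
  shows "AE s in dm x. s \<in> X"
proof -
  have "E X + E (- X) = 1" using E_Un[of X "- X"] assms(1) by (simp add: E_UNIV Compl_partition)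
  then have "(E X + E (- X)) \<cdot> x = x" by (simp add: bop_simps)
  then have "E (- X) \<cdot> x = 0" using assms(2) by (simp add: bop_simps)
  then have "emeasure (dm x) (- X) = 0" using assms(1) by (simp add: emeasure_dm)
  then show ?thesis using assms(1) by (subst AE_iff_measurable[of "- X"]) auto
qed

lemma spectral_projection_domain:
  assumes X: "X \<in> sets borel" "E X \<cdot> x = x" "\<And>s. s \<in> X \<Longrightarrow> \<bar>s\<bar> \<le> B"
  shows "integrable (dm x) (\<lambda>s. s\<^sup>2)"
proof (rule finite_measure.integrable_const_bound[OF finite_measure_dm, where B = "B\<^sup>2"])
  show "AE s in dm x. norm (s\<^sup>2) \<le> B\<^sup>2"
    using AE_dm[OF X(1,2)]
  proof eventually_elim
    case (elim s)
    then show ?case using power_mono[OF X(3)[OF elim] abs_ge_zero, of 2] by simp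
  qed
qed auto

lemma E_nonpos: "E {..0} = 0"
proof -
  have "E {- real n..0} \<cdot> x = 0" for n x
  proof -
    define y where "y = E {- real n..0} \<cdot> x"
    have Ey: "E {- real n..0} \<cdot> y = y" using projection[of "{- real n..0}"] by (simp add: y_def flip: bop_mult_apply)
    obtain z where z: "(y, z) \<in> \<Delta>"
      using spectral_projection_domain[OF _ Ey, of "real n"] \<Delta>_domain by auto
    obtain w where w: "(y, w) \<in> S" "\<And>x v. (x, v) \<in> S \<Longrightarrow> cinner v w = cinner z x"
      using z unfolding \<Delta>_iff by blast
    have "(\<integral>s. s \<partial>dm y) \<le> 0"
    proof -
      have "AE s in dm y. s \<in> {- real n..0}" by (rule AE_dm[OF _ Ey]) simp
      then have "AE s in dm y. 0 \<le> - s" by eventually_elim simp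
      then have "0 \<le> (\<integral>s. - s \<partial>dm y)" by (rule integral_nonneg_AE)
      then show ?thesis by simp
    qed
    moreover have "complex_of_real ((norm w)\<^sup>2) = cnj (cinner y z)"
      using w(2)[OF w(1)] cinner_commute[of z y] by (simp add: cinner_self)
    then have "complex_of_real ((norm w)\<^sup>2) = of_real (\<integral>s. s \<partial>dm y)" using \<Delta>_form[OF z] by simp
    then have "(norm w)\<^sup>2 = (\<integral>s. s \<partial>dm y)" unfolding of_real_eq_iff .
    ultimately have "(norm w)\<^sup>2 \<le> 0" by linarith
    then have "w = 0" by simp
    then show ?thesis using w(1) S_injective y_def by blast
  qed
  moreover have "(\<lambda>n. calc (indicator {- real n..0}) \<cdot> x) \<longlonglongrightarrow> calc (indicator {..0}) \<cdot> x" for x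
  proof (rule calc_strong_convergence[where K = 1])
    show "(\<lambda>n. indicator {- real n..0} s) \<longlonglongrightarrow> (indicator {..0} s :: complex)" for s
    proof -
      obtain N where N: "- s \<le> real N" using real_arch_simple by blast
      have "indicator {- real n..0} s = (indicator {..0} s :: complex)" if "n \<ge> N" for n
        using N that by (auto simp: indicator_def)
      then have "\<forall>\<^sub>F n in sequentially. indicator {- real n..0} s = (indicator {..0} s :: complex)"
        unfolding eventually_sequentially by blast
      then show ?thesis by (rule tendsto_eventually)
    qed
  qed (auto simp: indicator_def)
  ultimately show ?thesis
    by (intro bop_eqI) (simp add: calc_indicator LIMSEQ_const_iff bop_simps)
qed

lemma EL_tendsto: "(\<lambda>L. EL L \<cdot> x) \<longlonglongrightarrow> x"
proof -
  have "{..0} \<union> {0<..} = (UNIV :: real set)" "{..0} \<inter> {0<..} = ({} :: real set)" by auto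
  then have "E {0<..} = 1" using E_Un[of "{..0}" "{0<..}"] by (simp add: E_nonpos E_UNIV)
  then show ?thesis using EL_tendsto_pos[of x] by (simp add: bop_simps)
qed

lemma EL_ext: "(\<And>L. EL L \<cdot> x = EL L \<cdot> y) \<Longrightarrow> x = y"
  using EL_tendsto[of x] EL_tendsto[of y] LIMSEQ_unique by simp

lemma EL_E: "EL L = E {exp (- real L)..exp (real L)}"
proof -
  have "trunc L (\<lambda>r. 1) = indicator {exp (- real L)..exp (real L)}"
    by (auto simp: trunc_def indicator_def)
  then show ?thesis by (simp add: EL_def calc_indicator)
qed

lemma EL_\<Delta>: "\<exists>z. (EL L \<cdot> x, z) \<in> \<Delta>"
proof -
  have "E {exp (- real L)..exp (real L)} \<cdot> EL L \<cdot> x = EL L \<cdot> x"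
    using EL_EL(1)[of L L] by (simp add: EL_E)
  moreover have "\<bar>s\<bar> \<le> exp (real L)" if "s \<in> {exp (- real L)..exp (real L)}" for s
  proof -
    have "0 \<le> s" using that exp_gt_zero[of "- real L"] by (meson atLeastAtMost_iff less_imp_le order_trans)
    then show ?thesis using that by simp
  qed
  ultimately have "integrable (dm (EL L \<cdot> x)) (\<lambda>s. s\<^sup>2)"
    by (intro spectral_projection_domain[where X = "{exp (- real L)..exp (real L)}"]) simp_all
  then show ?thesis by (simp add: \<Delta>_domain)
qed

lemma \<Delta>_form_EL:
  assumes "(EL L \<cdot> x, z) \<in> \<Delta>"
  shows "cinner (EL L \<cdot> x) z = cinner (EL L \<cdot> x) (HL L \<cdot> HL L \<cdot> x)"
proof -
  let ?h = "trunc L (\<lambda>r. complex_of_real (exp (ln r / 2)))"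
  have sq: "?h r * ?h r = of_real r" if "r \<in> {exp (- real L)..exp (real L)}" for r
  proof -
    have "r > 0" using that exp_gt_zero[of "- real L"] by (meson atLeastAtMost_iff less_le_trans)
    then have "exp (ln r / 2) * exp (ln r / 2) = r" by (simp flip: exp_add)
    then show ?thesis using that by (simp add: trunc_def flip: of_real_mult)
  qed
  have "cinner (EL L \<cdot> x) (HL L \<cdot> HL L \<cdot> x) = cinner (EL L \<cdot> x) (HL L \<cdot> HL L \<cdot> EL L \<cdot> x)"
    by (simp add: HL_EL)
  also have "\<dots> = (\<integral>r. ?h r * ?h r \<partial>dm (EL L \<cdot> x))"
    using calc_mult[OF bounded_borel_HL bounded_borel_HL, of L L]
      cinner_calc[OF bounded_borel_mult[OF bounded_borel_HL bounded_borel_HL], of "EL L \<cdot> x" L L]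
    by (simp add: HL_def flip: bop_mult_apply[of "calc f" "calc f" for f])
  also have "\<dots> = (\<integral>r. of_real r \<partial>dm (EL L \<cdot> x))"
  proof (rule integral_cong_AE)
    have "E {exp (- real L)..exp (real L)} \<cdot> EL L \<cdot> x = EL L \<cdot> x"
      using EL_EL(1)[of L L] by (simp add: EL_E)
    then have "AE r in dm (EL L \<cdot> x). r \<in> {exp (- real L)..exp (real L)}" by (intro AE_dm) auto
    then show "AE r in dm (EL L \<cdot> x). ?h r * ?h r = of_real r" by eventually_elim (rule sq)
    show "(\<lambda>r. ?h r * ?h r) \<in> borel_measurable (dm (EL L \<cdot> x))"
      using bounded_borel_measurable[OF bounded_borel_mult[OF bounded_borel_HL bounded_borel_HL]] by simp
  qed auto
  also have "\<dots> = cinner (EL L \<cdot> x) z" by (simp add: \<Delta>_form[OF assms])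
  finally show ?thesis by simp
qed

lemma HL_HL_EL: "L \<le> L' \<Longrightarrow> HL L' \<cdot> HL L' \<cdot> EL L \<cdot> x = HL L \<cdot> HL L \<cdot> x"
  using HL_EL(2)[of L L' x] HL_EL(2)[of L L' "HL L \<cdot> x"] EL_HL(2)[of L L x] by simp

lemma \<Delta>_EL:
  assumes "(EL L \<cdot> x, z) \<in> \<Delta>"
  shows "z = HL L \<cdot> HL L \<cdot> x"
proof -
  have main: "cinner (EL L' \<cdot> y) z = cinner (EL L' \<cdot> y) (HL L \<cdot> HL L \<cdot> x)" if "L \<le> L'" for L' y
  proof -
    let ?x = "EL L \<cdot> x" let ?y = "EL L' \<cdot> y" let ?D = "\<lambda>u. HL L' \<cdot> HL L' \<cdot> u"
    obtain z' where z': "(?y, z') \<in> \<Delta>" using EL_\<Delta> by blast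
    have x: "EL L' \<cdot> ?x = ?x" and y: "EL L' \<cdot> ?y = ?y" using that by (simp_all add: EL_EL)
    have q: "cinner (?x + c *\<^sub>C ?y) (z + c *\<^sub>C z') = cinner (?x + c *\<^sub>C ?y) (?D (?x + c *\<^sub>C ?y))" for c
    proof -
      have "EL L' \<cdot> (?x + c *\<^sub>C ?y) = ?x + c *\<^sub>C ?y" using x y by (simp add: bop_add bop_scaleC)
      then show ?thesis
        using \<Delta>_form_EL[of L' "?x + c *\<^sub>C ?y"] \<Delta>_add_scale[OF assms z'] by simp
    qed
    have qx: "cinner ?x z = cinner ?x (?D ?x)"
      using q[of 0] by simp
    have qy: "cinner ?y z' = cinner ?y (?D ?y)"
      using \<Delta>_form_EL[OF z'] HL_EL(2)[of L' L' y] by simp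
    have 1: "cinner ?x z' + cinner ?y z = cinner ?x (?D ?y) + cinner ?y (?D ?x)"
      using q[of 1] qx qy by (simp add: bop_add scaleC_one cinner_simps algebra_simps)
    have "\<i> * (cinner ?x z' - cinner ?y z) = \<i> * (cinner ?x (?D ?y) - cinner ?y (?D ?x))"
      using q[of \<i>] qx qy by (simp add: bop_add bop_scaleC cinner_simps algebra_simps)
    then have "cinner ?x z' - cinner ?y z = cinner ?x (?D ?y) - cinner ?y (?D ?x)" by simp
    with 1 have "2 * cinner ?y z = 2 * cinner ?y (?D ?x)" by algebra
    then show ?thesis using HL_HL_EL[OF that] by simp
  qed
  have "EL L' \<cdot> z = EL L' \<cdot> HL L \<cdot> HL L \<cdot> x" if "L \<le> L'" for L'
    by (rule cinner_ext_right) (rule main[OF that, unfolded cinner_EL])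
  then have "\<forall>\<^sub>F L' in sequentially. EL L' \<cdot> z = EL L' \<cdot> HL L \<cdot> HL L \<cdot> x"
    unfolding eventually_sequentially by blast
  then have "(\<lambda>L'. EL L' \<cdot> HL L \<cdot> HL L \<cdot> x) \<longlonglongrightarrow> z"
    using EL_tendsto[of z] by (rule Lim_transform_eventually[rotated])
  then show ?thesis using EL_tendsto[of "HL L \<cdot> HL L \<cdot> x"] by (rule LIMSEQ_unique)
qed

lemma S_EL: "\<exists>w. (EL L \<cdot> x, w) \<in> S \<and> (\<forall>y v. (y, v) \<in> S \<longrightarrow> cinner v w = cinner (HL L \<cdot> HL L \<cdot> x) y)"
  using EL_\<Delta>[of L x] \<Delta>_EL[of L x] unfolding \<Delta>_iff by blast

lemma S_EL_form: "(EL L \<cdot> x, w) \<in> S \<Longrightarrow> (y, v) \<in> S \<Longrightarrow> cinner v w = cinner (HL L \<cdot> HL L \<cdot> x) y"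
  using S_EL[of L x] S_unique by blast

text \<open>The modular conjugation is defined by \<open>J = S \<Delta>\<^sup>-\<^sup>1\<^sup>/\<^sup>2\<close> on spectrally truncated vectors.\<close>

definition J_trunc :: "nat \<Rightarrow> 'g \<Rightarrow> 'g" where
  "J_trunc L x = (THE w. (KL L \<cdot> x, w) \<in> S)"

lemma S_J_trunc: "(KL L \<cdot> x, J_trunc L x) \<in> S"
proof -
  obtain w where "(EL L \<cdot> KL L \<cdot> x, w) \<in> S" using S_EL by blast
  then have w: "(KL L \<cdot> x, w) \<in> S" by (simp add: EL_KL)
  then have "J_trunc L x = w" unfolding J_trunc_def using S_unique by blast
  then show ?thesis using w by simp
qed

lemma J_trunc_eqI: "(KL L \<cdot> x, w) \<in> S \<Longrightarrow> J_trunc L x = w"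
  using S_J_trunc S_unique by blast

lemma norm_J_trunc: "norm (J_trunc L x) = norm (EL L \<cdot> x)"
proof -
  have "complex_of_real ((norm (J_trunc L x))\<^sup>2) = cinner (HL L \<cdot> HL L \<cdot> KL L \<cdot> x) (KL L \<cdot> x)"
    unfolding cinner_self[symmetric]
    by (rule S_EL_form) (use S_J_trunc[of L x] in \<open>simp_all add: EL_KL\<close>)
  also have "\<dots> = of_real ((norm (EL L \<cdot> x))\<^sup>2)"
    by (simp add: cinner_HL HL_KL cinner_self[symmetric] del: of_real_power)
  finally show ?thesis by (simp del: of_real_power)
qed

lemma J_trunc_convergent: "\<exists>y. (\<lambda>L. J_trunc L x) \<longlonglongrightarrow> y"
proof -
  have diff: "norm (J_trunc L' x - J_trunc L x) = norm (EL L' \<cdot> x - EL L \<cdot> x)" if "L \<le> L'" for L L'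
  proof -
    have "(KL L' \<cdot> (x - EL L \<cdot> x), J_trunc L' x - J_trunc L x) \<in> S"
      using S_diff[OF S_J_trunc[of L' x] S_J_trunc[of L x]] that by (simp add: bop_diff KL_EL)
    then have "J_trunc L' x - J_trunc L x = J_trunc L' (x - EL L \<cdot> x)" by (rule J_trunc_eqI[symmetric])
    then show ?thesis using that by (simp add: norm_J_trunc bop_diff EL_EL)
  qed
  have "Cauchy (\<lambda>L. EL L \<cdot> x)" using EL_tendsto by (rule LIMSEQ_imp_Cauchy)
  have "Cauchy (\<lambda>L. J_trunc L x)"
  proof (rule CauchyI)
    fix e :: real assume "e > 0"
    then obtain M where M: "\<And>m n. m \<ge> M \<Longrightarrow> n \<ge> M \<Longrightarrow> norm (EL m \<cdot> x - EL n \<cdot> x) < e"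
      using CauchyD[OF \<open>Cauchy (\<lambda>L. EL L \<cdot> x)\<close>] by blast
    have "norm (J_trunc m x - J_trunc n x) < e" if "m \<ge> M" "n \<ge> M" for m n
      using M[OF that] diff[of m n] diff[of n m] by (cases "m \<le> n") (auto simp: norm_minus_commute)
    then show "\<exists>M. \<forall>m\<ge>M. \<forall>n\<ge>M. norm (J_trunc m x - J_trunc n x) < e" by blast
  qed
  then show ?thesis using Cauchy_convergent convergent_def by blast
qed

definition J :: "'g \<Rightarrow> 'g" where "J x = lim (\<lambda>L. J_trunc L x)"

lemma J_trunc_tendsto: "(\<lambda>L. J_trunc L x) \<longlonglongrightarrow> J x"
  using J_trunc_convergent[of x] by (simp add: J_def lim_def) (rule theI', metis LIMSEQ_unique)

lemma J_add: "J (x + y) = J x + J y"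
proof -
  have "J_trunc L (x + y) = J_trunc L x + J_trunc L y" for L
    using S_add[OF S_J_trunc[of L x] S_J_trunc[of L y]] by (intro J_trunc_eqI) (simp add: bop_add)
  then show ?thesis
    using J_trunc_tendsto[of "x + y"] tendsto_add[OF J_trunc_tendsto[of x] J_trunc_tendsto[of y]] LIMSEQ_unique by simp
qed

lemma J_scale: "J (c *\<^sub>C x) = cnj c *\<^sub>C J x"
proof -
  have "J_trunc L (c *\<^sub>C x) = cnj c *\<^sub>C J_trunc L x" for L
    using S_scale[OF S_J_trunc[of L x], of c] by (intro J_trunc_eqI) (simp add: bop_scaleC)
  then show ?thesis
    using J_trunc_tendsto[of "c *\<^sub>C x"] tendsto_scaleC[OF J_trunc_tendsto[of x], of "cnj c"] LIMSEQ_unique by simp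
qed

lemma J_norm: "norm (J x) = norm x"
  using tendsto_norm[OF J_trunc_tendsto[of x]] tendsto_norm[OF EL_tendsto[of x]] LIMSEQ_unique
  by (simp add: norm_J_trunc)

lemma J_minus: "J (- x) = - J x"
  using J_scale[of "-1" x] by (simp add: scaleC_minus_left scaleC_one)

lemma J_diff: "J (x - y) = J x - J y"
  using J_add[of x "- y"] by (simp add: J_minus)

lemma J_cinner: "cinner (J x) (J y) = cinner y x"
proof -
  have re: "inner (J x) (J y) = inner x y" for x y
    by (simp add: dot_norm J_norm flip: J_add)
  have "inner (J x) (\<i> *\<^sub>C J y) = inner x ((- \<i>) *\<^sub>C y)"
    using re[of x "(- \<i>) *\<^sub>C y"] by (simp add: J_scale)
  also have "\<dots> = - inner x (\<i> *\<^sub>C y)" by (simp add: scaleC_minus_left)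
  finally have "cinner (J x) (J y) = cnj (cinner x y)"
    by (simp add: complex_eq_iff Im_cinner) (simp add: re flip: inner_eq_Re_cinner)
  then show ?thesis using cinner_commute[of y x] by simp
qed

lemma J_tendsto: "X \<longlonglongrightarrow> x \<Longrightarrow> (\<lambda>n. J (X n)) \<longlonglongrightarrow> J x"
  by (simp add: tendsto_iff dist_norm J_norm flip: J_diff)

lemma S_J: "(EL L \<cdot> x, J (HL L \<cdot> x)) \<in> S"
proof -
  obtain w where w: "(EL L \<cdot> x, w) \<in> S" using S_EL by blast
  have "J_trunc L' (HL L \<cdot> x) = w" if "L \<le> L'" for L'
    by (rule J_trunc_eqI) (use w that in \<open>simp add: KL_HL\<close>)
  then have "\<forall>\<^sub>F L' in sequentially. J_trunc L' (HL L \<cdot> x) = w" unfolding eventually_sequentially by blast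
  then have "J (HL L \<cdot> x) = w"
    by (intro LIMSEQ_unique[OF J_trunc_tendsto] tendsto_eventually)
  then show ?thesis using w by simp
qed

lemma S_J_form: "(y, v) \<in> S \<Longrightarrow> cinner v (J (HL L \<cdot> x)) = cinner (HL L \<cdot> HL L \<cdot> x) y"
  by (rule S_EL_form[OF S_J])

lemma \<Lambda>_S: "(\<Lambda>, \<Lambda>) \<in> S"
  using S_A[OF A_closed(1)] by (simp add: bop_simps)

lemma \<Lambda>_eigenvector: "HL L \<cdot> HL L \<cdot> \<Lambda> = EL L \<cdot> \<Lambda>"
proof (rule cinner_ext_right)
  fix x
  have "cinner (HL L \<cdot> HL L \<cdot> x) \<Lambda> = cinner \<Lambda> (J (HL L \<cdot> x))" by (rule S_J_form[OF \<Lambda>_S, symmetric])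
  also have "\<dots> = cnj (cinner \<Lambda> (EL L \<cdot> x))"
    using S_adjoint[OF A'_closed(1) S_J[of L x]] cinner_commute[of \<Lambda> "J (HL L \<cdot> x)"] by (simp add: bop_simps)
  also have "\<dots> = cinner (EL L \<cdot> x) \<Lambda>" by (metis cinner_commute)
  finally show "cinner x (HL L \<cdot> HL L \<cdot> \<Lambda>) = cinner x (EL L \<cdot> \<Lambda>)" by (simp add: cinner_HL cinner_EL)
qed

lemma \<Lambda>_null:
  assumes f: "bounded_borel (trunc L f)" "f 1 = 0"
  shows "calc (trunc L f) \<cdot> \<Lambda> = 0"
proof (rule calc_null[OF f(1)])
  let ?h = "trunc L (\<lambda>r. complex_of_real (exp (ln r / 2)))"
  let ?g = "\<lambda>r. ?h r * ?h r - trunc L (\<lambda>r. 1) r"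
  have bh: "bounded_borel (\<lambda>r. ?h r * ?h r)" by (intro bounded_borel_mult bounded_borel_HL)
  show "bounded_borel ?g" by (intro bounded_borel_diff bh bounded_borel_EL)
  have "calc ?g \<cdot> \<Lambda> = HL L \<cdot> HL L \<cdot> \<Lambda> - EL L \<cdot> \<Lambda>"
    by (simp add: calc_diff[OF bh bounded_borel_EL] minus_bop.rep_eq EL_def HL_def
        calc_mult[OF bounded_borel_HL bounded_borel_HL, symmetric] bop_mult_apply)
  then show "calc ?g \<cdot> \<Lambda> = 0" by (simp add: \<Lambda>_eigenvector)
  fix r assume g: "?g r = 0"
  show "trunc L f r = 0"
  proof (cases "r \<in> {exp (- real L)..exp (real L)}")
    case True
    then have r: "r > 0" using exp_gt_zero[of "- real L"] by (meson atLeastAtMost_iff less_le_trans)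
    have "complex_of_real (exp (ln r / 2) * exp (ln r / 2)) = of_real 1"
      using g True by (simp add: trunc_def)
    then have "exp (ln r / 2) * exp (ln r / 2) = 1" unfolding of_real_eq_iff .
    then have "r = 1" using r by (simp flip: exp_add)
    then show ?thesis using f(2) by (simp add: trunc_def)
  next
    case False
    then show ?thesis unfolding trunc_def by (rule if_not_P)
  qed
qed

lemma U_\<Lambda>: "U t \<cdot> \<Lambda> = \<Lambda>"
proof (rule EL_ext)
  fix L
  let ?c = "trunc L (\<lambda>r. cis (t * ln r) - 1)"
  have "?c = (\<lambda>r. cis (t * ln r) * trunc L (\<lambda>r. 1) r - trunc L (\<lambda>r. 1) r)"
    by (auto simp: trunc_def)
  moreover have bc: "bounded_borel (\<lambda>r. cis (t * ln r) * trunc L (\<lambda>r. 1) r)"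
    by (intro bounded_borel_mult bounded_borel_cis_ln bounded_borel_EL)
  ultimately have "bounded_borel ?c" "calc ?c = U t * EL L - EL L"
    using calc_diff[OF bc bounded_borel_EL] bounded_borel_diff[OF bc bounded_borel_EL]
    by (simp_all add: U_def EL_def calc_mult bounded_borel_cis_ln bounded_borel_EL)
  then have "(U t * EL L - EL L) \<cdot> \<Lambda> = 0" using \<Lambda>_null[of L "\<lambda>r. cis (t * ln r) - 1"] by simp
  then show "EL L \<cdot> U t \<cdot> \<Lambda> = EL L \<cdot> \<Lambda>" by (simp add: minus_bop.rep_eq bop_mult_apply U_EL)
qed

lemma U_A: "U t \<cdot> a \<cdot> \<Lambda> = (U t * a * U (- t)) \<cdot> \<Lambda>"
  by (simp add: bop_mult_apply U_\<Lambda>)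

lemma U_S:
  assumes "(x, w) \<in> S"
  shows "(U t \<cdot> x, U t \<cdot> w) \<in> S"
proof -
  obtain a where a: "\<And>n::nat. a n \<in> A" "(\<lambda>n. a n \<cdot> \<Lambda>) \<longlonglongrightarrow> x" "(\<lambda>n. star (a n) \<cdot> \<Lambda>) \<longlonglongrightarrow> w"
    using S_approx[OF assms] by blast
  show ?thesis
  proof (rule S_limit[of "\<lambda>n. U t \<cdot> a n \<cdot> \<Lambda>" "\<lambda>n. U t \<cdot> star (a n) \<cdot> \<Lambda>"])
    show "(U t \<cdot> a n \<cdot> \<Lambda>, U t \<cdot> star (a n) \<cdot> \<Lambda>) \<in> S" for n
      unfolding U_A using S_A[OF invariant[OF a(1)], of t n] by (simp add: star_mult star_U mult.assoc)
  qed (intro tendsto_bop a)+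
qed

lemma J_U: "J (U t \<cdot> x) = U t \<cdot> J x"
proof -
  have "J (U t \<cdot> EL L \<cdot> y) = U t \<cdot> J (EL L \<cdot> y)" for L y
  proof -
    have "(U t \<cdot> EL L \<cdot> KL L \<cdot> y, U t \<cdot> J (HL L \<cdot> KL L \<cdot> y)) \<in> S" by (rule U_S[OF S_J])
    moreover have "(EL L \<cdot> U t \<cdot> KL L \<cdot> y, J (HL L \<cdot> U t \<cdot> KL L \<cdot> y)) \<in> S" by (rule S_J)
    ultimately have "U t \<cdot> J (HL L \<cdot> KL L \<cdot> y) = J (HL L \<cdot> U t \<cdot> KL L \<cdot> y)"
      by (simp only: U_EL) (rule S_unique)
    then show ?thesis by (simp add: HL_KL flip: U_HL)
  qed
  moreover have "(\<lambda>L. J (U t \<cdot> EL L \<cdot> x)) \<longlonglongrightarrow> J (U t \<cdot> x)" "(\<lambda>L. U t \<cdot> J (EL L \<cdot> x)) \<longlonglongrightarrow> U t \<cdot> J x"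
    by (intro J_tendsto tendsto_bop EL_tendsto)+
  ultimately show ?thesis using LIMSEQ_unique by simp
qed

lemma S_core:
  assumes xw: "(x, w) \<in> S"
  obtains q where "(\<lambda>L. HL L \<cdot> x) \<longlonglongrightarrow> q" "J q = w"
proof -
  have sq: "complex_of_real ((norm (HL L \<cdot> x))\<^sup>2) = cinner w (J (HL L \<cdot> x))" for L
    using S_J_form[OF xw, of L x] by (simp add: cinner_HL cinner_self[symmetric] del: of_real_power)
  have bound: "norm (HL L \<cdot> x) \<le> norm w" for L
  proof -
    have "(norm (HL L \<cdot> x))\<^sup>2 = cmod (cinner w (J (HL L \<cdot> x)))" unfolding sq[symmetric] by (simp add: norm_power)
    also have "\<dots> \<le> norm w * norm (HL L \<cdot> x)" using cinner_cauchy_schwarz[of w "J (HL L \<cdot> x)"] by (simp add: J_norm)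
    finally show ?thesis by (cases "HL L \<cdot> x = 0") (auto simp: power2_eq_square)
  qed
  have orth: "(norm (HL L' \<cdot> x - HL L \<cdot> x))\<^sup>2 = (norm (HL L' \<cdot> x))\<^sup>2 - (norm (HL L \<cdot> x))\<^sup>2" if "L \<le> L'" for L L'
  proof -
    have 1: "cinner (HL L' \<cdot> x) (HL L \<cdot> x) = cinner (HL L \<cdot> x) (HL L \<cdot> x)"
    proof -
      have "cinner (HL L' \<cdot> x) (HL L \<cdot> x) = cinner (HL L' \<cdot> x) (EL L \<cdot> HL L \<cdot> x)" by (simp add: EL_HL)
      also have "\<dots> = cinner (EL L \<cdot> HL L' \<cdot> x) (HL L \<cdot> x)" by (simp add: cinner_EL)
      finally show ?thesis using that by (simp add: EL_HL)
    qed
    have 2: "cinner (HL L \<cdot> x) (HL L' \<cdot> x) = cinner (HL L \<cdot> x) (HL L \<cdot> x)" using 1 by (metis cinner_commute)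
    have "complex_of_real ((norm (HL L' \<cdot> x - HL L \<cdot> x))\<^sup>2) = of_real ((norm (HL L' \<cdot> x))\<^sup>2 - (norm (HL L \<cdot> x))\<^sup>2)"
      unfolding of_real_diff cinner_self[symmetric] by (simp add: cinner_simps 1 2)
    then show ?thesis unfolding of_real_eq_iff .
  qed
  have "incseq (\<lambda>L. (norm (HL L \<cdot> x))\<^sup>2)"
  proof (rule incseq_SucI)
    show "(norm (HL L \<cdot> x))\<^sup>2 \<le> (norm (HL (Suc L) \<cdot> x))\<^sup>2" for L
      using orth[of L "Suc L"] zero_le_power2[of "norm (HL (Suc L) \<cdot> x - HL L \<cdot> x)"] by linarith
  qed
  moreover have "\<forall>L. (norm (HL L \<cdot> x))\<^sup>2 \<le> (norm w)\<^sup>2" using bound by (simp add: power_mono)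
  ultimately have "\<exists>l. (\<lambda>L. (norm (HL L \<cdot> x))\<^sup>2) \<longlonglongrightarrow> l" using incseq_convergent by metis
  then have C: "Cauchy (\<lambda>L. (norm (HL L \<cdot> x))\<^sup>2)" using LIMSEQ_imp_Cauchy by blast
  have "Cauchy (\<lambda>L. HL L \<cdot> x)"
  proof (rule CauchyI)
    fix e :: real assume "e > 0"
    then obtain M where M: "\<And>m n. m \<ge> M \<Longrightarrow> n \<ge> M \<Longrightarrow> norm ((norm (HL m \<cdot> x))\<^sup>2 - (norm (HL n \<cdot> x))\<^sup>2) < e\<^sup>2"
      using CauchyD[OF C, of "e\<^sup>2"] by auto
    have "norm (HL m \<cdot> x - HL n \<cdot> x) < e" if "m \<ge> M" "n \<ge> M" for m n
    proof -
      have "(norm (HL m \<cdot> x - HL n \<cdot> x))\<^sup>2 < e\<^sup>2"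
        using M[OF that] M[OF that(2,1)] orth[of m n] orth[of n m]
        by (cases "m \<le> n") (auto simp: norm_minus_commute)
      then show ?thesis by (rule power2_less_imp_less) (use \<open>e > 0\<close> in simp)
    qed
    then show "\<exists>M. \<forall>m\<ge>M. \<forall>n\<ge>M. norm (HL m \<cdot> x - HL n \<cdot> x) < e" by blast
  qed
  then obtain q where q: "(\<lambda>L. HL L \<cdot> x) \<longlonglongrightarrow> q" using Cauchy_convergent convergent_def by blast
  have "(x, J q) \<in> S" by (rule S_limit[OF S_J EL_tendsto J_tendsto[OF q]])
  then have "J q = w" using xw S_unique by blast
  with q that show ?thesis by blast
qed

lemma dense_range_J: "closure (range J) = UNIV"
proof -
  have "{a \<cdot> \<Lambda> |a. a \<in> A} \<subseteq> range J"
  proof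
    fix x assume "x \<in> {a \<cdot> \<Lambda> |a. a \<in> A}"
    then obtain a where a: "a \<in> A" "x = a \<cdot> \<Lambda>" by blast
    have "(star a \<cdot> \<Lambda>, x) \<in> S" using S_sym[OF S_A[OF a(1)]] a(2) by simp
    then show "x \<in> range J" by (rule S_core) auto
  qed
  then have "closure {a \<cdot> \<Lambda> |a. a \<in> A} \<subseteq> closure (range J)" by (rule closure_mono)
  then show ?thesis using dense_A by auto
qed

lemma J_G: "J (G s \<cdot> x) = G s \<cdot> J x"
proof (rule dense_cinner_ext[OF dense_range_J])
  fix z assume "z \<in> range J"
  then obtain y where z: "z = J y" by blast
  have "cinner (J y) (J (G s \<cdot> x)) = cnj (cinner y (G s \<cdot> x))" by (metis J_cinner cinner_commute)
  also have "\<dots> = (\<integral>t. cnj (cinner y (U (s * t) \<cdot> x)) \<partial>gauss)"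
    unfolding cinner_G by (rule Bochner_Integration.integral_cnj[symmetric])
  also have "\<dots> = (\<integral>t. cinner (J y) (U (s * t) \<cdot> J x) \<partial>gauss)"
    by (intro Bochner_Integration.integral_cong refl) (metis J_U J_cinner cinner_commute)
  finally show "cinner z (J (G s \<cdot> x)) = cinner z (G s \<cdot> J x)" by (simp add: z cinner_G)
qed

lemma G_half_J:
  assumes "s \<noteq> 0"
  shows "G_half s \<cdot> J x = J (G_neg s \<cdot> x)"
proof (rule dense_cinner_ext[OF dense_range_J])
  fix z assume "z \<in> range J"
  then obtain y where z: "z = J y" by blast
  have "cinner (J y) (J (G_neg s \<cdot> x)) = cnj (cinner y (G_neg s \<cdot> x))" by (metis J_cinner cinner_commute)
  also have "\<dots> = (\<integral>t. cnj (cnj (gauss_weight s t) * cinner y (U (s * t) \<cdot> x)) \<partial>gauss)"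
    unfolding cinner_G_neg[OF assms] by (rule Bochner_Integration.integral_cnj[symmetric])
  also have "\<dots> = (\<integral>t. gauss_weight s t * cinner (J y) (U (s * t) \<cdot> J x) \<partial>gauss)"
  proof (intro Bochner_Integration.integral_cong refl)
    fix t
    have "cnj (cinner y (U (s * t) \<cdot> x)) = cinner (J y) (U (s * t) \<cdot> J x)"
      by (metis J_U J_cinner cinner_commute)
    then show "cnj (cnj (gauss_weight s t) * cinner y (U (s * t) \<cdot> x)) = gauss_weight s t * cinner (J y) (U (s * t) \<cdot> J x)"
      by simp
  qed
  finally show "cinner z (G_half s \<cdot> J x) = cinner z (J (G_neg s \<cdot> x))" by (simp add: z cinner_G_half assms)
qed

lemma G_q:
  assumes "(\<lambda>L. HL L \<cdot> x) \<longlonglongrightarrow> q" "s \<noteq> 0"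
  shows "G s \<cdot> q = G_half s \<cdot> x"
proof (rule LIMSEQ_unique)
  show "(\<lambda>L. G s \<cdot> HL L \<cdot> x) \<longlonglongrightarrow> G s \<cdot> q" by (intro tendsto_bop assms)
  show "(\<lambda>L. G s \<cdot> HL L \<cdot> x) \<longlonglongrightarrow> G_half s \<cdot> x"
    unfolding G_HL[OF assms(2)] by (intro tendsto_bop EL_tendsto)
qed

text \<open>\<open>J\<^sup>2 = 1\<close> because \<open>S\<close> is an involution and \<open>J \<Delta>\<^sup>1\<^sup>/\<^sup>2 = \<Delta>\<^sup>-\<^sup>1\<^sup>/\<^sup>2 J\<close>; the latter is used in
  its smoothed form.\<close>

lemma J_J: "J (J x) = x"
proof -
  have "J (J (EL L \<cdot> x)) = EL L \<cdot> x" for L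
  proof -
    let ?w = "J (HL L \<cdot> x)"
    obtain q where q: "(\<lambda>L'. HL L' \<cdot> ?w) \<longlonglongrightarrow> q" "J q = EL L \<cdot> x"
      using S_core[OF S_sym[OF S_J]] by blast
    have "G 1 \<cdot> q = G_half 1 \<cdot> ?w" by (rule G_q[OF q(1)]) simp
    also have "\<dots> = J (G_neg 1 \<cdot> HL L \<cdot> x)" by (rule G_half_J) simp
    also have "\<dots> = G 1 \<cdot> J (EL L \<cdot> x)" by (simp add: G_neg_HL J_G)
    finally have "q = J (EL L \<cdot> x)" by (rule G_inj)
    then show ?thesis using q(2) by simp
  qed
  moreover have "(\<lambda>L. J (J (EL L \<cdot> x))) \<longlonglongrightarrow> J (J x)" by (intro J_tendsto EL_tendsto)
  ultimately show ?thesis using EL_tendsto[of x] LIMSEQ_unique by simp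
qed

lemma J_swap: "cinner (J x) y = cinner (J y) x"
  by (metis J_J J_cinner)

lemma J_swap_right: "cinner x (J y) = cinner y (J x)"
  by (metis J_J J_cinner)

lemma HL_S_tendsto: "(x, w) \<in> S \<Longrightarrow> (\<lambda>L. HL L \<cdot> x) \<longlonglongrightarrow> J w"
  by (metis S_core J_J)

lemma HL_S:
  assumes "(x, w) \<in> S"
  shows "HL L \<cdot> x = EL L \<cdot> J w"
proof -
  have "(\<lambda>L'. EL L \<cdot> HL L' \<cdot> x) \<longlonglongrightarrow> EL L \<cdot> J w" by (intro tendsto_bop HL_S_tendsto[OF assms])
  moreover have "\<forall>\<^sub>F L' in sequentially. EL L \<cdot> HL L' \<cdot> x = HL L \<cdot> x"
    unfolding eventually_sequentially using EL_HL(1)[of L] by blast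
  ultimately show ?thesis by (metis LIMSEQ_unique[OF tendsto_eventually])
qed

lemma G_J: "(x, w) \<in> S \<Longrightarrow> s \<noteq> 0 \<Longrightarrow> G s \<cdot> J w = G_half s \<cdot> x"
  by (rule G_q[OF HL_S_tendsto])

lemma J_\<Lambda>: "J \<Lambda> = \<Lambda>"
proof (rule EL_ext)
  fix L
  have "trunc L (\<lambda>r. complex_of_real (exp (ln r / 2)) - 1) =
      (\<lambda>r. trunc L (\<lambda>r. complex_of_real (exp (ln r / 2))) r - trunc L (\<lambda>r. 1) r)"
    by (auto simp: trunc_def)
  then have "(HL L - EL L) \<cdot> \<Lambda> = 0"
    using \<Lambda>_null[of L "\<lambda>r. complex_of_real (exp (ln r / 2)) - 1"]
      bounded_borel_diff[OF bounded_borel_HL bounded_borel_EL, of L L]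
      calc_diff[OF bounded_borel_HL bounded_borel_EL, of L L]
    by (simp add: HL_def EL_def)
  then show "EL L \<cdot> J \<Lambda> = EL L \<cdot> \<Lambda>" using HL_S[OF \<Lambda>_S, of L] by (simp add: minus_bop.rep_eq)
qed

end

section \<open>Tomita's theorem\<close>

context modular_data
begin

lemma continuous_conjugation:
  "continuous_on UNIV (\<lambda>t. cinner y (U t \<cdot> a \<cdot> U (- t) \<cdot> z))"
proof -
  have "continuous_on UNIV (\<lambda>t. cinner (U (- t) \<cdot> y) (a \<cdot> U (- t) \<cdot> z))"
    by (intro continuous_on_cinner continuous_intros continuous_on_compose2[OF U_continuous]
        bounded_linear.continuous_on[OF bop_bounded_linear]) auto
  then show ?thesis by (simp add: cinner_U_left)
qed

lemma conjugation_bound: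
  obtains B where "B > 0" "\<And>t y z. cmod (cinner y (U t \<cdot> a \<cdot> U (- t) \<cdot> z)) \<le> norm y * (B * norm z)"
proof -
  obtain B where B: "B > 0" "\<And>z. norm (a \<cdot> z) \<le> B * norm z" using bop_bound by blast
  have "cmod (cinner y (U t \<cdot> a \<cdot> U (- t) \<cdot> z)) \<le> norm y * (B * norm z)" for t y z
    using order_trans[OF cinner_cauchy_schwarz mult_left_mono[OF _ norm_ge_zero]] B(2)[of "U (- t) \<cdot> z"]
    by (metis norm_U)
  with B(1) that show ?thesis by blast
qed

lemma conjugation_integral_tendsto:
  assumes c: "c \<in> borel_measurable borel" "\<And>t. cmod (c t) \<le> K" and Z: "Z \<longlonglongrightarrow> z"
  shows "(\<lambda>n. \<integral>t. c t * cinner y (U (s * t) \<cdot> a \<cdot> U (- (s * t)) \<cdot> Z n) \<partial>gauss)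
    \<longlonglongrightarrow> (\<integral>t. c t * cinner y (U (s * t) \<cdot> a \<cdot> U (- (s * t)) \<cdot> z) \<partial>gauss)"
proof -
  obtain B where B: "B > 0" "\<And>t y z. cmod (cinner y (U t \<cdot> a \<cdot> U (- t) \<cdot> z)) \<le> norm y * (B * norm z)"
    using conjugation_bound[of a] by blast
  obtain M where M: "\<And>n. norm (Z n) \<le> M" using convergent_imp_Bseq[of Z] Z
    by (auto simp: convergent_def Bseq_def)
  note [measurable] = c(1)
  have m: "(\<lambda>t. cinner y (U (s * t) \<cdot> a \<cdot> U (- (s * t)) \<cdot> v)) \<in> borel_measurable borel" for v
    by (intro borel_measurable_continuous_onI
        continuous_on_compose2[OF continuous_conjugation, where f = "\<lambda>t. s * t"] continuous_intros) auto
  show ?thesis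
  proof (rule integral_dominated_convergence[where w = "\<lambda>t. K * (norm y * (B * M))"])
    show "AE t in gauss. (\<lambda>n. c t * cinner y (U (s * t) \<cdot> a \<cdot> U (- (s * t)) \<cdot> Z n))
        \<longlonglongrightarrow> c t * cinner y (U (s * t) \<cdot> a \<cdot> U (- (s * t)) \<cdot> z)"
      by (intro AE_I2 tendsto_mult tendsto_const tendsto_cinner tendsto_bop Z)
    show "AE t in gauss. norm (c t * cinner y (U (s * t) \<cdot> a \<cdot> U (- (s * t)) \<cdot> Z n)) \<le> K * (norm y * (B * M))" for n
    proof (rule AE_I2)
      fix t
      have "cmod (cinner y (U (s * t) \<cdot> a \<cdot> U (- (s * t)) \<cdot> Z n)) \<le> norm y * (B * M)"
        using B(1) by (intro order_trans[OF B(2)] mult_left_mono M) auto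
      then show "norm (c t * cinner y (U (s * t) \<cdot> a \<cdot> U (- (s * t)) \<cdot> Z n)) \<le> K * (norm y * (B * M))"
        unfolding norm_mult by (intro mult_mono' c) auto
    qed
    show "integrable gauss (\<lambda>t. K * (norm y * (B * M)))"
      by (rule finite_measure.integrable_const[OF finite_measure_gauss])
    show "(\<lambda>t. c t * cinner y (U (s * t) \<cdot> a \<cdot> U (- (s * t)) \<cdot> z)) \<in> borel_measurable gauss"
      "(\<lambda>t. c t * cinner y (U (s * t) \<cdot> a \<cdot> U (- (s * t)) \<cdot> Z n)) \<in> borel_measurable gauss" for n
      using m by simp_all
  qed
qed

text \<open>\<open>J A J \<subseteq> A'\<close> in the form in which it comes out of the smoothed commutation relation in the limit
  of vanishing variance.\<close>

lemma J_exchange_smoothed: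
  assumes a: "a \<in> A" and x: "x \<in> A" and s: "s \<noteq> 0"
  shows "(\<integral>t. cinner (EL L \<cdot> y) (U (s * t) \<cdot> a \<cdot> U (- (s * t)) \<cdot> J (x \<cdot> \<Lambda>)) \<partial>gauss)
    = cnj (cinner (star x \<cdot> J (EL L \<cdot> y)) (G s \<cdot> J (a \<cdot> \<Lambda>)))"
proof -
  let ?\<xi> = "star x \<cdot> \<Lambda>"
  have \<xi>: "(?\<xi>, x \<cdot> \<Lambda>) \<in> S" by (rule S_sym[OF S_A[OF x]])
  have "(\<integral>t. 1 * cinner (EL L \<cdot> y) (U (s * t) \<cdot> a \<cdot> U (- (s * t)) \<cdot> J (x \<cdot> \<Lambda>)) \<partial>gauss)
      = (\<integral>t. cnj (gauss_weight s t) * cinner (HL L \<cdot> y) (U (s * t) \<cdot> a \<cdot> U (- (s * t)) \<cdot> ?\<xi>) \<partial>gauss)"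
  proof (rule LIMSEQ_unique)
    show "(\<lambda>L'. \<integral>t. 1 * cinner (EL L \<cdot> y) (U (s * t) \<cdot> a \<cdot> U (- (s * t)) \<cdot> HL L' \<cdot> ?\<xi>) \<partial>gauss)
      \<longlonglongrightarrow> (\<integral>t. 1 * cinner (EL L \<cdot> y) (U (s * t) \<cdot> a \<cdot> U (- (s * t)) \<cdot> J (x \<cdot> \<Lambda>)) \<partial>gauss)"
      by (intro conjugation_integral_tendsto[where K = 1] HL_S_tendsto[OF \<xi>]) auto
    have "(\<lambda>L'. \<integral>t. cnj (gauss_weight s t) * cinner (HL L \<cdot> y) (U (s * t) \<cdot> a \<cdot> U (- (s * t)) \<cdot> EL L' \<cdot> ?\<xi>) \<partial>gauss)
      \<longlonglongrightarrow> (\<integral>t. cnj (gauss_weight s t) * cinner (HL L \<cdot> y) (U (s * t) \<cdot> a \<cdot> U (- (s * t)) \<cdot> ?\<xi>) \<partial>gauss)"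
      by (intro conjugation_integral_tendsto[where K = "exp (1 / (8 * s\<^sup>2))"] EL_tendsto)
        (auto simp: gauss_weight_bounded)
    moreover have "(\<integral>t. cnj (gauss_weight s t) * cinner (HL L \<cdot> y) (U (s * t) \<cdot> a \<cdot> U (- (s * t)) \<cdot> EL L' \<cdot> ?\<xi>) \<partial>gauss)
        = (\<integral>t. 1 * cinner (EL L \<cdot> y) (U (s * t) \<cdot> a \<cdot> U (- (s * t)) \<cdot> HL L' \<cdot> ?\<xi>) \<partial>gauss)" if "L \<le> L'" for L'
      using smoothed_commutation[OF s, of L' "EL L \<cdot> y" a ?\<xi>] that by (simp add: EL_EL HL_EL)
    then have "\<forall>\<^sub>F L' in sequentially.
        (\<integral>t. cnj (gauss_weight s t) * cinner (HL L \<cdot> y) (U (s * t) \<cdot> a \<cdot> U (- (s * t)) \<cdot> EL L' \<cdot> ?\<xi>) \<partial>gauss)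
        = (\<integral>t. 1 * cinner (EL L \<cdot> y) (U (s * t) \<cdot> a \<cdot> U (- (s * t)) \<cdot> HL L' \<cdot> ?\<xi>) \<partial>gauss)"
      unfolding eventually_sequentially by blast
    ultimately show "(\<lambda>L'. \<integral>t. 1 * cinner (EL L \<cdot> y) (U (s * t) \<cdot> a \<cdot> U (- (s * t)) \<cdot> HL L' \<cdot> ?\<xi>) \<partial>gauss)
      \<longlonglongrightarrow> (\<integral>t. cnj (gauss_weight s t) * cinner (HL L \<cdot> y) (U (s * t) \<cdot> a \<cdot> U (- (s * t)) \<cdot> ?\<xi>) \<partial>gauss)"
      by (rule Lim_transform_eventually)
  qed
  also have "\<dots> = (\<integral>t. cnj (gauss_weight s t * cinner (star x \<cdot> J (EL L \<cdot> y)) (U (s * t) \<cdot> star a \<cdot> \<Lambda>)) \<partial>gauss)"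
  proof (intro Bochner_Integration.integral_cong refl)
    fix t
    let ?b = "U (s * t) * a * U (- (s * t))"
    have bx: "?b * star x \<in> A" by (intro A_closed invariant a x)
    have "cinner (HL L \<cdot> y) (U (s * t) \<cdot> a \<cdot> U (- (s * t)) \<cdot> ?\<xi>) = cinner y (HL L \<cdot> (?b * star x) \<cdot> \<Lambda>)"
      by (simp add: cinner_HL bop_mult_apply)
    also have "HL L \<cdot> (?b * star x) \<cdot> \<Lambda> = EL L \<cdot> J (star (?b * star x) \<cdot> \<Lambda>)"
      by (rule HL_S[OF S_A[OF bx]])
    also have "star (?b * star x) \<cdot> \<Lambda> = x \<cdot> U (s * t) \<cdot> star a \<cdot> \<Lambda>"
      by (simp add: star_mult star_star star_U bop_mult_apply U_\<Lambda>)
    also have "cinner y (EL L \<cdot> J (x \<cdot> U (s * t) \<cdot> star a \<cdot> \<Lambda>)) = cinner (x \<cdot> U (s * t) \<cdot> star a \<cdot> \<Lambda>) (J (EL L \<cdot> y))"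
      by (simp add: J_swap_right flip: cinner_EL)
    also have "\<dots> = cnj (cinner (star x \<cdot> J (EL L \<cdot> y)) (U (s * t) \<cdot> star a \<cdot> \<Lambda>))"
      by (simp add: cnj_cinner cinner_star_right)
    finally show "cnj (gauss_weight s t) * cinner (HL L \<cdot> y) (U (s * t) \<cdot> a \<cdot> U (- (s * t)) \<cdot> ?\<xi>)
      = cnj (gauss_weight s t * cinner (star x \<cdot> J (EL L \<cdot> y)) (U (s * t) \<cdot> star a \<cdot> \<Lambda>))" by simp
  qed
  also have "\<dots> = cnj (cinner (star x \<cdot> J (EL L \<cdot> y)) (G_half s \<cdot> star a \<cdot> \<Lambda>))"
    unfolding cinner_G_half[OF s] by (rule Bochner_Integration.integral_cnj)
  also have "G_half s \<cdot> star a \<cdot> \<Lambda> = G s \<cdot> J (a \<cdot> \<Lambda>)"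
    by (rule G_J[OF S_sym[OF S_A[OF a]] s, symmetric])
  finally show ?thesis by simp
qed

lemma J_exchange:
  assumes a: "a \<in> A" and x: "x \<in> A"
  shows "a \<cdot> J (x \<cdot> \<Lambda>) = J (x \<cdot> J (a \<cdot> \<Lambda>))"
proof (rule EL_ext, rule cinner_ext_right)
  fix L y
  let ?f = "\<lambda>t. cinner (EL L \<cdot> y) (U t \<cdot> a \<cdot> U (- t) \<cdot> J (x \<cdot> \<Lambda>))"
  obtain B where "B > 0" and B: "\<And>t y z. cmod (cinner y (U t \<cdot> a \<cdot> U (- t) \<cdot> z)) \<le> norm y * (B * norm z)"
    using conjugation_bound[of a] by blast
  have "(\<lambda>n. \<integral>t. ?f (inverse (real (Suc n)) * t) \<partial>gauss) \<longlonglongrightarrow> ?f 0"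
    by (rule gauss_approximate_identity[OF continuous_conjugation B])
  then have "(\<lambda>n. cnj (cinner (star x \<cdot> J (EL L \<cdot> y)) (G (inverse (real (Suc n))) \<cdot> J (a \<cdot> \<Lambda>)))) \<longlonglongrightarrow> ?f 0"
    by (simp add: J_exchange_smoothed[OF a x])
  moreover have "(\<lambda>n. cnj (cinner (star x \<cdot> J (EL L \<cdot> y)) (G (inverse (real (Suc n))) \<cdot> J (a \<cdot> \<Lambda>))))
      \<longlonglongrightarrow> cnj (cinner (star x \<cdot> J (EL L \<cdot> y)) (J (a \<cdot> \<Lambda>)))"
    by (intro tendsto_cnj tendsto_cinner tendsto_const G_tendsto)
  ultimately have "?f 0 = cnj (cinner (star x \<cdot> J (EL L \<cdot> y)) (J (a \<cdot> \<Lambda>)))" by (rule LIMSEQ_unique)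
  also have "\<dots> = cinner (x \<cdot> J (a \<cdot> \<Lambda>)) (J (EL L \<cdot> y))"
    by (simp add: cnj_cinner cinner_star_right)
  also have "\<dots> = cinner (EL L \<cdot> y) (J (x \<cdot> J (a \<cdot> \<Lambda>)))" by (rule J_swap_right)
  finally show "cinner y (EL L \<cdot> a \<cdot> J (x \<cdot> \<Lambda>)) = cinner y (EL L \<cdot> J (x \<cdot> J (a \<cdot> \<Lambda>)))"
    by (simp add: U_0 bop_simps cinner_EL)
qed

definition conj :: "'g bop \<Rightarrow> 'g bop" where "conj a = Bop (\<lambda>x. J (a \<cdot> J x))"

lemma conj_apply: "conj a \<cdot> x = J (a \<cdot> J x)"
proof -
  obtain B where B: "\<And>z. norm (a \<cdot> z) \<le> B * norm z" using bop_bound by blast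
  show ?thesis unfolding conj_def
    by (rule Bop_apply[where K = B])
      (use B[of "J _"] in \<open>auto simp: J_add J_scale bop_add bop_scaleC J_norm mult.commute\<close>)
qed

lemma conj_mult: "conj (a * b) = conj a * conj b"
  by (rule bop_eqI) (simp add: conj_apply J_J bop_mult_apply)

lemma conj_star: "conj (star a) = star (conj a)"
proof (rule star_bop_eqI[symmetric])
  fix x y
  have "cinner (conj (star a) \<cdot> x) y = cinner (J y) (star a \<cdot> J x)" by (simp add: conj_apply J_swap)
  also have "\<dots> = cinner (a \<cdot> J y) (J x)" by (rule cinner_star_right)
  also have "\<dots> = cinner x (conj a \<cdot> y)" unfolding conj_apply by (rule J_swap_right)
  finally show "cinner (conj (star a) \<cdot> x) y = cinner x (conj a \<cdot> y)" .
qed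

lemma conj_commutant:
  assumes a: "a \<in> A"
  shows "conj a \<in> commutant A"
proof -
  have 1: "conj a \<cdot> x \<cdot> \<Lambda> = x \<cdot> conj a \<cdot> \<Lambda>" if "x \<in> A" for x
    using J_exchange[OF a that] by (simp add: conj_apply J_J J_\<Lambda>)
  have "x * conj a = conj a * x" if x: "x \<in> A" for x
  proof (rule dense_bop_eqI[OF dense_A])
    fix z assume "z \<in> {a \<cdot> \<Lambda> |a. a \<in> A}"
    then obtain y where y: "y \<in> A" "z = y \<cdot> \<Lambda>" by blast
    show "(x * conj a) \<cdot> z = (conj a * x) \<cdot> z"
      using 1[OF A_closed(5)[OF x y(1)]] 1[OF y(1)] y(2) by (simp add: bop_mult_apply)
  qed
  then show ?thesis by (simp add: commutant_def)
qed

lemma S_conj_commutant: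
  assumes a': "a' \<in> commutant A"
  shows "(conj a' \<cdot> \<Lambda>, star (conj a') \<cdot> \<Lambda>) \<in> S"
proof -
  have H: "HL L \<cdot> J (a' \<cdot> \<Lambda>) = EL L \<cdot> star a' \<cdot> \<Lambda>" for L
  proof (rule cinner_ext_right)
    fix x
    have "cinner x (HL L \<cdot> J (a' \<cdot> \<Lambda>)) = cinner (a' \<cdot> \<Lambda>) (J (HL L \<cdot> x))"
      by (simp add: cinner_HL[symmetric] J_swap_right)
    also have "\<dots> = cnj (cinner (star a' \<cdot> \<Lambda>) (EL L \<cdot> x))"
      using S_adjoint[OF a' S_J[of L x]] by (simp flip: cnj_cinner[of "J _"])
    also have "\<dots> = cinner x (EL L \<cdot> star a' \<cdot> \<Lambda>)" by (simp add: cnj_cinner cinner_EL)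
    finally show "cinner x (HL L \<cdot> J (a' \<cdot> \<Lambda>)) = cinner x (EL L \<cdot> star a' \<cdot> \<Lambda>)" .
  qed
  have "(J (a' \<cdot> \<Lambda>), J (star a' \<cdot> \<Lambda>)) \<in> S"
  proof (rule S_limit[of "\<lambda>L. EL L \<cdot> J (a' \<cdot> \<Lambda>)" "\<lambda>L. J (EL L \<cdot> star a' \<cdot> \<Lambda>)"])
    show "(EL L \<cdot> J (a' \<cdot> \<Lambda>), J (EL L \<cdot> star a' \<cdot> \<Lambda>)) \<in> S" for L
      using S_J[of L "J (a' \<cdot> \<Lambda>)"] by (simp add: H)
  qed (intro EL_tendsto J_tendsto)+
  then show ?thesis by (simp add: conj_apply J_\<Lambda> flip: conj_star)
qed

lemma conj_in_algebra:
  assumes a': "a' \<in> commutant A"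
  shows "conj a' \<in> A"
proof -
  let ?X = "conj a'"
  obtain a where a: "\<And>n::nat. a n \<in> A" "(\<lambda>n. a n \<cdot> \<Lambda>) \<longlonglongrightarrow> ?X \<cdot> \<Lambda>"
    "(\<lambda>n. star (a n) \<cdot> \<Lambda>) \<longlonglongrightarrow> star ?X \<cdot> \<Lambda>"
    using S_approx[OF S_conj_commutant[OF a']] by blast
  have XJ: "?X * conj m = conj m * ?X" "star ?X * conj m = conj m * star ?X" if "m \<in> A" for m
    using commutant_commute[OF that a'] commutant_commute[OF that A'_closed(7)[OF a']]
    by (simp_all flip: conj_mult conj_star)
  have comm: "?X \<cdot> d \<cdot> \<Lambda> = d \<cdot> ?X \<cdot> \<Lambda>" if d: "d \<in> commutant A" for d
  proof (rule dense_cinner_ext)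
    show "closure {J (m \<cdot> \<Lambda>) |m. m \<in> A} = UNIV"
    proof -
      have "x \<in> closure {J (m \<cdot> \<Lambda>) |m. m \<in> A}" for x
      proof -
        obtain Y where Y: "\<And>n::nat. Y n \<in> {a \<cdot> \<Lambda> |a. a \<in> A}" "Y \<longlonglongrightarrow> J x"
          using dense_sequence[OF dense_A] by blast
        have "(\<lambda>n. J (Y n)) \<longlonglongrightarrow> x" using J_tendsto[OF Y(2)] by (simp add: J_J)
        moreover have "J (Y n) \<in> {J (m \<cdot> \<Lambda>) |m. m \<in> A}" for n
        proof -
          obtain m where "m \<in> A" "Y n = m \<cdot> \<Lambda>" using Y(1)[of n] by blast
          then show ?thesis by auto
        qed
        ultimately show ?thesis unfolding closure_sequential by (intro exI[of _ "\<lambda>n. J (Y n)"] conjI allI)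
      qed
      then show ?thesis by blast
    qed
    fix z assume "z \<in> {J (m \<cdot> \<Lambda>) |m. m \<in> A}"
    then obtain m where m: "m \<in> A" "z = J (m \<cdot> \<Lambda>)" by blast
    let ?c = "conj m"
    have z: "z = ?c \<cdot> \<Lambda>" by (simp add: conj_apply J_\<Lambda> m(2))
    have c: "?c \<in> commutant A" by (rule conj_commutant[OF m(1)])
    have "cinner z (?X \<cdot> d \<cdot> \<Lambda>) = cinner (star ?X \<cdot> ?c \<cdot> \<Lambda>) (d \<cdot> \<Lambda>)" by (simp add: z cinner_star_left)
    also have "star ?X \<cdot> ?c \<cdot> \<Lambda> = ?c \<cdot> star ?X \<cdot> \<Lambda>"
      using XJ(2)[OF m(1)] by (simp flip: bop_mult_apply)
    finally have l: "cinner z (?X \<cdot> d \<cdot> \<Lambda>) = cinner (?c \<cdot> star ?X \<cdot> \<Lambda>) (d \<cdot> \<Lambda>)" .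
    have "cinner (?c \<cdot> star (a n) \<cdot> \<Lambda>) (d \<cdot> \<Lambda>) = cinner (?c \<cdot> \<Lambda>) (d \<cdot> a n \<cdot> \<Lambda>)" for n
      using commutant_commute_apply[OF A_closed(7)[OF a(1)] c, of n \<Lambda>] commutant_commute_apply[OF a(1) d, of n \<Lambda>]
      by (metis cinner_star_left)
    moreover have "(\<lambda>n. cinner (?c \<cdot> star (a n) \<cdot> \<Lambda>) (d \<cdot> \<Lambda>)) \<longlonglongrightarrow> cinner (?c \<cdot> star ?X \<cdot> \<Lambda>) (d \<cdot> \<Lambda>)"
      "(\<lambda>n. cinner (?c \<cdot> \<Lambda>) (d \<cdot> a n \<cdot> \<Lambda>)) \<longlonglongrightarrow> cinner (?c \<cdot> \<Lambda>) (d \<cdot> ?X \<cdot> \<Lambda>)"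
      by (intro tendsto_cinner tendsto_bop tendsto_const a)+
    ultimately have "cinner (?c \<cdot> star ?X \<cdot> \<Lambda>) (d \<cdot> \<Lambda>) = cinner (?c \<cdot> \<Lambda>) (d \<cdot> ?X \<cdot> \<Lambda>)"
      using LIMSEQ_unique by simp
    then show "cinner z (?X \<cdot> d \<cdot> \<Lambda>) = cinner z (d \<cdot> ?X \<cdot> \<Lambda>)" using l z by simp
  qed
  have "d * ?X = ?X * d" if d: "d \<in> commutant A" for d
  proof (rule dense_bop_eqI[OF dense_A'])
    fix z assume "z \<in> {a' \<cdot> \<Lambda> |a'. a' \<in> commutant A}"
    then obtain e where e: "e \<in> commutant A" "z = e \<cdot> \<Lambda>" by blast
    show "(d * ?X) \<cdot> z = (?X * d) \<cdot> z"
      using comm[OF A'_closed(5)[OF d e(1)]] comm[OF e(1)] e(2) by (simp add: bop_mult_apply)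
  qed
  then have "?X \<in> commutant (commutant A)" by (simp add: commutant_def)
  then show ?thesis using vn by (simp add: von_neumann_algebra_def)
qed

lemma invariant_commutant:
  assumes a': "a' \<in> commutant A"
  shows "U t * a' * U (- t) \<in> commutant A"
proof -
  have "a * (U t * a' * U (- t)) = U t * a' * U (- t) * a" if a: "a \<in> A" for a
  proof -
    let ?b = "U (- t) * a * U t"
    have "?b \<in> A" using invariant[OF a, of "- t"] by simp
    then have "?b * a' = a' * ?b" by (rule commutant_commute[OF _ a'])
    then have "U t * (?b * a') * U (- t) = U t * (a' * ?b) * U (- t)" by simp
    moreover have "U t * U (- t) = 1" "U (- t) * U t = 1" by (simp_all add: U_mult U_0)
    then have "U t * (?b * a') * U (- t) = a * (U t * a' * U (- t))"
      "U t * (a' * ?b) * U (- t) = U t * a' * U (- t) * a"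
      by (simp_all add: mult.assoc) (simp_all flip: mult.assoc)
    ultimately show ?thesis by simp
  qed
  then show ?thesis by (simp add: commutant_def)
qed

lemma dual_map_eqI:
  assumes "c' \<in> commutant A" "\<And>b. b \<in> A \<Longrightarrow> cinner \<Lambda> (b \<cdot> c' \<cdot> \<Lambda>) = cinner \<Lambda> (\<beta> b \<cdot> b' \<cdot> \<Lambda>)"
  shows "dual_map A \<Lambda> \<beta> b' = c'"
  unfolding dual_map_def
proof (rule the_equality)
  fix d' assume d': "d' \<in> commutant A \<and> (\<forall>b\<in>A. cinner \<Lambda> (b \<cdot> d' \<cdot> \<Lambda>) = cinner \<Lambda> (\<beta> b \<cdot> b' \<cdot> \<Lambda>))"
  have v: "d' \<cdot> \<Lambda> = c' \<cdot> \<Lambda>"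
  proof (rule dense_cinner_ext[OF dense_A])
    fix z assume "z \<in> {a \<cdot> \<Lambda> |a. a \<in> A}"
    then obtain a where a: "a \<in> A" "z = a \<cdot> \<Lambda>" by blast
    have "cinner z (e \<cdot> \<Lambda>) = cinner \<Lambda> (star a \<cdot> e \<cdot> \<Lambda>)" for e by (simp add: a(2) cinner_star_right)
    then show "cinner z (d' \<cdot> \<Lambda>) = cinner z (c' \<cdot> \<Lambda>)" using assms(2) d' A_closed(7)[OF a(1)] by simp
  qed
  show "d' = c'"
  proof (rule dense_bop_eqI[OF dense_A])
    fix z assume "z \<in> {a \<cdot> \<Lambda> |a. a \<in> A}"
    then obtain a where a: "a \<in> A" "z = a \<cdot> \<Lambda>" by blast
    then show "d' \<cdot> z = c' \<cdot> z"
      using commutant_commute_apply[OF a(1), of d' \<Lambda>] commutant_commute_apply[OF a(1) assms(1), of \<Lambda>] d' v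
      by simp
  qed
qed (use assms in blast)

lemma dual_map_modular:
  assumes b': "b' \<in> commutant A" and \<sigma>: "\<And>a. a \<in> A \<Longrightarrow> \<sigma> a = U t * a * U (- t)"
  shows "dual_map A \<Lambda> \<sigma> b' = U (- t) * b' * U t"
proof (rule dual_map_eqI)
  show "U (- t) * b' * U t \<in> commutant A" using invariant_commutant[OF b', of "- t"] by simp
  fix b assume b: "b \<in> A"
  have "cinner \<Lambda> (\<sigma> b \<cdot> b' \<cdot> \<Lambda>) = cinner (U (- t) \<cdot> \<Lambda>) (b \<cdot> U (- t) \<cdot> b' \<cdot> \<Lambda>)"
    by (simp add: \<sigma>[OF b] bop_mult_apply cinner_U_left)
  then show "cinner \<Lambda> (b \<cdot> (U (- t) * b' * U t) \<cdot> \<Lambda>) = cinner \<Lambda> (\<sigma> b \<cdot> b' \<cdot> \<Lambda>)"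
    by (simp add: U_\<Lambda> bop_mult_apply)
qed

end

lemma J_intertwining:
  fixes V :: "'g::chilbert_space bop"
  assumes M: "modular_data E1 A \<Lambda>1" and N: "modular_data E2 A \<Lambda>2"
    and VU: "\<And>t x. V \<cdot> pvm.U E1 t \<cdot> x = pvm.U E2 t \<cdot> V \<cdot> x"
    and VS: "\<And>x w. (x, w) \<in> modular_data.S A \<Lambda>1 \<Longrightarrow> (V \<cdot> x, V \<cdot> w) \<in> modular_data.S A \<Lambda>2"
  shows "V \<cdot> modular_data.J E1 A \<Lambda>1 x = modular_data.J E2 A \<Lambda>2 (V \<cdot> x)"
proof -
  interpret M: modular_data E1 A \<Lambda>1 by (rule M)
  interpret N: modular_data E2 A \<Lambda>2 by (rule N)
  have VG: "V \<cdot> M.G 1 \<cdot> x = N.G 1 \<cdot> V \<cdot> x" for x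
  proof (rule cinner_ext_right)
    fix y
    have "cinner y (V \<cdot> M.G 1 \<cdot> x) = (\<integral>t. cinner (star V \<cdot> y) (M.U (1 * t) \<cdot> x) \<partial>gauss)"
      unfolding M.cinner_G[symmetric] by (rule cinner_star_left[symmetric])
    then show "cinner y (V \<cdot> M.G 1 \<cdot> x) = cinner y (N.G 1 \<cdot> V \<cdot> x)"
      by (simp add: N.cinner_G VU cinner_star_left)
  qed
  have VGh: "V \<cdot> M.G_half 1 \<cdot> x = N.G_half 1 \<cdot> V \<cdot> x" for x
  proof (rule cinner_ext_right)
    fix y
    have "cinner y (V \<cdot> M.G_half 1 \<cdot> x) = (\<integral>t. gauss_weight 1 t * cinner (star V \<cdot> y) (M.U (1 * t) \<cdot> x) \<partial>gauss)"
      unfolding M.cinner_G_half[OF one_neq_zero, symmetric] by (rule cinner_star_left[symmetric])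
    then show "cinner y (V \<cdot> M.G_half 1 \<cdot> x) = cinner y (N.G_half 1 \<cdot> V \<cdot> x)"
      by (simp add: N.cinner_G_half VU cinner_star_left)
  qed
  have on_S: "V \<cdot> M.J w = N.J (V \<cdot> w)" if "(x, w) \<in> M.S" for x w
  proof (rule N.G_inj)
    have "N.G 1 \<cdot> V \<cdot> M.J w = V \<cdot> M.G_half 1 \<cdot> x" using M.G_J[OF that, of 1] by (simp flip: VG)
    also have "\<dots> = N.G 1 \<cdot> N.J (V \<cdot> w)" using N.G_J[OF VS[OF that], of 1] by (simp add: VGh)
    finally show "N.G 1 \<cdot> V \<cdot> M.J w = N.G 1 \<cdot> N.J (V \<cdot> w)" .
  qed
  obtain X where X: "\<And>n::nat. X n \<in> {a \<cdot> \<Lambda>1 |a. a \<in> A}" "X \<longlonglongrightarrow> x"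
    using dense_sequence[OF M.dense_A] by blast
  have "V \<cdot> M.J (X n) = N.J (V \<cdot> X n)" for n
  proof -
    obtain a where "a \<in> A" "X n = a \<cdot> \<Lambda>1" using X(1)[of n] by blast
    then show ?thesis using on_S[OF M.S_sym[OF M.S_A]] by simp
  qed
  moreover have "(\<lambda>n. V \<cdot> M.J (X n)) \<longlonglongrightarrow> V \<cdot> M.J x" "(\<lambda>n. N.J (V \<cdot> X n)) \<longlonglongrightarrow> N.J (V \<cdot> x)"
    by (intro tendsto_bop M.J_tendsto N.J_tendsto X)+
  ultimately show ?thesis using LIMSEQ_unique by simp
qed

section \<open>Completion of semi-inner product spaces\<close>

lemma discriminant_le:
  fixes p q m :: real
  assumes q: "q \<ge> 0" and quad: "\<And>t. 0 \<le> p - 2 * t * m\<^sup>2 + t\<^sup>2 * m\<^sup>2 * q"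
  shows "m\<^sup>2 \<le> p * q"
proof (cases "q = 0")
  case True
  have "m = 0"
  proof (rule ccontr)
    assume "m \<noteq> 0"
    then have "p - (p + 1) \<ge> 0" using quad[of "(p + 1) / (2 * m\<^sup>2)"] True by simp
    then show False by simp
  qed
  then show ?thesis using True by simp
next
  case False
  then have "0 \<le> p - m\<^sup>2 / q" using quad[of "1 / q"] by (simp add: power2_eq_square field_simps)
  then show ?thesis using False q by (simp add: field_simps)
qed

text \<open>The completion is realized on functions: a vector \<open>h\<close> is identified with the conjugate-linear
  function \<open>y \<mapsto> \<langle>y, h\<rangle>\<close> on the subspace \<open>B\<close>, extended by \<open>0\<close>.\<close>

locale semi_inner =
  fixes B :: "'a::complex_vector set" and b :: "'a \<Rightarrow> 'a \<Rightarrow> complex"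
  assumes B_add: "x \<in> B \<Longrightarrow> y \<in> B \<Longrightarrow> x + y \<in> B"
    and B_scale: "x \<in> B \<Longrightarrow> c *\<^sub>C x \<in> B"
    and B_zero: "0 \<in> B"
    and b_add: "x \<in> B \<Longrightarrow> y \<in> B \<Longrightarrow> z \<in> B \<Longrightarrow> b x (y + z) = b x y + b x z"
    and b_scale: "x \<in> B \<Longrightarrow> y \<in> B \<Longrightarrow> b x (c *\<^sub>C y) = c * b x y"
    and b_commute: "x \<in> B \<Longrightarrow> y \<in> B \<Longrightarrow> b x y = cnj (b y x)"
    and b_pos: "x \<in> B \<Longrightarrow> b x x \<in> \<real>\<^sub>\<ge>\<^sub>0"
begin

lemma B_diff: "x \<in> B \<Longrightarrow> y \<in> B \<Longrightarrow> x - y \<in> B"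
  using B_add[OF _ B_scale, of x y "-1"] by (simp add: scaleC_minus_left scaleC_one)

lemma b_add_left: "x \<in> B \<Longrightarrow> y \<in> B \<Longrightarrow> z \<in> B \<Longrightarrow> b (x + y) z = b x z + b y z"
  using b_commute[of "x + y" z] b_commute[of x z] b_commute[of y z] by (simp add: b_add B_add)

lemma b_scale_left: "x \<in> B \<Longrightarrow> y \<in> B \<Longrightarrow> b (c *\<^sub>C x) y = cnj c * b x y"
  using b_commute[of "c *\<^sub>C x" y] b_commute[of x y] by (simp add: b_scale B_scale)

lemma b_diff: "x \<in> B \<Longrightarrow> y \<in> B \<Longrightarrow> z \<in> B \<Longrightarrow> b x (y - z) = b x y - b x z"
  using b_add[of x y "-1 *\<^sub>C z"] b_scale[of x z "-1"] B_scale[of z "-1"] by (simp add: scaleC_minus_left scaleC_one)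

lemma b_diff_left: "x \<in> B \<Longrightarrow> y \<in> B \<Longrightarrow> z \<in> B \<Longrightarrow> b (x - y) z = b x z - b y z"
  using b_commute[of "x - y" z] b_commute[of x z] b_commute[of y z] by (simp add: b_diff B_diff)

definition sn :: "'a \<Rightarrow> real" where "sn x = sqrt (Re (b x x))"

lemma b_real: "x \<in> B \<Longrightarrow> b x x = of_real ((sn x)\<^sup>2)"
  using b_pos[of x] by (simp add: sn_def complex_nonneg_Reals_iff complex_eq_iff)

lemma sn_nonneg: "x \<in> B \<Longrightarrow> 0 \<le> sn x"
  using b_pos[of x] by (simp add: sn_def complex_nonneg_Reals_iff)

lemma cauchy_schwarz:
  assumes x: "x \<in> B" and y: "y \<in> B"
  shows "cmod (b x y) \<le> sn x * sn y"
proof -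
  define z where "z = b x y"
  have zc: "b y x = cnj z" using b_commute[OF y x] by (simp add: z_def)
  have quad: "0 \<le> (sn x)\<^sup>2 - 2 * t * (cmod z)\<^sup>2 + t\<^sup>2 * (cmod z)\<^sup>2 * (sn y)\<^sup>2" for t
  proof -
    define c where "c = - (of_real t * cnj z)"
    have m: "x + c *\<^sub>C y \<in> B" by (intro B_add B_scale x y)
    have "b (x + c *\<^sub>C y) (x + c *\<^sub>C y) = b x x + c * z + (cnj c * cnj z + cnj c * (c * b y y))"
      using x y by (simp add: b_add b_add_left b_scale b_scale_left B_add B_scale zc z_def[symmetric] algebra_simps)
    also have "\<dots> = of_real ((sn x)\<^sup>2 - 2 * t * (cmod z)\<^sup>2 + t\<^sup>2 * (cmod z)\<^sup>2 * (sn y)\<^sup>2)"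
      unfolding b_real[OF x] b_real[OF y] c_def of_real_add of_real_diff of_real_mult
        complex_norm_square of_real_power[of t]
      by (simp add: power2_eq_square algebra_simps)
    finally show ?thesis
      using b_pos[OF m] by (simp only: nonneg_Reals_of_real_iff)
  qed
  have "(cmod z)\<^sup>2 \<le> (sn x)\<^sup>2 * (sn y)\<^sup>2" by (rule discriminant_le[OF _ quad]) simp
  then have "(cmod z)\<^sup>2 \<le> (sn x * sn y)\<^sup>2" by (simp add: power_mult_distrib)
  then show ?thesis unfolding z_def by (rule power2_le_imp_le) (simp add: sn_nonneg x y)
qed

lemma sn_triangle:
  assumes x: "x \<in> B" and y: "y \<in> B"
  shows "sn (x + y) \<le> sn x + sn y"
proof (rule power2_le_imp_le)
  have "complex_of_real ((sn (x + y))\<^sup>2) = b x x + b x y + (b y x + b y y)"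
    unfolding b_real[OF B_add[OF x y], symmetric] using x y by (simp add: b_add b_add_left B_add)
  then have "Re (complex_of_real ((sn (x + y))\<^sup>2)) = Re (b x x + b x y + (b y x + b y y))" by simp
  then have "(sn (x + y))\<^sup>2 = (sn x)\<^sup>2 + 2 * Re (b x y) + (sn y)\<^sup>2"
    using b_commute[OF y x] by (simp add: b_real x y)
  also have "Re (b x y) \<le> sn x * sn y" using cauchy_schwarz[OF x y] complex_Re_le_cmod order_trans by blast
  finally show "(sn (x + y))\<^sup>2 \<le> (sn x + sn y)\<^sup>2" by (simp add: power2_sum)
qed (simp add: sn_nonneg x y)

lemma sn_scale: "x \<in> B \<Longrightarrow> sn (c *\<^sub>C x) = cmod c * sn x"
proof -
  assume x: "x \<in> B"
  have "b (c *\<^sub>C x) (c *\<^sub>C x) = of_real ((cmod c)\<^sup>2) * b x x"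
    using x by (simp only: b_scale b_scale_left B_scale complex_norm_square) simp
  then show ?thesis by (simp add: sn_def real_sqrt_mult)
qed

lemma sn_minus_commute: "x \<in> B \<Longrightarrow> y \<in> B \<Longrightarrow> sn (x - y) = sn (y - x)"
  using sn_scale[of "x - y" "-1"] B_diff by (simp add: scaleC_minus_left scaleC_one)

definition cauchy :: "(nat \<Rightarrow> 'a) \<Rightarrow> bool" where
  "cauchy X \<longleftrightarrow> (\<forall>e>0. \<exists>N. \<forall>m\<ge>N. \<forall>n\<ge>N. sn (X m - X n) < e)"

definition represents :: "(nat \<Rightarrow> 'a) \<Rightarrow> ('a \<Rightarrow> complex) \<Rightarrow> bool" where
  "represents X h \<longleftrightarrow> range X \<subseteq> B \<and> cauchy X \<and> (\<forall>y\<in>B. (\<lambda>n. b y (X n)) \<longlonglongrightarrow> h y) \<and> (\<forall>y. y \<notin> B \<longrightarrow> h y = 0)"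

lemma representsD:
  assumes "represents X h"
  shows "X n \<in> B" "cauchy X" "y \<in> B \<Longrightarrow> (\<lambda>n. b y (X n)) \<longlonglongrightarrow> h y" "y \<notin> B \<Longrightarrow> h y = 0"
  using assms by (auto simp: represents_def)

lemma cauchy_bounded:
  assumes "range X \<subseteq> B" "cauchy X"
  obtains M where "M > 0" "\<And>n. sn (X n) \<le> M"
proof -
  have X: "X n \<in> B" for n using assms(1) by blast
  obtain N where N: "\<And>n. n \<ge> N \<Longrightarrow> sn (X n - X N) < 1"
    using assms(2) unfolding cauchy_def by (metis zero_less_one order_refl)
  define M where "M = Max ((\<lambda>n. sn (X n)) ` {..N}) + 1"
  have small: "sn (X n) \<le> Max ((\<lambda>n. sn (X n)) ` {..N})" if "n \<le> N" for n using that by (intro Max_ge) auto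
  have "sn (X n) \<le> M" for n
  proof (cases "n \<le> N")
    case True
    then show ?thesis using small[OF True] unfolding M_def by linarith
  next
    case False
    have "sn (X n) \<le> sn (X n - X N) + sn (X N)" using sn_triangle[of "X n - X N" "X N"] X B_diff by simp
    then show ?thesis using N[of n] small[OF order_refl] False unfolding M_def by linarith
  qed
  moreover have "M > 0" using small[OF le0] sn_nonneg[OF X[of 0]] unfolding M_def by linarith
  ultimately show ?thesis using that by blast
qed

lemma represents_cauchy:
  assumes X: "range X \<subseteq> B" "cauchy X"
  shows "\<exists>h. represents X h"
proof -
  have XB: "X n \<in> B" for n using X(1) by blast
  have "\<exists>l. (\<lambda>n. b y (X n)) \<longlonglongrightarrow> l" if y: "y \<in> B" for y
  proof -
    have "Cauchy (\<lambda>n. b y (X n))"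
    proof (rule CauchyI)
      fix e :: real assume e: "e > 0"
      have sy: "sn y + 1 > 0" using sn_nonneg[OF y] by simp
      then obtain N where N: "\<And>m n. m \<ge> N \<Longrightarrow> n \<ge> N \<Longrightarrow> sn (X m - X n) < e / (sn y + 1)"
        using X(2) e unfolding cauchy_def by (metis divide_pos_pos)
      have "norm (b y (X m) - b y (X n)) < e" if "m \<ge> N" "n \<ge> N" for m n
      proof -
        have "norm (b y (X m) - b y (X n)) \<le> sn y * sn (X m - X n)"
          using cauchy_schwarz[OF y B_diff[OF XB XB]] by (simp add: b_diff y XB)
        also have "\<dots> \<le> (sn y + 1) * sn (X m - X n)"
          using sn_nonneg[OF B_diff[OF XB XB]] by (intro mult_right_mono) auto
        also have "\<dots> < e" using N[OF that] sy by (simp add: field_simps)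
        finally show ?thesis .
      qed
      then show "\<exists>M. \<forall>m\<ge>M. \<forall>n\<ge>M. norm (b y (X m) - b y (X n)) < e" by blast
    qed
    then show ?thesis using Cauchy_convergent convergent_def by blast
  qed
  then obtain l where l: "\<And>y. y \<in> B \<Longrightarrow> (\<lambda>n. b y (X n)) \<longlonglongrightarrow> l y" by metis
  then have "represents X (\<lambda>y. if y \<in> B then l y else 0)" using X by (simp add: represents_def)
  then show ?thesis by blast
qed

lemma represents_zero: "represents (\<lambda>n. 0) (\<lambda>y. 0)"
  using b_scale[of _ 0 0] b_scale[of 0 0 0] by (auto simp: represents_def cauchy_def B_zero sn_def)

lemma represents_scale:
  assumes "represents X h"
  shows "represents (\<lambda>n. c *\<^sub>C X n) (\<lambda>y. c * h y)"
proof -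
  note X = representsD[OF assms]
  have "cauchy (\<lambda>n. c *\<^sub>C X n)"
    unfolding cauchy_def
  proof (intro allI impI)
    fix e :: real assume e: "e > 0"
    have "e / (cmod c + 1) > 0" using e by (simp add: add_nonneg_pos)
    then obtain N where N: "\<And>m n. m \<ge> N \<Longrightarrow> n \<ge> N \<Longrightarrow> sn (X m - X n) < e / (cmod c + 1)"
      using X(2) unfolding cauchy_def by metis
    have "sn (c *\<^sub>C X m - c *\<^sub>C X n) < e" if "m \<ge> N" "n \<ge> N" for m n
    proof -
      have "sn (c *\<^sub>C X m - c *\<^sub>C X n) = cmod c * sn (X m - X n)"
        using sn_scale[OF B_diff[OF X(1) X(1)]] by (simp add: scaleC_diff_right)
      also have "\<dots> \<le> (cmod c + 1) * sn (X m - X n)"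
        using sn_nonneg[OF B_diff[OF X(1) X(1)]] by (intro mult_right_mono) auto
      also have "\<dots> < e"
        using N[OF that] pos_less_divide_eq[of "cmod c + 1" "sn (X m - X n)" e] by (simp add: mult.commute add_nonneg_pos)
      finally show ?thesis .
    qed
    then show "\<exists>N. \<forall>m\<ge>N. \<forall>n\<ge>N. sn (c *\<^sub>C X m - c *\<^sub>C X n) < e" by blast
  qed
  moreover have "(\<lambda>n. b y (c *\<^sub>C X n)) \<longlonglongrightarrow> c * h y" if "y \<in> B" for y
    using tendsto_mult_left[OF X(3)[OF that], of c] by (simp add: b_scale that X(1))
  ultimately show ?thesis using X(1,4) B_scale by (auto simp: represents_def)
qed

lemma represents_add:
  assumes "represents X h" "represents Y k"
  shows "represents (\<lambda>n. X n + Y n) (\<lambda>y. h y + k y)"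
proof -
  note X = representsD[OF assms(1)] and Y = representsD[OF assms(2)]
  have "cauchy (\<lambda>n. X n + Y n)"
    unfolding cauchy_def
  proof (intro allI impI)
    fix e :: real assume "e > 0"
    then have e: "e / 2 > 0" by simp
    obtain N where N: "\<And>m n. m \<ge> N \<Longrightarrow> n \<ge> N \<Longrightarrow> sn (X m - X n) < e / 2"
      using X(2) e unfolding cauchy_def by metis
    obtain M where M: "\<And>m n. m \<ge> M \<Longrightarrow> n \<ge> M \<Longrightarrow> sn (Y m - Y n) < e / 2"
      using Y(2) e unfolding cauchy_def by metis
    have "sn (X m + Y m - (X n + Y n)) < e" if "m \<ge> max M N" "n \<ge> max M N" for m n
    proof -
      have "X m + Y m - (X n + Y n) = (X m - X n) + (Y m - Y n)" by simp
      then have "sn (X m + Y m - (X n + Y n)) \<le> sn (X m - X n) + sn (Y m - Y n)"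
        using sn_triangle[OF B_diff[OF X(1) X(1)] B_diff[OF Y(1) Y(1)]] by metis
      also have "\<dots> < e" using N[of m n] M[of m n] that by simp
      finally show ?thesis .
    qed
    then show "\<exists>N. \<forall>m\<ge>N. \<forall>n\<ge>N. sn (X m + Y m - (X n + Y n)) < e" by blast
  qed
  moreover have "(\<lambda>n. b y (X n + Y n)) \<longlonglongrightarrow> h y + k y" if "y \<in> B" for y
    using tendsto_add[OF X(3)[OF that] Y(3)[OF that]] by (simp add: b_add that X(1) Y(1))
  ultimately show ?thesis using X(1,4) Y(1,4) B_add by (auto simp: represents_def)
qed

lemma represents_diff:
  assumes "represents X h" "represents Y k"
  shows "represents (\<lambda>n. X n - Y n) (\<lambda>y. h y - k y)"
  using represents_add[OF assms(1) represents_scale[OF assms(2), of "-1"]]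
  by (simp add: scaleC_minus_left scaleC_one)

lemma represents_null:
  assumes "represents X (\<lambda>y. 0)"
  shows "(\<lambda>n. sn (X n)) \<longlonglongrightarrow> 0"
proof (rule LIMSEQ_I)
  note X = representsD[OF assms]
  obtain M where M: "M > 0" "\<And>n. sn (X n) \<le> M"
    using cauchy_bounded[OF _ X(2)] X(1) by blast
  fix r :: real assume r: "r > 0"
  define e where "e = r\<^sup>2 / 2"
  have e: "e > 0" using r by (simp add: e_def)
  obtain N where N: "\<And>m n. m \<ge> N \<Longrightarrow> n \<ge> N \<Longrightarrow> sn (X m - X n) < e / M"
    using X(2) e M(1) unfolding cauchy_def by (metis divide_pos_pos)
  obtain N' where N': "\<And>n. n \<ge> N' \<Longrightarrow> cmod (b (X N) (X n)) < e"
    using LIMSEQ_D[OF X(3)[OF X(1)[of N]] e] by auto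
  have "norm (sn (X n) - 0) < r" if n: "n \<ge> max N N'" for n
  proof -
    have "complex_of_real ((sn (X n))\<^sup>2) = b (X n - X N) (X n) + b (X N) (X n)"
      unfolding b_real[OF X(1), symmetric] using X(1) by (simp add: b_diff_left)
    then have "(sn (X n))\<^sup>2 = cmod (b (X n - X N) (X n) + b (X N) (X n))"
      by (metis abs_of_nonneg norm_of_real zero_le_power2)
    also have "\<dots> \<le> sn (X n - X N) * sn (X n) + cmod (b (X N) (X n))"
      using cauchy_schwarz[OF B_diff[OF X(1) X(1)] X(1)] by (intro order_trans[OF norm_triangle_ineq] add_right_mono)
    also have "\<dots> \<le> (e / M) * M + cmod (b (X N) (X n))"
      using N[of n N] n M e sn_nonneg X(1) B_diff by (intro add_right_mono mult_mono) auto
    also have "\<dots> < r\<^sup>2" using N'[of n] n M(1) by (simp add: e_def)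
    finally have "sn (X n) < r" by (rule power2_less_imp_less) (use r in simp)
    then show ?thesis using sn_nonneg[OF X(1)[of n]] by simp
  qed
  then show "\<exists>no. \<forall>n\<ge>no. norm (sn (X n) - 0) < r" by blast
qed

lemma b_tendsto_0:
  assumes "range X \<subseteq> B" "range Y \<subseteq> B" "(\<lambda>n. sn (X n)) \<longlonglongrightarrow> 0" "\<And>n. sn (Y n) \<le> M"
  shows "(\<lambda>n. b (X n) (Y n)) \<longlonglongrightarrow> 0" "(\<lambda>n. b (Y n) (X n)) \<longlonglongrightarrow> 0"
proof -
  have XY: "X n \<in> B" "Y n \<in> B" for n using assms(1,2) by auto
  have l: "(\<lambda>n. sn (X n) * M) \<longlonglongrightarrow> 0" using tendsto_mult_right[OF assms(3), of M] by simp
  have "cmod (b (X n) (Y n)) \<le> sn (X n) * M" for n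
    using cauchy_schwarz[OF XY] mult_left_mono[OF assms(4) sn_nonneg[OF XY(1)]] order_trans by blast
  then show 1: "(\<lambda>n. b (X n) (Y n)) \<longlonglongrightarrow> 0"
    by (intro Lim_null_comparison[OF _ l] always_eventually allI)
  show "(\<lambda>n. b (Y n) (X n)) \<longlonglongrightarrow> 0"
    using tendsto_cnj[OF 1] b_commute[OF XY(2) XY(1)] by simp
qed

definition rseq :: "('a \<Rightarrow> complex) \<Rightarrow> nat \<Rightarrow> 'a" where "rseq h = (SOME X. represents X h)"

definition cinn :: "('a \<Rightarrow> complex) \<Rightarrow> ('a \<Rightarrow> complex) \<Rightarrow> complex" where
  "cinn h k = lim (\<lambda>n. b (rseq h n) (rseq k n))"

lemma rseq: "represents X h \<Longrightarrow> represents (rseq h) h"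
  using someI[of "\<lambda>X. represents X h" X] by (simp add: rseq_def)

lemma cinn_convergent:
  assumes "represents X h" "represents Y k"
  shows "\<exists>l. (\<lambda>n. b (X n) (Y n)) \<longlonglongrightarrow> l"
proof -
  note X = representsD[OF assms(1)] and Y = representsD[OF assms(2)]
  obtain M where M: "M > 0" "\<And>n. sn (X n) \<le> M" using cauchy_bounded[OF _ X(2)] X(1) by blast
  obtain L where L: "L > 0" "\<And>n. sn (Y n) \<le> L" using cauchy_bounded[OF _ Y(2)] Y(1) by blast
  have "Cauchy (\<lambda>n. b (X n) (Y n))"
  proof (rule CauchyI)
    fix e :: real assume e: "e > 0"
    obtain N where N: "\<And>m n. m \<ge> N \<Longrightarrow> n \<ge> N \<Longrightarrow> sn (X m - X n) < e / (2 * L)"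
      using X(2) e L(1) unfolding cauchy_def by (metis divide_pos_pos mult_pos_pos zero_less_numeral)
    obtain N' where N': "\<And>m n. m \<ge> N' \<Longrightarrow> n \<ge> N' \<Longrightarrow> sn (Y m - Y n) < e / (2 * M)"
      using Y(2) e M(1) unfolding cauchy_def by (metis divide_pos_pos mult_pos_pos zero_less_numeral)
    have "norm (b (X m) (Y m) - b (X n) (Y n)) < e" if "m \<ge> max N N'" "n \<ge> max N N'" for m n
    proof -
      have "b (X m) (Y m) - b (X n) (Y n) = b (X m - X n) (Y m) + b (X n) (Y m - Y n)"
        using X(1) Y(1) by (simp add: b_diff b_diff_left)
      then have "norm (b (X m) (Y m) - b (X n) (Y n)) \<le> sn (X m - X n) * sn (Y m) + sn (X n) * sn (Y m - Y n)"
        using cauchy_schwarz[OF B_diff[OF X(1) X(1)] Y(1), of m n m] cauchy_schwarz[OF X(1) B_diff[OF Y(1) Y(1)], of n m n]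
        by (metis add_mono norm_triangle_le)
      also have "sn (X m - X n) * sn (Y m) \<le> sn (X m - X n) * L"
        by (intro mult_left_mono L sn_nonneg B_diff X)
      also have "sn (X n) * sn (Y m - Y n) \<le> M * sn (Y m - Y n)"
        by (intro mult_right_mono M sn_nonneg B_diff Y)
      also have "sn (X m - X n) * L < e / 2" using N[of m n] that L(1) by (simp add: field_simps)
      also have "M * sn (Y m - Y n) < e / 2" using N'[of m n] that M(1) by (simp add: field_simps)
      finally show ?thesis by simp
    qed
    then show "\<exists>M. \<forall>m\<ge>M. \<forall>n\<ge>M. norm (b (X m) (Y m) - b (X n) (Y n)) < e" by blast
  qed
  then show ?thesis using Cauchy_convergent convergent_def by blast
qed

lemma cinn_tendsto:
  assumes X: "represents X h" and Y: "represents Y k"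
  shows "(\<lambda>n. b (X n) (Y n)) \<longlonglongrightarrow> cinn h k"
proof -
  note X' = rseq[OF X] and Y' = rseq[OF Y]
  obtain l where l: "(\<lambda>n. b (rseq h n) (rseq k n)) \<longlonglongrightarrow> l" using cinn_convergent[OF X' Y'] by blast
  then have lc: "l = cinn h k" by (simp add: cinn_def limI)
  note XB = representsD(1)[OF X] representsD(1)[OF X'] and YB = representsD(1)[OF Y] representsD(1)[OF Y']
  obtain M where M: "M > 0" "\<And>n. sn (rseq h n) \<le> M" using cauchy_bounded[OF _ representsD(2)[OF X']] XB(2) by blast
  obtain L where L: "L > 0" "\<And>n. sn (Y n) \<le> L" using cauchy_bounded[OF _ representsD(2)[OF Y]] YB(1) by blast
  have dX: "(\<lambda>n. sn (X n - rseq h n)) \<longlonglongrightarrow> 0" and dY: "(\<lambda>n. sn (Y n - rseq k n)) \<longlonglongrightarrow> 0"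
    using represents_null represents_diff[OF X X'] represents_diff[OF Y Y'] by simp_all
  have "(\<lambda>n. b (X n - rseq h n) (Y n)) \<longlonglongrightarrow> 0"
    by (rule b_tendsto_0(1)[OF _ _ dX L(2)]) (use XB YB B_diff in auto)
  moreover have "(\<lambda>n. b (rseq h n) (Y n - rseq k n)) \<longlonglongrightarrow> 0"
    by (rule b_tendsto_0(2)[OF _ _ dY M(2)]) (use XB YB B_diff in auto)
  ultimately have "(\<lambda>n. b (X n - rseq h n) (Y n) + b (rseq h n) (Y n - rseq k n) + b (rseq h n) (rseq k n)) \<longlonglongrightarrow> 0 + 0 + l"
    by (intro tendsto_add l)
  moreover have "b (X n - rseq h n) (Y n) + b (rseq h n) (Y n - rseq k n) + b (rseq h n) (rseq k n) = b (X n) (Y n)" for n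
    using XB YB by (simp add: b_diff b_diff_left)
  ultimately show ?thesis using lc by simp
qed

definition completion :: "('a \<Rightarrow> complex) hspace" where
  "completion = \<lparr>hcarrier = {h. \<exists>X. represents X h}, hzero = (\<lambda>y. 0), hadd = (\<lambda>h k y. h y + k y),
    hscale = (\<lambda>c h y. c * h y), hinner = cinn\<rparr>"

lemma completion_simps [simp]:
  "hcarrier completion = {h. \<exists>X. represents X h}" "hzero completion = (\<lambda>y. 0)"
  "hadd completion h k = (\<lambda>y. h y + k y)" "hscale completion c h = (\<lambda>y. c * h y)"
  "hinner completion = cinn" "hdiff completion h k = (\<lambda>y. h y - k y)"
  by (simp_all add: completion_def hdiff_def)

lemma hnorm_completion_tendsto:
  assumes X: "represents X h"
  shows "(\<lambda>n. sn (X n)) \<longlonglongrightarrow> hnorm completion h"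
  using tendsto_real_sqrt[OF tendsto_Re[OF cinn_tendsto[OF X X]]] by (simp add: sn_def hnorm_def)

definition embed :: "'a \<Rightarrow> 'a \<Rightarrow> complex" where "embed x = (\<lambda>y. if y \<in> B then b y x else 0)"

lemma represents_embed: "x \<in> B \<Longrightarrow> represents (\<lambda>n. x) (embed x)"
  using b_scale[of 0 0 0] B_zero by (auto simp: represents_def embed_def cauchy_def sn_def)

lemma cinn_embed: "x \<in> B \<Longrightarrow> y \<in> B \<Longrightarrow> cinn (embed x) (embed y) = b x y"
  using cinn_tendsto[OF represents_embed represents_embed] by (simp add: LIMSEQ_const_iff)

lemma hnorm_completion_triangle:
  assumes "represents X h" "represents Y k"
  shows "hnorm completion (\<lambda>y. h y + k y) \<le> hnorm completion h + hnorm completion k"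
proof (rule LIMSEQ_le)
  show "(\<lambda>n. sn (X n + Y n)) \<longlonglongrightarrow> hnorm completion (\<lambda>y. h y + k y)"
    by (rule hnorm_completion_tendsto[OF represents_add[OF assms]])
  show "(\<lambda>n. sn (X n) + sn (Y n)) \<longlonglongrightarrow> hnorm completion h + hnorm completion k"
    by (intro tendsto_add hnorm_completion_tendsto assms)
qed (use sn_triangle representsD(1)[OF assms(1)] representsD(1)[OF assms(2)] in blast)

lemma hnorm_completion_minus_commute:
  assumes "represents X h" "represents Y k"
  shows "hnorm completion (\<lambda>y. h y - k y) = hnorm completion (\<lambda>y. k y - h y)"
proof (rule LIMSEQ_unique)
  show "(\<lambda>n. sn (X n - Y n)) \<longlonglongrightarrow> hnorm completion (\<lambda>y. h y - k y)"
    by (rule hnorm_completion_tendsto[OF represents_diff[OF assms]])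
  show "(\<lambda>n. sn (X n - Y n)) \<longlonglongrightarrow> hnorm completion (\<lambda>y. k y - h y)"
    using hnorm_completion_tendsto[OF represents_diff[OF assms(2,1)]]
    by (simp add: sn_minus_commute[OF representsD(1)[OF assms(1)] representsD(1)[OF assms(2)]])
qed

lemma embed_tendsto:
  assumes X: "represents X h"
  shows "(\<lambda>n. hnorm completion (\<lambda>y. h y - embed (X n) y)) \<longlonglongrightarrow> 0"
proof (rule LIMSEQ_I)
  fix r :: real assume "r > 0"
  then have r: "r / 2 > 0" by simp
  note XB = representsD(1)[OF X]
  obtain N where N: "\<And>m n. m \<ge> N \<Longrightarrow> n \<ge> N \<Longrightarrow> sn (X m - X n) < r / 2"
    using representsD(2)[OF X] r unfolding cauchy_def by metis
  have "norm (hnorm completion (\<lambda>y. h y - embed (X n) y) - 0) < r" if n: "n \<ge> N" for n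
  proof -
    have l: "(\<lambda>m. sn (X m - X n)) \<longlonglongrightarrow> hnorm completion (\<lambda>y. h y - embed (X n) y)"
      by (rule hnorm_completion_tendsto[OF represents_diff[OF X represents_embed[OF XB]]])
    have "hnorm completion (\<lambda>y. h y - embed (X n) y) \<le> r / 2"
      by (rule LIMSEQ_le_const2[OF l]) (use N n less_imp_le in blast)
    moreover have "0 \<le> hnorm completion (\<lambda>y. h y - embed (X n) y)"
      by (rule LIMSEQ_le_const[OF l]) (use sn_nonneg B_diff XB in blast)
    ultimately show ?thesis using r by simp
  qed
  then show "\<exists>no. \<forall>n\<ge>no. norm (hnorm completion (\<lambda>y. h y - embed (X n) y) - 0) < r" by blast
qed

lemma completion_complete:
  assumes H: "\<And>n::nat. \<exists>X. represents X (H n)"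
    and C: "\<forall>e>0. \<exists>N. \<forall>m\<ge>N. \<forall>n\<ge>N. hnorm completion (\<lambda>y. H m y - H n y) < e"
  shows "\<exists>h. (\<exists>X. represents X h) \<and> (\<lambda>n. hnorm completion (\<lambda>y. H n y - h y)) \<longlonglongrightarrow> 0"
proof -
  have "\<exists>x\<in>B. hnorm completion (\<lambda>y. H n y - embed x y) < inverse (real (Suc n))" for n
  proof -
    obtain X where X: "represents X (H n)" using H by blast
    obtain m where "norm (hnorm completion (\<lambda>y. H n y - embed (X m) y) - 0) < inverse (real (Suc n))"
      using LIMSEQ_D[OF embed_tendsto[OF X], of "inverse (real (Suc n))"] by auto
    then show ?thesis using representsD(1)[OF X, of m] by (intro bexI[of _ "X m"]) auto
  qed
  then obtain x where x: "\<And>n. x n \<in> B" "\<And>n. hnorm completion (\<lambda>y. H n y - embed (x n) y) < inverse (real (Suc n))"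
    by metis
  have tri: "hnorm completion (\<lambda>y. f y - g y) \<le> hnorm completion (\<lambda>y. f y - k y) + hnorm completion (\<lambda>y. k y - g y)"
    if "represents X f" "represents Y k" "represents Z g" for X Y Z f g k
    using hnorm_completion_triangle[OF represents_diff[OF that(1,2)] represents_diff[OF that(2,3)]] by simp
  have sne: "sn (x m - x n) = hnorm completion (\<lambda>y. embed (x m) y - embed (x n) y)" for m n
    using hnorm_completion_tendsto[OF represents_diff[OF represents_embed[OF x(1)] represents_embed[OF x(1)]]]
    by (simp add: LIMSEQ_const_iff)
  have "cauchy x"
    unfolding cauchy_def
  proof (intro allI impI)
    fix e :: real assume "e > 0"
    then have e: "e / 3 > 0" by simp
    obtain N where N: "\<And>m n. m \<ge> N \<Longrightarrow> n \<ge> N \<Longrightarrow> hnorm completion (\<lambda>y. H m y - H n y) < e / 3"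
      using C e by metis
    obtain N' where N': "inverse (real (Suc N')) < e / 3" using reals_Archimedean[OF e] by blast
    have inv: "hnorm completion (\<lambda>y. H n y - embed (x n) y) < e / 3" if "n \<ge> N'" for n
    proof -
      have "inverse (real (Suc n)) \<le> inverse (real (Suc N'))" using that by simp
      then show ?thesis using x(2)[of n] N' by linarith
    qed
    have "sn (x m - x n) < e" if mn: "m \<ge> max N N'" "n \<ge> max N N'" for m n
    proof -
      obtain X Y where X: "represents X (H m)" and Y: "represents Y (H n)" using H by blast
      note em = represents_embed[OF x(1)[of m]] and en = represents_embed[OF x(1)[of n]]
      have "hnorm completion (\<lambda>y. embed (x m) y - embed (x n) y)
        \<le> hnorm completion (\<lambda>y. embed (x m) y - H m y) + hnorm completion (\<lambda>y. H m y - embed (x n) y)"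
        by (rule tri[OF em X en])
      also have "hnorm completion (\<lambda>y. H m y - embed (x n) y)
        \<le> hnorm completion (\<lambda>y. H m y - H n y) + hnorm completion (\<lambda>y. H n y - embed (x n) y)"
        by (rule tri[OF X Y en])
      also have "hnorm completion (\<lambda>y. embed (x m) y - H m y) = hnorm completion (\<lambda>y. H m y - embed (x m) y)"
        by (rule hnorm_completion_minus_commute[OF em X])
      finally show ?thesis using N[of m n] inv[of m] inv[of n] mn unfolding sne by linarith
    qed
    then show "\<exists>N. \<forall>m\<ge>N. \<forall>n\<ge>N. sn (x m - x n) < e" by blast
  qed
  then obtain h where h: "represents x h" using represents_cauchy[of x] x(1) by blast
  have "(\<lambda>n. hnorm completion (\<lambda>y. H n y - h y)) \<longlonglongrightarrow> 0"
  proof (rule tendsto_sandwich)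
    show "\<forall>\<^sub>F n in sequentially. 0 \<le> hnorm completion (\<lambda>y. H n y - h y)"
    proof (intro always_eventually allI)
      fix n
      obtain X where X: "represents X (H n)" using H by blast
      show "0 \<le> hnorm completion (\<lambda>y. H n y - h y)"
        by (rule LIMSEQ_le_const[OF hnorm_completion_tendsto[OF represents_diff[OF X h]]])
          (use sn_nonneg B_diff representsD(1)[OF X] x(1) in blast)
    qed
    show "\<forall>\<^sub>F n in sequentially. hnorm completion (\<lambda>y. H n y - h y)
        \<le> inverse (real (Suc n)) + hnorm completion (\<lambda>y. h y - embed (x n) y)"
    proof (intro always_eventually allI)
      fix n
      obtain X where X: "represents X (H n)" using H by blast
      note en = represents_embed[OF x(1)[of n]]
      show "hnorm completion (\<lambda>y. H n y - h y) \<le> inverse (real (Suc n)) + hnorm completion (\<lambda>y. h y - embed (x n) y)"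
        using tri[OF X en h] x(2)[of n] hnorm_completion_minus_commute[OF en h] by simp
    qed
    show "(\<lambda>n. inverse (real (Suc n)) + hnorm completion (\<lambda>y. h y - embed (x n) y)) \<longlonglongrightarrow> 0"
      using tendsto_add[OF LIMSEQ_inverse_real_of_nat embed_tendsto[OF h]] by simp
  qed simp
  with h show ?thesis by blast
qed

lemma hilbert_space_completion: "hilbert_space completion"
proof -
  have lin1: "cinn h (\<lambda>y. k y + k' y) = cinn h k + cinn h k'"
    if "represents X h" "represents Y k" "represents Z k'" for X Y Z h k k'
  proof (rule LIMSEQ_unique[OF cinn_tendsto[OF that(1) represents_add[OF that(2,3)]]])
    show "(\<lambda>n. b (X n) (Y n + Z n)) \<longlonglongrightarrow> cinn h k + cinn h k'"
      using tendsto_add[OF cinn_tendsto[OF that(1,2)] cinn_tendsto[OF that(1,3)]]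
        representsD(1)[OF that(1)] representsD(1)[OF that(2)] representsD(1)[OF that(3)] by (simp add: b_add)
  qed
  have lin2: "cinn h (\<lambda>y. c * k y) = c * cinn h k" if "represents X h" "represents Y k" for X Y h k c
  proof (rule LIMSEQ_unique[OF cinn_tendsto[OF that(1) represents_scale[OF that(2)]]])
    show "(\<lambda>n. b (X n) (c *\<^sub>C Y n)) \<longlonglongrightarrow> c * cinn h k"
      using tendsto_mult_left[OF cinn_tendsto[OF that], of c]
        representsD(1)[OF that(1)] representsD(1)[OF that(2)] by (simp add: b_scale)
  qed
  have herm: "cinn h k = cnj (cinn k h)" if "represents X h" "represents Y k" for X Y h k
  proof (rule LIMSEQ_unique[OF cinn_tendsto[OF that]])
    show "(\<lambda>n. b (X n) (Y n)) \<longlonglongrightarrow> cnj (cinn k h)"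
      using tendsto_cnj[OF cinn_tendsto[OF that(2,1)]]
        b_commute[OF representsD(1)[OF that(1)] representsD(1)[OF that(2)]] by simp
  qed
  have pos: "cinn h h \<in> \<real>\<^sub>\<ge>\<^sub>0" if X: "represents X h" for X h
    by (rule closed_sequentially[OF closed_nonneg_Reals_complex _ cinn_tendsto[OF X X]])
      (use b_pos representsD(1)[OF X] in blast)
  have def0: "h = (\<lambda>y. 0)" if X: "represents X h" and 0: "cinn h h = 0" for X h
  proof
    fix y
    show "h y = 0"
    proof (cases "y \<in> B")
      case True
      have "(\<lambda>n. sn (X n)) \<longlonglongrightarrow> 0" using hnorm_completion_tendsto[OF X] 0 by (simp add: hnorm_def)
      then have "(\<lambda>n. b y (X n)) \<longlonglongrightarrow> 0"
        by (intro b_tendsto_0(2)[of X "\<lambda>n. y" "sn y"]) (use True representsD(1)[OF X] in auto)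
      then show ?thesis using representsD(3)[OF X True] LIMSEQ_unique by blast
    qed (simp add: representsD(4)[OF X])
  qed
  show ?thesis
    unfolding hilbert_space_def
  proof (intro conjI)
    show "\<forall>X :: nat \<Rightarrow> 'a \<Rightarrow> complex. range X \<subseteq> hcarrier completion \<and>
        (\<forall>e>0. \<exists>N. \<forall>m\<ge>N. \<forall>n\<ge>N. hnorm completion (hdiff completion (X m) (X n)) < e) \<longrightarrow>
        (\<exists>x\<in>hcarrier completion. (\<lambda>n. hnorm completion (hdiff completion (X n) x)) \<longlonglongrightarrow> 0)"
    proof (intro allI impI)
      fix H :: "nat \<Rightarrow> 'a \<Rightarrow> complex"
      assume H: "range H \<subseteq> hcarrier completion \<and>
        (\<forall>e>0. \<exists>N. \<forall>m\<ge>N. \<forall>n\<ge>N. hnorm completion (hdiff completion (H m) (H n)) < e)"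
      have "\<exists>h. (\<exists>X. represents X h) \<and> (\<lambda>n. hnorm completion (\<lambda>y. H n y - h y)) \<longlonglongrightarrow> 0"
        by (rule completion_complete) (use H in auto)
      then show "\<exists>x\<in>hcarrier completion. (\<lambda>n. hnorm completion (hdiff completion (H n) x)) \<longlonglongrightarrow> 0" by auto
    qed
  qed (auto simp: algebra_simps intro: represents_zero represents_add represents_scale
      lin1 lin2 herm pos def0)
qed

lemma bounded_hop_completion:
  assumes T: "\<And>x. x \<in> B \<Longrightarrow> T x \<in> B" "\<And>x. x \<in> B \<Longrightarrow> T' x \<in> B"
    and diff: "\<And>x y. x \<in> B \<Longrightarrow> y \<in> B \<Longrightarrow> T (x - y) = T x - T y"
    and adj: "\<And>x y. x \<in> B \<Longrightarrow> y \<in> B \<Longrightarrow> b y (T x) = b (T' y) x"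
    and bound: "\<And>x. x \<in> B \<Longrightarrow> sn (T x) \<le> K * sn x"
  defines "f \<equiv> (\<lambda>h y. if y \<in> B then h (T' y) else 0)"
  shows "represents X h \<Longrightarrow> represents (\<lambda>n. T (X n)) (f h)"
    and "bounded_hop completion f"
proof -
  show rep: "represents (\<lambda>n. T (X n)) (f h)" if X: "represents X h" for X h
  proof -
    note X = representsD[OF that]
    have "cauchy (\<lambda>n. T (X n))"
      unfolding cauchy_def
    proof (intro allI impI)
      fix e :: real assume e: "e > 0"
      have "e / (\<bar>K\<bar> + 1) > 0" using e by simp
      then obtain N where N: "\<And>m n. m \<ge> N \<Longrightarrow> n \<ge> N \<Longrightarrow> sn (X m - X n) < e / (\<bar>K\<bar> + 1)"
        using X(2) unfolding cauchy_def by metis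
      have "sn (T (X m) - T (X n)) < e" if "m \<ge> N" "n \<ge> N" for m n
      proof -
        have "sn (T (X m) - T (X n)) \<le> K * sn (X m - X n)"
          using bound[OF B_diff[OF X(1) X(1)]] by (simp add: diff X(1))
        also have "\<dots> \<le> (\<bar>K\<bar> + 1) * sn (X m - X n)"
          using sn_nonneg[OF B_diff[OF X(1) X(1)]] by (intro mult_right_mono) auto
        also have "\<dots> < e" using N[OF that] by (simp add: field_simps)
        finally show ?thesis .
      qed
      then show "\<exists>N. \<forall>m\<ge>N. \<forall>n\<ge>N. sn (T (X m) - T (X n)) < e" by blast
    qed
    moreover have "(\<lambda>n. b y (T (X n))) \<longlonglongrightarrow> f h y" if y: "y \<in> B" for y
      using X(3)[OF T(2)[OF y]] by (simp add: adj y X(1) f_def)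
    ultimately show ?thesis using X(1) T(1) by (auto simp: represents_def f_def)
  qed
  have norm: "hnorm completion (f h) \<le> K * hnorm completion h" if X: "represents X h" for X h
    by (rule LIMSEQ_le[OF hnorm_completion_tendsto[OF rep[OF X]]
          tendsto_mult_left[OF hnorm_completion_tendsto[OF X]]])
      (use bound representsD(1)[OF X] in blast)
  show "bounded_hop completion f"
    unfolding bounded_hop_def
  proof (intro conjI)
    show "f \<in> hcarrier completion \<rightarrow> hcarrier completion" using rep by (simp add: Pi_iff) blast
    show "\<exists>K. \<forall>x\<in>hcarrier completion. hnorm completion (f x) \<le> K * hnorm completion x"
      using norm by auto
  qed (auto simp: f_def fun_eq_iff)
qed

lemma represents_additive:
  assumes X: "represents X h" and xy: "x \<in> B" "y \<in> B"
  shows "h (x + y) = h x + h y"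
proof (rule LIMSEQ_unique[OF representsD(3)[OF X B_add[OF xy]]])
  show "(\<lambda>n. b (x + y) (X n)) \<longlonglongrightarrow> h x + h y"
    using tendsto_add[OF representsD(3)[OF X xy(1)] representsD(3)[OF X xy(2)]]
    by (simp add: b_add_left xy representsD(1)[OF X])
qed

lemma represents_antilinear:
  assumes X: "represents X h" and x: "x \<in> B"
  shows "h (c *\<^sub>C x) = cnj c * h x"
proof (rule LIMSEQ_unique[OF representsD(3)[OF X B_scale[OF x]]])
  show "(\<lambda>n. b (c *\<^sub>C x) (X n)) \<longlonglongrightarrow> cnj c * h x"
    using tendsto_mult_left[OF representsD(3)[OF X x], of "cnj c"]
    by (simp add: b_scale_left x representsD(1)[OF X])
qed

end

section \<open>The Gelfand-Naimark-Segal construction\<close>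

locale star_subalgebra =
  fixes B :: "'a::star_algebra set"
  assumes one: "1 \<in> B" and add: "x \<in> B \<Longrightarrow> y \<in> B \<Longrightarrow> x + y \<in> B"
    and scale: "x \<in> B \<Longrightarrow> c *\<^sub>C x \<in> B" and mult: "x \<in> B \<Longrightarrow> y \<in> B \<Longrightarrow> x * y \<in> B"
    and star: "x \<in> B \<Longrightarrow> star x \<in> B"
begin

lemma state_commute:
  assumes \<omega>: "state B \<omega>" and xy: "x \<in> B" "y \<in> B"
  shows "\<omega> (star x * y) = cnj (\<omega> (star y * x))"
proof -
  have lin: "\<omega> (u + v) = \<omega> u + \<omega> v" "\<omega> (c *\<^sub>C u) = c * \<omega> u" if "u \<in> B" "v \<in> B" for u v c
    using \<omega> that unfolding state_def by blast+
  have pos: "Im (\<omega> (star u * u)) = 0" if "u \<in> B" for u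
    using \<omega> that unfolding state_def by (simp add: complex_nonneg_Reals_iff)
  have m: "star u * v \<in> B" if "u \<in> B" "v \<in> B" for u v using that by (intro mult star)
  have e: "\<omega> (star (x + c *\<^sub>C y) * (x + c *\<^sub>C y))
      = \<omega> (star x * x) + c * \<omega> (star x * y) + (cnj c * \<omega> (star y * x) + cnj c * (c * \<omega> (star y * y)))" for c
  proof -
    have "star (x + c *\<^sub>C y) * (x + c *\<^sub>C y) = (star x * x + c *\<^sub>C (star x * y))
        + (cnj c *\<^sub>C (star y * x) + cnj c *\<^sub>C (c *\<^sub>C (star y * y)))"
      by (simp add: star_add star_scaleC distrib_left distrib_right scaleC_mult_left scaleC_mult_right
          scaleC_add_right add.assoc)
        (simp add: algebra_simps scaleC_scaleC)
    then show ?thesis using xy by (simp add: lin m add scale)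
  qed
  have "Im (\<omega> (star x * y) + \<omega> (star y * x)) = 0"
    using pos[OF add[OF xy(1) scale[OF xy(2)]], of 1] pos[OF xy(1)] pos[OF xy(2)] e[of 1] by simp
  moreover have "Im (\<i> * \<omega> (star x * y) - \<i> * \<omega> (star y * x)) = 0"
    using pos[OF add[OF xy(1) scale[OF xy(2)]], of \<i>] pos[OF xy(1)] pos[OF xy(2)] e[of \<i>] by simp
  ultimately show ?thesis by (simp add: complex_eq_iff)
qed

lemma semi_inner_state:
  assumes \<omega>: "state B \<omega>"
  shows "semi_inner B (\<lambda>x y. \<omega> (star x * y))"
proof
  have m: "star u * v \<in> B" if "u \<in> B" "v \<in> B" for u v using that by (intro mult star)
  fix x y z :: 'a and c :: complex
  show "0 \<in> B" using scale[OF one, of 0] by simp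
  assume x: "x \<in> B"
  show "\<omega> (star x * x) \<in> \<real>\<^sub>\<ge>\<^sub>0" using \<omega> x unfolding state_def by blast
  show "c *\<^sub>C x \<in> B" by (rule scale[OF x])
  assume y: "y \<in> B"
  show "x + y \<in> B" by (rule add[OF x y])
  show "\<omega> (star x * y) = cnj (\<omega> (star y * x))" by (rule state_commute[OF \<omega> x y])
  show "\<omega> (star x * (c *\<^sub>C y)) = c * \<omega> (star x * y)"
    using \<omega> m[OF x y] unfolding state_def by (simp add: scaleC_mult_right)
  assume z: "z \<in> B"
  show "\<omega> (star x * (y + z)) = \<omega> (star x * y) + \<omega> (star x * z)"
    using \<omega> m[OF x y] m[OF x z] unfolding state_def by (simp add: distrib_left)
qed

lemma gns_representation:
  assumes \<omega>: "state B \<omega>"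
    and bound: "\<And>x. x \<in> B \<Longrightarrow> \<exists>K. \<forall>y\<in>B. Re (\<omega> (star (x * y) * (x * y))) \<le> K * Re (\<omega> (star y * y))"
  shows "\<exists>R :: ('a \<Rightarrow> complex) hspace \<times> _ \<times> _. cyclic_representation B \<omega> R"
proof -
  interpret S: semi_inner B "\<lambda>x y. \<omega> (star x * y)" by (rule semi_inner_state[OF \<omega>])
  define \<pi> where "\<pi> x h y = (if y \<in> B then h (star x * y) else 0)" for x and h :: "'a \<Rightarrow> complex" and y
  have sn_bound: "\<exists>K. \<forall>y\<in>B. S.sn (x * y) \<le> K * S.sn y" if x: "x \<in> B" for x
  proof -
    obtain K where K: "\<And>y. y \<in> B \<Longrightarrow> Re (\<omega> (star (x * y) * (x * y))) \<le> K * Re (\<omega> (star y * y))"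
      using bound[OF x] by blast
    have "S.sn (x * y) \<le> sqrt K * S.sn y" if "y \<in> B" for y
      unfolding S.sn_def real_sqrt_mult[symmetric] using K[OF that] by (rule real_sqrt_le_mono)
    then show ?thesis by blast
  qed
  have op: "S.represents X h \<Longrightarrow> S.represents (\<lambda>n. x * X n) (\<pi> x h)" "bounded_hop S.completion (\<pi> x)"
    if x: "x \<in> B" for x X h
  proof -
    obtain K where K: "\<And>y. y \<in> B \<Longrightarrow> S.sn (x * y) \<le> K * S.sn y" using sn_bound[OF x] by blast
    have eq: "\<pi> x = (\<lambda>h y. if y \<in> B then h (star x * y) else 0)" by (simp add: \<pi>_def fun_eq_iff)
    show "S.represents X h \<Longrightarrow> S.represents (\<lambda>n. x * X n) (\<pi> x h)" "bounded_hop S.completion (\<pi> x)"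
      unfolding eq
      by (rule S.bounded_hop_completion[where T = "\<lambda>y. x * y" and T' = "\<lambda>y. star x * y" and K = K];
          use x K in \<open>simp add: mult star right_diff_distrib star_mult star_star mult.assoc\<close>)+
  qed
  have pe: "\<pi> x (S.embed 1) = S.embed x" if x: "x \<in> B" for x
    using x by (auto simp: \<pi>_def S.embed_def fun_eq_iff star_mult star_star mult star)
  have rep: "representation B S.completion \<pi>"
    unfolding representation_def
  proof (intro conjI ballI allI)
    fix x y c h g
    assume x: "x \<in> B"
    show "bounded_hop S.completion (\<pi> x)" by (rule op(2)[OF x])
    assume h: "h \<in> hcarrier S.completion"
    then obtain X where X: "S.represents X h" by auto
    show "\<pi> (c *\<^sub>C x) h = hscale S.completion c (\<pi> x h)"
      using x by (auto simp: \<pi>_def fun_eq_iff star_scaleC scaleC_mult_left S.represents_antilinear[OF X] mult star)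
  next
    fix x y h
    assume x: "x \<in> B" and y: "y \<in> B" and h: "h \<in> hcarrier S.completion"
    then obtain X where X: "S.represents X h" by auto
    show "\<pi> (x + y) h = hadd S.completion (\<pi> x h) (\<pi> y h)"
      using x y by (auto simp: \<pi>_def fun_eq_iff star_add distrib_right S.represents_additive[OF X] mult star)
    show "\<pi> (x * y) h = \<pi> x (\<pi> y h)"
      using x y by (auto simp: \<pi>_def fun_eq_iff star_mult mult.assoc mult star)
  next
    fix h assume "h \<in> hcarrier S.completion"
    then obtain X where X: "S.represents X h" by auto
    show "\<pi> 1 h = h" using S.representsD(4)[OF X] by (auto simp: \<pi>_def fun_eq_iff)
  next
    fix x g h
    assume x: "x \<in> B" and "g \<in> hcarrier S.completion" "h \<in> hcarrier S.completion"
    then obtain X Y where X: "S.represents X g" and Y: "S.represents Y h" by auto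
    have "(\<lambda>n. \<omega> (star (star x * X n) * Y n)) \<longlonglongrightarrow> S.cinn (\<pi> (star x) g) h"
      by (rule S.cinn_tendsto[OF op(1)[OF star[OF x] X] Y])
    moreover have "(\<lambda>n. \<omega> (star (X n) * (x * Y n))) \<longlonglongrightarrow> S.cinn g (\<pi> x h)"
      by (rule S.cinn_tendsto[OF X op(1)[OF x Y]])
    ultimately show "hinner S.completion (\<pi> (star x) g) h = hinner S.completion g (\<pi> x h)"
      using LIMSEQ_unique by (simp add: star_mult star_star mult.assoc)
  qed
  have cyc: "hclosure S.completion {\<pi> x (S.embed 1) |x. x \<in> B} = hcarrier S.completion"
  proof
    show "hcarrier S.completion \<subseteq> hclosure S.completion {\<pi> x (S.embed 1) |x. x \<in> B}"
    proof
      fix h assume h: "h \<in> hcarrier S.completion"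
      then obtain X where X: "S.represents X h" by auto
      have "\<exists>y\<in>{\<pi> x (S.embed 1) |x. x \<in> B}. hnorm S.completion (hdiff S.completion h y) < e" if e: "e > 0" for e
      proof -
        obtain n where n: "norm (hnorm S.completion (\<lambda>y. h y - S.embed (X n) y) - 0) < e"
          using LIMSEQ_D[OF S.embed_tendsto[OF X] e] by blast
        have "S.embed (X n) \<in> {\<pi> x (S.embed 1) |x. x \<in> B}"
          using pe[OF S.representsD(1)[OF X, of n]] S.representsD(1)[OF X, of n] by force
        moreover have "hnorm S.completion (hdiff S.completion h (S.embed (X n))) < e" using n by simp
        ultimately show ?thesis by blast
      qed
      then show "h \<in> hclosure S.completion {\<pi> x (S.embed 1) |x. x \<in> B}"
        unfolding hclosure_def using h by blast
    qed
  qed (auto simp: hclosure_def)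
  have "cyclic_representation B \<omega> (S.completion, \<pi>, S.embed 1)"
    unfolding cyclic_representation_def prod.case
  proof (intro conjI ballI)
    show "S.embed 1 \<in> hcarrier S.completion" using S.represents_embed[OF one] by auto
    show "\<omega> x = hinner S.completion (S.embed 1) (\<pi> x (S.embed 1))" if "x \<in> B" for x
      using S.cinn_embed[OF one that] by (simp add: pe[OF that])
  qed (fact S.hilbert_space_completion rep cyc)+
  then show ?thesis by blast
qed

end

section \<open>Functionals on algebraic tensor products\<close>

lift_definition tensor_form ::
    "('a::star_algebra \<Rightarrow> 'b::star_algebra \<Rightarrow> complex) \<Rightarrow> ('a, 'b) tensor \<Rightarrow> complex"
  is "\<lambda>f xs. if cbilinear f then formal_value f xs else 0"
  by (simp add: tensor_eq_def)

lemma tensor_form: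
  assumes "cbilinear f"
  shows "tensor_form f (x + y) = tensor_form f x + tensor_form f y"
    "tensor_form f (c *\<^sub>C x) = c * tensor_form f x"
    "tensor_form f (a \<otimes> b) = f a b"
proof -
  show "tensor_form f (x + y) = tensor_form f x + tensor_form f y"
    by transfer simp
  show "tensor_form f (c *\<^sub>C x) = c * tensor_form f x"
    using assms by transfer (simp add: formal_value_map cbilinear_simps formal_value_mult del: map_map)
  show "tensor_form f (a \<otimes> b) = f a b" using assms by transfer simp
qed

lemma elem_tensor_mult: "(a \<otimes> b) * (c \<otimes> d) = (a * c) \<otimes> (b * d)"
  by transfer (simp add: formal_mult_def tensor_eq_def)

lemma star_elem_tensor: "star (a \<otimes> b) = star a \<otimes> star b"
  by transfer (simp add: tensor_eq_def)

lemma elem_tensor_one: "1 \<otimes> 1 = 1"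
  by transfer (simp add: tensor_eq_def)

lemma scaleC_elem_tensor: "c *\<^sub>C (a \<otimes> b) = (c *\<^sub>C a) \<otimes> b"
  by transfer (simp add: tensor_eq_def)

lemma elem_tensor_scaleC: "a \<otimes> (c *\<^sub>C b) = c *\<^sub>C (a \<otimes> b)"
  by transfer (simp add: tensor_eq_def cbilinear_simps)

lemma elem_tensor_add_left: "(a + a') \<otimes> b = a \<otimes> b + a' \<otimes> b"
  by transfer (simp add: tensor_eq_def cbilinear_simps)

lemma elem_tensor_add_right: "a \<otimes> (b + b') = a \<otimes> b + a \<otimes> b'"
  by transfer (simp add: tensor_eq_def cbilinear_simps)

lemma elem_tensor_power_left: "(a \<otimes> 1) ^ m = (a ^ m) \<otimes> 1"
  by (induction m) (simp_all add: elem_tensor_one elem_tensor_mult)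

lemma elem_tensor_power_right: "(1 \<otimes> b) ^ m = 1 \<otimes> (b ^ m)"
  by (induction m) (simp_all add: elem_tensor_one elem_tensor_mult)

lemma tensor_product_elem: "a \<in> A \<Longrightarrow> b \<in> B \<Longrightarrow> a \<otimes> b \<in> A \<odot> B"
  unfolding tensor_product_def by (intro CollectI exI[of _ "[(a, b)]"]) simp

lemma tensor_product_zero: "0 \<in> A \<odot> B"
  unfolding tensor_product_def by (intro CollectI exI[of _ "[]"]) simp

lemma tensor_product_add:
  assumes "x \<in> A \<odot> B" "y \<in> A \<odot> B"
  shows "x + y \<in> A \<odot> B"
proof -
  obtain xs ys where "set xs \<subseteq> A \<times> B" "x = (\<Sum>(a, b)\<leftarrow>xs. a \<otimes> b)"
    "set ys \<subseteq> A \<times> B" "y = (\<Sum>(a, b)\<leftarrow>ys. a \<otimes> b)"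
    using assms unfolding tensor_product_def by blast
  then show ?thesis unfolding tensor_product_def by (intro CollectI exI[of _ "xs @ ys"]) simp
qed

lemma tensor_product_induct [consumes 1, case_names zero add]:
  assumes x: "x \<in> A \<odot> B" and zero: "P 0"
    and add: "\<And>a b y. a \<in> A \<Longrightarrow> b \<in> B \<Longrightarrow> y \<in> A \<odot> B \<Longrightarrow> P y \<Longrightarrow> P (a \<otimes> b + y)"
  shows "P x"
proof -
  obtain xs where xs: "set xs \<subseteq> A \<times> B" "x = (\<Sum>(a, b)\<leftarrow>xs. a \<otimes> b)"
    using x unfolding tensor_product_def by blast
  have "(\<Sum>(a, b)\<leftarrow>xs. a \<otimes> b) \<in> A \<odot> B \<and> P (\<Sum>(a, b)\<leftarrow>xs. a \<otimes> b)" using xs(1)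
  proof (induction xs)
    case (Cons p xs)
    obtain a b where p: "p = (a, b)" "a \<in> A" "b \<in> B" using Cons.prems by (cases p) auto
    with Cons show ?case by (simp add: add tensor_product_add tensor_product_elem)
  qed (simp add: zero tensor_product_zero)
  then show ?thesis using xs(2) by simp
qed

lemma star_subalgebra_tensor_product:
  fixes A :: "'a::chilbert_space bop set"
  assumes A: "von_neumann_algebra A"
  shows "star_subalgebra (A \<odot> commutant A)"
proof
  note A = von_neumann_algebra_closed[OF A] von_neumann_algebra_closed[OF von_neumann_algebra_commutant[OF A]]
  let ?B = "A \<odot> commutant A"
  show "1 \<in> ?B" using tensor_product_elem[OF A(1) A(8)] by (simp add: elem_tensor_one)
  show "x + y \<in> ?B" if "x \<in> ?B" "y \<in> ?B" for x y using that by (rule tensor_product_add)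
  show "c *\<^sub>C x \<in> ?B" if "x \<in> ?B" for x c
    using that by (induction rule: tensor_product_induct)
      (auto simp: scaleC_add_right scaleC_elem_tensor scaleC_zero_right
        intro: tensor_product_zero tensor_product_add tensor_product_elem A)
  show "star x \<in> ?B" if "x \<in> ?B" for x
    using that by (induction rule: tensor_product_induct)
      (auto simp: star_add star_elem_tensor intro: tensor_product_zero tensor_product_add tensor_product_elem A)
  show "x * y \<in> ?B" if x: "x \<in> ?B" and y: "y \<in> ?B" for x y
    using x
  proof (induction rule: tensor_product_induct)
    case zero
    then show ?case by (simp add: tensor_product_zero)
  next
    case (add a b x)
    have "(a \<otimes> b) * y \<in> ?B"
      using y by (induction rule: tensor_product_induct)
        (use add in \<open>auto simp: distrib_left elem_tensor_mult intro: tensor_product_zero tensor_product_add tensor_product_elem A\<close>)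
    then show ?case using add by (simp add: distrib_right tensor_product_add)
  qed
qed

lemma quadratic_growth_bound:
  fixes p :: "nat \<Rightarrow> real"
  assumes q: "q \<ge> 0" and K: "K > 0" and p: "p 0 \<ge> 0" "\<And>n. (p n)\<^sup>2 \<le> q * p (Suc n)"
    and growth: "\<And>n. p n \<le> C * K ^ (2 ^ n)"
  shows "p 0 \<le> K * q"
proof (cases "q = 0")
  case True
  then show ?thesis using p(2)[of 0] by simp
next
  case False
  then have q: "q > 0" using q by simp
  define r where "r n = p n / (q * K ^ (2 ^ n))" for n
  have r2: "(r n)\<^sup>2 \<le> r (Suc n)" for n
  proof -
    have "(r n)\<^sup>2 = (p n)\<^sup>2 / (q\<^sup>2 * K ^ (2 ^ Suc n))"
      by (simp add: r_def power_divide power_mult_distrib mult.commute flip: power_mult)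
    also have "\<dots> \<le> (q * p (Suc n)) / (q\<^sup>2 * K ^ (2 ^ Suc n))"
      using p(2)[of n] q K by (intro divide_right_mono) auto
    also have "\<dots> = r (Suc n)" using q by (simp add: r_def power2_eq_square)
    finally show ?thesis .
  qed
  have rC: "r n \<le> C / q" for n
    using growth[of n] q K by (simp add: r_def field_simps)
  have r0: "r 0 \<ge> 0" using p(1) q K by (simp add: r_def)
  have rp: "(r 0) ^ (2 ^ n) \<le> r n" for n
  proof (induction n)
    case (Suc n)
    have "(r 0) ^ (2 ^ Suc n) = ((r 0) ^ (2 ^ n))\<^sup>2" by (simp add: mult.commute flip: power_mult)
    also have "\<dots> \<le> (r n)\<^sup>2" using Suc r0 by (intro power_mono) auto
    finally show ?case using r2[of n] by linarith
  qed simp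
  have "r 0 \<le> 1"
  proof (rule ccontr)
    assume "\<not> r 0 \<le> 1"
    then have r1: "r 0 > 1" by simp
    obtain m where m: "C / q < r 0 ^ m" using real_arch_pow[OF r1] by blast
    have "r 0 ^ m \<le> r 0 ^ (2 ^ m)" using r1 by (intro power_increasing less_imp_le) auto
    then show False using m rp[of m] rC[of m] by linarith
  qed
  then show ?thesis using q K by (simp add: r_def field_simps)
qed

text \<open>A norm bound on the representing operator of \<open>c\<close> follows from polynomial bounds on the powers of
  \<open>c\<^sup>* c\<close> by iterating the Cauchy-Schwarz inequality; no square roots in the algebra are needed.\<close>

lemma (in star_subalgebra) left_mult_bounded:
  assumes \<omega>: "state B \<omega>" and c: "c \<in> B" and K: "K > 0"
    and growth: "\<And>y. y \<in> B \<Longrightarrow> \<exists>C. \<forall>m. cmod (\<omega> (star y * (star c * c) ^ m * y)) \<le> C * K ^ m"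
    and y: "y \<in> B"
  shows "Re (\<omega> (star (c * y) * (c * y))) \<le> K * Re (\<omega> (star y * y))"
proof -
  interpret S: semi_inner B "\<lambda>x y. \<omega> (star x * y)" by (rule semi_inner_state[OF \<omega>])
  define z where "z = star c * c"
  have z: "star (z ^ m) = z ^ m" "z ^ m \<in> B" for m
  proof -
    have "star z = z" "z \<in> B" using c by (simp_all add: z_def star_mult star_star mult star)
    then show "star (z ^ m) = z ^ m" "z ^ m \<in> B"
      by (induction m) (simp_all add: one mult star_mult power_commutes)
  qed
  define p where "p n = Re (\<omega> (star y * z ^ (2 ^ n) * y))" for n
  obtain C where C: "\<And>m. cmod (\<omega> (star y * z ^ m * y)) \<le> C * K ^ m"
    using growth[OF y] unfolding z_def by blast
  have "p 0 \<le> K * Re (\<omega> (star y * y))"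
  proof (rule quadratic_growth_bound[OF _ K])
    show "0 \<le> Re (\<omega> (star y * y))" using S.b_pos[OF y] by (simp add: complex_nonneg_Reals_iff)
    show "0 \<le> p 0"
      using S.b_pos[OF mult[OF c y]] by (simp add: p_def z_def star_mult mult.assoc complex_nonneg_Reals_iff)
    show "(p n)\<^sup>2 \<le> Re (\<omega> (star y * y)) * p (Suc n)" for n
    proof -
      let ?v = "z ^ (2 ^ n) * y"
      have v: "?v \<in> B" by (intro mult z y)
      have "\<bar>p n\<bar> \<le> S.sn y * S.sn ?v"
        using S.cauchy_schwarz[OF y v] abs_Re_le_cmod[of "\<omega> (star y * ?v)"] by (simp add: p_def mult.assoc)
      then have "(p n)\<^sup>2 \<le> (S.sn y * S.sn ?v)\<^sup>2" by (metis abs_ge_zero power2_abs power_mono)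
      also have "\<dots> = Re (\<omega> (star y * y)) * Re (\<omega> (star ?v * ?v))"
        using S.b_pos[OF y] S.b_pos[OF v] by (simp add: S.sn_def power_mult_distrib complex_nonneg_Reals_iff)
      also have "star ?v * ?v = star y * z ^ (2 ^ Suc n) * y"
        by (simp add: star_mult z(1) mult.assoc power_add mult_2)
      finally show ?thesis by (simp add: p_def)
    qed
    show "p n \<le> C * K ^ (2 ^ n)" for n
      using C[of "2 ^ n"] complex_Re_le_cmod[of "\<omega> (star y * z ^ (2 ^ n) * y)"] by (simp add: p_def)
  qed
  then show ?thesis by (simp add: p_def z_def star_mult mult.assoc)
qed

section \<open>Couplings of vector states\<close>

locale coupling =
  fixes A :: "'g::chilbert_space bop set" and \<Lambda>1 \<Lambda>2 :: 'g and \<omega> :: "('g bop, 'g bop) tensor \<Rightarrow> complex"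
  assumes vn: "von_neumann_algebra A"
    and cyclic1: "cyclic_vector A \<Lambda>1" and separating1: "separating_vector A \<Lambda>1"
    and cyclic2: "cyclic_vector A \<Lambda>2" and separating2: "separating_vector A \<Lambda>2"
    and state: "state (A \<odot> commutant A) \<omega>"
    and left: "a \<in> A \<Longrightarrow> \<omega> (a \<otimes> 1) = cinner \<Lambda>1 (a \<cdot> \<Lambda>1)"
    and right: "a' \<in> commutant A \<Longrightarrow> \<omega> (1 \<otimes> a') = cinner \<Lambda>2 (a' \<cdot> \<Lambda>2)"
begin

abbreviation A' :: "'g bop set" where "A' \<equiv> commutant A"
abbreviation AA :: "('g bop, 'g bop) tensor set" where "AA \<equiv> A \<odot> A'"

sublocale star_subalgebra AA by (rule star_subalgebra_tensor_product[OF vn])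

sublocale SI: semi_inner AA "\<lambda>x y. \<omega> (star x * y)" by (rule semi_inner_state[OF state])

lemmas A_closed = von_neumann_algebra_closed[OF vn]
lemmas A'_closed = von_neumann_algebra_closed[OF von_neumann_algebra_commutant[OF vn]]

lemma dense1: "closure {a \<cdot> \<Lambda>1 |a. a \<in> A} = UNIV"
  using cyclic1 by (simp add: cyclic_vector_def)

lemma dense2: "closure {a' \<cdot> \<Lambda>2 |a'. a' \<in> A'} = UNIV"
  by (rule cyclic_for_commutant[OF vn separating2])

lemma \<omega>_add: "x \<in> AA \<Longrightarrow> y \<in> AA \<Longrightarrow> \<omega> (x + y) = \<omega> x + \<omega> y"
  and \<omega>_scale: "x \<in> AA \<Longrightarrow> \<omega> (c *\<^sub>C x) = c * \<omega> x"
  using state unfolding state_def by blast+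

lemma \<omega>_hermitian: "a \<in> A \<Longrightarrow> a' \<in> A' \<Longrightarrow> \<omega> (star a \<otimes> star a') = cnj (\<omega> (a \<otimes> a'))"
  using state_commute[OF state tensor_product_elem one, of a a'] by (simp add: star_elem_tensor)

lemma \<omega>_bound:
  assumes a: "a \<in> A" and a': "a' \<in> A'"
  shows "cmod (\<omega> (star a \<otimes> a')) \<le> norm (a \<cdot> \<Lambda>1) * norm (a' \<cdot> \<Lambda>2)"
proof -
  have m: "a \<otimes> 1 \<in> AA" "1 \<otimes> a' \<in> AA" by (intro tensor_product_elem a a' A_closed A'_closed)+
  have "SI.sn (a \<otimes> 1) = norm (a \<cdot> \<Lambda>1)"
    using left[OF A_closed(5)[OF A_closed(7)[OF a] a]]
    by (simp add: SI.sn_def star_elem_tensor elem_tensor_mult bop_mult_apply cinner_star_right cinner_self)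
  moreover have "SI.sn (1 \<otimes> a') = norm (a' \<cdot> \<Lambda>2)"
    using right[OF A'_closed(5)[OF A'_closed(7)[OF a'] a']]
    by (simp add: SI.sn_def star_elem_tensor elem_tensor_mult bop_mult_apply cinner_star_right cinner_self)
  ultimately show ?thesis
    using SI.cauchy_schwarz[OF m] by (simp add: star_elem_tensor elem_tensor_mult)
qed

lemma separating: "a \<in> A \<Longrightarrow> b \<in> A \<Longrightarrow> a \<cdot> \<Lambda>1 = b \<cdot> \<Lambda>1 \<Longrightarrow> a = b"
proof -
  assume "a \<in> A" "b \<in> A" "a \<cdot> \<Lambda>1 = b \<cdot> \<Lambda>1"
  then have "a - b \<in> A" "(a - b) \<cdot> \<Lambda>1 = 0" by (simp_all add: A_closed minus_bop.rep_eq)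
  then show ?thesis using separating1 unfolding separating_vector_def by fastforce
qed

lemma separating': "a' \<in> A' \<Longrightarrow> b' \<in> A' \<Longrightarrow> a' \<cdot> \<Lambda>2 = b' \<cdot> \<Lambda>2 \<Longrightarrow> a' = b'"
proof (rule dense_bop_eqI)
  show "closure {a \<cdot> \<Lambda>2 |a. a \<in> A} = UNIV" using cyclic2 by (simp add: cyclic_vector_def)
  fix y assume *: "a' \<in> A'" "b' \<in> A'" "a' \<cdot> \<Lambda>2 = b' \<cdot> \<Lambda>2" "y \<in> {a \<cdot> \<Lambda>2 |a. a \<in> A}"
  then obtain a where a: "a \<in> A" "y = a \<cdot> \<Lambda>2" by blast
  show "a' \<cdot> y = b' \<cdot> y"
    using commutant_commute_apply[OF a(1) *(1), of \<Lambda>2] commutant_commute_apply[OF a(1) *(2), of \<Lambda>2] *(3) a(2) by simp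
qed

lemma coupling_operator_exists:
  "\<exists>V. \<forall>a\<in>A. \<forall>a'\<in>A'. cinner (V \<cdot> a \<cdot> \<Lambda>1) (a' \<cdot> \<Lambda>2) = \<omega> (star a \<otimes> a')"
proof -
  define l where "l x = (THE a. a \<in> A \<and> a \<cdot> \<Lambda>1 = x)" for x
  define r where "r x = (THE a'. a' \<in> A' \<and> a' \<cdot> \<Lambda>2 = x)" for x
  have l: "l (a \<cdot> \<Lambda>1) = a" if "a \<in> A" for a
    unfolding l_def using that separating by (intro the_equality) auto
  have r: "r (a' \<cdot> \<Lambda>2) = a'" if "a' \<in> A'" for a'
    unfolding r_def using that separating' by (intro the_equality) auto
  define f where "f x y = \<omega> (star (l x) \<otimes> r y)" for x y
  have f: "f (a \<cdot> \<Lambda>1) (a' \<cdot> \<Lambda>2) = \<omega> (star a \<otimes> a')" if "a \<in> A" "a' \<in> A'" for a a'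
    using that by (simp add: f_def l r)
  have add: "a \<cdot> x + b \<cdot> x = (a + b) \<cdot> x" and sc: "c *\<^sub>C (a \<cdot> x) = (c *\<^sub>C a) \<cdot> x" for a b :: "'g bop" and x c
    by (simp_all add: bop_simps)
  have "\<exists>F. bounded_linear F \<and> (\<forall>c x. F (c *\<^sub>C x) = c *\<^sub>C F x) \<and>
    (\<forall>x\<in>{a \<cdot> \<Lambda>1 |a. a \<in> A}. \<forall>y\<in>{a' \<cdot> \<Lambda>2 |a'. a' \<in> A'}. cinner (F x) y = f x y)"
  proof (rule sesquilinear_extension[OF dense1 dense2])
    show "x + y \<in> {a \<cdot> \<Lambda>1 |a. a \<in> A}" if "x \<in> {a \<cdot> \<Lambda>1 |a. a \<in> A}" "y \<in> {a \<cdot> \<Lambda>1 |a. a \<in> A}" for x y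
      using that add A_closed(3) by auto
    show "c *\<^sub>C x \<in> {a \<cdot> \<Lambda>1 |a. a \<in> A}" if "x \<in> {a \<cdot> \<Lambda>1 |a. a \<in> A}" for c x
      using that sc A_closed(6) by auto
    show "x + y \<in> {a' \<cdot> \<Lambda>2 |a'. a' \<in> A'}" if "x \<in> {a' \<cdot> \<Lambda>2 |a'. a' \<in> A'}" "y \<in> {a' \<cdot> \<Lambda>2 |a'. a' \<in> A'}" for x y
      using that add A'_closed(3) by auto
    show "c *\<^sub>C x \<in> {a' \<cdot> \<Lambda>2 |a'. a' \<in> A'}" if "x \<in> {a' \<cdot> \<Lambda>2 |a'. a' \<in> A'}" for c x
      using that sc A'_closed(6) by auto
  next
    fix x y y' assume "x \<in> {a \<cdot> \<Lambda>1 |a. a \<in> A}" "y \<in> {a' \<cdot> \<Lambda>2 |a'. a' \<in> A'}" "y' \<in> {a' \<cdot> \<Lambda>2 |a'. a' \<in> A'}"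
    then obtain a a' b' where "a \<in> A" "x = a \<cdot> \<Lambda>1" "a' \<in> A'" "y = a' \<cdot> \<Lambda>2" "b' \<in> A'" "y' = b' \<cdot> \<Lambda>2" by blast
    then show "f x (y + y') = f x y + f x y'"
      by (simp add: add f A'_closed A_closed elem_tensor_add_right \<omega>_add tensor_product_elem)
  next
    fix x x' y assume "x \<in> {a \<cdot> \<Lambda>1 |a. a \<in> A}" "x' \<in> {a \<cdot> \<Lambda>1 |a. a \<in> A}" "y \<in> {a' \<cdot> \<Lambda>2 |a'. a' \<in> A'}"
    then obtain a b a' where "a \<in> A" "x = a \<cdot> \<Lambda>1" "b \<in> A" "x' = b \<cdot> \<Lambda>1" "a' \<in> A'" "y = a' \<cdot> \<Lambda>2" by blast
    then show "f (x + x') y = f x y + f x' y"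
      by (simp add: add f A'_closed A_closed star_add elem_tensor_add_left \<omega>_add tensor_product_elem)
  next
    fix c x y assume "x \<in> {a \<cdot> \<Lambda>1 |a. a \<in> A}" "y \<in> {a' \<cdot> \<Lambda>2 |a'. a' \<in> A'}"
    then obtain a a' where "a \<in> A" "x = a \<cdot> \<Lambda>1" "a' \<in> A'" "y = a' \<cdot> \<Lambda>2" by blast
    then show "f x (c *\<^sub>C y) = c * f x y" "f (c *\<^sub>C x) y = cnj c * f x y" "cmod (f x y) \<le> norm x * norm y"
      by (simp_all add: sc f A'_closed A_closed star_scaleC elem_tensor_scaleC \<omega>_scale \<omega>_bound tensor_product_elem
          flip: scaleC_elem_tensor)
  qed
  then obtain F where F: "bounded_linear F" "\<forall>c x. F (c *\<^sub>C x) = c *\<^sub>C F x"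
    "\<And>x y. x \<in> {a \<cdot> \<Lambda>1 |a. a \<in> A} \<Longrightarrow> y \<in> {a' \<cdot> \<Lambda>2 |a'. a' \<in> A'} \<Longrightarrow> cinner (F x) y = f x y"
    by blast
  have "cinner (F (a \<cdot> \<Lambda>1)) (a' \<cdot> \<Lambda>2) = \<omega> (star a \<otimes> a')" if "a \<in> A" "a' \<in> A'" for a a'
    using F(3)[of "a \<cdot> \<Lambda>1" "a' \<cdot> \<Lambda>2"] f[OF that] that by auto
  then show ?thesis using F(1,2) by (intro exI[of _ "Bop F"]) (simp add: Bop_inverse)
qed

lemma power_bound:
  fixes z :: "'g bop"
  assumes "\<And>x. norm (z \<cdot> x) \<le> K * norm x" "K > 0"
  shows "norm ((z ^ m) \<cdot> x) \<le> K ^ m * norm x"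
proof (induction m)
  case (Suc m)
  have "norm ((z ^ Suc m) \<cdot> x) \<le> K * norm ((z ^ m) \<cdot> x)" using assms(1) by (simp add: bop_mult_apply)
  also have "\<dots> \<le> K * (K ^ m * norm x)" using Suc assms(2) by (intro mult_left_mono) auto
  finally show ?case by (simp add: mult.assoc)
qed (simp add: bop_simps)

lemma power_closed: "z \<in> A \<Longrightarrow> z ^ m \<in> A" "z' \<in> A' \<Longrightarrow> z' ^ m \<in> A'"
  by (induction m) (simp_all add: A_closed A'_closed)

lemma star_power: "star (z ^ m) = star z ^ m" for z :: "'g bop"
  by (induction m) (simp_all add: star_mult power_commutes)

lemma sesquilinear_growth:
  assumes z: "z \<in> A" "star z = z" "\<And>x. norm (z \<cdot> x) \<le> K * norm x" and K: "K > 0" "K' > 0"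
    and z': "z' \<in> A'" "\<And>x. norm (z' \<cdot> x) \<le> K' * norm x"
    and x: "x \<in> AA" and y: "y \<in> AA"
  shows "\<exists>C. \<forall>m m'. cmod (\<omega> (star x * (z ^ m \<otimes> z' ^ m') * y)) \<le> C * (K ^ m * K' ^ m')"
proof -
  have zz: "z ^ m \<otimes> z' ^ m' \<in> AA" for m m' by (intro tensor_product_elem power_closed z z')
  have \<omega>0: "\<omega> 0 = 0" using \<omega>_scale[OF tensor_product_zero, of 0] by simp
  have elem: "\<exists>C. \<forall>m m'. cmod (\<omega> (star (b \<otimes> b') * (z ^ m \<otimes> z' ^ m') * (d \<otimes> d'))) \<le> C * (K ^ m * K' ^ m')"
    if b: "b \<in> A" "b' \<in> A'" and d: "d \<in> A" "d' \<in> A'" for b b' d d'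
  proof -
    obtain Kd where Kd: "Kd > 0" "\<And>x. norm (star d \<cdot> x) \<le> Kd * norm x" using bop_bound by blast
    obtain Kb where Kb: "Kb > 0" "\<And>x. norm (star b' \<cdot> x) \<le> Kb * norm x" using bop_bound by blast
    have "cmod (\<omega> (star (b \<otimes> b') * (z ^ m \<otimes> z' ^ m') * (d \<otimes> d')))
        \<le> (Kd * norm (b \<cdot> \<Lambda>1) * (Kb * norm (d' \<cdot> \<Lambda>2))) * (K ^ m * K' ^ m')" for m m'
    proof -
      have e: "star (b \<otimes> b') * (z ^ m \<otimes> z' ^ m') * (d \<otimes> d') = star (star d * z ^ m * b) \<otimes> (star b' * z' ^ m' * d')"
        by (simp add: star_elem_tensor elem_tensor_mult star_mult star_star star_power z(2) mult.assoc)
      have 1: "norm ((star d * z ^ m * b) \<cdot> \<Lambda>1) \<le> Kd * (K ^ m * norm (b \<cdot> \<Lambda>1))"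
        using order_trans[OF Kd(2) mult_left_mono[OF power_bound[OF z(3) K(1)]]] Kd(1)
        by (simp add: bop_mult_apply)
      have 2: "norm ((star b' * z' ^ m' * d') \<cdot> \<Lambda>2) \<le> Kb * (K' ^ m' * norm (d' \<cdot> \<Lambda>2))"
        using order_trans[OF Kb(2) mult_left_mono[OF power_bound[OF z'(2) K(2)]]] Kb(1)
        by (simp add: bop_mult_apply)
      have "cmod (\<omega> (star (star d * z ^ m * b) \<otimes> (star b' * z' ^ m' * d')))
          \<le> norm ((star d * z ^ m * b) \<cdot> \<Lambda>1) * norm ((star b' * z' ^ m' * d') \<cdot> \<Lambda>2)"
        by (rule \<omega>_bound) (intro A_closed A'_closed power_closed z z' b d)+
      also have "\<dots> \<le> (Kd * (K ^ m * norm (b \<cdot> \<Lambda>1))) * (Kb * (K' ^ m' * norm (d' \<cdot> \<Lambda>2)))"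
        by (rule mult_mono[OF 1 2]) (use Kd K in auto)
      finally show ?thesis unfolding e by (simp add: mult_ac)
    qed
    then show ?thesis by blast
  qed
  have sum: "\<exists>C. \<forall>m m'. cmod (f m m' + g m m') \<le> C * (K ^ m * K' ^ m')"
    if fg: "\<exists>C. \<forall>m m'. cmod (f m m') \<le> C * (K ^ m * K' ^ m')" "\<exists>C. \<forall>m m'. cmod (g m m') \<le> C * (K ^ m * K' ^ m')"
    for f g :: "nat \<Rightarrow> nat \<Rightarrow> complex"
  proof -
    obtain C D where "\<And>m m'. cmod (f m m') \<le> C * (K ^ m * K' ^ m')" "\<And>m m'. cmod (g m m') \<le> D * (K ^ m * K' ^ m')"
      using fg by blast
    then have "cmod (f m m' + g m m') \<le> (C + D) * (K ^ m * K' ^ m')" for m m'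
      unfolding distrib_right using norm_triangle_mono by blast
    then show ?thesis by blast
  qed
  have right: "\<exists>C. \<forall>m m'. cmod (\<omega> (star (b \<otimes> b') * (z ^ m \<otimes> z' ^ m') * y)) \<le> C * (K ^ m * K' ^ m')"
    if b: "b \<in> A" "b' \<in> A'" for b b'
    using y
  proof (induction rule: tensor_product_induct)
    case zero
    show ?case by (intro exI[of _ 0]) (simp add: \<omega>0)
  next
    case (add d d' y)
    have "\<omega> (star (b \<otimes> b') * (z ^ m \<otimes> z' ^ m') * (d \<otimes> d' + y))
      = \<omega> (star (b \<otimes> b') * (z ^ m \<otimes> z' ^ m') * (d \<otimes> d')) + \<omega> (star (b \<otimes> b') * (z ^ m \<otimes> z' ^ m') * y)" for m m'
      unfolding distrib_left by (intro \<omega>_add mult star zz tensor_product_elem b add)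
    then show ?case using sum[OF elem[OF b add(1,2)] add(4)] by simp
  qed
  show ?thesis
    using x
  proof (induction rule: tensor_product_induct)
    case zero
    show ?case by (intro exI[of _ 0]) (simp add: \<omega>0)
  next
    case (add b b' x)
    have "\<omega> (star (b \<otimes> b' + x) * (z ^ m \<otimes> z' ^ m') * y)
      = \<omega> (star (b \<otimes> b') * (z ^ m \<otimes> z' ^ m') * y) + \<omega> (star x * (z ^ m \<otimes> z' ^ m') * y)" for m m'
      unfolding distrib_right star_add by (intro \<omega>_add mult star zz tensor_product_elem y add)
    then show ?case using sum[OF right[OF add(1,2)] add(4)] by simp
  qed
qed

lemma left_mult_elem_bounded:
  assumes c: "c = a \<otimes> 1 \<and> a \<in> A \<or> c = 1 \<otimes> a' \<and> a' \<in> A'"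
  shows "\<exists>K>0. \<forall>y\<in>AA. SI.sn (c * y) \<le> K * SI.sn y"
proof -
  obtain z z' where z: "star c * c = z \<otimes> z'" "z \<in> A" "z' \<in> A'" "star z = z"
    and pow: "\<And>m. (z \<otimes> z') ^ m = z ^ m \<otimes> z' ^ m"
  proof (cases "c = a \<otimes> 1 \<and> a \<in> A")
    case True
    then have "star c * c = (star a * a) \<otimes> 1" "star a * a \<in> A"
      by (simp_all add: star_elem_tensor elem_tensor_mult A_closed)
    then show ?thesis
      using that[of "star a * a" 1] A'_closed(1) by (simp add: star_mult star_star elem_tensor_power_left)
  next
    case False
    with c have "star c * c = 1 \<otimes> (star a' * a')" "star a' * a' \<in> A'"
      by (simp_all add: star_elem_tensor elem_tensor_mult A'_closed)
    then show ?thesis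
      using that[of 1 "star a' * a'"] A_closed(1) by (simp add: elem_tensor_power_right)
  qed
  have cA: "c \<in> AA" using c A_closed(1) A'_closed(1) tensor_product_elem by blast
  obtain K where K: "K > 0" "\<And>x. norm (z \<cdot> x) \<le> K * norm x" using bop_bound by blast
  obtain K' where K': "K' > 0" "\<And>x. norm (z' \<cdot> x) \<le> K' * norm x" using bop_bound by blast
  have growth: "\<exists>C. \<forall>m. cmod (\<omega> (star y * (star c * c) ^ m * y)) \<le> C * (K * K') ^ m" if "y \<in> AA" for y
    using sesquilinear_growth[OF z(2,4) K(2,1) K'(1) z(3) K'(2) that that]
    unfolding z(1) pow power_mult_distrib by blast
  have "SI.sn (c * y) \<le> sqrt (K * K') * SI.sn y" if y: "y \<in> AA" for y
    unfolding SI.sn_def real_sqrt_mult[symmetric]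
    using left_mult_bounded[OF state cA mult_pos_pos[OF K(1) K'(1)] growth y] by (rule real_sqrt_le_mono)
  then show ?thesis using K(1) K'(1) by (intro exI[of _ "sqrt (K * K')"]) simp
qed

lemma left_mult_sn_bounded:
  assumes "x \<in> AA"
  shows "\<exists>K\<ge>0. \<forall>y\<in>AA. SI.sn (x * y) \<le> K * SI.sn y"
  using assms
proof (induction rule: tensor_product_induct)
  case zero
  have "\<omega> 0 = 0" using \<omega>_scale[OF tensor_product_zero, of 0] by simp
  then show ?case by (intro exI[of _ 0]) (simp add: SI.sn_def)
next
  case (add a a' x)
  obtain K where K: "K > 0" "\<And>y. y \<in> AA \<Longrightarrow> SI.sn ((a \<otimes> 1) * y) \<le> K * SI.sn y"
    using left_mult_elem_bounded[of "a \<otimes> 1"] add by blast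
  obtain K' where K': "K' > 0" "\<And>y. y \<in> AA \<Longrightarrow> SI.sn ((1 \<otimes> a') * y) \<le> K' * SI.sn y"
    using left_mult_elem_bounded[of "1 \<otimes> a'" undefined a'] add by blast
  obtain L where L: "L \<ge> 0" "\<And>y. y \<in> AA \<Longrightarrow> SI.sn (x * y) \<le> L * SI.sn y" using add by blast
  have aa: "a \<otimes> 1 \<in> AA" "1 \<otimes> a' \<in> AA" by (intro tensor_product_elem add A_closed A'_closed)+
  have "SI.sn ((a \<otimes> a' + x) * y) \<le> (K * K' + L) * SI.sn y" if y: "y \<in> AA" for y
  proof -
    have e: "(a \<otimes> a' + x) * y = (a \<otimes> 1) * ((1 \<otimes> a') * y) + x * y"
      by (simp add: distrib_right elem_tensor_mult flip: mult.assoc)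
    have "SI.sn ((a \<otimes> a' + x) * y) \<le> SI.sn ((a \<otimes> 1) * ((1 \<otimes> a') * y)) + SI.sn (x * y)"
      unfolding e by (intro SI.sn_triangle mult aa y add)
    also have "SI.sn ((a \<otimes> 1) * ((1 \<otimes> a') * y)) \<le> K * SI.sn ((1 \<otimes> a') * y)" by (intro K mult aa y)
    also have "\<dots> \<le> K * (K' * SI.sn y)" using K(1) by (intro mult_left_mono K' y) auto
    finally show ?thesis using L(2)[OF y] by (simp add: distrib_right mult.assoc)
  qed
  then show ?case using K(1) K'(1) L(1) by (intro exI[of _ "K * K' + L"]) auto
qed

lemma cyclic_representation_exists:
  "\<exists>R :: (('g bop, 'g bop) tensor \<Rightarrow> complex) hspace \<times> _ \<times> _. cyclic_representation AA \<omega> R"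
proof (rule gns_representation[OF state])
  fix x assume x: "x \<in> AA"
  obtain K where K: "K \<ge> 0" "\<And>y. y \<in> AA \<Longrightarrow> SI.sn (x * y) \<le> K * SI.sn y"
    using left_mult_sn_bounded[OF x] by blast
  have "Re (\<omega> (star (x * y) * (x * y))) \<le> K\<^sup>2 * Re (\<omega> (star y * y))" if y: "y \<in> AA" for y
  proof -
    have "(SI.sn (x * y))\<^sup>2 \<le> (K * SI.sn y)\<^sup>2" by (intro power_mono K y SI.sn_nonneg mult x)
    then show ?thesis
      using SI.b_pos[OF y] SI.b_pos[OF mult[OF x y]]
      by (simp add: SI.sn_def power_mult_distrib complex_nonneg_Reals_iff)
  qed
  then show "\<exists>K. \<forall>y\<in>AA. Re (\<omega> (star (x * y) * (x * y))) \<le> K * Re (\<omega> (star y * y))" by blast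
qed

end

section \<open>Isometries into Hilbert spaces with explicit carrier\<close>

locale hilbert =
  fixes H :: "'h hspace"
  assumes hs: "hilbert_space H"
begin

abbreviation "C \<equiv> hcarrier H"
abbreviation "ip \<equiv> hinner H"

lemmas carrier_zero = hs[unfolded hilbert_space_def, THEN conjunct1, rule_format]
lemmas carrier_add = hs[unfolded hilbert_space_def, THEN conjunct2, THEN conjunct1, rule_format]
lemmas carrier_scale = hs[unfolded hilbert_space_def, THEN conjunct2, THEN conjunct2, THEN conjunct1, rule_format]
lemmas hadd_assoc = hs[unfolded hilbert_space_def, THEN conjunct2, THEN conjunct2, THEN conjunct2, THEN conjunct1, rule_format]
lemmas hadd_commute = hs[unfolded hilbert_space_def, THEN conjunct2, THEN conjunct2, THEN conjunct2, THEN conjunct2, THEN conjunct1, rule_format]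
lemmas hadd_zero = hs[unfolded hilbert_space_def, THEN conjunct2, THEN conjunct2, THEN conjunct2, THEN conjunct2, THEN conjunct2, THEN conjunct1, rule_format]
lemmas hdiff_self = hs[unfolded hilbert_space_def, THEN conjunct2, THEN conjunct2, THEN conjunct2, THEN conjunct2, THEN conjunct2, THEN conjunct2, THEN conjunct1, rule_format]
lemmas ip_add = hs[unfolded hilbert_space_def, THEN conjunct2, THEN conjunct2, THEN conjunct2, THEN conjunct2, THEN conjunct2, THEN conjunct2, THEN conjunct2, THEN conjunct2, THEN conjunct2, THEN conjunct2, THEN conjunct2, THEN conjunct1, rule_format]
lemmas ip_scale = hs[unfolded hilbert_space_def, THEN conjunct2, THEN conjunct2, THEN conjunct2, THEN conjunct2, THEN conjunct2, THEN conjunct2, THEN conjunct2, THEN conjunct2, THEN conjunct2, THEN conjunct2, THEN conjunct2, THEN conjunct2, THEN conjunct1, rule_format]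
lemmas ip_commute = hs[unfolded hilbert_space_def, THEN conjunct2, THEN conjunct2, THEN conjunct2, THEN conjunct2, THEN conjunct2, THEN conjunct2, THEN conjunct2, THEN conjunct2, THEN conjunct2, THEN conjunct2, THEN conjunct2, THEN conjunct2, THEN conjunct2, THEN conjunct1, rule_format]
lemmas ip_pos = hs[unfolded hilbert_space_def, THEN conjunct2, THEN conjunct2, THEN conjunct2, THEN conjunct2, THEN conjunct2, THEN conjunct2, THEN conjunct2, THEN conjunct2, THEN conjunct2, THEN conjunct2, THEN conjunct2, THEN conjunct2, THEN conjunct2, THEN conjunct2, THEN conjunct1, rule_format]
lemmas ip_definite = hs[unfolded hilbert_space_def, THEN conjunct2, THEN conjunct2, THEN conjunct2, THEN conjunct2, THEN conjunct2, THEN conjunct2, THEN conjunct2, THEN conjunct2, THEN conjunct2, THEN conjunct2, THEN conjunct2, THEN conjunct2, THEN conjunct2, THEN conjunct2, THEN conjunct2, THEN conjunct1, rule_format]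
lemmas carrier = carrier_zero carrier_add carrier_scale

lemma complete:
  "(\<And>n::nat. X n \<in> C) \<Longrightarrow> (\<And>e. e > 0 \<Longrightarrow> \<exists>N. \<forall>m\<ge>N. \<forall>n\<ge>N. hnorm H (hdiff H (X m) (X n)) < e)
    \<Longrightarrow> \<exists>x\<in>C. (\<lambda>n. hnorm H (hdiff H (X n) x)) \<longlonglongrightarrow> 0"
proof -
  assume X: "\<And>n. X n \<in> C" "\<And>e. e > 0 \<Longrightarrow> \<exists>N. \<forall>m\<ge>N. \<forall>n\<ge>N. hnorm H (hdiff H (X m) (X n)) < e"
  have "\<forall>X :: nat \<Rightarrow> 'h. range X \<subseteq> C \<and>
      (\<forall>e>0. \<exists>N. \<forall>m\<ge>N. \<forall>n\<ge>N. hnorm H (hdiff H (X m) (X n)) < e)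
      \<longrightarrow> (\<exists>x\<in>C. (\<lambda>n. hnorm H (hdiff H (X n) x)) \<longlonglongrightarrow> 0)"
    using hs unfolding hilbert_space_def by (elim conjE)
  then show ?thesis using X by blast
qed

lemma hdiff_carrier: "x \<in> C \<Longrightarrow> y \<in> C \<Longrightarrow> hdiff H x y \<in> C"
  unfolding hdiff_def by (intro carrier)

lemma ip_diff: "x \<in> C \<Longrightarrow> y \<in> C \<Longrightarrow> z \<in> C \<Longrightarrow> ip x (hdiff H y z) = ip x y - ip x z"
  unfolding hdiff_def by (simp add: ip_add ip_scale carrier)

lemma ip_add_left: "x \<in> C \<Longrightarrow> y \<in> C \<Longrightarrow> z \<in> C \<Longrightarrow> ip (hadd H x y) z = ip x z + ip y z"
  using ip_commute[of "hadd H x y" z] ip_commute[of x z] ip_commute[of y z] by (simp add: ip_add carrier)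

lemma ip_scale_left: "x \<in> C \<Longrightarrow> y \<in> C \<Longrightarrow> ip (hscale H c x) y = cnj c * ip x y"
  using ip_commute[of "hscale H c x" y] ip_commute[of x y] by (simp add: ip_scale carrier)

lemma ip_diff_left: "x \<in> C \<Longrightarrow> y \<in> C \<Longrightarrow> z \<in> C \<Longrightarrow> ip (hdiff H x y) z = ip x z - ip y z"
  using ip_commute[of "hdiff H x y" z] ip_commute[of x z] ip_commute[of y z] by (simp add: ip_diff hdiff_carrier)

lemma ip_self: "x \<in> C \<Longrightarrow> ip x x = of_real ((hnorm H x)\<^sup>2)"
  using ip_pos[of x] by (simp add: hnorm_def complex_nonneg_Reals_iff complex_eq_iff)

lemma hnorm_nonneg: "x \<in> C \<Longrightarrow> 0 \<le> hnorm H x"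
  using ip_pos[of x] by (simp add: hnorm_def complex_nonneg_Reals_iff)

lemma ip_cauchy_schwarz:
  assumes x: "x \<in> C" and y: "y \<in> C"
  shows "cmod (ip x y) \<le> hnorm H x * hnorm H y"
proof -
  define z where "z = ip x y"
  have zc: "ip y x = cnj z" using ip_commute[OF y x] by (simp add: z_def)
  have quad: "0 \<le> (hnorm H x)\<^sup>2 - 2 * t * (cmod z)\<^sup>2 + t\<^sup>2 * (cmod z)\<^sup>2 * (hnorm H y)\<^sup>2" for t
  proof -
    define c where "c = - (of_real t * cnj z)"
    let ?v = "hadd H x (hscale H c y)"
    have m: "?v \<in> C" by (intro carrier x y)
    have "ip ?v ?v = ip x x + c * z + (cnj c * cnj z + cnj c * (c * ip y y))"
      using x y by (simp add: ip_add ip_add_left ip_scale ip_scale_left carrier zc z_def[symmetric] algebra_simps)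
    also have "\<dots> = of_real ((hnorm H x)\<^sup>2 - 2 * t * (cmod z)\<^sup>2 + t\<^sup>2 * (cmod z)\<^sup>2 * (hnorm H y)\<^sup>2)"
      unfolding ip_self[OF x] ip_self[OF y] c_def of_real_add of_real_diff of_real_mult
        complex_norm_square of_real_power[of t]
      by (simp add: power2_eq_square algebra_simps)
    finally show ?thesis using ip_pos[OF m] by (simp only: nonneg_Reals_of_real_iff)
  qed
  have "(cmod z)\<^sup>2 \<le> (hnorm H x)\<^sup>2 * (hnorm H y)\<^sup>2" by (rule discriminant_le[OF _ quad]) simp
  then have "(cmod z)\<^sup>2 \<le> (hnorm H x * hnorm H y)\<^sup>2" by (simp add: power_mult_distrib)
  then show ?thesis unfolding z_def by (rule power2_le_imp_le) (simp add: hnorm_nonneg x y)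
qed

lemma hnorm_diff_square:
  assumes "x \<in> C" "y \<in> C"
  shows "(hnorm H (hdiff H x y))\<^sup>2 = (hnorm H x)\<^sup>2 + (hnorm H y)\<^sup>2 - 2 * Re (ip x y)"
proof -
  have "complex_of_real ((hnorm H (hdiff H x y))\<^sup>2) = ip x x - ip x y - (ip y x - ip y y)"
    using assms by (simp add: ip_diff ip_diff_left hdiff_carrier del: of_real_power flip: ip_self)
  then have "Re (complex_of_real ((hnorm H (hdiff H x y))\<^sup>2)) = Re (ip x x - ip x y - (ip y x - ip y y))" by simp
  then show ?thesis using ip_commute[OF assms(2,1)] by (simp add: ip_self assms)
qed

lemma hdiff_eqI:
  assumes xy: "x \<in> C" "y \<in> C" and 0: "hnorm H (hdiff H x y) = 0"
  shows "x = y"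
proof -
  have "hdiff H x y = hzero H" using 0 by (intro ip_definite) (simp_all add: ip_self hdiff_carrier xy)
  then have "y = hadd H (hdiff H x y) y" by (simp add: hadd_zero xy)
  also have "\<dots> = hadd H x (hadd H (hscale H (- 1) y) y)"
    unfolding hdiff_def by (rule hadd_assoc) (intro carrier xy)+
  also have "hadd H (hscale H (- 1) y) y = hdiff H y y" unfolding hdiff_def by (rule hadd_commute) (intro carrier xy)+
  also have "hadd H x (hdiff H y y) = hadd H (hzero H) x"
    using xy by (simp add: hdiff_self hadd_commute[of x] carrier)
  finally show ?thesis by (simp add: hadd_zero xy)
qed

lemma ip_tendsto:
  assumes X: "\<And>n::nat. X n \<in> C" "x \<in> C" "(\<lambda>n. hnorm H (hdiff H (X n) x)) \<longlonglongrightarrow> 0"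
    and Y: "\<And>n. Y n \<in> C" "y \<in> C" "(\<lambda>n. hnorm H (hdiff H (Y n) y)) \<longlonglongrightarrow> 0"
  shows "(\<lambda>n. ip (X n) (Y n)) \<longlonglongrightarrow> ip x y"
proof -
  let ?d = "\<lambda>n. hnorm H (hdiff H (X n) x)" let ?e = "\<lambda>n. hnorm H (hdiff H (Y n) y)"
  have "cmod (ip (X n) (Y n) - ip x y) \<le> ?d n * ?e n + ?d n * hnorm H y + hnorm H x * ?e n" for n
  proof -
    have "ip (X n) (Y n) - ip x y = ip (hdiff H (X n) x) (hdiff H (Y n) y) + ip (hdiff H (X n) x) y + ip x (hdiff H (Y n) y)"
      using X(1,2) Y(1,2) by (simp add: ip_diff ip_diff_left hdiff_carrier)
    also have "cmod \<dots> \<le> cmod (ip (hdiff H (X n) x) (hdiff H (Y n) y)) + cmod (ip (hdiff H (X n) x) y) + cmod (ip x (hdiff H (Y n) y))"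
      by (intro order_trans[OF norm_triangle_ineq] add_right_mono norm_triangle_ineq)
    also have "\<dots> \<le> ?d n * ?e n + ?d n * hnorm H y + hnorm H x * ?e n"
      by (intro add_mono ip_cauchy_schwarz hdiff_carrier X Y)
    finally show ?thesis .
  qed
  then have "\<forall>\<^sub>F n in sequentially. cmod (ip (X n) (Y n) - ip x y) \<le> ?d n * ?e n + ?d n * hnorm H y + hnorm H x * ?e n"
    by (rule always_eventually[OF allI])
  moreover have "(\<lambda>n. ?d n * ?e n + ?d n * hnorm H y + hnorm H x * ?e n) \<longlonglongrightarrow> 0 * 0 + 0 * hnorm H y + hnorm H x * 0"
    by (intro tendsto_intros X Y)
  then have "(\<lambda>n. ?d n * ?e n + ?d n * hnorm H y + hnorm H x * ?e n) \<longlonglongrightarrow> 0" by simp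
  ultimately have "(\<lambda>n. ip (X n) (Y n) - ip x y) \<longlonglongrightarrow> 0" by (rule Lim_null_comparison)
  then show ?thesis by (simp add: LIM_zero_iff)
qed

lemma isometry_ex1:
  fixes v :: "'i \<Rightarrow> 'g::chilbert_space" and T :: "'i \<Rightarrow> 'h"
  assumes T: "\<And>i. i \<in> D \<Longrightarrow> T i \<in> C"
    and gram: "\<And>i j. i \<in> D \<Longrightarrow> j \<in> D \<Longrightarrow> ip (T i) (T j) = cinner (v i) (v j)"
    and dense: "closure {v i |i. i \<in> D} = UNIV"
  shows "\<exists>!u. bij_betw u UNIV (hclosure H {T i |i. i \<in> D}) \<and>
    (\<forall>x y. u (x + y) = hadd H (u x) (u y)) \<and> (\<forall>c x. u (c *\<^sub>C x) = hscale H c (u x)) \<and>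
    (\<forall>x y. ip (u x) (u y) = cinner x y) \<and> (\<forall>i\<in>D. u (v i) = T i)"
proof -
  define L where "L x h \<longleftrightarrow> h \<in> C \<and> (\<exists>s::nat \<Rightarrow> 'i. (\<forall>n. s n \<in> D) \<and> (\<lambda>n. v (s n)) \<longlonglongrightarrow> x \<and>
    (\<lambda>n. hnorm H (hdiff H (T (s n)) h)) \<longlonglongrightarrow> 0)" for x h
  have normT: "hnorm H (hdiff H (T i) (T j)) = norm (v i - v j)" if "i \<in> D" "j \<in> D" for i j
  proof -
    have "complex_of_real ((hnorm H (hdiff H (T i) (T j)))\<^sup>2) = of_real ((norm (v i - v j))\<^sup>2)"
      using that T by (simp add: gram cinner_simps ip_diff ip_diff_left hdiff_carrier del: of_real_power
          flip: ip_self cinner_self)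
    then have "(hnorm H (hdiff H (T i) (T j)))\<^sup>2 = (norm (v i - v j))\<^sup>2" unfolding of_real_eq_iff .
    then show ?thesis using that by (simp add: power2_eq_iff_nonneg hnorm_nonneg hdiff_carrier T)
  qed
  have Lip: "ip h k = cinner x y" if hk: "L x h" "L y k" for x y h k
  proof -
    obtain s where s: "\<And>n. s n \<in> D" "(\<lambda>n. v (s n)) \<longlonglongrightarrow> x" "(\<lambda>n. hnorm H (hdiff H (T (s n)) h)) \<longlonglongrightarrow> 0"
      using hk(1) unfolding L_def by blast
    obtain r where r: "\<And>n. r n \<in> D" "(\<lambda>n. v (r n)) \<longlonglongrightarrow> y" "(\<lambda>n. hnorm H (hdiff H (T (r n)) k)) \<longlonglongrightarrow> 0"
      using hk(2) unfolding L_def by blast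
    have "(\<lambda>n. ip (T (s n)) (T (r n))) \<longlonglongrightarrow> ip h k"
      using hk by (intro ip_tendsto T s r) (auto simp: L_def)
    moreover have "(\<lambda>n. ip (T (s n)) (T (r n))) \<longlonglongrightarrow> cinner x y"
      using tendsto_cinner[OF s(2) r(2)] by (simp add: gram s(1) r(1))
    ultimately show ?thesis by (rule LIMSEQ_unique)
  qed
  have LC: "h \<in> C" if "L x h" for x h using that by (simp add: L_def)
  have norm_diff: "hnorm H (hdiff H h k) = norm (x - y)" if "L x h" "L y k" for x y h k
  proof -
    have "complex_of_real ((hnorm H (hdiff H h k))\<^sup>2) = of_real ((norm (x - y))\<^sup>2)"
      using that LC by (simp add: Lip cinner_simps ip_diff ip_diff_left hdiff_carrier del: of_real_power
          flip: ip_self cinner_self)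
    then have "(hnorm H (hdiff H h k))\<^sup>2 = (norm (x - y))\<^sup>2" unfolding of_real_eq_iff .
    then show ?thesis using that by (simp add: power2_eq_iff_nonneg hnorm_nonneg hdiff_carrier LC)
  qed
  have Luniq: "h = k" if "L x h" "L x k" for x h k
    using norm_diff[OF that] LC that by (intro hdiff_eqI) auto
  have cauchyD: "\<exists>N. \<forall>m\<ge>N. \<forall>n\<ge>N. norm (v (s m) - v (s n)) < e" if "(\<lambda>n. v (s n)) \<longlonglongrightarrow> x" "e > 0" for s :: "nat \<Rightarrow> 'i" and x e
    using CauchyD[OF LIMSEQ_imp_Cauchy[OF that(1)] that(2)] .
  have Lex: "\<exists>h. L x h" for x
  proof -
    obtain Y where Y: "\<And>n::nat. Y n \<in> {v i |i. i \<in> D}" "Y \<longlonglongrightarrow> x" using dense_sequence[OF dense] by blast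
    have "\<exists>i. i \<in> D \<and> Y n = v i" for n using Y(1)[of n] by blast
    then obtain s where s: "\<And>n. s n \<in> D" "\<And>n. Y n = v (s n)" by metis
    have l: "(\<lambda>n. v (s n)) \<longlonglongrightarrow> x" using Y(2) by (simp flip: s(2))
    have "\<exists>h\<in>C. (\<lambda>n. hnorm H (hdiff H (T (s n)) h)) \<longlonglongrightarrow> 0"
      by (rule complete) (use T s(1) cauchyD[OF l] in \<open>auto simp: normT\<close>)
    then show ?thesis unfolding L_def using s(1) l by blast
  qed
  have LT: "L (v i) (T i)" if "i \<in> D" for i
    unfolding L_def using that T
    by (intro conjI exI[of _ "\<lambda>n. i"]) (auto simp: normT)
  obtain u where u: "\<And>x. L x (u x)" using Lex by metis
  have uC: "u x \<in> C" for x using u LC by blast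
  have inner: "ip (u x) (u y) = cinner x y" for x y by (rule Lip[OF u u])
  have add: "u (x + y) = hadd H (u x) (u y)" for x y
  proof (rule hdiff_eqI)
    let ?d = "hdiff H (u (x + y)) (hadd H (u x) (u y))"
    have "ip ?d ?d = 0"
      by (simp add: ip_diff ip_diff_left ip_add ip_add_left inner uC carrier hdiff_carrier cinner_simps)
    then show "hnorm H ?d = 0" by (simp add: hnorm_def)
  qed (intro uC carrier)+
  have scale: "u (c *\<^sub>C x) = hscale H c (u x)" for c x
  proof (rule hdiff_eqI)
    let ?d = "hdiff H (u (c *\<^sub>C x)) (hscale H c (u x))"
    have "ip ?d ?d = 0"
      by (simp add: ip_diff ip_diff_left ip_scale ip_scale_left inner uC carrier hdiff_carrier cinner_simps)
    then show "hnorm H ?d = 0" by (simp add: hnorm_def)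
  qed (intro uC carrier)+
  have uT: "u (v i) = T i" if "i \<in> D" for i by (rule Luniq[OF u LT[OF that]])
  have range: "range u = hclosure H {T i |i. i \<in> D}"
  proof
    show "range u \<subseteq> hclosure H {T i |i. i \<in> D}"
    proof
      fix h assume "h \<in> range u"
      then obtain x where h: "h = u x" by blast
      have "\<exists>y\<in>{T i |i. i \<in> D}. hnorm H (hdiff H h y) < e" if e: "e > 0" for e
      proof -
        obtain Y where Y: "\<And>n::nat. Y n \<in> {v i |i. i \<in> D}" "Y \<longlonglongrightarrow> x" using dense_sequence[OF dense] by blast
        obtain n where n: "norm (Y n - x) < e" using LIMSEQ_D[OF Y(2) e] by blast
        obtain i where i: "i \<in> D" "Y n = v i" using Y(1)[of n] by blast
        have "hnorm H (hdiff H h (T i)) < e"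
          using norm_diff[OF u LT[OF i(1)], of x] n i(2) by (simp add: h norm_minus_commute)
        then show ?thesis using i(1) by blast
      qed
      then show "h \<in> hclosure H {T i |i. i \<in> D}" unfolding hclosure_def using h uC by blast
    qed
    show "hclosure H {T i |i. i \<in> D} \<subseteq> range u"
    proof
      fix h assume h: "h \<in> hclosure H {T i |i. i \<in> D}"
      then have hC: "h \<in> C" by (simp add: hclosure_def)
      have "\<exists>i. i \<in> D \<and> hnorm H (hdiff H h (T i)) < inverse (real (Suc n))" for n
      proof -
        have "inverse (real (Suc n)) > 0" by simp
        then obtain y where "y \<in> {T i |i. i \<in> D}" "hnorm H (hdiff H h y) < inverse (real (Suc n))"
          using h unfolding hclosure_def by blast
        then show ?thesis by blast
      qed
      then obtain s where s: "\<And>n. s n \<in> D" "\<And>n. hnorm H (hdiff H h (T (s n))) < inverse (real (Suc n))" by metis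
      have sym: "hnorm H (hdiff H (T (s n)) h) = hnorm H (hdiff H h (T (s n)))" for n
      proof -
        have "(hnorm H (hdiff H (T (s n)) h))\<^sup>2 = (hnorm H (hdiff H h (T (s n))))\<^sup>2"
          using ip_commute[OF hC T[OF s(1)], of n] by (simp add: hnorm_diff_square hC T s(1))
        then show ?thesis by (simp add: power2_eq_iff_nonneg hnorm_nonneg hdiff_carrier hC T s(1))
      qed
      have lim: "(\<lambda>n. hnorm H (hdiff H (T (s n)) h)) \<longlonglongrightarrow> 0"
      proof (rule tendsto_sandwich[OF _ _ tendsto_const LIMSEQ_inverse_real_of_nat])
        show "\<forall>\<^sub>F n in sequentially. 0 \<le> hnorm H (hdiff H (T (s n)) h)"
          by (intro always_eventually allI hnorm_nonneg hdiff_carrier T s hC)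
        show "\<forall>\<^sub>F n in sequentially. hnorm H (hdiff H (T (s n)) h) \<le> inverse (real (Suc n))"
          unfolding sym using s(2) less_imp_le by (intro always_eventually allI) blast
      qed
      have "Cauchy (\<lambda>n. v (s n))"
      proof (rule CauchyI)
        fix e :: real assume "e > 0"
        then have e: "e / 2 > 0" by simp
        obtain N where N': "\<And>n. n \<ge> N \<Longrightarrow> norm (hnorm H (hdiff H (T (s n)) h) - 0) < e / 2"
          using LIMSEQ_D[OF lim e] by blast
        have N: "hnorm H (hdiff H (T (s n)) h) < e / 2" if "n \<ge> N" for n using N'[OF that] by simp
        have "norm (v (s m) - v (s n)) < e" if "m \<ge> N" "n \<ge> N" for m n
        proof (cases "v (s m) - v (s n) = 0")
          case True
          then show ?thesis using \<open>e > 0\<close> by simp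
        next
          case False
          let ?a = "T (s m)" let ?b = "T (s n)" let ?d = "hdiff H ?a ?b"
          have C: "?a \<in> C" "?b \<in> C" "?d \<in> C" by (intro T s hdiff_carrier)+
          have "complex_of_real ((hnorm H ?d)\<^sup>2) = ip ?d (hdiff H ?a h) - ip ?d (hdiff H ?b h)"
            using C hC by (simp add: ip_diff del: of_real_power flip: ip_self)
          then have "(hnorm H ?d)\<^sup>2 = cmod (ip ?d (hdiff H ?a h) - ip ?d (hdiff H ?b h))"
            by (metis abs_of_nonneg norm_of_real zero_le_power2)
          also have "\<dots> \<le> hnorm H ?d * hnorm H (hdiff H ?a h) + hnorm H ?d * hnorm H (hdiff H ?b h)"
            using C hC by (intro order_trans[OF norm_triangle_ineq4] add_mono ip_cauchy_schwarz hdiff_carrier)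
          finally have "hnorm H ?d * hnorm H ?d \<le> hnorm H ?d * (hnorm H (hdiff H ?a h) + hnorm H (hdiff H ?b h))"
            by (simp add: power2_eq_square distrib_left)
          moreover have "hnorm H ?d = norm (v (s m) - v (s n))" by (rule normT[OF s(1) s(1)])
          ultimately have "norm (v (s m) - v (s n)) \<le> hnorm H (hdiff H ?a h) + hnorm H (hdiff H ?b h)"
            using False by simp
          then show ?thesis using N[OF that(1)] N[OF that(2)] by simp
        qed
        then show "\<exists>M. \<forall>m\<ge>M. \<forall>n\<ge>M. norm (v (s m) - v (s n)) < e" by blast
      qed
      then obtain x where x: "(\<lambda>n. v (s n)) \<longlonglongrightarrow> x" using Cauchy_convergent convergent_def by blast
      have "L x h" unfolding L_def using hC s(1) x lim by blast
      then have "h = u x" using Luniq u by blast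
      then show "h \<in> range u" by blast
    qed
  qed
  have inj: "inj u"
  proof (rule injI)
    fix x y assume "u x = u y"
    then have "cinner x z = cinner y z" for z using inner[of x z] inner[of y z] by simp
    then show "x = y" by (rule cinner_ext)
  qed
  show ?thesis
  proof (rule ex1I[of _ u])
    show "bij_betw u UNIV (hclosure H {T i |i. i \<in> D}) \<and>
      (\<forall>x y. u (x + y) = hadd H (u x) (u y)) \<and> (\<forall>c x. u (c *\<^sub>C x) = hscale H c (u x)) \<and>
      (\<forall>x y. ip (u x) (u y) = cinner x y) \<and> (\<forall>i\<in>D. u (v i) = T i)"
      using inj range add scale inner uT by (simp add: bij_betw_def)
  next
    fix w
    assume w: "bij_betw w UNIV (hclosure H {T i |i. i \<in> D}) \<and>
      (\<forall>x y. w (x + y) = hadd H (w x) (w y)) \<and> (\<forall>c x. w (c *\<^sub>C x) = hscale H c (w x)) \<and>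
      (\<forall>x y. ip (w x) (w y) = cinner x y) \<and> (\<forall>i\<in>D. w (v i) = T i)"
    have wC: "w x \<in> C" for x
    proof -
      have "w x \<in> hclosure H {T i |i. i \<in> D}" using w bij_betwE by blast
      then show ?thesis by (simp add: hclosure_def)
    qed
    show "w = u"
    proof
      fix x
      obtain Y where Y: "\<And>n::nat. Y n \<in> {v i |i. i \<in> D}" "Y \<longlonglongrightarrow> x" using dense_sequence[OF dense] by blast
      have "\<exists>i. i \<in> D \<and> Y n = v i" for n using Y(1)[of n] by blast
      then obtain s where s: "\<And>n. s n \<in> D" "\<And>n. Y n = v (s n)" by metis
      have "hnorm H (hdiff H (T (s n)) (w x)) = norm (Y n - x)" for n
      proof -
        have Tw: "T (s n) = w (Y n)" using w s by simp
        have "complex_of_real ((hnorm H (hdiff H (w (Y n)) (w x)))\<^sup>2) = of_real ((norm (Y n - x))\<^sup>2)"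
          using w wC by (simp add: cinner_simps ip_diff ip_diff_left hdiff_carrier del: of_real_power
              flip: ip_self cinner_self)
        then have "(hnorm H (hdiff H (w (Y n)) (w x)))\<^sup>2 = (norm (Y n - x))\<^sup>2" unfolding of_real_eq_iff .
        then show ?thesis unfolding Tw by (simp add: power2_eq_iff_nonneg hnorm_nonneg hdiff_carrier wC)
      qed
      moreover have "(\<lambda>n. norm (Y n - x)) \<longlonglongrightarrow> 0" using Y(2) by (simp add: LIM_zero_iff tendsto_norm_zero_iff)
      moreover have "(\<lambda>n. v (s n)) \<longlonglongrightarrow> x" using Y(2) by (simp flip: s(2))
      ultimately have "L x (w x)"
        unfolding L_def using wC s(1) by (intro conjI exI[of _ s]) simp_all
      then show "w x = u x" using Luniq u by blast
    qed
  qed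
qed

end

section \<open>The cost of a coupling\<close>

context coupling
begin

lemma cost_in_eq:
  assumes R: "cyclic_representation AA \<omega> (H, \<pi>, \<Omega>)"
    and V: "\<And>a a'. a \<in> A \<Longrightarrow> a' \<in> A' \<Longrightarrow> cinner (V \<cdot> a \<cdot> \<Lambda>1) (a' \<cdot> \<Lambda>2) = \<omega> (star a \<otimes> a')"
    and k: "\<And>l. l \<in> {1..n} \<Longrightarrow> k l \<in> A"
  shows "cost_in A \<Lambda>2 n k (H, \<pi>, \<Omega>) = (\<Sum>l = 1..n. (norm (k l \<cdot> \<Lambda>1))\<^sup>2 + (norm (k l \<cdot> \<Lambda>2))\<^sup>2
    - 2 * Re (cinner (V \<cdot> k l \<cdot> \<Lambda>1) (k l \<cdot> \<Lambda>2)))"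
proof -
  have hs: "hilbert_space H" and rep: "representation AA H \<pi>" and \<Omega>: "\<Omega> \<in> hcarrier H"
    and \<omega>: "\<And>x. x \<in> AA \<Longrightarrow> \<omega> x = hinner H \<Omega> (\<pi> x \<Omega>)"
    using R unfolding cyclic_representation_def by auto
  interpret hilbert H by standard (rule hs)
  have \<pi>C: "\<pi> x h \<in> C" if "x \<in> AA" "h \<in> C" for x h
    using rep that unfolding representation_def bounded_hop_def by blast
  have \<pi>mult: "\<pi> (x * y) h = \<pi> x (\<pi> y h)" if "x \<in> AA" "y \<in> AA" "h \<in> C" for x y h
    using rep that unfolding representation_def by blast
  have \<pi>one: "\<pi> 1 h = h" if "h \<in> C" for h
    using rep that unfolding representation_def by blast
  have \<pi>star: "ip (\<pi> (star x) g) h = ip g (\<pi> x h)" if "x \<in> AA" "g \<in> C" "h \<in> C" for x g h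
    using rep that unfolding representation_def by blast
  have gram: "ip (\<pi> x \<Omega>) (\<pi> y \<Omega>) = \<omega> (star x * y)" if "x \<in> AA" "y \<in> AA" for x y
    using \<pi>star[OF star[OF that(1)] \<Omega> \<pi>C[OF that(2) \<Omega>]] that \<Omega>
    by (simp add: star_star \<omega> \<pi>mult mult star)
  define T where "T a' = \<pi> (1 \<otimes> a') \<Omega>" for a'
  have m: "a \<otimes> 1 \<in> AA" if "a \<in> A" for a by (intro tensor_product_elem that A'_closed)
  have m': "1 \<otimes> a' \<in> AA" if "a' \<in> A'" for a' by (intro tensor_product_elem that A_closed)
  have TC: "T a' \<in> C" if "a' \<in> A'" for a' unfolding T_def by (intro \<pi>C m' that \<Omega>)
  have gramT: "ip (T a') (T b') = cinner (a' \<cdot> \<Lambda>2) (b' \<cdot> \<Lambda>2)" if "a' \<in> A'" "b' \<in> A'" for a' b'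
    using that right[OF A'_closed(5)[OF A'_closed(7)[OF that(1)] that(2)]]
    by (simp add: T_def gram m' star_elem_tensor elem_tensor_mult bop_mult_apply cinner_star_right)
  define u where "u = right_unitary A \<Lambda>2 (H, \<pi>, \<Omega>)"
  let ?K = "right_subspace A (H, \<pi>, \<Omega>)"
  have K: "?K = hclosure H {T a' |a'. a' \<in> A'}" by (simp add: right_subspace_def T_def)
  have "bij_betw u UNIV ?K \<and> (\<forall>x y. u (x + y) = hadd H (u x) (u y)) \<and> (\<forall>c x. u (c *\<^sub>C x) = hscale H c (u x)) \<and>
    (\<forall>x y. ip (u x) (u y) = cinner x y) \<and> (\<forall>a'\<in>A'. u (a' \<cdot> \<Lambda>2) = T a')"
    unfolding u_def right_unitary_def prod.case K T_def[symmetric]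
    by (rule theI'[OF isometry_ex1[where D = A' and v = "\<lambda>a'. a' \<cdot> \<Lambda>2", OF TC gramT dense2]])
  then have u: "bij_betw u UNIV ?K" "\<And>x y. ip (u x) (u y) = cinner x y" "\<And>a'. a' \<in> A' \<Longrightarrow> u (a' \<cdot> \<Lambda>2) = T a'"
    by auto
  have uC: "u x \<in> C" for x
  proof -
    have "u x \<in> ?K" using u(1) bij_betwE by blast
    then show ?thesis by (simp add: K hclosure_def)
  qed
  have u\<Lambda>: "u \<Lambda>2 = \<Omega>"
    using u(3)[OF A'_closed(1)] by (simp add: T_def elem_tensor_one \<pi>one \<Omega> bop_simps)
  have \<Omega>K: "\<Omega> \<in> ?K" using u(1) u\<Lambda> bij_betwE by blast
  have inv: "inv u \<Omega> = \<Lambda>2" using bij_betw_imp_inj_on[OF u(1)] u\<Lambda> inv_f_f by metis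
  have rr: "right_rep A \<Lambda>2 (H, \<pi>, \<Omega>) b \<Omega> = u (b \<cdot> \<Lambda>2)" for b
    unfolding right_rep_def u_def[symmetric] using \<Omega>K by (simp add: inv)
  have \<Omega>L: "\<Omega> \<in> left_subspace A (H, \<pi>, \<Omega>)"
  proof -
    have "\<Omega> \<in> {\<pi> (a \<otimes> 1) \<Omega> |a. a \<in> A}" using A_closed(1) by (auto simp: elem_tensor_one \<pi>one \<Omega> intro!: exI[of _ 1])
    moreover have "hnorm H (hdiff H \<Omega> \<Omega>) = 0"
      using hnorm_diff_square[OF \<Omega> \<Omega>] by (simp add: ip_self \<Omega>)
    ultimately show ?thesis unfolding left_subspace_def prod.case hclosure_def using \<Omega> by force
  qed
  have lr: "left_rep A (H, \<pi>, \<Omega>) a \<Omega> = \<pi> (a \<otimes> 1) \<Omega>" for a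
    unfolding left_rep_def prod.case using \<Omega>L by simp
  have cross: "ip (\<pi> (a \<otimes> 1) \<Omega>) (u x) = cinner (V \<cdot> a \<cdot> \<Lambda>1) x" if a: "a \<in> A" for a x
  proof -
    obtain Y where Y: "\<And>n::nat. Y n \<in> {a' \<cdot> \<Lambda>2 |a'. a' \<in> A'}" "Y \<longlonglongrightarrow> x" using dense_sequence[OF dense2] by blast
    have on: "ip (\<pi> (a \<otimes> 1) \<Omega>) (u (Y n)) = cinner (V \<cdot> a \<cdot> \<Lambda>1) (Y n)" for n
    proof -
      obtain a' where a': "a' \<in> A'" "Y n = a' \<cdot> \<Lambda>2" using Y(1)[of n] by blast
      show ?thesis using a a' by (simp add: u(3) T_def gram m m' V star_elem_tensor elem_tensor_mult)
    qed
    have "hnorm H (hdiff H (u (Y n)) (u x)) = norm (Y n - x)" for n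
    proof -
      have "complex_of_real ((hnorm H (hdiff H (u (Y n)) (u x)))\<^sup>2) = of_real ((norm (Y n - x))\<^sup>2)"
        by (simp add: u(2) uC cinner_simps ip_diff ip_diff_left hdiff_carrier del: of_real_power
            flip: ip_self cinner_self)
      then have "(hnorm H (hdiff H (u (Y n)) (u x)))\<^sup>2 = (norm (Y n - x))\<^sup>2" unfolding of_real_eq_iff .
      then show ?thesis by (simp add: power2_eq_iff_nonneg hnorm_nonneg hdiff_carrier uC)
    qed
    then have "(\<lambda>n. hnorm H (hdiff H (u (Y n)) (u x))) \<longlonglongrightarrow> 0"
      using Y(2) by (simp add: LIM_zero_iff tendsto_norm_zero_iff)
    moreover have "hnorm H (hdiff H (\<pi> (a \<otimes> 1) \<Omega>) (\<pi> (a \<otimes> 1) \<Omega>)) = 0"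
      using hnorm_diff_square[OF \<pi>C[OF m[OF a] \<Omega>] \<pi>C[OF m[OF a] \<Omega>]] by (simp add: ip_self \<pi>C m a \<Omega>)
    ultimately have "(\<lambda>n. ip (\<pi> (a \<otimes> 1) \<Omega>) (u (Y n))) \<longlonglongrightarrow> ip (\<pi> (a \<otimes> 1) \<Omega>) (u x)"
      by (intro ip_tendsto uC \<pi>C m a \<Omega>) auto
    moreover have "(\<lambda>n. ip (\<pi> (a \<otimes> 1) \<Omega>) (u (Y n))) \<longlonglongrightarrow> cinner (V \<cdot> a \<cdot> \<Lambda>1) x"
      unfolding on by (intro tendsto_cinner tendsto_const Y)
    ultimately show ?thesis by (rule LIMSEQ_unique)
  qed
  have nl: "(hnorm H (\<pi> (a \<otimes> 1) \<Omega>))\<^sup>2 = (norm (a \<cdot> \<Lambda>1))\<^sup>2" if a: "a \<in> A" for a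
  proof -
    have "complex_of_real ((hnorm H (\<pi> (a \<otimes> 1) \<Omega>))\<^sup>2) = of_real ((norm (a \<cdot> \<Lambda>1))\<^sup>2)"
      using left[OF A_closed(5)[OF A_closed(7)[OF a] a]] a
      by (simp add: gram m \<pi>C \<Omega> star_elem_tensor elem_tensor_mult bop_mult_apply cinner_star_right
          del: of_real_power flip: ip_self cinner_self)
    then show ?thesis unfolding of_real_eq_iff .
  qed
  have nr: "(hnorm H (u x))\<^sup>2 = (norm x)\<^sup>2" for x
  proof -
    have "complex_of_real ((hnorm H (u x))\<^sup>2) = of_real ((norm x)\<^sup>2)"
      by (simp add: u(2) uC del: of_real_power flip: ip_self cinner_self)
    then show ?thesis unfolding of_real_eq_iff .
  qed
  show ?thesis
    unfolding cost_in_def prod.case lr rr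
    by (intro sum.cong refl) (simp add: hnorm_diff_square \<pi>C uC m k \<Omega> nl nr cross)
qed

lemma transport_cost_eq:
  assumes V: "\<And>a a'. a \<in> A \<Longrightarrow> a' \<in> A' \<Longrightarrow> cinner (V \<cdot> a \<cdot> \<Lambda>1) (a' \<cdot> \<Lambda>2) = \<omega> (star a \<otimes> a')"
    and k: "\<And>l. l \<in> {1..n} \<Longrightarrow> k l \<in> A"
  shows "transport_cost A \<Lambda>2 n k \<omega> = (\<Sum>l = 1..n. (norm (k l \<cdot> \<Lambda>1))\<^sup>2 + (norm (k l \<cdot> \<Lambda>2))\<^sup>2
    - 2 * Re (cinner (V \<cdot> k l \<cdot> \<Lambda>1) (k l \<cdot> \<Lambda>2)))"
proof -
  define R :: "(('g bop, 'g bop) tensor \<Rightarrow> complex) hspace \<times> _ \<times> _"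
    where "R = (SOME R. cyclic_representation AA \<omega> R)"
  have R: "cyclic_representation AA \<omega> R" unfolding R_def by (rule someI_ex[OF cyclic_representation_exists])
  obtain H \<pi> \<Omega> where e: "R = (H, \<pi>, \<Omega>)" by (cases R)
  show ?thesis
    unfolding transport_cost_def R_def[symmetric] e by (rule cost_in_eq[OF R[unfolded e] V k])
qed

end

section \<open>Reversal of modular couplings\<close>

text \<open>\<open>S\<close> is not only contained in but equal to the adjoint of \<open>a' \<Lambda> \<mapsto> a'\<^sup>* \<Lambda>\<close>.\<close>

lemma (in modular_data) S_adjointI:
  assumes *: "\<And>a'. a' \<in> commutant A \<Longrightarrow> cinner w (a' \<cdot> \<Lambda>) = cinner (star a' \<cdot> \<Lambda>) x"
  shows "(x, w) \<in> S"
proof -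
  have 1: "cinner y (J w) = cinner (J x) v" if yv: "(y, v) \<in> S" for y v
  proof -
    obtain a where a: "\<And>n::nat. a n \<in> A" "(\<lambda>n. a n \<cdot> \<Lambda>) \<longlonglongrightarrow> y" "(\<lambda>n. star (a n) \<cdot> \<Lambda>) \<longlonglongrightarrow> v"
      using S_approx[OF yv] by blast
    have "cinner (a n \<cdot> \<Lambda>) (J w) = cinner (J x) (star (a n) \<cdot> \<Lambda>)" for n
    proof -
      have "cinner (a n \<cdot> \<Lambda>) (J w) = cinner w (conj (a n) \<cdot> \<Lambda>)"
        by (simp add: conj_apply J_\<Lambda> J_swap_right)
      also have "\<dots> = cinner (star (conj (a n)) \<cdot> \<Lambda>) x" by (rule *[OF conj_commutant[OF a(1)]])
      also have "\<dots> = cinner (J x) (star (a n) \<cdot> \<Lambda>)"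
        by (simp add: conj_apply J_\<Lambda> J_swap flip: conj_star)
      finally show ?thesis .
    qed
    moreover have "(\<lambda>n. cinner (a n \<cdot> \<Lambda>) (J w)) \<longlonglongrightarrow> cinner y (J w)"
      "(\<lambda>n. cinner (J x) (star (a n) \<cdot> \<Lambda>)) \<longlonglongrightarrow> cinner (J x) v"
      by (intro tendsto_cinner tendsto_const a)+
    ultimately show ?thesis using LIMSEQ_unique by simp
  qed
  have H: "HL L \<cdot> x = EL L \<cdot> J w" for L
  proof (rule cinner_ext_right)
    fix z
    have "cinner (EL L \<cdot> z) (J w) = cinner (J x) (J (HL L \<cdot> z))" by (rule 1[OF S_J])
    then show "cinner z (HL L \<cdot> x) = cinner z (EL L \<cdot> J w)" by (simp add: J_cinner cinner_EL cinner_HL)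
  qed
  show ?thesis
  proof (rule S_limit[of "\<lambda>L. EL L \<cdot> x" "\<lambda>L. J (EL L \<cdot> J w)"])
    show "(EL L \<cdot> x, J (EL L \<cdot> J w)) \<in> S" for L using S_J[of L x] by (simp add: H)
    show "(\<lambda>L. J (EL L \<cdot> J w)) \<longlonglongrightarrow> w" using J_tendsto[OF EL_tendsto[of "J w"]] by (simp add: J_J)
  qed (rule EL_tendsto)
qed

locale modular_coupling =
  coupling A \<Lambda>1 \<Lambda>2 \<omega> + M: modular_data E1 A \<Lambda>1 + N: modular_data E2 A \<Lambda>2
  for A :: "'g::chilbert_space bop set" and \<Lambda>1 \<Lambda>2 :: 'g and \<omega> and E1 E2 +
  assumes modular: "a \<in> A \<Longrightarrow> a' \<in> commutant A \<Longrightarrow>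
    \<omega> ((M.U t * a * M.U (- t)) \<otimes> a') = \<omega> (a \<otimes> (N.U (- t) * a' * N.U t))"
begin

definition V :: "'g bop" where
  "V = (SOME V. \<forall>a\<in>A. \<forall>a'\<in>A'. cinner (V \<cdot> a \<cdot> \<Lambda>1) (a' \<cdot> \<Lambda>2) = \<omega> (star a \<otimes> a'))"

lemma V: "a \<in> A \<Longrightarrow> a' \<in> A' \<Longrightarrow> cinner (V \<cdot> a \<cdot> \<Lambda>1) (a' \<cdot> \<Lambda>2) = \<omega> (star a \<otimes> a')"
  using someI_ex[OF coupling_operator_exists] unfolding V_def by blast

lemma V_right: "a \<in> A \<Longrightarrow> a' \<in> A' \<Longrightarrow> cinner (a' \<cdot> \<Lambda>2) (V \<cdot> a \<cdot> \<Lambda>1) = \<omega> (a \<otimes> star a')"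
  using V[of a a'] \<omega>_hermitian[of a "star a'"] cnj_cinner[of "V \<cdot> a \<cdot> \<Lambda>1" "a' \<cdot> \<Lambda>2"]
  by (simp add: star_star A'_closed)

lemma V_U: "V \<cdot> M.U t \<cdot> x = N.U t \<cdot> V \<cdot> x"
proof -
  have "(V * M.U t) \<cdot> x = (N.U t * V) \<cdot> x" for x
  proof (rule arg_cong[of _ _ "\<lambda>W. W \<cdot> x"], rule dense_bop_eqI[OF dense1])
    fix y assume "y \<in> {a \<cdot> \<Lambda>1 |a. a \<in> A}"
    then obtain a where a: "a \<in> A" "y = a \<cdot> \<Lambda>1" by blast
    show "(V * M.U t) \<cdot> y = (N.U t * V) \<cdot> y"
    proof (rule dense_cinner_ext[OF dense2])
      fix z assume "z \<in> {a' \<cdot> \<Lambda>2 |a'. a' \<in> A'}"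
      then obtain a' where a': "a' \<in> A'" "z = a' \<cdot> \<Lambda>2" by blast
      have "cinner z (V \<cdot> M.U t \<cdot> y) = \<omega> ((M.U t * a * M.U (- t)) \<otimes> star a')"
        unfolding a'(2) a(2) M.U_A by (rule V_right[OF M.invariant[OF a(1)] a'(1)])
      also have "\<dots> = \<omega> (a \<otimes> (N.U (- t) * star a' * N.U t))" by (intro modular a A'_closed a')
      also have "N.U (- t) * star a' * N.U t = star (N.U (- t) * a' * N.U t)"
        by (simp add: star_mult N.star_U mult.assoc)
      also have "\<omega> (a \<otimes> star (N.U (- t) * a' * N.U t)) = cinner ((N.U (- t) * a' * N.U t) \<cdot> \<Lambda>2) (V \<cdot> a \<cdot> \<Lambda>1)"
        using N.invariant_commutant[OF a'(1), of "- t"] by (intro V_right[symmetric] a) simp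
      also have "\<dots> = cinner z (N.U t \<cdot> V \<cdot> y)"
        by (simp add: bop_mult_apply N.U_\<Lambda> N.cinner_U_left a(2) a'(2))
      finally show "cinner z ((V * M.U t) \<cdot> y) = cinner z ((N.U t * V) \<cdot> y)" by (simp add: bop_mult_apply)
    qed
  qed
  then show ?thesis by (simp add: bop_mult_apply)
qed

lemma V_S: "(x, w) \<in> M.S \<Longrightarrow> (V \<cdot> x, V \<cdot> w) \<in> N.S"
proof -
  assume "(x, w) \<in> M.S"
  then obtain a where a: "\<And>n::nat. a n \<in> A" "(\<lambda>n. a n \<cdot> \<Lambda>1) \<longlonglongrightarrow> x" "(\<lambda>n. star (a n) \<cdot> \<Lambda>1) \<longlonglongrightarrow> w"
    using M.S_approx by blast
  show ?thesis
  proof (rule N.S_limit[of "\<lambda>n. V \<cdot> a n \<cdot> \<Lambda>1" "\<lambda>n. V \<cdot> star (a n) \<cdot> \<Lambda>1"])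
    show "(V \<cdot> a n \<cdot> \<Lambda>1, V \<cdot> star (a n) \<cdot> \<Lambda>1) \<in> N.S" for n
      by (rule N.S_adjointI) (simp add: V V_right a A_closed A'_closed star_star)
  qed (intro tendsto_bop a)+
qed

lemma V_J: "V \<cdot> M.J x = N.J (V \<cdot> x)"
  by (rule J_intertwining[OF M.modular_data_axioms N.modular_data_axioms V_U V_S])

lemma V_\<Lambda>: "V \<cdot> \<Lambda>1 = \<Lambda>2"
proof (rule dense_cinner_ext[OF dense2])
  fix z assume "z \<in> {a' \<cdot> \<Lambda>2 |a'. a' \<in> A'}"
  then obtain a' where a': "a' \<in> A'" "z = a' \<cdot> \<Lambda>2" by blast
  then show "cinner z (V \<cdot> \<Lambda>1) = cinner z \<Lambda>2"
    using V_right[OF A_closed(1) a'(1)] right[OF A'_closed(7)[OF a'(1)]]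
    by (simp add: bop_simps cinner_star_right)
qed

lemma star_V_\<Lambda>: "star V \<cdot> \<Lambda>2 = \<Lambda>1"
proof (rule dense_cinner_ext[OF dense1])
  fix z assume "z \<in> {a \<cdot> \<Lambda>1 |a. a \<in> A}"
  then obtain a where a: "a \<in> A" "z = a \<cdot> \<Lambda>1" by blast
  have "cinner z (star V \<cdot> \<Lambda>2) = cinner (V \<cdot> a \<cdot> \<Lambda>1) (1 \<cdot> \<Lambda>2)" by (simp add: cinner_star_right a(2) bop_simps)
  also have "\<dots> = cinner \<Lambda>1 (star a \<cdot> \<Lambda>1)" by (simp only: V[OF a(1) A'_closed(1)] left[OF A_closed(7)[OF a(1)]])
  also have "\<dots> = cinner z \<Lambda>1" by (simp add: cinner_star_right a(2))
  finally show "cinner z (star V \<cdot> \<Lambda>2) = cinner z \<Lambda>1" .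
qed

text \<open>The reversed coupling corresponds to the adjoint of \<open>V\<close>. On \<open>A \<odot> A'\<close> it arises from \<open>\<omega>\<close> by the
  conjugations, which exchange \<open>A\<close> and \<open>A'\<close>; hence its positivity.\<close>

definition \<theta> :: "('g bop, 'g bop) tensor \<Rightarrow> complex" where
  "\<theta> = tensor_form (\<lambda>b a'. cinner (V \<cdot> star a' \<cdot> \<Lambda>1) (b \<cdot> \<Lambda>2))"

lemma \<theta>: "\<theta> (x + y) = \<theta> x + \<theta> y" "\<theta> (c *\<^sub>C x) = c * \<theta> x"
  "\<theta> (b \<otimes> a') = cinner (V \<cdot> star a' \<cdot> \<Lambda>1) (b \<cdot> \<Lambda>2)"
proof -
  have "cbilinear (\<lambda>b a'. cinner (V \<cdot> star a' \<cdot> \<Lambda>1) (b \<cdot> \<Lambda>2))"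
    unfolding cbilinear_def by (simp add: bop_simps star_add star_scaleC bop_add bop_scaleC cinner_simps)
  from tensor_form[OF this] show "\<theta> (x + y) = \<theta> x + \<theta> y" "\<theta> (c *\<^sub>C x) = c * \<theta> x"
    "\<theta> (b \<otimes> a') = cinner (V \<cdot> star a' \<cdot> \<Lambda>1) (b \<cdot> \<Lambda>2)"
    unfolding \<theta>_def by blast+
qed

lemma \<theta>_conj:
  assumes b: "b \<in> A" and a': "a' \<in> A'"
  shows "\<theta> (b \<otimes> a') = \<omega> (star (M.conj a') \<otimes> star (N.conj b))"
proof -
  have "V \<cdot> star a' \<cdot> \<Lambda>1 = N.J (V \<cdot> star (M.conj a') \<cdot> \<Lambda>1)"
    using V_J[of "star (M.conj a') \<cdot> \<Lambda>1"]
    by (simp add: M.conj_apply M.J_J M.J_\<Lambda> flip: M.conj_star)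
  moreover have "b \<cdot> \<Lambda>2 = N.J (N.conj b \<cdot> \<Lambda>2)" by (simp add: N.conj_apply N.J_J N.J_\<Lambda>)
  ultimately have "\<theta> (b \<otimes> a') = cinner (N.conj b \<cdot> \<Lambda>2) (V \<cdot> star (M.conj a') \<cdot> \<Lambda>1)"
    by (simp add: \<theta>(3) N.J_cinner)
  also have "\<dots> = \<omega> (star (M.conj a') \<otimes> star (N.conj b))"
    by (intro V_right A_closed M.conj_in_algebra N.conj_commutant a' b)
  finally show ?thesis .
qed

lemma \<theta>_gram:
  assumes xs: "set xs \<subseteq> A \<times> A'" and ys: "set ys \<subseteq> A \<times> A'"
  shows "\<theta> (star (\<Sum>(b, a')\<leftarrow>xs. b \<otimes> a') * (\<Sum>(b, a')\<leftarrow>ys. b \<otimes> a')) =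
    \<omega> (star (\<Sum>(b, a')\<leftarrow>ys. M.conj a' \<otimes> N.conj b) * (\<Sum>(b, a')\<leftarrow>xs. M.conj a' \<otimes> N.conj b))"
proof -
  have \<theta>0: "\<theta> 0 = 0" using \<theta>(2)[of 0 0] by simp
  have \<omega>0: "\<omega> 0 = 0" using \<omega>_scale[OF tensor_product_zero, of 0] by simp
  have conj_mem: "M.conj a' \<otimes> N.conj b \<in> AA" if "b \<in> A" "a' \<in> A'" for b a'
    by (intro tensor_product_elem M.conj_in_algebra N.conj_commutant that)
  have sum_mem: "(\<Sum>(b, a')\<leftarrow>zs. M.conj a' \<otimes> N.conj b) \<in> AA" if "set zs \<subseteq> A \<times> A'" for zs
    using that by (induction zs) (auto simp: tensor_product_zero intro!: tensor_product_add conj_mem)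
  have elem: "\<theta> (star (b \<otimes> a') * (d \<otimes> c')) = \<omega> (star (M.conj c' \<otimes> N.conj d) * (M.conj a' \<otimes> N.conj b))"
    if "b \<in> A" "a' \<in> A'" "d \<in> A" "c' \<in> A'" for b a' d c'
    using \<theta>_conj[of "star b * d" "star a' * c'"] that
    by (simp add: star_elem_tensor elem_tensor_mult A_closed A'_closed M.conj_mult M.conj_star N.conj_mult
        N.conj_star star_mult star_star)
  have one: "\<theta> (star (b \<otimes> a') * (\<Sum>(b, a')\<leftarrow>ys. b \<otimes> a')) =
      \<omega> (star (\<Sum>(b, a')\<leftarrow>ys. M.conj a' \<otimes> N.conj b) * (M.conj a' \<otimes> N.conj b))"
    if b: "b \<in> A" "a' \<in> A'" for b a'
    using ys
  proof (induction ys)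
    case (Cons p ys)
    obtain d c' where p: "p = (d, c')" "d \<in> A" "c' \<in> A'" using Cons.prems by (cases p) auto
    have "\<omega> (star (M.conj c' \<otimes> N.conj d + (\<Sum>(b, a')\<leftarrow>ys. M.conj a' \<otimes> N.conj b)) * (M.conj a' \<otimes> N.conj b))
      = \<omega> (star (M.conj c' \<otimes> N.conj d) * (M.conj a' \<otimes> N.conj b))
        + \<omega> (star (\<Sum>(b, a')\<leftarrow>ys. M.conj a' \<otimes> N.conj b) * (M.conj a' \<otimes> N.conj b))"
      unfolding star_add distrib_right
      by (intro \<omega>_add mult star conj_mem sum_mem b p) (use Cons.prems in auto)
    then show ?case using Cons p elem[OF b p(2,3)] by (simp add: distrib_left \<theta>(1))
  qed (simp add: \<theta>0 \<omega>0)
  show ?thesis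
    using xs
  proof (induction xs)
    case (Cons p xs)
    obtain b a' where p: "p = (b, a')" "b \<in> A" "a' \<in> A'" using Cons.prems by (cases p) auto
    let ?Y = "\<Sum>(b, a')\<leftarrow>ys. M.conj a' \<otimes> N.conj b"
    have "\<omega> (star ?Y * (M.conj a' \<otimes> N.conj b + (\<Sum>(b, a')\<leftarrow>xs. M.conj a' \<otimes> N.conj b)))
      = \<omega> (star ?Y * (M.conj a' \<otimes> N.conj b)) + \<omega> (star ?Y * (\<Sum>(b, a')\<leftarrow>xs. M.conj a' \<otimes> N.conj b))"
      unfolding distrib_left
      by (intro \<omega>_add mult star conj_mem sum_mem ys p) (use Cons.prems in auto)
    then show ?case using Cons p one[OF p(2,3)] by (simp add: star_add distrib_right \<theta>(1))
  qed (simp add: \<theta>0 \<omega>0)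
qed

lemma \<theta>_positive:
  assumes "x \<in> AA"
  shows "\<theta> (star x * x) \<in> \<real>\<^sub>\<ge>\<^sub>0"
proof -
  obtain xs where xs: "set xs \<subseteq> A \<times> A'" "x = (\<Sum>(b, a')\<leftarrow>xs. b \<otimes> a')"
    using assms unfolding tensor_product_def by blast
  let ?y = "\<Sum>(b, a')\<leftarrow>xs. M.conj a' \<otimes> N.conj b"
  have "?y \<in> AA"
    using xs(1) by (induction xs)
      (auto simp: tensor_product_zero intro!: tensor_product_add tensor_product_elem M.conj_in_algebra N.conj_commutant)
  then have "\<omega> (star ?y * ?y) \<in> \<real>\<^sub>\<ge>\<^sub>0" using state unfolding state_def by blast
  then show ?thesis using \<theta>_gram[OF xs(1) xs(1)] by (simp add: xs(2))
qed

lemma \<theta>_left: "\<theta> (b \<otimes> 1) = cinner \<Lambda>2 (b \<cdot> \<Lambda>2)"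
  by (simp add: \<theta>(3) V_\<Lambda> bop_simps)

lemma \<theta>_right: "\<theta> (1 \<otimes> a') = cinner \<Lambda>1 (a' \<cdot> \<Lambda>1)"
proof -
  have "\<theta> (1 \<otimes> a') = cinner (star a' \<cdot> \<Lambda>1) (star V \<cdot> \<Lambda>2)"
    by (simp add: \<theta>(3) cinner_star_right bop_simps)
  then show ?thesis by (simp add: star_V_\<Lambda> cinner_star_left)
qed

lemma coupling_\<theta>: "coupling A \<Lambda>2 \<Lambda>1 \<theta>"
proof
  have "\<theta> 1 = 1"
    using \<theta>_left[of 1] right[OF A'_closed(1)] state
    by (simp add: elem_tensor_one state_def bop_simps)
  then show "state AA \<theta>" unfolding state_def using \<theta>(1,2) \<theta>_positive by blast
qed (rule vn cyclic1 cyclic2 separating1 separating2 \<theta>_left \<theta>_right)+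

lemma modular_coupling_\<theta>: "modular_coupling A \<Lambda>2 \<Lambda>1 \<theta> E2 E1"
proof -
  interpret R: coupling A \<Lambda>2 \<Lambda>1 \<theta> by (rule coupling_\<theta>)
  show ?thesis
  proof
    fix b a' t assume b: "b \<in> A" and a': "a' \<in> A'"
    have "\<theta> (b \<otimes> (M.U (- t) * a' * M.U t)) = cinner (V \<cdot> M.U (- t) \<cdot> star a' \<cdot> \<Lambda>1) (b \<cdot> \<Lambda>2)"
      by (simp add: \<theta>(3) star_mult M.star_U bop_mult_apply M.U_\<Lambda>)
    also have "\<dots> = cinner (V \<cdot> star a' \<cdot> \<Lambda>1) (N.U t \<cdot> b \<cdot> \<Lambda>2)"
      by (simp add: V_U N.cinner_U_left)
    also have "\<dots> = \<theta> ((N.U t * b * N.U (- t)) \<otimes> a')" by (simp add: \<theta>(3) N.U_A)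
    finally show "\<theta> ((N.U t * b * N.U (- t)) \<otimes> a') = \<theta> (b \<otimes> (M.U (- t) * a' * M.U t))" by simp
  qed
qed

lemma star_V_\<theta>: "b \<in> A \<Longrightarrow> a' \<in> A' \<Longrightarrow> cinner (star V \<cdot> b \<cdot> \<Lambda>2) (a' \<cdot> \<Lambda>1) = \<theta> (star b \<otimes> a')"
proof -
  interpret R: coupling A \<Lambda>2 \<Lambda>1 \<theta> by (rule coupling_\<theta>)
  assume b: "b \<in> A" and a': "a' \<in> A'"
  have "\<theta> (star b \<otimes> a') = cnj (\<theta> (b \<otimes> star a'))"
    using R.\<omega>_hermitian[OF b A'_closed(7)[OF a']] by (simp add: star_star)
  also have "\<dots> = cinner (b \<cdot> \<Lambda>2) (V \<cdot> a' \<cdot> \<Lambda>1)" by (simp add: \<theta>(3) star_star cnj_cinner)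
  finally show ?thesis by (simp add: cinner_star_left)
qed

lemma transport_cost_\<theta>:
  assumes k: "\<And>l. l \<in> {1..n} \<Longrightarrow> k l \<in> A"
  shows "transport_cost A \<Lambda>1 n k \<theta> = transport_cost A \<Lambda>2 n k \<omega>"
proof -
  interpret R: coupling A \<Lambda>2 \<Lambda>1 \<theta> by (rule coupling_\<theta>)
  have "Re (cinner (star V \<cdot> x) y) = Re (cinner (V \<cdot> y) x)" for x y
    by (simp add: cinner_star_left flip: cnj_cinner[of x "V \<cdot> y"])
  then have "transport_cost A \<Lambda>1 n k \<theta> = (\<Sum>l = 1..n. (norm (k l \<cdot> \<Lambda>1))\<^sup>2 + (norm (k l \<cdot> \<Lambda>2))\<^sup>2
      - 2 * Re (cinner (V \<cdot> k l \<cdot> \<Lambda>1) (k l \<cdot> \<Lambda>2)))"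
    by (subst R.transport_cost_eq[OF star_V_\<theta> k]) (simp_all add: add.commute)
  also have "\<dots> = transport_cost A \<Lambda>2 n k \<omega>" by (rule transport_cost_eq[symmetric, OF V k])
  finally show ?thesis .
qed

end

section \<open>Symmetry of the Wasserstein distance\<close>

lemma modular_group_data:
  assumes A: "von_neumann_algebra A" and cyc: "cyclic_vector A \<Lambda>" "separating_vector A \<Lambda>"
    and \<sigma>: "modular_group A \<Lambda> \<sigma>"
  obtains E where "modular_data E A \<Lambda>" "\<And>t a. a \<in> A \<Longrightarrow> \<sigma> t a = pvm.U E t * a * pvm.U E (- t)"
proof -
  obtain W where \<sigma>A: "\<And>t. \<sigma> t \<in> A \<rightarrow> A" and W: "imaginary_powers (modular_operator A \<Lambda>) W"
    and \<sigma>W: "\<And>t a. a \<in> A \<Longrightarrow> \<sigma> t a = W t * a * W (- t)"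
    using \<sigma> unfolding modular_group_def by blast
  obtain E where E: "spectral_measure_of E (modular_operator A \<Lambda>)"
    and WE: "\<And>t x. cinner x (W t \<cdot> x) = (\<integral>s. cis (t * ln s) \<partial>diagonal_measure E x)"
    using W unfolding imaginary_powers_def by blast
  interpret pvm E by standard (use E in \<open>simp add: spectral_measure_of_def\<close>)
  have U: "U t = W t" for t unfolding U_def by (rule calc_eqI) (rule WE)
  have "U t * a * U (- t) \<in> A" if "a \<in> A" for t a
    using funcset_mem[OF \<sigma>A[of t] that] by (simp add: U \<sigma>W[OF that])
  then have "modular_data E A \<Lambda>" by (intro modular_data.intro modular_data_axioms.intro A cyc E pvm_axioms)
  moreover have "\<sigma> t a = U t * a * U (- t)" if "a \<in> A" for t a by (simp add: U \<sigma>W[OF that])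
  ultimately show ?thesis by (rule that)
qed

lemma modular_transport_plan_reverse:
  fixes A :: "'g::chilbert_space bop set"
  assumes A: "von_neumann_algebra A"
    and \<Lambda>: "\<forall>\<rho>\<in>\<FF> A. cyclic_vector A (\<Lambda> \<rho>) \<and> separating_vector A (\<Lambda> \<rho>) \<and>
           (\<forall>a\<in>A. \<rho> a = vector_state (\<Lambda> \<rho>) a)"
    and \<sigma>: "\<forall>\<rho>\<in>\<FF> A. modular_group A (\<Lambda> \<rho>) (\<sigma> \<rho>)"
    and k: "\<forall>l\<in>{1..n}. k l \<in> A" and \<mu>: "\<mu> \<in> \<FF> A" and \<nu>: "\<nu> \<in> \<FF> A"
    and \<omega>: "\<omega> \<in> modular_transport_plans A \<Lambda> \<sigma> \<mu> \<nu>"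
  shows "\<exists>\<theta>\<in>modular_transport_plans A \<Lambda> \<sigma> \<nu> \<mu>. transport_cost A (\<Lambda> \<mu>) n k \<theta> = transport_cost A (\<Lambda> \<nu>) n k \<omega>"
proof -
  have cs: "cyclic_vector A (\<Lambda> \<mu>)" "separating_vector A (\<Lambda> \<mu>)" "cyclic_vector A (\<Lambda> \<nu>)" "separating_vector A (\<Lambda> \<nu>)"
    using \<Lambda> \<mu> \<nu> by simp_all
  obtain E1 where E1: "modular_data E1 A (\<Lambda> \<mu>)" "\<And>t a. a \<in> A \<Longrightarrow> \<sigma> \<mu> t a = pvm.U E1 t * a * pvm.U E1 (- t)"
    by (rule modular_group_data[OF A cs(1,2) bspec[OF \<sigma> \<mu>]]) (rule that)
  obtain E2 where E2: "modular_data E2 A (\<Lambda> \<nu>)" "\<And>t a. a \<in> A \<Longrightarrow> \<sigma> \<nu> t a = pvm.U E2 t * a * pvm.U E2 (- t)"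
    by (rule modular_group_data[OF A cs(3,4) bspec[OF \<sigma> \<nu>]]) (rule that)
  interpret M: modular_data E1 A "\<Lambda> \<mu>" by (rule E1)
  interpret N: modular_data E2 A "\<Lambda> \<nu>" by (rule E2)
  have st: "\<mu> a = cinner (\<Lambda> \<mu>) (a \<cdot> \<Lambda> \<mu>)" "\<nu> a = cinner (\<Lambda> \<nu>) (a \<cdot> \<Lambda> \<nu>)" if "a \<in> A" for a
    using \<Lambda> \<mu> \<nu> that by (auto simp: vector_state_def)
  have plan: "state (A \<odot> commutant A) \<omega>" "\<And>a. a \<in> A \<Longrightarrow> \<omega> (a \<otimes> 1) = \<mu> a"
    "\<And>a'. a' \<in> commutant A \<Longrightarrow> \<omega> (1 \<otimes> a') = vector_state (\<Lambda> \<nu>) a'"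
    "\<And>a a' t. a \<in> A \<Longrightarrow> a' \<in> commutant A \<Longrightarrow>
      \<omega> (\<sigma> \<mu> t a \<otimes> a') = \<omega> (a \<otimes> dual_map A (\<Lambda> \<nu>) (\<sigma> \<nu> t) a')"
    using \<omega> unfolding modular_transport_plans_def transport_plans_def by blast+
  interpret C: modular_coupling A "\<Lambda> \<mu>" "\<Lambda> \<nu>" \<omega> E1 E2
  proof
    show "\<omega> ((M.U t * a * M.U (- t)) \<otimes> a') = \<omega> (a \<otimes> (N.U (- t) * a' * N.U t))"
      if "a \<in> A" "a' \<in> commutant A" for a a' t
      using plan(4)[OF that, of t] by (simp only: E1(2)[OF that(1)] N.dual_map_modular[OF that(2) E2(2)])
    show "\<omega> (a \<otimes> 1) = cinner (\<Lambda> \<mu>) (a \<cdot> \<Lambda> \<mu>)" if "a \<in> A" for a by (simp only: plan(2) st that)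
    show "\<omega> (1 \<otimes> a') = cinner (\<Lambda> \<nu>) (a' \<cdot> \<Lambda> \<nu>)" if "a' \<in> commutant A" for a'
      by (simp only: plan(3) that vector_state_def)
  qed (fact A cs plan(1))+
  interpret R: modular_coupling A "\<Lambda> \<nu>" "\<Lambda> \<mu>" C.\<theta> E2 E1 by (rule C.modular_coupling_\<theta>)
  have "C.\<theta> \<in> modular_transport_plans A \<Lambda> \<sigma> \<nu> \<mu>"
    unfolding modular_transport_plans_def transport_plans_def mem_Collect_eq
  proof (intro conjI ballI allI)
    fix b a' t assume b: "b \<in> A" and a': "a' \<in> commutant A"
    show "C.\<theta> (\<sigma> \<nu> t b \<otimes> a') = C.\<theta> (b \<otimes> dual_map A (\<Lambda> \<mu>) (\<sigma> \<mu> t) a')"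
      using R.modular[OF b a', of t] by (simp only: E2(2)[OF b] M.dual_map_modular[OF a' E1(2)])
  qed (simp_all only: R.state R.left R.right st vector_state_def)
  moreover have "transport_cost A (\<Lambda> \<mu>) n k C.\<theta> = transport_cost A (\<Lambda> \<nu>) n k \<omega>"
    by (rule C.transport_cost_\<theta>) (rule bspec[OF k])
  ultimately show ?thesis by (intro bexI)
qed

theorem proposition5p4:
  fixes A :: "'g::chilbert_space bop set"
    and \<Lambda> :: "('g bop \<Rightarrow> complex) \<Rightarrow> 'g"
    and \<sigma> :: "('g bop \<Rightarrow> complex) \<Rightarrow> real \<Rightarrow> 'g bop \<Rightarrow> 'g bop"
    and n :: nat
    and k :: "nat \<Rightarrow> 'g bop"
    and \<mu> \<nu> :: "'g bop \<Rightarrow> complex"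
  assumes "von_neumann_algebra A"
    and "sigma_finite A"
    and "standard_form A"
    and "\<forall>\<rho>\<in>\<FF> A. cyclic_vector A (\<Lambda> \<rho>) \<and> separating_vector A (\<Lambda> \<rho>) \<and>
           (\<forall>a\<in>A. \<rho> a = vector_state (\<Lambda> \<rho>) a)"
    and "\<forall>\<rho>\<in>\<FF> A. modular_group A (\<Lambda> \<rho>) (\<sigma> \<rho>)"
    and "\<forall>l\<in>{1..n}. k l \<in> A"
    and "\<mu> \<in> \<FF> A"
    and "\<nu> \<in> \<FF> A"
  shows "wasserstein_distance A \<Lambda> \<sigma> n k \<mu> \<nu> = wasserstein_distance A \<Lambda> \<sigma> n k \<nu> \<mu>"
proof -
  note reverse = modular_transport_plan_reverse[OF assms(1,4,5,6)]
  have "(\<lambda>\<omega>. sqrt (transport_cost A (\<Lambda> \<nu>) n k \<omega>)) ` modular_transport_plans A \<Lambda> \<sigma> \<mu> \<nu>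
      \<subseteq> (\<lambda>\<omega>. sqrt (transport_cost A (\<Lambda> \<mu>) n k \<omega>)) ` modular_transport_plans A \<Lambda> \<sigma> \<nu> \<mu>"
    if "\<mu> \<in> \<FF> A" "\<nu> \<in> \<FF> A" for \<mu> \<nu>
  proof (rule image_subsetI)
    fix \<omega> assume "\<omega> \<in> modular_transport_plans A \<Lambda> \<sigma> \<mu> \<nu>"
    from reverse[OF that this] obtain \<theta> where "\<theta> \<in> modular_transport_plans A \<Lambda> \<sigma> \<nu> \<mu>"
      "transport_cost A (\<Lambda> \<mu>) n k \<theta> = transport_cost A (\<Lambda> \<nu>) n k \<omega>" by (rule bexE)
    then show "sqrt (transport_cost A (\<Lambda> \<nu>) n k \<omega>) \<in>
        (\<lambda>\<omega>. sqrt (transport_cost A (\<Lambda> \<mu>) n k \<omega>)) ` modular_transport_plans A \<Lambda> \<sigma> \<nu> \<mu>"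
      by (intro rev_image_eqI[of \<theta>]) simp_all
  qed
  from this[OF assms(7,8)] this[OF assms(8,7)] show ?thesis
    unfolding wasserstein_distance_def by (intro arg_cong[of _ _ Inf] subset_antisym)
qed

end
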